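(* Let $g=\begin{pmatrix}a_0+a_1\pi&b_0+b_1\pi\\c_1\pi&d_0+d_1\pi\end{pmatrix}\in\overline{\mathfrak U}^\times$ with $a_m,b_m,c_1,d_m\in\mu_{q-1}(\mathcal O_F)\cup\{0\}$, where $\overline{\mathfrak U}^\times\subset G_2^F$ is the inverse image of the upper triangular subgroup of ${\rm GL}_2(\mathbb F_q)$. Let $i=(\zeta,\tilde\mu)\in\mathbb F_q^\times\times\mathbb F_q\simeq(\mathcal O_F/\pi^2)^\times$ and $\bar y_0\in\mu_{2(q^2-1)}$; put $ig=\det(g)\,i$ and $\bar y_0g=\bar d_0\bar y_0$. Fix a square root $(a_0/d_0)^{1/2}$. Then the right action of $g$ on $\mathcal X(\pi^2)$ induces the morphism $$g:W^i_{0,\bar y_0}\to W^{ig}_{0,\bar y_0g},\qquad(a,s)\mapsto\Bigl((\bar a_0/\bar d_0)\bigl(a+(\bar c_1/\bar a_0)+(\bar b_0/\bar d_0)(\zeta/\bar y_0^{q+1})^2\bigr),\ (\bar a_0/\bar d_0)^{1/2}s\Bigr).$$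
   Context: **Lubin–Tate space.** $F$ is a non-archimedean local field with ring of integers $\mathcal O_F$, uniformizer $\pi$, residue field $\mathbb F_q$ of characteristic $p\ne2$; $\mathbf C$ is the completion of an algebraic closure of $F$, with ring of integers $\mathcal O_{\mathbf C}$, residue field $k^{\rm ac}$ and valuation $v$, $v(\pi)=1$; a bar denotes reduction. If ${\rm char}\,F=0$ let $f(X)=\sum_{k\ge 0}b_kX^{q^k}\in F[[u,X]]$ with $b_0=1$, $b_{-1}=0$, $\pi b_k=b_{k-1}u^{q^{k-1}}+b_{k-2}$ ($k\ge1$), and $X+_uY=f^{-1}(f(X)+f(Y))$, $[a]_u(X)=f^{-1}(af(X))$ (coefficients in $\mathcal O_F[[u]]$). If ${\rm char}\,F=p$, $F=\mathbb F_q((\pi))$, let $X+_uY=X+Y$, $[\zeta]_u(X)=\zeta X$ ($\zeta\in\mathbb F_q$), $[\pi]_u(X)=\pi X+uX^q+X^{q^2}$. For $u\in\mathbf C$, $v(u)>0$, this gives a formal $\mathcal O_F$-module $\mathcal F_u$ over $\mathcal O_{\mathbf C}$. $\mathcal X(\pi^2)$ is the Lubin–Tate curve whose $\mathbf C$-points are triples $(X_2,Y_2,u)$ with $v(u)>0$ and $(X_2,Y_2)$ a basis of the free $\mathcal O_F/\pi^2$-module $\mathcal F_u[\pi^2]$; $X_1=[\pi]_u(X_2)$, $Y_1=[\pi]_u(Y_2)$. The reduction of an affinoid over $\mathbf C$ is ${\rm Spec}$ of power-bounded functions modulo topologically nilpotent ones. $G_2^F={\rm GL}_2(\mathcal O_F/\pi^2)$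 acts on the right: $\begin{pmatrix}a&b\\c&d\end{pmatrix}$ acts by $(X_2,Y_2,u)\mapsto([a]_uX_2+_u[c]_uY_2,\,[b]_uX_2+_u[d]_uY_2,\,u)$. **The curves $W^i_{0,\bar y_0}$.** $\mathbf Z_{1,1,0}$ is defined by $v(u)=\frac12$, $v(X_1)=\frac1{2(q-1)}$, $v(X_2)=\frac1{2q^2(q-1)}$, $v(Y_1)=\frac1{2q(q-1)}$, $v(Y_2)=\frac1{2q^3(q-1)}$. Fix $\kappa_1$ with $\kappa_1^{2q^4(q-1)}=\pi$; $\kappa=\kappa_1^q$, $\gamma=\kappa^{q(q-1)^2}$ (fractional powers of $\gamma$ being the corresponding powers of $\kappa_1$), $x=X_2/\kappa^q$, $y=Y_2/\kappa$. Fix $\gamma_0,\theta$ with $\gamma_0^q-\gamma^{2q}\gamma_0=1$, $\theta^q=\gamma_0$. Identify $(\mathcal O_F/\pi^2)^\times\simeq\mathbb F_q^\times\times\mathbb F_q$ by $a_0+a_1\pi\mapsto(\bar a_0,\bar a_1/\bar a_0)$ ($a_0\in\mu_{q-1}(\mathcal O_F)$, $a_1\in\mu_{q-1}(\mathcal O_F)\cup\{0\}$). For $i=(\zeta,\tilde\mu)$ let $[\zeta]\in\mu_{q-1}(\mathcal O_F)$ be the Teichmüller lift; the geometric connected component $\mathbf Z^i_{1,1,0}$ is the one on which $xy^q$ reduces to $\zeta$ and $\gamma^{-2q/(q-1)}([\zeta]\gamma_0-\mathcal Z)$ reduces to $\tilde\mu\zeta$, where $\mathcal Z=(xy^q)^q-\gamma(xy^{q^3}+[\zeta]y^{-q(q^2-1)})$.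 On it define $Z_1,Z_2$ by $xy^q=[\zeta]\theta+\gamma^{1/q}Z_1$ and $\gamma^{1/q^2}y^{q^2-1}Z_2=Z_1-[\zeta](y^{q^2-1}+y^{-(q^2-1)})$. For $\bar y_0\in\mu_{2(q^2-1)}(k^{\rm ac})$ put $\iota=\bar y_0^{q^2-1}\in\{\pm1\}$; fix (depending only on $\iota$) $\delta_\iota$ with $\delta_\iota^q=2\iota(1+\gamma^{1/q^2}\delta_\iota)^{1/2}$ (square root $\equiv1$), let $\tilde\gamma_1=[\zeta]\delta_\iota$, let $y_0$ be the lift of $\bar y_0$ with $y_0^{q^2-1}=\iota(1+\gamma^{1/q^2}\delta_\iota)^{-1/2}$, $w=y_0^{q+1}\gamma^{1/(q^2(q-1))}$, and $w_1$ with $y_0^{q^2-3}([\zeta]+\gamma^{1/q^2}\tilde\gamma_1)w_1^2=w^q$. $\mathbf W^i_{0,\bar y_0}$ is the affinoid of points of $\mathbf Z^i_{1,1,0}$ with $v(y-y_0)\ge v(w_1)=\frac1{4q^3}$; put $Z_2=\tilde\gamma_1+wa$, $y=y_0+w_1s$. Its reduction $W^i_{0,\bar y_0}$ is the curve $a^q-a=s^2$. On the target $W^{ig}_{0,\bar y_0g}$ the coordinates are defined in the same way, with $y_0$, $w$, $w_1$ replaced by $d_0y_0$, $d_0^2w$, $d_0(d_0/a_0)^{1/2}w_1$, where $(d_0/a_0)^{1/2}=((a_0/d_0)^{1/2})^{-1}$. *)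

theory Defs
  imports "HOL-Analysis.Analysis" "HOL-Algebra.QuotRing"
    "HOL-Computational_Algebra.Computational_Algebra"
begin

section \<open>The local field and its completed algebraic closure\<close>

text \<open>
  The field \<open>\<^bold>C\<close> is the type \<open>'c\<close> and its residue field is the type \<open>'k\<close>. The record
  collects the additive valuation (with value \<open>\<infinity>\<close> exactly at \<open>0\<close>), the reduction map from
  the ring of integers of \<open>\<^bold>C\<close> onto \<open>'k\<close>, the subfield \<open>F\<close> and the uniformizer.
\<close>

record ('c, 'k) lt_field =
  valu :: "'c \<Rightarrow> ereal"
  bar :: "'c \<Rightarrow> 'k"
  base :: "'c set"
  unif :: 'c

definition is_valuation :: "('c::field \<Rightarrow> ereal) \<Rightarrow> bool" where
  "is_valuation v \<longleftrightarrow>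
     (\<forall>x. v x = \<infinity> \<longleftrightarrow> x = 0) \<and> (\<forall>x. v x \<noteq> -\<infinity>) \<and>
     (\<forall>x y. v (x * y) = v x + v y) \<and> (\<forall>x y. min (v x) (v y) \<le> v (x + y))"

definition vtends :: "('c::field \<Rightarrow> ereal) \<Rightarrow> (nat \<Rightarrow> 'c) \<Rightarrow> 'c \<Rightarrow> bool" where
  "vtends v X l \<longleftrightarrow> (\<forall>N::real. \<forall>\<^sub>F n in sequentially. v (X n - l) \<ge> ereal N)"

definition vlim :: "('c::field \<Rightarrow> ereal) \<Rightarrow> (nat \<Rightarrow> 'c) \<Rightarrow> 'c" where
  "vlim v X = (THE l. vtends v X l)"

definition vcauchy :: "('c::field \<Rightarrow> ereal) \<Rightarrow> (nat \<Rightarrow> 'c) \<Rightarrow> bool" where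
  "vcauchy v X \<longleftrightarrow> (\<forall>N::real. \<exists>M. \<forall>m\<ge>M. \<forall>n\<ge>M. v (X m - X n) \<ge> ereal N)"

definition vcomplete :: "('c::field \<Rightarrow> ereal) \<Rightarrow> 'c set \<Rightarrow> bool" where
  "vcomplete v K \<longleftrightarrow> (\<forall>X. range X \<subseteq> K \<and> vcauchy v X \<longrightarrow> (\<exists>l\<in>K. vtends v X l))"

definition is_subfield :: "'c::field set \<Rightarrow> bool" where
  "is_subfield K \<longleftrightarrow> 0 \<in> K \<and> 1 \<in> K \<and>
     (\<forall>x\<in>K. \<forall>y\<in>K. x + y \<in> K \<and> x - y \<in> K \<and> x * y \<in> K) \<and> (\<forall>x\<in>K. inverse x \<in> K)"

definition is_algebraic_closure :: "'c::field set \<Rightarrow> 'c set \<Rightarrow> bool" where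
  "is_algebraic_closure K F \<longleftrightarrow> is_subfield K \<and> F \<subseteq> K \<and>
     (\<forall>x\<in>K. \<exists>P. P \<noteq> 0 \<and> (\<forall>n. poly.coeff P n \<in> F) \<and> poly P x = 0) \<and>
     (\<forall>P. (\<forall>n. poly.coeff P n \<in> K) \<and> 0 < degree P \<longrightarrow> (\<exists>x\<in>K. poly P x = 0))"

definition OF :: "('c::field, 'k::field, 'm) lt_field_scheme \<Rightarrow> 'c set" where
  "OF S = {x \<in> base S. 0 \<le> valu S x}"

text \<open>The residue field of \<open>F\<close>, as a subfield of the residue field of \<open>\<^bold>C\<close>.\<close>

definition Fq :: "('c::field, 'k::field, 'm) lt_field_scheme \<Rightarrow> 'k set" where
  "Fq S = bar S ` OF S"

definition qq :: "('c::field, 'k::field, 'm) lt_field_scheme \<Rightarrow> nat" where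
  "qq S = card (Fq S)"

definition lt_field_axioms :: "('c::field, 'k::field, 'm) lt_field_scheme \<Rightarrow> bool" where
  "lt_field_axioms S \<longleftrightarrow>
     is_valuation (valu S) \<and>
     \<comment> \<open>the reduction map\<close>
     bar S 1 = 1 \<and>
     (\<forall>x y. 0 \<le> valu S x \<and> 0 \<le> valu S y \<longrightarrow>
        bar S (x + y) = bar S x + bar S y \<and> bar S (x * y) = bar S x * bar S y) \<and>
     (\<forall>x. 0 \<le> valu S x \<longrightarrow> (bar S x = 0 \<longleftrightarrow> 0 < valu S x)) \<and>
     (\<forall>z. \<exists>x. 0 \<le> valu S x \<and> bar S x = z) \<and>
     \<comment> \<open>\<open>F\<close> is a non-archimedean local field with uniformizer \<open>\<pi>\<close>, \<open>v(\<pi>) = 1\<close>, \<open>p \<noteq> 2\<close>\<close>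
     is_subfield (base S) \<and> vcomplete (valu S) (base S) \<and>
     unif S \<in> base S \<and> valu S (unif S) = 1 \<and>
     (\<forall>x\<in>base S. x \<noteq> 0 \<longrightarrow> (\<exists>n::int. valu S x = ereal (of_int n))) \<and>
     finite (Fq S) \<and> CHAR('k) \<noteq> 2 \<and>
     \<comment> \<open>\<open>\<^bold>C\<close> is the completion of an algebraic closure of \<open>F\<close>\<close>
     vcomplete (valu S) UNIV \<and>
     (\<exists>K. is_algebraic_closure K (base S) \<and>
        (\<forall>x. \<forall>N::real. \<exists>y\<in>K. ereal N \<le> valu S (x - y)))"

text \<open>\<open>\<mu>\<^bsub>q-1\<^esub>(\<O>\<^sub>F) \<union> {0}\<close>, Teichmueller lifts, and the digits of an element of \<open>\<O>\<^sub>F\<close> in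
  its expansion \<open>\<Sum>a\<^sub>k\<pi>\<^sup>k\<close>.\<close>

definition mu0 :: "('c::field, 'k::field, 'm) lt_field_scheme \<Rightarrow> 'c set" where
  "mu0 S = {x \<in> OF S. x ^ (qq S - 1) = 1} \<union> {0}"

definition teich :: "('c::field, 'k::field, 'm) lt_field_scheme \<Rightarrow> 'k \<Rightarrow> 'c" where
  "teich S z = (THE x. x \<in> mu0 S \<and> bar S x = z)"

primrec digit_rest :: "('c::field, 'k::field, 'm) lt_field_scheme \<Rightarrow> 'c \<Rightarrow> nat \<Rightarrow> 'c" where
  "digit_rest S a 0 = a"
| "digit_rest S a (Suc k) =
     (digit_rest S a k - teich S (bar S (digit_rest S a k))) / unif S"

definition digit :: "('c::field, 'k::field, 'm) lt_field_scheme \<Rightarrow> 'c \<Rightarrow> nat \<Rightarrow> 'c" where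
  "digit S a k = teich S (bar S (digit_rest S a k))"


section \<open>The formal modules\<close>

text \<open>
  Characteristic \<open>0\<close>. The \<open>b\<^sub>k\<close> are polynomials in \<open>u\<close> over \<open>F\<close>, so all coefficients of \<open>f\<close>,
  \<open>f\<^sup>-\<^sup>1\<close>, \<open>X +\<^sub>u Y\<close> and \<open>[a]\<^sub>u\<close> are polynomials in \<open>u\<close>, and it is the same to specialize
  \<open>u\<close> to an element of \<open>\<^bold>C\<close> before or after forming these series.
\<close>

fun lt_b :: "('c::field, 'k::field, 'm) lt_field_scheme \<Rightarrow> 'c \<Rightarrow> nat \<Rightarrow> 'c" where
  "lt_b S u 0 = 1"
| "lt_b S u (Suc 0) = u / unif S"
| "lt_b S u (Suc (Suc k)) = (lt_b S u (Suc k) * u ^ (qq S ^ Suc k) + lt_b S u k) / unif S"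

definition lt_log :: "('c::field, 'k::field, 'm) lt_field_scheme \<Rightarrow> 'c \<Rightarrow> 'c fps" where
  "lt_log S u = Abs_fps (\<lambda>n. \<Sum>k | k \<le> n \<and> qq S ^ k = n. lt_b S u k)"

text \<open>The coefficient of \<open>X\<^sup>iY\<^sup>j\<close> in \<open>f\<^sup>-\<^sup>1(f(X) + f(Y))\<close>; only the terms of degree
  \<open>n \<le> i + j\<close> of \<open>f\<^sup>-\<^sup>1\<close> contribute, and \<open>(f(X) + f(Y))\<^sup>n\<close> is expanded binomially.\<close>

definition lt_add_coeff ::
  "('c::field, 'k::field, 'm) lt_field_scheme \<Rightarrow> 'c \<Rightarrow> nat \<Rightarrow> nat \<Rightarrow> 'c" where
  "lt_add_coeff S u i j =
     (\<Sum>n\<le>i + j. fps_nth (fps_inv (lt_log S u)) n *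
        (\<Sum>m\<le>n. of_nat (n choose m) *
           fps_nth (lt_log S u ^ m) i * fps_nth (lt_log S u ^ (n - m)) j))"

definition lt_mult_series ::
  "('c::field, 'k::field, 'm) lt_field_scheme \<Rightarrow> 'c \<Rightarrow> 'c \<Rightarrow> 'c fps" where
  "lt_mult_series S u a = fps_compose (fps_inv (lt_log S u)) (fps_const a * lt_log S u)"

definition lt_pi_p :: "('c::field, 'k::field, 'm) lt_field_scheme \<Rightarrow> 'c \<Rightarrow> 'c \<Rightarrow> 'c" where
  "lt_pi_p S u X = unif S * X + u * X ^ qq S + X ^ ((qq S)\<^sup>2)"

text \<open>
  The group law \<open>X +\<^sub>u Y\<close> and the multiplication \<open>[a]\<^sub>u(X)\<close> on the points of the maximal ideal
  of \<open>\<O>\<^bsub>\<^bold>C\<^esub>\<close>. In characteristic \<open>p\<close> one has \<open>F = \<F>\<^sub>q((\<pi>))\<close> with \<open>\<F>\<^sub>q = \<mu>\<^bsub>q-1\<^esub> \<union> {0}\<close>, and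
  \<open>[\<Sum>a\<^sub>k\<pi>\<^sup>k]\<^sub>u = \<Sum>a\<^sub>k[\<pi>]\<^sub>u\<^sup>k\<close>.
\<close>

definition lt_add ::
  "('c::field, 'k::field, 'm) lt_field_scheme \<Rightarrow> 'c \<Rightarrow> 'c \<Rightarrow> 'c \<Rightarrow> 'c" where
  "lt_add S u x y =
     (if CHAR('c) = 0
      then vlim (valu S) (\<lambda>N. \<Sum>i\<le>N. \<Sum>j\<le>N. lt_add_coeff S u i j * x ^ i * y ^ j)
      else x + y)"

definition lt_mult ::
  "('c::field, 'k::field, 'm) lt_field_scheme \<Rightarrow> 'c \<Rightarrow> 'c \<Rightarrow> 'c \<Rightarrow> 'c" where
  "lt_mult S u a x =
     (if CHAR('c) = 0
      then vlim (valu S) (\<lambda>N. \<Sum>n\<le>N. fps_nth (lt_mult_series S u a) n * x ^ n)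
      else vlim (valu S) (\<lambda>N. \<Sum>k\<le>N. digit S a k * (lt_pi_p S u ^^ k) x))"

definition lt_torsion :: "('c::field, 'k::field, 'm) lt_field_scheme \<Rightarrow> 'c \<Rightarrow> 'c set" where
  "lt_torsion S u = {x. 0 < valu S x \<and> lt_mult S u ((unif S)\<^sup>2) x = 0}"


section \<open>The curve and the group action\<close>

definition cong_pi2 :: "('c::field, 'k::field, 'm) lt_field_scheme \<Rightarrow> 'c \<Rightarrow> 'c \<Rightarrow> bool" where
  "cong_pi2 S a b \<longleftrightarrow> (\<exists>c\<in>OF S. a - b = (unif S)\<^sup>2 * c)"

definition lt_basis ::
  "('c::field, 'k::field, 'm) lt_field_scheme \<Rightarrow> 'c \<Rightarrow> 'c \<Rightarrow> 'c \<Rightarrow> bool" where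
  "lt_basis S u X Y \<longleftrightarrow> X \<in> lt_torsion S u \<and> Y \<in> lt_torsion S u \<and>
     (\<forall>z\<in>lt_torsion S u. \<exists>a\<in>OF S. \<exists>b\<in>OF S.
        z = lt_add S u (lt_mult S u a X) (lt_mult S u b Y)) \<and>
     (\<forall>a\<in>OF S. \<forall>b\<in>OF S. lt_add S u (lt_mult S u a X) (lt_mult S u b Y) = 0 \<longrightarrow>
        cong_pi2 S a 0 \<and> cong_pi2 S b 0)"

type_synonym 'c point = "'c \<times> 'c \<times> 'c"  \<comment> \<open>\<open>(X\<^sub>2, Y\<^sub>2, u)\<close>\<close>

definition lt_curve :: "('c::field, 'k::field, 'm) lt_field_scheme \<Rightarrow> 'c point set" where
  "lt_curve S = {(X, Y, u). 0 < valu S u \<and> lt_basis S u X Y}"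

definition X1_of :: "('c::field, 'k::field, 'm) lt_field_scheme \<Rightarrow> 'c point \<Rightarrow> 'c" where
  "X1_of S = (\<lambda>(X, Y, u). lt_mult S u (unif S) X)"

definition Y1_of :: "('c::field, 'k::field, 'm) lt_field_scheme \<Rightarrow> 'c point \<Rightarrow> 'c" where
  "Y1_of S = (\<lambda>(X, Y, u). lt_mult S u (unif S) Y)"

text \<open>
  Elements of \<open>GL\<^sub>2(\<O>\<^sub>F/\<pi>\<^sup>2)\<close> are represented by matrices over \<open>\<O>\<^sub>F\<close> that are invertible
  modulo \<open>\<pi>\<^sup>2\<close>; all notions below only depend on the entries modulo \<open>\<pi>\<^sup>2\<close>.
\<close>

definition integral_matrix ::
  "('c::field, 'k::field, 'm) lt_field_scheme \<Rightarrow> 'c^2^2 \<Rightarrow> bool" where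
  "integral_matrix S g \<longleftrightarrow> (\<forall>i j. g $ i $ j \<in> OF S)"

definition G2F :: "('c::field, 'k::field, 'm) lt_field_scheme \<Rightarrow> ('c^2^2) set" where
  "G2F S = {g. integral_matrix S g \<and> (\<exists>h. integral_matrix S h \<and>
     (\<forall>i j. cong_pi2 S ((g ** h) $ i $ j) (mat 1 $ i $ j)) \<and>
     (\<forall>i j. cong_pi2 S ((h ** g) $ i $ j) (mat 1 $ i $ j)))}"

definition Ubar :: "('c::field, 'k::field, 'm) lt_field_scheme \<Rightarrow> ('c^2^2) set" where
  "Ubar S = {g \<in> G2F S. bar S (g $ 2 $ 1) = 0}"

definition lt_act ::
  "('c::field, 'k::field, 'm) lt_field_scheme \<Rightarrow> 'c^2^2 \<Rightarrow> 'c point \<Rightarrow> 'c point" where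
  "lt_act S g = (\<lambda>(X, Y, u).
     (lt_add S u (lt_mult S u (g $ 1 $ 1) X) (lt_mult S u (g $ 2 $ 1) Y),
      lt_add S u (lt_mult S u (g $ 1 $ 2) X) (lt_mult S u (g $ 2 $ 2) Y), u))"

text \<open>The identification of \<open>(\<O>\<^sub>F/\<pi>\<^sup>2)\<^sup>\<times>\<close> with \<open>\<F>\<^sub>q\<^sup>\<times> \<times> \<F>\<^sub>q\<close>, in both directions.\<close>

definition unit_index :: "('c::field, 'k::field, 'm) lt_field_scheme \<Rightarrow> 'c \<Rightarrow> 'k \<times> 'k" where
  "unit_index S a = (bar S (digit S a 0), bar S (digit S a 1) / bar S (digit S a 0))"

definition index_unit :: "('c::field, 'k::field, 'm) lt_field_scheme \<Rightarrow> 'k \<times> 'k \<Rightarrow> 'c" where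
  "index_unit S i = teich S (fst i) + teich S (snd i * fst i) * unif S"

definition index_act ::
  "('c::field, 'k::field, 'm) lt_field_scheme \<Rightarrow> 'c^2^2 \<Rightarrow> 'k \<times> 'k \<Rightarrow> 'k \<times> 'k" where
  "index_act S g i = unit_index S (det g * index_unit S i)"


section \<open>Affinoids and their reductions\<close>

text \<open>
  An affinoid \<open>W\<close> occurring here is a rational subdomain of the intersection of the reduced
  curve with a closed polydisc in the coordinates \<open>(X\<^sub>2, Y\<^sub>2, u)\<close>. Its affinoid algebra therefore
  consists of the functions on \<open>W\<close> which are uniform limits of rational functions in
  \<open>(X\<^sub>2, Y\<^sub>2, u)\<close> without poles on \<open>W\<close>; by the maximum modulus principle, having no poles on \<open>W\<close>
  means having a denominator that is bounded away from \<open>0\<close> on \<open>W\<close>. Functions on \<open>W\<close> are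
  represented by functions that are \<open>undefined\<close> outside \<open>W\<close>.
\<close>

inductive_set rational_functions ::
  "('c::field, 'k::field, 'm) lt_field_scheme \<Rightarrow> 'c point set \<Rightarrow> ('c point \<Rightarrow> 'c) set"
  for S and W where
  const: "(\<lambda>P. c) \<in> rational_functions S W"
| coord_X: "(\<lambda>(X, Y, u). X) \<in> rational_functions S W"
| coord_Y: "(\<lambda>(X, Y, u). Y) \<in> rational_functions S W"
| coord_u: "(\<lambda>(X, Y, u). u) \<in> rational_functions S W"
| add: "\<lbrakk>f \<in> rational_functions S W; g \<in> rational_functions S W\<rbrakk> \<Longrightarrow>
    (\<lambda>P. f P + g P) \<in> rational_functions S W"
| mult: "\<lbrakk>f \<in> rational_functions S W; g \<in> rational_functions S W\<rbrakk> \<Longrightarrow>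
    (\<lambda>P. f P * g P) \<in> rational_functions S W"
| inverse: "\<lbrakk>f \<in> rational_functions S W; \<exists>B::real. \<forall>P\<in>W. valu S (f P) \<le> ereal B\<rbrakk> \<Longrightarrow>
    (\<lambda>P. inverse (f P)) \<in> rational_functions S W"

definition analytic_functions ::
  "('c::field, 'k::field, 'm) lt_field_scheme \<Rightarrow> 'c point set \<Rightarrow> ('c point \<Rightarrow> 'c) set" where
  "analytic_functions S W = {f \<in> extensional W.
     \<forall>N::real. \<exists>r\<in>rational_functions S W. \<forall>P\<in>W. ereal N \<le> valu S (f P - r P)}"

definition power_bounded ::
  "('c::field, 'k::field, 'm) lt_field_scheme \<Rightarrow> 'c point set \<Rightarrow> ('c point \<Rightarrow> 'c) \<Rightarrow> bool" where
  "power_bounded S W f \<longleftrightarrow> (\<exists>B::real. \<forall>n. \<forall>P\<in>W. ereal B \<le> valu S (f P ^ n))"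

definition topologically_nilpotent ::
  "('c::field, 'k::field, 'm) lt_field_scheme \<Rightarrow> 'c point set \<Rightarrow> ('c point \<Rightarrow> 'c) \<Rightarrow> bool" where
  "topologically_nilpotent S W f \<longleftrightarrow>
     (\<forall>N::real. \<forall>\<^sub>F n in sequentially. \<forall>P\<in>W. ereal N \<le> valu S (f P ^ n))"

definition power_bounded_ring ::
  "('c::field, 'k::field, 'm) lt_field_scheme \<Rightarrow> 'c point set \<Rightarrow> ('c point \<Rightarrow> 'c) ring" where
  "power_bounded_ring S W =
     \<lparr>carrier = {f \<in> analytic_functions S W. power_bounded S W f},
      mult = (\<lambda>f g. restrict (\<lambda>P. f P * g P) W), one = restrict (\<lambda>P. 1) W,
      zero = restrict (\<lambda>P. 0) W, add = (\<lambda>f g. restrict (\<lambda>P. f P + g P) W)\<rparr>"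

definition nilpotent_ideal ::
  "('c::field, 'k::field, 'm) lt_field_scheme \<Rightarrow> 'c point set \<Rightarrow> ('c point \<Rightarrow> 'c) set" where
  "nilpotent_ideal S W = {f \<in> analytic_functions S W. topologically_nilpotent S W f}"

text \<open>The coordinate ring of the (affine) reduction of \<open>W\<close>.\<close>

definition reduction ::
  "('c::field, 'k::field, 'm) lt_field_scheme \<Rightarrow> 'c point set \<Rightarrow> ('c point \<Rightarrow> 'c) set ring" where
  "reduction S W = power_bounded_ring S W Quot nilpotent_ideal S W"

definition reduce ::
  "('c::field, 'k::field, 'm) lt_field_scheme \<Rightarrow> 'c point set \<Rightarrow> ('c point \<Rightarrow> 'c) \<Rightarrow>
     ('c point \<Rightarrow> 'c) set" where
  "reduce S W f = nilpotent_ideal S W +>\<^bsub>power_bounded_ring S W\<^esub> restrict f W"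

text \<open>The structure map from the residue field of \<open>\<^bold>C\<close>; it does not depend on the lift.\<close>

definition scalar ::
  "('c::field, 'k::field, 'm) lt_field_scheme \<Rightarrow> 'c point set \<Rightarrow> 'k \<Rightarrow> ('c point \<Rightarrow> 'c) set" where
  "scalar S W z = reduce S W (\<lambda>P. SOME x. 0 \<le> valu S x \<and> bar S x = z)"

text \<open>
  A map \<open>h\<close> from \<open>W\<close> to \<open>W'\<close> induces the morphism of reductions given by the ring
  homomorphism \<open>\<phi>\<close>, from the coordinate ring of the reduction of \<open>W'\<close> to that of \<open>W\<close>.
\<close>

definition induces_on_reductions ::
  "('c::field, 'k::field, 'm) lt_field_scheme \<Rightarrow> ('c point \<Rightarrow> 'c point) \<Rightarrow>
     'c point set \<Rightarrow> 'c point set \<Rightarrow>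
     (('c point \<Rightarrow> 'c) set \<Rightarrow> ('c point \<Rightarrow> 'c) set) \<Rightarrow> bool" where
  "induces_on_reductions S h W W' \<phi> \<longleftrightarrow> h \<in> W \<rightarrow> W' \<and>
     \<phi> \<in> ring_hom (reduction S W') (reduction S W) \<and>
     (\<forall>f\<in>carrier (power_bounded_ring S W').
        restrict (f \<circ> h) W \<in> carrier (power_bounded_ring S W) \<and>
        \<phi> (reduce S W' f) = reduce S W (f \<circ> h))"

text \<open>The power-bounded functions \<open>a\<close> and \<open>s\<close> on \<open>W\<close> define a map from the reduction of \<open>W\<close>
  to the curve \<open>a\<^sup>q - a = s\<^sup>2\<close>.\<close>

definition curve_coordinates ::
  "('c::field, 'k::field, 'm) lt_field_scheme \<Rightarrow> 'c point set \<Rightarrow>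
     ('c point \<Rightarrow> 'c) \<Rightarrow> ('c point \<Rightarrow> 'c) \<Rightarrow> bool" where
  "curve_coordinates S W a s \<longleftrightarrow>
     restrict a W \<in> carrier (power_bounded_ring S W) \<and>
     restrict s W \<in> carrier (power_bounded_ring S W) \<and>
     reduce S W a [^]\<^bsub>reduction S W\<^esub> qq S \<ominus>\<^bsub>reduction S W\<^esub> reduce S W a
       = reduce S W s [^]\<^bsub>reduction S W\<^esub> (2::nat)"


section \<open>The affinoids \<open>\<^bold>W\<close>\<close>

text \<open>The auxiliary choices. \<open>delta\<close> takes the sign \<open>\<iota> \<in> {1, -1}\<close>, as an element of \<open>\<^bold>C\<close>.\<close>

record ('c, 'k) lt_data = "('c, 'k) lt_field" +
  kappa1 :: 'c
  gamma0 :: 'c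
  theta :: 'c
  delta :: "'c \<Rightarrow> 'c"

definition kappa :: "('c::field, 'k::field) lt_data \<Rightarrow> 'c" where
  "kappa S = kappa1 S ^ qq S"

text \<open>\<open>\<gamma>\<^sup>r\<close> as a power of \<open>\<kappa>\<^sub>1\<close>, where \<open>\<gamma> = \<kappa>\<^bsup>q(q-1)\<^sup>2\<^esup> = \<kappa>\<^sub>1\<^bsup>q\<^sup>2(q-1)\<^sup>2\<^esup>\<close>. It is only used for
  \<open>r\<close> such that \<open>r q\<^sup>2(q-1)\<^sup>2\<close> is an integer.\<close>

definition gampow :: "('c::field, 'k::field) lt_data \<Rightarrow> rat \<Rightarrow> 'c" where
  "gampow S r = kappa1 S powi \<lfloor>r * (of_nat (qq S))\<^sup>2 * (of_nat (qq S) - 1)\<^sup>2\<rfloor>"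

definition gam :: "('c::field, 'k::field) lt_data \<Rightarrow> 'c" where
  "gam S = kappa S ^ (qq S * (qq S - 1)\<^sup>2)"

definition principal_sqrt :: "('c::field, 'k::field, 'm) lt_field_scheme \<Rightarrow> 'c \<Rightarrow> 'c \<Rightarrow> bool" where
  "principal_sqrt S x r \<longleftrightarrow> r\<^sup>2 = x \<and> 0 < valu S (r - 1)"

definition lt_data_axioms :: "('c::field, 'k::field) lt_data \<Rightarrow> bool" where
  "lt_data_axioms S \<longleftrightarrow> lt_field_axioms S \<and>
     kappa1 S ^ (2 * qq S ^ 4 * (qq S - 1)) = unif S \<and>
     gamma0 S ^ qq S - gam S ^ (2 * qq S) * gamma0 S = 1 \<and>
     theta S ^ qq S = gamma0 S \<and>
     (\<forall>\<iota>\<in>{1, -1}. \<exists>r.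
        principal_sqrt S (1 + gampow S (1 / (of_nat (qq S))\<^sup>2) * delta S \<iota>) r \<and>
        delta S \<iota> ^ qq S = 2 * \<iota> * r)"

definition xc :: "('c::field, 'k::field) lt_data \<Rightarrow> 'c point \<Rightarrow> 'c" where
  "xc S = (\<lambda>(X, Y, u). X / kappa S ^ qq S)"

definition yc :: "('c::field, 'k::field) lt_data \<Rightarrow> 'c point \<Rightarrow> 'c" where
  "yc S = (\<lambda>(X, Y, u). Y / kappa S)"

definition Z110 :: "('c::field, 'k::field) lt_data \<Rightarrow> 'c point set" where
  "Z110 S = {P \<in> lt_curve S. let q = real (qq S); (X2, Y2, u) = P in
     valu S u = ereal (1 / 2) \<and>
     valu S (X1_of S P) = ereal (1 / (2 * (q - 1))) \<and>
     valu S X2 = ereal (1 / (2 * q^2 * (q - 1))) \<and>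
     valu S (Y1_of S P) = ereal (1 / (2 * q * (q - 1))) \<and>
     valu S Y2 = ereal (1 / (2 * q^3 * (q - 1)))}"

definition calZ :: "('c::field, 'k::field) lt_data \<Rightarrow> 'k \<times> 'k \<Rightarrow> 'c point \<Rightarrow> 'c" where
  "calZ S i P = (let q = qq S; x = xc S P; y = yc S P in
     (x * y ^ q) ^ q -
     gam S * (x * y ^ (q^3) + teich S (fst i) * inverse (y ^ (q * (q^2 - 1)))))"

definition Z110_component :: "('c::field, 'k::field) lt_data \<Rightarrow> 'k \<times> 'k \<Rightarrow> 'c point set" where
  "Z110_component S i = {P \<in> Z110 S.
     let q = qq S; m = xc S P * yc S P ^ q;
         n = gampow S (- (2 * of_nat q / (of_nat q - 1))) *
               (teich S (fst i) * gamma0 S - calZ S i P)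
     in 0 \<le> valu S m \<and> bar S m = fst i \<and> 0 \<le> valu S n \<and> bar S n = snd i * fst i}"

definition Z1_of :: "('c::field, 'k::field) lt_data \<Rightarrow> 'k \<times> 'k \<Rightarrow> 'c point \<Rightarrow> 'c" where
  "Z1_of S i P =
     (xc S P * yc S P ^ qq S - teich S (fst i) * theta S) / gampow S (1 / of_nat (qq S))"

definition Z2_of :: "('c::field, 'k::field) lt_data \<Rightarrow> 'k \<times> 'k \<Rightarrow> 'c point \<Rightarrow> 'c" where
  "Z2_of S i P = (let t = yc S P ^ ((qq S)\<^sup>2 - 1) in
     (Z1_of S i P - teich S (fst i) * (t + inverse t)) /
     (gampow S (1 / (of_nat (qq S))\<^sup>2) * t))"

definition iota_of :: "('c::field, 'k::field) lt_data \<Rightarrow> 'k \<Rightarrow> 'c" where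
  "iota_of S yb = (if yb ^ ((qq S)\<^sup>2 - 1) = 1 then 1 else -1)"

definition gamma1_tilde :: "('c::field, 'k::field) lt_data \<Rightarrow> 'k \<times> 'k \<Rightarrow> 'k \<Rightarrow> 'c" where
  "gamma1_tilde S i yb = teich S (fst i) * delta S (iota_of S yb)"

definition y0_of :: "('c::field, 'k::field) lt_data \<Rightarrow> 'k \<Rightarrow> 'c" where
  "y0_of S yb = (THE y. 0 \<le> valu S y \<and> bar S y = yb \<and>
     (\<exists>r. principal_sqrt S
            (1 + gampow S (1 / (of_nat (qq S))\<^sup>2) * delta S (iota_of S yb)) r \<and>
          y ^ ((qq S)\<^sup>2 - 1) = iota_of S yb * inverse r))"

definition w_of :: "('c::field, 'k::field) lt_data \<Rightarrow> 'k \<Rightarrow> 'c" where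
  "w_of S yb = y0_of S yb ^ (qq S + 1) *
     gampow S (1 / ((of_nat (qq S))\<^sup>2 * (of_nat (qq S) - 1)))"

definition is_w1 :: "('c::field, 'k::field) lt_data \<Rightarrow> 'k \<times> 'k \<Rightarrow> 'k \<Rightarrow> 'c \<Rightarrow> bool" where
  "is_w1 S i yb w1 \<longleftrightarrow>
     y0_of S yb ^ ((qq S)\<^sup>2 - 3) *
       (teich S (fst i) + gampow S (1 / (of_nat (qq S))\<^sup>2) * gamma1_tilde S i yb) * w1\<^sup>2
     = w_of S yb ^ qq S"

definition W_affinoid :: "('c::field, 'k::field) lt_data \<Rightarrow> 'k \<times> 'k \<Rightarrow> 'k \<Rightarrow> 'c point set" where
  "W_affinoid S i yb = {P \<in> Z110_component S i.
     ereal (1 / (4 * real (qq S) ^ 3)) \<le> valu S (yc S P - y0_of S yb)}"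

text \<open>The coordinates determined by \<open>Z\<^sub>2 = gamma1_tilde + w a\<close> and \<open>y = y\<^sub>0 + w\<^sub>1 s\<close>. The values
  of \<open>w\<close>, \<open>y\<^sub>0\<close> and \<open>w\<^sub>1\<close> are arguments, since on the target of a group element they are
  transported from the source.\<close>

definition a_coord ::
  "('c::field, 'k::field) lt_data \<Rightarrow> 'k \<times> 'k \<Rightarrow> 'k \<Rightarrow> 'c \<Rightarrow> 'c point \<Rightarrow> 'c" where
  "a_coord S i yb w P = (Z2_of S i P - gamma1_tilde S i yb) / w"

definition s_coord :: "('c::field, 'k::field) lt_data \<Rightarrow> 'c \<Rightarrow> 'c \<Rightarrow> 'c point \<Rightarrow> 'c" where
  "s_coord S y0 w1 P = (yc S P - y0) / w1"

end

theory Submission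
  imports Defs
begin

text \<open>
  Rescale the valuation so that \<open>\<kappa>\<^sub>1\<close> has valuation \<open>1\<close>. On \<open>\<^bold>Z\<^bsub>1,1,0\<^esub>\<close> one has
  \<open>[\<pi>]\<^sub>u(X) \<equiv> X\<^bsup>q\<^sup>2\<^esup>\<close>, and the group law is additive, to a precision at which the action of \<open>g\<close>
  becomes \<open>X\<^sub>2 \<mapsto> a\<^sub>0X\<^sub>2 + c\<^sub>1Y\<^sub>2\<^bsup>q\<^sup>2\<^esup> + a\<^sub>1X\<^sub>2\<^bsup>q\<^sup>2\<^esup>\<close> and \<open>Y\<^sub>2 \<mapsto> d\<^sub>0Y\<^sub>2 + b\<^sub>0X\<^sub>2 + d\<^sub>1Y\<^sub>2\<^bsup>q\<^sup>2\<^esup>\<close>.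
  Besides the \<open>\<O>\<^sub>F\<close>-module axioms this needs only two facts on the formal group law
  \<open>F\<^sub>u(X, Y)\<close>: its coefficients are polynomials in \<open>u\<close> over \<open>\<O>\<^sub>F\<close>, which is Hazewinkel's
  functional equation lemma, and \<open>F\<^sub>0(X, Y)\<close> has no terms of degree between \<open>2\<close> and \<open>q\<^sup>2 - 1\<close>.
  Everything else is elementary: raising to \<open>q\<close>-th powers is additive modulo \<open>\<pi>\<close>, so the equation
  defining \<open>\<Z>\<close> can be solved approximately for \<open>Z\<^sub>1\<close> and \<open>Z\<^sub>2\<close>, and congruences between
  integral functions with a uniform positive gap become equalities in the reductions.
\<close>

subsection \<open>Valued fields\<close>

text \<open>In the scale where \<kappa>_1 has valuation 1, write Q for q: X_2 has valuation Q^2, Y_2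
  has Q and \<pi> has 2Q^4(Q-1). The coordinate a sits inside xy^q behind the factors
  \<gamma>^(1/q), \<gamma>^(1/q^2) and w, of valuations Q(Q-1)^2, (Q-1)^2 and Q-1. They add up to
  Q^2(Q-1), exactly the size of the terms with c_1 and b_0 that g adds to x and to y^q; this is why
  these entries translate a. The terms with a_1 and d_1 have size Q^2(Q^2-1) in x and y^q, invisible
  in a. Multiplied by \<gamma> they reach 2Q^3(Q-1), the scale at which the second invariant of the
  component is read off, and so does the product b_0c_1: together they form the coefficient of \<pi>
  in det g. Every estimate is therefore carried one unit beyond these sizes. The coordinate s is
  finer than a: y - y_0 has valuation at least Q(Q-1)/2, while g changes y to d_0y up to Q(Q-1), so
  s is only scaled. In the equation of the curve the choice of \<delta> and y_0 places y_0 at a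
  critical point, which is the reason for the square s^2.\<close>

locale valued =
  fixes v :: "'c::field \<Rightarrow> ereal"
  assumes is_val: "is_valuation v"
begin

abbreviation ge :: "real \<Rightarrow> 'c \<Rightarrow> bool" where
  "ge r x \<equiv> ereal r \<le> v x"

lemma v_inf_iff: "v x = \<infinity> \<longleftrightarrow> x = 0"
  using is_val by (auto simp: is_valuation_def)

lemma v_zero [simp]: "v 0 = \<infinity>"
  by (simp add: v_inf_iff)

lemma v_not_minf [simp]: "v x \<noteq> -\<infinity>"
  using is_val by (auto simp: is_valuation_def)

lemma v_mult: "v (x * y) = v x + v y"
  using is_val by (auto simp: is_valuation_def)

lemma v_add: "min (v x) (v y) \<le> v (x + y)"
  using is_val by (auto simp: is_valuation_def)

lemma v_real: assumes "x \<noteq> 0" obtains r where "v x = ereal r"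
  using assms v_inf_iff[of x] v_not_minf[of x] by (cases "v x") auto

lemma v_eq_nonzero: "v x = ereal r \<Longrightarrow> x \<noteq> 0"
  by auto

lemma v_one [simp]: "v 1 = 0"
proof -
  obtain r where r: "v 1 = ereal r" by (rule v_real[of 1]) auto
  have "v 1 = v 1 + v 1" using v_mult[of 1 1] by simp
  then show ?thesis using r by simp
qed

lemma v_uminus [simp]: "v (- x) = v x"
proof -
  obtain r where r: "v (- 1) = ereal r" by (rule v_real[of "-1"]) auto
  have "v (-1) + v (-1) = 0" using v_mult[of "-1" "-1"] by simp
  then have "v (-1) = 0" using r by simp
  then show ?thesis using v_mult[of "-1" x] by simp
qed

lemma v_minus_commute: "v (x - y) = v (y - x)"
  using v_uminus[of "x - y"] by simp

lemma ge_zero [simp]: "ge r 0" by simp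

lemma ge_mono: "ge r x \<Longrightarrow> s \<le> r \<Longrightarrow> ge s x"
  by (meson ereal_less_eq(3) order_trans)

lemma ge_add: "ge r x \<Longrightarrow> ge r y \<Longrightarrow> ge r (x + y)"
  using v_add[of x y] by (metis min.bounded_iff order_trans)

lemma ge_diff: "ge r x \<Longrightarrow> ge r y \<Longrightarrow> ge r (x - y)"
  using ge_add[of r x "-y"] by simp

lemma ge_sum: "(\<And>i. i \<in> A \<Longrightarrow> ge r (f i)) \<Longrightarrow> ge r (sum f A)"
  by (induction A rule: infinite_finite_induct) (auto intro: ge_add)

lemma ge_mult: "ge r x \<Longrightarrow> ge s y \<Longrightarrow> ge (r + s) (x * y)"
  using add_mono[of "ereal r" "v x" "ereal s" "v y"] by (simp add: v_mult)

lemma ge_mult': "ge r x \<Longrightarrow> ge s y \<Longrightarrow> t \<le> r + s \<Longrightarrow> ge t (x * y)"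
  using ge_mult ge_mono by blast

lemma ge_mult_left: "ge r x \<Longrightarrow> ge 0 y \<Longrightarrow> ge r (x * y)"
  using ge_mult[of r x 0 y] by simp

lemma ge_mult_right: "ge 0 x \<Longrightarrow> ge r y \<Longrightarrow> ge r (x * y)"
  using ge_mult[of 0 x r y] by simp

lemma ge_one [simp]: "ge 0 1" by (simp add: zero_ereal_def)

lemma ge_power: "ge r x \<Longrightarrow> ge (real n * r) (x ^ n)"
  by (induction n) (auto simp: algebra_simps intro: ge_mult)

lemma ge_power0: "ge 0 x \<Longrightarrow> ge 0 (x ^ n)"
  using ge_power[of 0 x n] by simp

lemma ge_power_le: "ge r x \<Longrightarrow> 0 \<le> r \<Longrightarrow> 0 < n \<Longrightarrow> ge r (x ^ n)"
  by (rule ge_mono[OF ge_power[of r x n]]) (auto simp: mult_le_cancel_right1)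

lemma ge_of_nat [simp]: "ge 0 (of_nat n)"
  by (induction n) (auto intro: ge_add)

lemma v_power: "v x = ereal r \<Longrightarrow> v (x ^ n) = ereal (real n * r)"
  by (induction n) (auto simp: v_mult algebra_simps zero_ereal_def)

lemma v_prod: "v x = ereal r \<Longrightarrow> v y = ereal s \<Longrightarrow> v (x * y) = ereal (r + s)"
  by (simp add: v_mult)

lemma v_inverse: assumes "v x = ereal r" shows "v (inverse x) = ereal (- r)"
proof -
  have "x \<noteq> 0" using assms by auto
  then obtain s where s: "v (inverse x) = ereal s" by (meson nonzero_imp_inverse_nonzero v_real)
  have "v (x * inverse x) = 0" using \<open>x \<noteq> 0\<close> by simp
  then show ?thesis using assms s by (auto simp: v_mult zero_ereal_def)
qed

lemma v_divide: "v x = ereal r \<Longrightarrow> v y = ereal s \<Longrightarrow> v (x / y) = ereal (r - s)"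
  by (simp add: divide_inverse v_mult v_inverse)

lemma ge_divide: "ge r x \<Longrightarrow> v y = ereal s \<Longrightarrow> ge (r - s) (x / y)"
  using ge_mult[of r x "- s" "inverse y"] by (simp add: divide_inverse v_inverse)

lemma ge_divide': "ge r x \<Longrightarrow> v y = ereal s \<Longrightarrow> t \<le> r - s \<Longrightarrow> ge t (x / y)"
  using ge_divide ge_mono by blast

lemma ge_cancel: "v y = ereal s \<Longrightarrow> ge r (x * y) \<Longrightarrow> ge (r - s) x"
  using ge_divide[of r "x * y" y s] v_eq_nonzero[of y s] by simp

lemma v_add_dominant: assumes "v x = ereal r" "ge s y" "r < s" shows "v (x + y) = ereal r"
proof (rule antisym)
  show "ereal r \<le> v (x + y)" using ge_add[of r x y] ge_mono[of s y r] assms by auto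
  show "v (x + y) \<le> ereal r"
  proof (rule ccontr)
    assume "\<not> ?thesis"
    then have l: "ereal r < v (x + y)" by simp
    have "ereal r < min (v (x + y)) (v (- y))" using l assms(2,3)
      by (auto intro: less_le_trans[of _ "ereal s"])
    also have "\<dots> \<le> v x" using v_add[of "x + y" "- y"] by simp
    finally show False using assms(1) by simp
  qed
qed

lemma ge_root: assumes "0 < n" "ge (real n * r) (x ^ n)" shows "ge r x"
proof (cases "x = 0")
  case False
  then obtain s where s: "v x = ereal s" by (rule v_real)
  then show ?thesis using assms v_power[OF s, of n] by simp
qed simp

lemma v_root: assumes "0 < n" "v (x ^ n) = ereal (real n * r)" shows "v x = ereal r"
proof -
  have "x \<noteq> 0" using assms by (auto simp: power_0_left)
  then obtain s where s: "v x = ereal s" by (rule v_real)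
  then show ?thesis using assms v_power[OF s, of n] by simp
qed

lemma v_unit_root: "0 < n \<Longrightarrow> v (x ^ n) = 0 \<Longrightarrow> v x = 0"
  using v_root[of n x 0] by (simp add: zero_ereal_def)

lemma zero_if_ge_all: assumes "\<And>r. ge r x" shows "x = 0"
proof (rule ccontr)
  assume "x \<noteq> 0"
  then obtain s where s: "v x = ereal s" by (rule v_real)
  then show False using assms[of "s + 1"] by simp
qed

text \<open>A nonzero element has a finite valuation \<open>s\<close>, which is never at least
  \<open>s + d\<close>. This yields uniqueness of the fixed points of the contractions x^q and
  y^(q^2)/c further down.\<close>

lemma zero_if_ge_increase:
  assumes "0 < d" "ge r x" "\<And>s. ge s x \<Longrightarrow> r \<le> s \<Longrightarrow> ge (s + d) x" shows "x = 0"
proof (rule ccontr)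
  assume "x \<noteq> 0"
  then obtain s where s: "v x = ereal s" by (rule v_real)
  then show False using assms(3)[of s] assms(1,2) by simp
qed

lemma ge_positive: assumes "0 < v x" obtains r where "0 < r" "ge r x"
  by (metis assms ereal_dense2 less_ereal.simps(1) less_imp_le zero_ereal_def)

section \<open>Congruences modulo elements of valuation at least \<open>r\<close>\<close>

definition cg :: "real \<Rightarrow> 'c \<Rightarrow> 'c \<Rightarrow> bool" where
  "cg r x y \<longleftrightarrow> ge r (x - y)"

lemma cg_refl [simp]: "cg r x x" by (simp add: cg_def)

lemma cg_sym: "cg r x y \<Longrightarrow> cg r y x" by (simp add: cg_def v_minus_commute)

lemma cg_trans [trans]: "cg r x y \<Longrightarrow> cg r y z \<Longrightarrow> cg r x z"
  using ge_add[of r "x - y" "y - z"] by (simp add: cg_def)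

lemma cg_mono: "cg r x y \<Longrightarrow> s \<le> r \<Longrightarrow> cg s x y" by (auto simp: cg_def intro: ge_mono)

lemma cg_eq_trans [trans]: "cg r x y \<Longrightarrow> y = z \<Longrightarrow> cg r x z" by simp

lemma eq_cg_trans [trans]: "x = y \<Longrightarrow> cg r y z \<Longrightarrow> cg r x z" by simp

lemma cg_0_iff: "cg r x 0 \<longleftrightarrow> ge r x" by (simp add: cg_def)

lemma cg_add: "cg r x x' \<Longrightarrow> cg r y y' \<Longrightarrow> cg r (x + y) (x' + y')"
  using ge_add[of r "x - x'" "y - y'"] by (simp add: cg_def algebra_simps)

lemma cg_minus: "cg r x x' \<Longrightarrow> cg r (- x) (- x')"
  using cg_sym by (simp add: cg_def algebra_simps)

lemma cg_diff: "cg r x x' \<Longrightarrow> cg r y y' \<Longrightarrow> cg r (x - y) (x' - y')"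
  using cg_add[of r x x' "-y" "-y'"] by (simp add: cg_minus)

lemma cg_ge: "cg r x y \<Longrightarrow> ge r y \<Longrightarrow> ge r x"
  using ge_add[of r "x - y" y] by (simp add: cg_def)

lemma cg_ge': "cg r x y \<Longrightarrow> ge s y \<Longrightarrow> s \<le> r \<Longrightarrow> ge s x"
  using cg_ge cg_mono by blast

lemma cg_mult: "cg r x x' \<Longrightarrow> cg r y y' \<Longrightarrow> ge 0 x \<Longrightarrow> ge 0 y' \<Longrightarrow> cg r (x * y) (x' * y')"
  using ge_add[of r "x * (y - y')" "(x - x') * y'"] ge_mult_right[of x r "y - y'"]
    ge_mult_left[of r "x - x'" y'] by (simp add: cg_def algebra_simps)

lemma cg_mult_left: "cg r y y' \<Longrightarrow> ge s x \<Longrightarrow> cg (s + r) (x * y) (x * y')"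
  using ge_mult[of s x r "y - y'"] by (simp add: cg_def algebra_simps)

lemma cg_mult_left': "cg r y y' \<Longrightarrow> ge s x \<Longrightarrow> t \<le> s + r \<Longrightarrow> cg t (x * y) (x * y')"
  using cg_mult_left cg_mono by blast

lemma cg_power: "cg r x y \<Longrightarrow> ge 0 x \<Longrightarrow> ge 0 y \<Longrightarrow> cg r (x ^ n) (y ^ n)"
  by (induction n) (auto intro: cg_mult ge_power0)

lemma cg_inverse: assumes "cg r x y" "v x = 0" "v y = 0" shows "cg r (inverse x) (inverse y)"
proof -
  have n: "x \<noteq> 0" "y \<noteq> 0" using assms by auto
  have u: "ge 0 (inverse x)" "ge 0 (inverse y)"
    using assms v_inverse[of x 0] v_inverse[of y 0] by (auto simp: zero_ereal_def)
  have "ge r ((y - x) * (inverse x * inverse y))"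
    using assms u cg_sym[OF assms(1)] by (intro ge_mult_left) (auto simp: cg_def intro: ge_mult_left)
  also have "(y - x) * (inverse x * inverse y) = inverse x - inverse y"
    using n by (simp add: field_simps)
  finally show ?thesis by (simp add: cg_def)
qed

lemma cg_unit: "cg r x y \<Longrightarrow> 0 < r \<Longrightarrow> v y = 0 \<Longrightarrow> v x = 0"
  using v_add_dominant[of y 0 r "x - y"] by (simp add: cg_def zero_ereal_def)

lemma cg_cancel: assumes "v c = ereal s" "cg r (c * x) (c * y)" shows "cg (r - s) x y"
  using ge_cancel[OF assms(1), of r "x - y"] assms(2) by (simp add: cg_def algebra_simps)

lemma cg_cancel': assumes "v c = ereal s" "cg r (c * x) (c * y)" "t \<le> r - s" shows "cg t x y"
  using cg_mono[OF cg_cancel[OF assms(1,2)] assms(3)] .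

lemma cg_drop: "ge r e \<Longrightarrow> cg r (x + e) x" by (simp add: cg_def)

lemma v_mult_0: "v x = 0 \<Longrightarrow> v y = 0 \<Longrightarrow> v (x * y) = 0" by (simp add: v_mult)
lemma v_power_0: "v x = 0 \<Longrightarrow> v (x ^ n) = 0"
  using v_power[of x 0 n] by (simp add: zero_ereal_def)
lemma v_inverse_0: "v x = 0 \<Longrightarrow> v (inverse x) = 0"
  using v_inverse[of x 0] by (simp add: zero_ereal_def)
lemma ge_unit: "v x = 0 \<Longrightarrow> ge 0 x" by (simp add: zero_ereal_def)
lemma unit_nonzero: "v x = 0 \<Longrightarrow> x \<noteq> 0" by auto

subsection \<open>Limits\<close>

lemma vtends_ge: assumes "vtends v X l" "\<forall>\<^sub>F n in sequentially. ge r (X n)" shows "ge r l"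
proof -
  have "\<forall>\<^sub>F n in sequentially. ge r (X n - l) \<and> ge r (X n)"
    using assms by (auto simp: vtends_def eventually_conj_iff)
  then obtain n where "ge r (X n - l)" "ge r (X n)"
    by (metis (mono_tags, lifting) eventually_happens' sequentially_bot)
  then show ?thesis using ge_diff[of r "X n" "X n - l"] by simp
qed

lemma vtends_const: "vtends v (\<lambda>_. l) l"
  by (simp add: vtends_def)

lemma vtends_add: "vtends v X l \<Longrightarrow> vtends v Y m \<Longrightarrow> vtends v (\<lambda>n. X n + Y n) (l + m)"
  unfolding vtends_def
proof
  fix N assume *: "\<forall>N. \<forall>\<^sub>F n in sequentially. ge N (X n - l)" "\<forall>N. \<forall>\<^sub>F n in sequentially. ge N (Y n - m)"
  show "\<forall>\<^sub>F n in sequentially. ge N (X n + Y n - (l + m))"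
    using *[THEN spec, of N]
  proof eventually_elim
    case (elim n)
    then show ?case using ge_add[of N "X n - l" "Y n - m"] by (simp add: algebra_simps)
  qed
qed

lemma vtends_mult_const: assumes "vtends v X l" shows "vtends v (\<lambda>n. c * X n) (c * l)"
proof (cases "c = 0")
  case True then show ?thesis by (simp add: vtends_def)
next
  case False
  then obtain r where r: "v c = ereal r" by (rule v_real)
  show ?thesis unfolding vtends_def
  proof
    fix N
    have "\<forall>\<^sub>F n in sequentially. ge (N - r) (X n - l)" using assms by (auto simp: vtends_def)
    then show "\<forall>\<^sub>F n in sequentially. ge N (c * X n - c * l)"
    proof eventually_elim
      case (elim n)
      then show ?case using ge_mult[of r c "N - r" "X n - l"] r by (simp add: algebra_simps)
    qed
  qed
qed

lemma vtends_minus: "vtends v X l \<Longrightarrow> vtends v (\<lambda>n. - X n) (- l)"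
  using vtends_mult_const[of X l "-1"] by simp

lemma vtends_diff: "vtends v X l \<Longrightarrow> vtends v Y m \<Longrightarrow> vtends v (\<lambda>n. X n - Y n) (l - m)"
  using vtends_add[of X l "\<lambda>n. - Y n" "- m"] vtends_minus[of Y m] by simp

lemma vtends_unique: assumes "vtends v X l" "vtends v X m" shows "l = m"
proof -
  have "vtends v (\<lambda>n. X n - X n) (l - m)" using assms by (rule vtends_diff)
  then have "ge r (l - m)" for r by (rule vtends_ge) simp
  then show ?thesis using zero_if_ge_all by fastforce
qed

lemma vlim_eq: "vtends v X l \<Longrightarrow> vlim v X = l"
  unfolding vlim_def using vtends_unique by blast

text \<open>By the ultrametric inequality the difference of two late terms is no larger than the
  first step between them, so linear growth of the valuations of single steps suffices.\<close>

lemma vcauchy_of_steps: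
  assumes "0 < d" "\<And>n. ge (r + d * real n) (X (Suc n) - X n)"
  shows "vcauchy v X"
proof -
  have st: "ge (r + d * real m) (X (m + k) - X m)" for m k
  proof (induction k)
    case (Suc k)
    have "ge (r + d * real m) (X (Suc (m + k)) - X (m + k))"
      by (rule ge_mono[OF assms(2)[of "m + k"]]) (use assms(1) in auto)
    then show ?case using ge_add[OF _ Suc.IH, of "X (Suc (m + k)) - X (m + k)"] by simp
  qed simp
  show ?thesis unfolding vcauchy_def
  proof
    fix N
    obtain M :: nat where M: "(N - r) / d \<le> real M" using real_arch_simple by blast
    then have MN: "N \<le> r + d * real M" using assms(1) by (simp add: field_simps)
    have "ge N (X m - X M)" if "M \<le> m" for m
      using st[of M "m - M"] that MN ge_mono by fastforce
    then have "ge N (X m - X n)" if "M \<le> m" "M \<le> n" for m n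
      using ge_diff[of N "X m - X M" "X n - X M"] that by simp
    then show "\<exists>M. \<forall>m\<ge>M. \<forall>n\<ge>M. ge N (X m - X n)" by blast
  qed
qed

lemma vtends_Suc: "vtends v X l \<Longrightarrow> vtends v (\<lambda>n. X (Suc n)) l"
  by (simp add: vtends_def eventually_sequentially_Suc[of "\<lambda>n. ge N (X n - l)" for N])

end

subsection \<open>The local field and its residue field\<close>

locale lt_fld =
  fixes S :: "('c::field, 'k::field, 'm) lt_field_scheme"
  assumes lt_ax: "lt_field_axioms S"
begin

sublocale valued "valu S"
  using lt_ax by unfold_locales (simp add: lt_field_axioms_def)

abbreviation "q \<equiv> qq S"
abbreviation "\<pi> \<equiv> unif S"
abbreviation "v \<equiv> valu S"
abbreviation "br \<equiv> bar S"

lemma br_one [simp]: "br 1 = 1"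
  using lt_ax by (simp add: lt_field_axioms_def)

lemma br_add: "ge 0 x \<Longrightarrow> ge 0 y \<Longrightarrow> br (x + y) = br x + br y"
  using lt_ax by (simp add: lt_field_axioms_def zero_ereal_def)

lemma br_mult: "ge 0 x \<Longrightarrow> ge 0 y \<Longrightarrow> br (x * y) = br x * br y"
  using lt_ax by (simp add: lt_field_axioms_def zero_ereal_def)

lemma br_eq_0_iff: "ge 0 x \<Longrightarrow> br x = 0 \<longleftrightarrow> 0 < v x"
  using lt_ax by (simp add: lt_field_axioms_def zero_ereal_def)

lemma br_surj: "\<exists>x. ge 0 x \<and> br x = z"
  using lt_ax by (simp add: lt_field_axioms_def zero_ereal_def)

lemma br_zero [simp]: "br 0 = 0"
  by (simp add: br_eq_0_iff)

lemma br_minus: "ge 0 x \<Longrightarrow> br (- x) = - br x"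
  using br_add[of x "- x"] by (simp add: eq_neg_iff_add_eq_0 add.commute)

lemma br_diff: "ge 0 x \<Longrightarrow> ge 0 y \<Longrightarrow> br (x - y) = br x - br y"
  using br_add[of x "- y"] by (simp add: br_minus)

lemma br_power: "ge 0 x \<Longrightarrow> br (x ^ n) = br x ^ n"
  by (induction n) (auto simp: br_mult ge_power0)

lemma br_of_nat: "br (of_nat n) = of_nat n"
  by (induction n) (auto simp: br_add)

lemma br_eq_iff: "ge 0 x \<Longrightarrow> ge 0 y \<Longrightarrow> br x = br y \<longleftrightarrow> 0 < v (x - y)"
  using br_eq_0_iff[of "x - y"] by (simp add: br_diff ge_diff)

lemma br_cg: "cg r x y \<Longrightarrow> 0 < r \<Longrightarrow> ge 0 y \<Longrightarrow> br x = br y"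
proof -
  assume a: "cg r x y" "0 < r" "ge 0 y"
  then have "ge 0 x" using cg_ge'[of r x y 0] by simp
  moreover have "0 < v (x - y)" using a by (auto simp: cg_def zero_ereal_def intro: less_le_trans[of _ "ereal r"])
  ultimately show ?thesis using a by (simp add: br_eq_iff)
qed

lemma br_nonzero_iff: "ge 0 x \<Longrightarrow> br x \<noteq> 0 \<longleftrightarrow> v x = 0"
  using br_eq_0_iff[of x] by (auto simp: zero_ereal_def less_le)

lemma br_inverse: "v x = 0 \<Longrightarrow> br (inverse x) = inverse (br x)"
proof -
  assume a: "v x = 0"
  then have "ge 0 x" "ge 0 (inverse x)" "x \<noteq> 0"
    using v_inverse[of x 0] by (auto simp: zero_ereal_def)
  then have "br x * br (inverse x) = 1" by (simp flip: br_mult)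
  then show ?thesis by (simp add: inverse_unique)
qed

lemma v_pi: "v \<pi> = 1"
  using lt_ax by (simp add: lt_field_axioms_def)

lemma pi_nonzero [simp]: "\<pi> \<noteq> 0"
  using v_pi by auto

lemma v_pi': "v \<pi> = ereal 1"
  by (simp add: v_pi one_ereal_def)

lemma ge_pi: "ge 1 \<pi>"
  by (simp add: v_pi')

lemma base_subfield: "is_subfield (base S)"
  using lt_ax by (simp add: lt_field_axioms_def)

lemma base_discrete: "x \<in> base S \<Longrightarrow> x \<noteq> 0 \<Longrightarrow> \<exists>n::int. v x = ereal (of_int n)"
  using lt_ax by (simp add: lt_field_axioms_def)

lemma pi_base: "\<pi> \<in> base S"
  using lt_ax by (simp add: lt_field_axioms_def)

lemma OF_iff: "x \<in> OF S \<longleftrightarrow> x \<in> base S \<and> ge 0 x"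
  by (simp add: OF_def zero_ereal_def)

lemma OF_ge: "x \<in> OF S \<Longrightarrow> ge 0 x"
  by (simp add: OF_iff)

lemma OF_zero [simp]: "0 \<in> OF S" and OF_one [simp]: "1 \<in> OF S"
  using base_subfield by (auto simp: OF_iff is_subfield_def)

lemma OF_pi [simp]: "\<pi> \<in> OF S"
  using pi_base by (auto simp: OF_iff v_pi')

lemma OF_add: "x \<in> OF S \<Longrightarrow> y \<in> OF S \<Longrightarrow> x + y \<in> OF S"
  using base_subfield by (auto simp: OF_iff is_subfield_def intro: ge_add)

lemma OF_diff: "x \<in> OF S \<Longrightarrow> y \<in> OF S \<Longrightarrow> x - y \<in> OF S"
  using base_subfield by (auto simp: OF_iff is_subfield_def intro: ge_diff)

lemma OF_minus: "x \<in> OF S \<Longrightarrow> - x \<in> OF S"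
  using OF_diff[of 0 x] by simp

lemma OF_mult: "x \<in> OF S \<Longrightarrow> y \<in> OF S \<Longrightarrow> x * y \<in> OF S"
  using base_subfield by (auto simp: OF_iff is_subfield_def intro: ge_mult_left)

lemma OF_power: "x \<in> OF S \<Longrightarrow> x ^ n \<in> OF S"
  by (induction n) (auto intro: OF_mult)

lemma OF_of_nat: "of_nat n \<in> OF S"
  by (induction n) (auto intro: OF_add)

lemma OF_ge_1: assumes "x \<in> OF S" "0 < v x" shows "ge 1 x"
proof (cases "x = 0")
  case False
  then obtain n where "v x = ereal (of_int n)" using assms base_discrete by (auto simp: OF_iff)
  then show ?thesis using assms by (simp add: zero_ereal_def)
qed simp

lemma OF_divide_pi: assumes "x \<in> OF S" "0 < v x" shows "x / \<pi> \<in> OF S"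
proof -
  have "ge 0 (x / \<pi>)" using ge_divide[of 1 x \<pi> 1] OF_ge_1[OF assms] v_pi' by simp
  moreover have "x * inverse \<pi> \<in> base S"
    using base_subfield assms pi_base by (auto simp: is_subfield_def OF_iff)
  ultimately show ?thesis by (simp add: OF_iff divide_inverse)
qed

lemma Fq_bar: "x \<in> OF S \<Longrightarrow> br x \<in> Fq S"
  by (simp add: Fq_def)

lemma Fq_finite [simp]: "finite (Fq S)"
  using lt_ax by (simp add: lt_field_axioms_def)

lemma FqE: assumes "z \<in> Fq S" obtains x where "x \<in> OF S" "br x = z"
  using assms by (auto simp: Fq_def)

lemma Fq_0 [simp]: "0 \<in> Fq S" and Fq_1 [simp]: "1 \<in> Fq S"
  using Fq_bar[of 0] Fq_bar[of 1] by auto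

lemma Fq_add: "z \<in> Fq S \<Longrightarrow> w \<in> Fq S \<Longrightarrow> z + w \<in> Fq S"
  by (metis Fq_bar FqE OF_add OF_ge br_add)

lemma Fq_mult: "z \<in> Fq S \<Longrightarrow> w \<in> Fq S \<Longrightarrow> z * w \<in> Fq S"
  by (metis Fq_bar FqE OF_mult OF_ge br_mult)

lemma Fq_minus: "z \<in> Fq S \<Longrightarrow> - z \<in> Fq S"
  by (metis Fq_bar FqE OF_minus OF_ge br_minus)

section \<open>The finite residue field of \<open>F\<close> and the q-th power map modulo
  \<pi>\<close>

lemma two_nonzero_k: "(2::'k) \<noteq> 0"
proof
  assume "(2::'k) = 0"
  then have "CHAR('k) dvd 2" using of_nat_eq_0_iff_char_dvd[of 2, where 'a='k] by simp
  moreover have "CHAR('k) \<noteq> 2" using lt_ax by (simp add: lt_field_axioms_def)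
  moreover have "CHAR('k) \<noteq> 1" by simp
  ultimately show False using prime_nat_iff[of 2] by auto
qed

lemma v_two: "v 2 = 0"
  using br_nonzero_iff[of 2] br_of_nat[of 2] two_nonzero_k ge_of_nat[of 2] by simp

text \<open>0, 1 and -1 are distinct because the residue characteristic is not 2. The bound is used,
  among other places, to push h^q to at least three times the valuation of h in the equation of the
  curve.\<close>

lemma q_ge_3: "3 \<le> q"
proof -
  have "(1::'k) \<noteq> -1" using two_nonzero_k by (metis one_add_one add.left_inverse)
  then have "card {0, 1, -1::'k} = 3" by simp
  moreover have "{0, 1, -1} \<subseteq> Fq S" using Fq_minus[of 1] by simp
  ultimately show ?thesis unfolding qq_def by (metis card_mono Fq_finite)
qed

lemma q_pos [simp]: "0 < q" and q_nonzero [simp]: "q \<noteq> 0" and q_ge_1 [simp]: "Suc 0 \<le> q"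
  using q_ge_3 by simp_all

text \<open>Multiplication by a nonzero z permutes \<open>Fq S - {0}\<close>; comparing the products
  of all elements gives z^(q-1) = 1. The argument is spelled out since \<open>Fq S\<close> is a
  subset of the residue field and not a type.\<close>

lemma Fq_power_q: assumes "z \<in> Fq S" shows "z ^ q = z"
proof (cases "z = 0")
  case True then show ?thesis using q_pos by simp
next
  case False
  let ?A = "Fq S - {0}"
  have fin: "finite ?A" by simp
  have inj: "inj_on (times z) ?A" using False by (auto simp: inj_on_def)
  have sub: "times z ` ?A \<subseteq> ?A" using False assms Fq_mult by auto
  have "times z ` ?A = ?A" using fin inj sub by (simp add: card_image card_subset_eq)
  then have "bij_betw (times z) ?A ?A" using inj by (simp add: bij_betw_def)
  then have "(\<Prod>y\<in>?A. z * y) = (\<Prod>y\<in>?A. y)"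
    by (rule prod.reindex_bij_betw)
  moreover have "(\<Prod>y\<in>?A. z * y) = z ^ card ?A * (\<Prod>y\<in>?A. y)" by (simp add: prod.distrib)
  moreover have "(\<Prod>y\<in>?A. y) \<noteq> 0" using fin by simp
  ultimately have "z ^ card ?A = 1" by simp
  moreover have "q = Suc (card ?A)" using Fq_0 Fq_finite unfolding qq_def
    by (metis card.remove)
  ultimately show ?thesis by (metis power_Suc2 mult_1)
qed

lemma binom_char: assumes "0 < j" "j < q" shows "of_nat (q choose j) = (0::'k)"
proof -
  define P :: "'k poly" where "P = (\<Sum>k\<in>{0<..<q}. monom (of_nat (q choose k)) k)"
  have cP: "poly.coeff P n = (if 0 < n \<and> n < q then of_nat (q choose n) else 0)" for n
    by (auto simp: P_def coeff_sum if_distrib sum.delta cong: if_cong)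
  have "poly P z = 0" if "z \<in> Fq S" for z
  proof -
    have dj: "{..q} = {0<..<q} \<union> {0, q}" using q_pos by auto
    have "(z + 1) ^ q = (\<Sum>k\<le>q. of_nat (q choose k) * z ^ k * 1 ^ (q - k))"
      by (rule binomial_ring)
    also have "\<dots> = (\<Sum>k\<in>{0<..<q}. of_nat (q choose k) * z ^ k) + (\<Sum>k\<in>{0, q}. of_nat (q choose k) * z ^ k)"
      unfolding dj by (subst sum.union_disjoint) auto
    also have "(\<Sum>k\<in>{0, q}. of_nat (q choose k) * z ^ k) = 1 + z ^ q" using q_pos by simp
    also have "(\<Sum>k\<in>{0<..<q}. of_nat (q choose k) * z ^ k) = poly P z"
      by (simp add: P_def poly_sum poly_monom)
    finally show ?thesis using Fq_power_q[OF that] Fq_power_q[OF Fq_add[OF that Fq_1]] by simp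
  qed
  then have "Fq S \<subseteq> {z. poly P z = 0}" by auto
  moreover have "degree P < q"
    by (rule le_less_trans[of _ "q - 1"]) (auto intro!: degree_le simp: cP)
  ultimately have "P = 0"
    using card_mono[of "{z. poly P z = 0}" "Fq S"] poly_roots_finite[of P] card_poly_roots_bound[of P]
    unfolding qq_def by fastforce
  then show ?thesis using cP[of j] assms by simp
qed

lemma binom_ge: assumes "0 < j" "j < q" shows "ge 1 (of_nat (q choose j))"
proof (rule OF_ge_1[OF OF_of_nat])
  show "0 < v (of_nat (q choose j))"
    using binom_char[OF assms] br_eq_0_iff[OF ge_of_nat[of "q choose j"]] by (simp add: br_of_nat)
qed

text \<open>Each middle term has a binomial coefficient divisible by \<pi> and at least one factor
  \<open>y\<close>; its other q - 1 factors have valuation at least \<open>s\<close>.\<close>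

lemma frob_gen: assumes "s \<le> r" "ge s x" "ge r y"
  shows "ge (1 + r + (real q - 1) * s) ((x + y) ^ q - x ^ q - y ^ q)"
proof -
  have dj: "{..q} = {0<..<q} \<union> {0, q}" using q_pos by auto
  have "(x + y) ^ q = (\<Sum>k\<le>q. of_nat (q choose k) * x ^ k * y ^ (q - k))"
    by (rule binomial_ring)
  also have "\<dots> = (\<Sum>k\<in>{0<..<q}. of_nat (q choose k) * x ^ k * y ^ (q - k))
      + (\<Sum>k\<in>{0, q}. of_nat (q choose k) * x ^ k * y ^ (q - k))"
    unfolding dj by (subst sum.union_disjoint) auto
  also have "(\<Sum>k\<in>{0, q}. of_nat (q choose k) * x ^ k * y ^ (q - k)) = y ^ q + x ^ q"
    using q_pos by simp
  finally have eq: "(x + y) ^ q - x ^ q - y ^ q = (\<Sum>k\<in>{0<..<q}. of_nat (q choose k) * x ^ k * y ^ (q - k))"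
    by simp
  show ?thesis unfolding eq
  proof (rule ge_sum)
    fix k assume k: "k \<in> {0<..<q}"
    define m where "m = q - k - 1"
    have qm: "q = k + m + 1" using k by (simp add: m_def)
    have "ge (1 + real k * s + real (q - k) * r) (of_nat (q choose k) * x ^ k * y ^ (q - k))"
      using k by (intro ge_mult binom_ge ge_power assms) auto
    moreover have "real m * s \<le> real m * r" using assms by (intro mult_left_mono) auto
    ultimately show "ge (1 + r + (real q - 1) * s) (of_nat (q choose k) * x ^ k * y ^ (q - k))"
      by (elim ge_mono) (simp add: qm algebra_simps)
  qed
qed

lemma frob0: assumes "ge 0 x" "ge r y" "0 \<le> r"
  shows "cg (1 + r) ((x + y) ^ q) (x ^ q + y ^ q)"
  using frob_gen[of 0 r x y] assms by (simp add: cg_def algebra_simps)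

text \<open>The mixed terms gain the valuation 1 of \<pi>, and (x - y)^q gains as much because q r
  is at least 2 r, hence at least 1 + r. So the q-th power map contracts balls of radius parameter
  at least 1.\<close>

lemma frob_cg: assumes "1 \<le> r" "cg r x y" "ge 0 y" shows "cg (1 + r) (x ^ q) (y ^ q)"
proof -
  have "cg (1 + r) ((y + (x - y)) ^ q) (y ^ q + (x - y) ^ q)"
    using assms by (intro frob0) (auto simp: cg_def)
  moreover have "ge (1 + r) ((x - y) ^ q)"
  proof (rule ge_mono[OF ge_power])
    show "ge r (x - y)" using assms by (simp add: cg_def)
    have "2 * r \<le> real q * r" using q_ge_3 assms by (intro mult_right_mono) auto
    then show "1 + r \<le> real q * r" using assms by linarith
  qed
  ultimately show ?thesis using ge_add[of "1 + r" "x ^ q - (y ^ q + (x - y) ^ q)" "(x - y) ^ q"]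
    by (simp add: cg_def)
qed

lemma OF_fermat: assumes "a \<in> OF S" shows "ge 1 (a ^ q - a)"
proof (rule OF_ge_1)
  show "a ^ q - a \<in> OF S" using assms by (intro OF_diff OF_power)
  show "0 < v (a ^ q - a)"
    using Fq_power_q[OF Fq_bar[OF assms]] assms by (subst br_eq_iff[symmetric]) (auto simp: OF_ge ge_power0 br_power)
qed

section \<open>Teichmueller representatives\<close>

lemma mu0_iff: "x \<in> mu0 S \<longleftrightarrow> x \<in> OF S \<and> x ^ q = x"
proof -
  have "q = Suc (q - 1)" using q_pos by simp
  then have "x ^ q = x * x ^ (q - 1)" by (metis power_Suc)
  then have "x ^ q = x \<longleftrightarrow> x = 0 \<or> x ^ (q - 1) = 1" by auto
  then show ?thesis unfolding mu0_def by auto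
qed

lemma mu0_OF: "x \<in> mu0 S \<Longrightarrow> x \<in> OF S" by (simp add: mu0_iff)
lemma mu0_ge: "x \<in> mu0 S \<Longrightarrow> ge 0 x" by (simp add: mu0_iff OF_ge)
lemma mu0_power_q: "x \<in> mu0 S \<Longrightarrow> x ^ q = x" by (simp add: mu0_iff)

lemma mu0_mult: "x \<in> mu0 S \<Longrightarrow> y \<in> mu0 S \<Longrightarrow> x * y \<in> mu0 S"
  by (simp add: mu0_iff OF_mult power_mult_distrib)

lemma mu0_0 [simp]: "0 \<in> mu0 S" by (simp add: mu0_def)
lemma mu0_1 [simp]: "1 \<in> mu0 S" by (simp add: mu0_iff)

lemma mu0_unit: "x \<in> mu0 S \<Longrightarrow> x \<noteq> 0 \<Longrightarrow> v x = 0"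
  using v_unit_root[of "q - 1" x] q_ge_3 by (auto simp: mu0_def)

text \<open>Both elements are fixed by the q-th power map, so \<open>frob_cg\<close> improves their
  congruence without end. It starts at 1 because valuations on \<open>F\<close> are
  integers.\<close>

lemma mu0_inj: assumes "x \<in> mu0 S" "y \<in> mu0 S" "br x = br y" shows "x = y"
proof -
  have "ge 1 (x - y)" using assms by (intro OF_ge_1 OF_diff) (auto simp: mu0_OF mu0_ge br_eq_iff)
  moreover have "ge (r + 1) (x - y)" if "ge r (x - y)" "1 \<le> r" for r
    using frob_cg[of r x y] that assms by (simp add: cg_def mu0_iff mu0_ge add.commute)
  ultimately show ?thesis using zero_if_ge_increase[of 1 1 "x - y"] by simp
qed

text \<open>The representative is the limit of a^(q^n) for any lift a: Fermat's congruence gives the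
  first step and \<open>frob_cg\<close> improves each further one by 1.\<close>

lemma mu0_exists: assumes "z \<in> Fq S" shows "\<exists>x. x \<in> mu0 S \<and> br x = z"
proof -
  obtain a where a: "a \<in> OF S" "br a = z" using FqE assms by blast
  define X where "X n = a ^ (q ^ n)" for n
  have XS: "X (Suc n) = X n ^ q" for n by (simp add: X_def flip: power_mult) (simp add: mult.commute)
  have XO: "X n \<in> OF S" for n by (simp add: X_def OF_power a)
  have st: "ge (1 + 1 * real n) (X (Suc n) - X n)" for n
  proof (induction n)
    case 0 then show ?case using OF_fermat[OF a(1)] by (simp add: X_def)
  next
    case (Suc n)
    then show ?case using frob_cg[of "1 + real n" "X (Suc n)" "X n"]
      by (simp add: cg_def XS OF_ge XO)
  qed
  have "vcauchy v X" using vcauchy_of_steps[OF _ st] by simp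
  moreover have "vcomplete v (base S)" using lt_ax by (simp add: lt_field_axioms_def)
  moreover have "range X \<subseteq> base S" using XO by (auto simp: OF_iff)
  ultimately have "\<exists>l\<in>base S. vtends v X l" by (simp add: vcomplete_def)
  then obtain l where l: "l \<in> base S" "vtends v X l" by blast
  have "ge 0 l" by (rule vtends_ge[OF l(2)]) (simp add: OF_ge XO)
  then have lO: "l \<in> OF S" using l by (simp add: OF_iff)
  have "vtends v (\<lambda>n. X (Suc n)) l"
    using l(2) by (simp add: vtends_def eventually_sequentially_Suc[of "\<lambda>n. ge N (X n - l)" for N])
  moreover have "vtends v (\<lambda>n. X (Suc n)) (l ^ q)" unfolding vtends_def
  proof
    fix N :: real
    define M where "M = max N 1"
    have M: "N \<le> 1 + M" "1 \<le> M" by (auto simp: M_def)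
    have "\<forall>\<^sub>F n in sequentially. ge M (X n - l)" using l(2) by (auto simp: vtends_def)
    then show "\<forall>\<^sub>F n in sequentially. ge N (X (Suc n) - l ^ q)"
    proof eventually_elim
      case (elim n)
      have "cg (1 + M) (X n ^ q) (l ^ q)" using elim \<open>ge 0 l\<close> M by (intro frob_cg) (auto simp: cg_def)
      then show ?case using M ge_mono[of "1 + M" _ N] by (simp add: cg_def XS)
    qed
  qed
  ultimately have "l ^ q = l" using vtends_unique by blast
  moreover have "br l = z"
  proof -
    have "vtends v (\<lambda>n. X n - a) (l - a)" by (rule vtends_diff[OF l(2) vtends_const])
    moreover have "ge 1 (X n - a)" for n
    proof (induction n)
      case (Suc n)
      then show ?case using ge_add[of 1 "X (Suc n) - X n" "X n - a"] ge_mono[OF st[of n], of 1] by simp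
    qed (simp add: X_def)
    ultimately have "ge 1 (l - a)" by (intro vtends_ge) auto
    then show ?thesis using br_cg[of 1 l a] a OF_ge by (simp add: cg_def)
  qed
  ultimately show ?thesis using lO by (auto simp: mu0_iff)
qed

lemma teich: assumes "z \<in> Fq S" shows teich_mu0: "teich S z \<in> mu0 S" and br_teich: "br (teich S z) = z"
proof -
  have "\<exists>!x. x \<in> mu0 S \<and> br x = z" using mu0_exists[OF assms] mu0_inj by auto
  from theI'[OF this] show "teich S z \<in> mu0 S" "br (teich S z) = z" by (simp_all add: teich_def)
qed

lemma teich_br: assumes "x \<in> mu0 S" shows "teich S (br x) = x"
  using teich[OF Fq_bar[OF mu0_OF[OF assms]]] assms mu0_inj by auto

lemma teich_mult: "z \<in> Fq S \<Longrightarrow> w \<in> Fq S \<Longrightarrow> teich S (z * w) = teich S z * teich S w"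
  by (rule mu0_inj) (auto simp: teich_mu0 mu0_mult br_teich Fq_mult br_mult mu0_ge)

lemma teich_0: "teich S 0 = 0"
  using teich_br[of 0] by simp

lemma teich_unit: "z \<in> Fq S \<Longrightarrow> z \<noteq> 0 \<Longrightarrow> v (teich S z) = 0"
  using br_nonzero_iff[of "teich S z"] by (simp add: teich_mu0 br_teich mu0_ge)

lemma OF_teich_diff: assumes "a \<in> OF S" shows "(a - teich S (br a)) / \<pi> \<in> OF S"
  using assms Fq_bar[OF assms]
  by (intro OF_divide_pi OF_diff mu0_OF[OF teich_mu0])
     (auto simp: br_eq_iff[symmetric] OF_ge mu0_ge teich_mu0 br_teich)

lemma vcomplete_C: assumes "vcauchy v X" shows "\<exists>l. vtends v X l"
proof -
  have "vcomplete v (UNIV :: 'c set)" using lt_ax by (simp add: lt_field_axioms_def)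
  then show ?thesis using assms by (simp add: vcomplete_def)
qed

end

subsection \<open>Integrality of the formal module\<close>

unbundle no vec_syntax
unbundle fps_syntax

definition agree :: "nat \<Rightarrow> 'a::zero fps \<Rightarrow> 'a fps \<Rightarrow> bool" where
  "agree n g h \<longleftrightarrow> (\<forall>j\<le>n. g $ j = h $ j)"

lemma agree_mult:
  fixes g :: "'a::comm_semiring_0 fps"
  shows "agree n g h \<Longrightarrow> agree n g' h' \<Longrightarrow> agree n (g * g') (h * h')"
  by (auto simp: agree_def fps_mult_nth intro!: sum.cong)

lemma agree_power:
  fixes g :: "'a::comm_semiring_1 fps"
  shows "agree n g h \<Longrightarrow> agree n (g ^ m) (h ^ m)"
  by (induction m) (auto intro: agree_mult simp: agree_def[of n 1 1])

lemma agree_compose: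
  fixes g :: "'a::comm_semiring_1 fps"
  assumes "agree n g h" shows "agree n (lg oo g) (lg oo h)"
  using agree_power[OF assms] by (auto simp: agree_def fps_compose_nth intro!: sum.cong)

text \<open>Writing g = X g' and h = X h', the series g' and h' agree up to degree n - 1, and g^m =
  X^m g'^m shifts this by m, at least 2. The gained degree lets coefficients be determined one after
  the other from f(g) = L.\<close>

lemma agree_power_start0:
  fixes g :: "'a::comm_ring_1 fps"
  assumes "agree n g h" "g $ 0 = 0" "h $ 0 = 0" "2 \<le> m"
  shows "agree (Suc n) (g ^ m) (h ^ m)"
proof -
  define g' h' where "g' = fps_shift 1 g" and "h' = fps_shift 1 h"
  have gh: "g = fps_X * g'" "h = fps_X * h'"
    using assms by (auto simp: g'_def h'_def fps_eq_iff fps_mult_fps_X_commute)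
  show ?thesis
  proof (cases n)
    case 0
    have "(g ^ m) $ j = 0" "(h ^ m) $ j = 0" if "j \<le> 1" for j
      using startsby_zero_power_prefix[of g m] startsby_zero_power_prefix[of h m] assms that by auto
    then show ?thesis using 0 by (auto simp: agree_def)
  next
    case (Suc k)
    have "agree k g' h'" using assms Suc by (auto simp: agree_def g'_def h'_def)
    then have "agree k (g' ^ m) (h' ^ m)" by (rule agree_power)
    then show ?thesis using assms(4) Suc
      by (auto simp: agree_def gh power_mult_distrib fps_X_power_mult_nth)
  qed
qed

context lt_fld
begin

section \<open>The logarithm and its functional equations\<close>

abbreviation "lb \<equiv> lt_b S"
abbreviation "lg \<equiv> lt_log S"

lemma q_power_gt: "n < q ^ n"
  using q_ge_3 by (intro less_exp[of n, THEN less_le_trans] power_mono) auto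

lemma q_power_inj: "q ^ k = q ^ j \<longleftrightarrow> k = j"
  using q_ge_3 by simp

lemma f_nth_power: "lg u $ (q ^ k) = lb u k"
proof -
  have "{j. j \<le> q ^ k \<and> q ^ j = q ^ k} = {k}"
    using q_power_gt[of k] by (auto simp: q_power_inj)
  then show ?thesis by (simp add: lt_log_def)
qed

lemma f_nth_other: "(\<And>k. n \<noteq> q ^ k) \<Longrightarrow> lg u $ n = 0"
  by (simp add: lt_log_def) (metis (mono_tags, lifting) empty_Collect_eq sum.empty)

lemma f_nth_0 [simp]: "lg u $ 0 = 0"
  by (rule f_nth_other) (use q_pos in simp)

lemma f_nth_1 [simp]: "lg u $ 1 = 1" "lg u $ Suc 0 = 1"
  using f_nth_power[of u 0] by auto

lemma power_nth_small:
  fixes g :: "'c fps"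
  assumes "g $ 0 = 0" "n < q ^ k" shows "(g ^ (q ^ k)) $ n = 0"
  using startsby_zero_power_prefix[OF assms(1), of "q ^ k"] assms(2) by blast

text \<open>Only exponents q^k occur in f, and k < q^k, so no relevant k exceeds \<open>N\<close>;
  surplus terms vanish because g has no constant term. The free bound \<open>N\<close> lets sums of
  different lengths be matched in the functional equations.\<close>

lemma f_compose_nth:
  assumes "g $ 0 = 0" "n \<le> N"
  shows "(lg u oo g) $ n = (\<Sum>k\<le>N. lb u k * (g ^ (q ^ k)) $ n)"
proof -
  have "(\<Sum>k\<le>N. lb u k * (g ^ (q ^ k)) $ n) = (\<Sum>i\<in>(\<lambda>k. q ^ k) ` {..N}. lg u $ i * (g ^ i) $ n)"
    by (subst sum.reindex) (auto simp: inj_on_def q_power_inj f_nth_power)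
  also have "\<dots> = (\<Sum>i\<in>{0..n} \<union> (\<lambda>k. q ^ k) ` {..N}. lg u $ i * (g ^ i) $ n)"
  proof (rule sum.mono_neutral_left)
    show "\<forall>i\<in>{0..n} \<union> (\<lambda>k. q ^ k) ` {..N} - (\<lambda>k. q ^ k) ` {..N}. lg u $ i * (g ^ i) $ n = 0"
    proof
      fix i assume i: "i \<in> {0..n} \<union> (\<lambda>k. q ^ k) ` {..N} - (\<lambda>k. q ^ k) ` {..N}"
      have "i \<noteq> q ^ k" for k
      proof
        assume *: "i = q ^ k"
        then have "k < i" using q_power_gt by simp
        then show False using i * assms(2) by auto
      qed
      then show "lg u $ i * (g ^ i) $ n = 0" by (simp add: f_nth_other)
    qed
  qed auto
  also have "\<dots> = (\<Sum>i\<in>{0..n}. lg u $ i * (g ^ i) $ n)"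
  proof (rule sum.mono_neutral_right)
    show "\<forall>i\<in>{0..n} \<union> (\<lambda>k. q ^ k) ` {..N} - {0..n}. lg u $ i * (g ^ i) $ n = 0"
      using assms power_nth_small[OF assms(1), of n] by auto
  qed auto
  finally show ?thesis by (simp add: fps_compose_nth)
qed

lemma b_rec: "\<pi> * lb u (Suc (Suc k)) = lb u (Suc k) * u ^ (q ^ Suc k) + lb u k"
  by simp

lemma b_one: "\<pi> * lb u (Suc 0) = u"
  by simp

text \<open>b_k is a sum over the ways to write k as an ordered sum of parts 1 and 2. The defining
  recursion splits off the last part; this one splits off the first, so that in the remaining factor
  u is raised to the power q or q^2.\<close>

lemma b_rec_left: "\<pi> * lb u (Suc (Suc k)) = u * lb (u ^ q) (Suc k) + lb (u ^ (q\<^sup>2)) k"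
proof (induction k rule: less_induct)
  case (less k)
  have pp: "u ^ (q ^ Suc (Suc n)) = (u ^ q) ^ (q ^ Suc n)" "u ^ (q ^ Suc (Suc n)) = (u ^ (q\<^sup>2)) ^ (q ^ n)" for n
    by (simp_all flip: power_mult power_add add: power2_eq_square mult.assoc)
  show ?case
  proof (cases k)
    case 0
    then show ?thesis using pi_nonzero by (simp add: field_simps)
  next
    case (Suc j)
    have IH1: "\<pi> * lb u (Suc (Suc j)) = u * lb (u ^ q) (Suc j) + lb (u ^ (q\<^sup>2)) j"
      using less[of j] Suc by simp
    have e1: "\<pi> * lb u (Suc (Suc k)) = lb u (Suc (Suc j)) * u ^ (q ^ Suc (Suc j)) + lb u (Suc j)"
      using b_rec[of u k] Suc by simp
    show ?thesis
    proof (cases j)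
      case 0
      have "\<pi> * (\<pi> * lb u (Suc (Suc k))) = (\<pi> * lb u (Suc (Suc j))) * u ^ (q ^ Suc (Suc j)) + \<pi> * lb u (Suc j)"
        unfolding e1 by (simp add: algebra_simps)
      also have "\<dots> = (u * lb (u ^ q) (Suc 0) + 1) * u ^ (q ^ Suc (Suc j)) + u"
        unfolding IH1 using 0 by simp
      also have "\<dots> = u * (lb (u ^ q) (Suc 0) * (u ^ q) ^ (q ^ Suc 0) + 1) + (u ^ (q\<^sup>2))"
        unfolding pp(1) using 0 by (simp add: algebra_simps power2_eq_square flip: power_mult)
      also have "\<dots> = u * (\<pi> * lb (u ^ q) (Suc (Suc 0))) + \<pi> * lb (u ^ (q\<^sup>2)) (Suc 0)"
        using b_rec[of "u ^ q" 0] b_one[of "u ^ (q\<^sup>2)"] by simp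
      also have "\<dots> = \<pi> * (u * lb (u ^ q) (Suc k) + lb (u ^ (q\<^sup>2)) k)" using 0 Suc by (simp add: algebra_simps)
      finally show ?thesis using pi_nonzero by (metis mult_left_cancel)
    next
      case (Suc i)
      have IH2: "\<pi> * lb u (Suc j) = u * lb (u ^ q) (Suc i) + lb (u ^ (q\<^sup>2)) i"
        using less[of i] \<open>k = Suc j\<close> Suc by simp
      have "\<pi> * (\<pi> * lb u (Suc (Suc k))) = (\<pi> * lb u (Suc (Suc j))) * u ^ (q ^ Suc (Suc j)) + \<pi> * lb u (Suc j)"
        unfolding e1 by (simp add: algebra_simps)
      also have "\<dots> = u * (lb (u ^ q) (Suc j) * (u ^ q) ^ (q ^ Suc j) + lb (u ^ q) j)
          + (lb (u ^ (q\<^sup>2)) j * (u ^ (q\<^sup>2)) ^ (q ^ j) + lb (u ^ (q\<^sup>2)) i)"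
        unfolding IH1 IH2 unfolding pp(1)[of j, symmetric] pp(2)[of j, symmetric] using Suc by (simp add: algebra_simps)
      also have "\<dots> = u * (\<pi> * lb (u ^ q) (Suc (Suc j))) + \<pi> * lb (u ^ (q\<^sup>2)) (Suc (Suc i))"
        unfolding b_rec using Suc by simp
      also have "\<dots> = \<pi> * (u * lb (u ^ q) (Suc k) + lb (u ^ (q\<^sup>2)) k)"
        using \<open>k = Suc j\<close> Suc by (simp add: algebra_simps)
      finally show ?thesis using pi_nonzero by (metis mult_left_cancel)
    qed
  qed
qed

lemma sum_two_steps:
  fixes F :: "nat \<Rightarrow> 'c"
  shows "(\<Sum>k\<le>Suc (Suc N). F k) = F 0 + F (Suc 0) + (\<Sum>k\<le>N. F (Suc (Suc k)))"
  by (simp add: sum.atMost_Suc_shift add.assoc del: sum.atMost_Suc)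

text \<open>The form with twisted parameters u^q and u^(q^2): it is compatible with the Frobenius
  lift \<open>famsig\<close> and is therefore the one used for integrality.\<close>

lemma f_left_equation:
  assumes "g $ 0 = 0"
  shows "fps_const \<pi> * (lg u oo g) = fps_const \<pi> * g + fps_const u * (lg (u ^ q) oo (g ^ q))
    + (lg (u ^ (q\<^sup>2)) oo (g ^ (q\<^sup>2)))"
proof (rule fps_ext)
  fix n
  have g0: "(g ^ q) $ 0 = 0" "(g ^ (q\<^sup>2)) $ 0 = 0" using assms by (auto simp: startsby_zero_power)
  let ?G = "\<lambda>k. (g ^ (q ^ k)) $ n"
  have c1: "((g ^ q) ^ (q ^ k)) $ n = ?G (Suc k)" for k
    by (simp flip: power_mult)
  have c2: "((g ^ (q\<^sup>2)) ^ (q ^ k)) $ n = ?G (Suc (Suc k))" for k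
    by (simp add: power2_eq_square mult.assoc flip: power_mult)
  have "(lg u oo g) $ n = (\<Sum>k\<le>Suc (Suc n). lb u k * ?G k)"
    by (rule f_compose_nth[OF assms]) simp
  then have "\<pi> * (lg u oo g) $ n = \<pi> * ?G 0 + \<pi> * lb u (Suc 0) * ?G (Suc 0) + (\<Sum>k\<le>n. \<pi> * lb u (Suc (Suc k)) * ?G (Suc (Suc k)))"
    by (simp only: sum_two_steps) (simp add: algebra_simps sum_distrib_left)
  also have "\<dots> = \<pi> * ?G 0 + u * ?G (Suc 0) + (\<Sum>k\<le>n. u * (lb (u ^ q) (Suc k) * ?G (Suc (Suc k))) + lb (u ^ (q\<^sup>2)) k * ?G (Suc (Suc k)))"
    unfolding b_rec_left b_one by (simp add: algebra_simps)
  also have "\<dots> = \<pi> * ?G 0 + u * (\<Sum>k\<le>Suc n. lb (u ^ q) k * ?G (Suc k)) + (\<Sum>k\<le>n. lb (u ^ (q\<^sup>2)) k * ?G (Suc (Suc k)))"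
    by (simp add: sum.atMost_Suc_shift sum.distrib algebra_simps sum_distrib_left del: sum.atMost_Suc)
  also have "(\<Sum>k\<le>Suc n. lb (u ^ q) k * ?G (Suc k)) = (lg (u ^ q) oo (g ^ q)) $ n"
    by (subst f_compose_nth[OF g0(1), of n "Suc n"]) (auto simp only: c1)
  also have "(\<Sum>k\<le>n. lb (u ^ (q\<^sup>2)) k * ?G (Suc (Suc k))) = (lg (u ^ (q\<^sup>2)) oo (g ^ (q\<^sup>2))) $ n"
    by (subst f_compose_nth[OF g0(2), of n n]) (auto simp only: c2)
  finally show "(fps_const \<pi> * (lg u oo g)) $ n = (fps_const \<pi> * g + fps_const u * (lg (u ^ q) oo (g ^ q))
    + (lg (u ^ (q\<^sup>2)) oo (g ^ (q\<^sup>2)))) $ n" by simp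
qed

text \<open>Here u is the same in all logarithms, so that f^-1 can be applied: [\<pi>]_u(X) becomes
  the formal sum of f^-1(\<pi>X), uX^q and X^(q^2), as used in \<open>smul_pi\<close>.\<close>

lemma f_right_equation:
  assumes "g $ 0 = 0"
  shows "fps_const \<pi> * (lg u oo g) = fps_const \<pi> * g + (lg u oo (fps_const u * g ^ q))
    + (lg u oo (g ^ (q\<^sup>2)))"
proof (rule fps_ext)
  fix n
  have g0: "(fps_const u * g ^ q) $ 0 = 0" "(g ^ (q\<^sup>2)) $ 0 = 0"
    using assms by (auto simp: startsby_zero_power)
  let ?G = "\<lambda>k. (g ^ (q ^ k)) $ n"
  have c1: "((fps_const u * g ^ q) ^ (q ^ k)) $ n = u ^ (q ^ k) * ?G (Suc k)" for k
    by (simp add: power_mult_distrib fps_const_power flip: power_mult)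
  have c2: "((g ^ (q\<^sup>2)) ^ (q ^ k)) $ n = ?G (Suc (Suc k))" for k
    by (simp add: power2_eq_square mult.assoc flip: power_mult)
  have "(lg u oo g) $ n = (\<Sum>k\<le>Suc (Suc n). lb u k * ?G k)"
    by (rule f_compose_nth[OF assms]) simp
  then have "\<pi> * (lg u oo g) $ n = \<pi> * ?G 0 + \<pi> * lb u (Suc 0) * ?G (Suc 0) + (\<Sum>k\<le>n. \<pi> * lb u (Suc (Suc k)) * ?G (Suc (Suc k)))"
    by (simp only: sum_two_steps) (simp add: algebra_simps sum_distrib_left)
  also have "\<dots> = \<pi> * ?G 0 + u * ?G (Suc 0) + (\<Sum>k\<le>n. lb u (Suc k) * (u ^ (q ^ Suc k) * ?G (Suc (Suc k))) + lb u k * ?G (Suc (Suc k)))"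
    unfolding b_rec b_one by (simp add: algebra_simps)
  also have "\<dots> = \<pi> * ?G 0 + (\<Sum>k\<le>Suc n. lb u k * (u ^ (q ^ k) * ?G (Suc k))) + (\<Sum>k\<le>n. lb u k * ?G (Suc (Suc k)))"
    by (simp add: sum.atMost_Suc_shift sum.distrib algebra_simps sum_distrib_left del: sum.atMost_Suc)
  also have "(\<Sum>k\<le>Suc n. lb u k * (u ^ (q ^ k) * ?G (Suc k))) = (lg u oo (fps_const u * g ^ q)) $ n"
    by (subst f_compose_nth[OF g0(1), of n "Suc n"]) (auto simp only: c1)
  also have "(\<Sum>k\<le>n. lb u k * ?G (Suc (Suc k))) = (lg u oo (g ^ (q\<^sup>2))) $ n"
    by (subst f_compose_nth[OF g0(2), of n n]) (auto simp only: c2)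
  finally show "(fps_const \<pi> * (lg u oo g)) $ n = (fps_const \<pi> * g + (lg u oo (fps_const u * g ^ q))
    + (lg u oo (g ^ (q\<^sup>2)))) $ n" by simp
qed

lemma fps_inv_f_0 [simp]: "fps_inv (lg u) $ 0 = 0"
  by (simp add: fps_inv_def)

lemma fps_inv_f: "fps_inv (lg u) oo lg u = fps_X"
  by (rule fps_inv) auto

lemma f_fps_inv: "lg u oo fps_inv (lg u) = fps_X"
  by (rule fps_inv_right) auto

lemma fps_inv_f_compose: "g $ 0 = 0 \<Longrightarrow> fps_inv (lg u) oo (lg u oo g) = g"
  by (subst fps_compose_assoc) (auto simp: fps_inv_f)

lemma f_fps_inv_compose: "g $ 0 = 0 \<Longrightarrow> lg u oo (fps_inv (lg u) oo g) = g"
  by (subst fps_compose_assoc) (auto simp: f_fps_inv)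

lemma f_inject: "g $ 0 = 0 \<Longrightarrow> h $ 0 = 0 \<Longrightarrow> lg u oo g = lg u oo h \<Longrightarrow> g = h"
  by (metis fps_inv_f_compose)

text \<open>Integral power series depending on \<open>(u, x, y)\<close> are treated as families of power series over \<open>'c\<close>
  whose coefficients are in \<open>intpoly\<close>; this replaces power series over \<open>\<O>\<^sub>F[u, x, y]\<close>, on which
  the substitution \<open>sig\<close> of \<open>q\<close>-th powers is a Frobenius lift.\<close>

inductive_set intpoly :: "('c \<times> 'c \<times> 'c \<Rightarrow> 'c) set" where
  const: "a \<in> OF S \<Longrightarrow> (\<lambda>p. a) \<in> intpoly"
| u: "(\<lambda>p. fst p) \<in> intpoly"
| x: "(\<lambda>p. fst (snd p)) \<in> intpoly"
| y: "(\<lambda>p. snd (snd p)) \<in> intpoly"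
| add: "\<phi> \<in> intpoly \<Longrightarrow> \<psi> \<in> intpoly \<Longrightarrow> (\<lambda>p. \<phi> p + \<psi> p) \<in> intpoly"
| mult: "\<phi> \<in> intpoly \<Longrightarrow> \<psi> \<in> intpoly \<Longrightarrow> (\<lambda>p. \<phi> p * \<psi> p) \<in> intpoly"

definition sig :: "'c \<times> 'c \<times> 'c \<Rightarrow> 'c \<times> 'c \<times> 'c" where
  "sig p = (fst p ^ q, fst (snd p) ^ q, snd (snd p) ^ q)"

lemma intpoly_minus: "\<phi> \<in> intpoly \<Longrightarrow> (\<lambda>p. - \<phi> p) \<in> intpoly"
  using intpoly.mult[OF intpoly.const[of "- 1"], of \<phi>] OF_minus[OF OF_one] by simp

lemma intpoly_diff: "\<phi> \<in> intpoly \<Longrightarrow> \<psi> \<in> intpoly \<Longrightarrow> (\<lambda>p. \<phi> p - \<psi> p) \<in> intpoly"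
  using intpoly.add[of \<phi> "\<lambda>p. - \<psi> p"] intpoly_minus[of \<psi>] by simp

lemma intpoly_0: "(\<lambda>p. 0) \<in> intpoly" by (rule intpoly.const) simp
lemma intpoly_1: "(\<lambda>p. 1) \<in> intpoly" by (rule intpoly.const) simp

lemma intpoly_if:
  "(P \<Longrightarrow> \<phi> \<in> intpoly) \<Longrightarrow> (\<not> P \<Longrightarrow> \<psi> \<in> intpoly) \<Longrightarrow> (\<lambda>p. if P then \<phi> p else \<psi> p) \<in> intpoly"
  by (cases P) simp_all

lemma intpoly_power: "\<phi> \<in> intpoly \<Longrightarrow> (\<lambda>p. \<phi> p ^ n) \<in> intpoly"
  by (induction n) (auto intro: intpoly_1 intpoly.mult)

lemma intpoly_sum: "(\<And>i. i \<in> A \<Longrightarrow> \<phi> i \<in> intpoly) \<Longrightarrow> (\<lambda>p. \<Sum>i\<in>A. \<phi> i p) \<in> intpoly"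
  by (induction A rule: infinite_finite_induct) (auto intro: intpoly_0 intpoly.add)

lemma intpoly_sig: "\<phi> \<in> intpoly \<Longrightarrow> (\<lambda>p. \<phi> (sig p)) \<in> intpoly"
  by (induction rule: intpoly.induct)
     (auto simp: sig_def intro: intpoly.const intpoly_power[OF intpoly.u] intpoly_power[OF intpoly.x]
       intpoly_power[OF intpoly.y] intpoly.add intpoly.mult)

lemma intpoly_ge:
  "\<phi> \<in> intpoly \<Longrightarrow> ge 0 (fst p) \<Longrightarrow> ge 0 (fst (snd p)) \<Longrightarrow> ge 0 (snd (snd p)) \<Longrightarrow> ge 0 (\<phi> p)"
  by (induction rule: intpoly.induct) (auto intro: OF_ge ge_add ge_mult_left)

text \<open>The specialization x = 1, y = 0 leads from the generic combination
  \<open>logcomb\<close> to the series [a]_u.\<close>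

lemma intpoly_fst: "\<phi> \<in> intpoly \<Longrightarrow> (\<lambda>p. \<phi> (fst p, 1, 0)) \<in> intpoly"
  by (induction rule: intpoly.induct)
     (auto intro: intpoly.const intpoly.u intpoly_0 intpoly_1 intpoly.add intpoly.mult)

lemma binom_pi: assumes "0 < j" "j < q" obtains c where "c \<in> OF S" "of_nat (q choose j) = \<pi> * c"
proof
  have "0 < v (of_nat (q choose j))"
    using binom_ge[OF assms] by (auto intro: less_le_trans[of _ "ereal 1"])
  then show "of_nat (q choose j) / \<pi> \<in> OF S" using OF_divide_pi OF_of_nat by blast
qed simp

section \<open>Families of integral power series and congruences modulo powers of \<pi>\<close>

definition intfam :: "('c \<times> 'c \<times> 'c \<Rightarrow> 'c fps) set" where
  "intfam = {G. \<forall>n. (\<lambda>p. G p $ n) \<in> intpoly}"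

lemma intfam_nth: "G \<in> intfam \<Longrightarrow> (\<lambda>p. G p $ n) \<in> intpoly"
  by (simp add: intfam_def)

lemma intfam_add: "G \<in> intfam \<Longrightarrow> H \<in> intfam \<Longrightarrow> (\<lambda>p. G p + H p) \<in> intfam"
  by (simp add: intfam_def intpoly.add)

lemma intfam_mult: "G \<in> intfam \<Longrightarrow> H \<in> intfam \<Longrightarrow> (\<lambda>p. G p * H p) \<in> intfam"
  by (simp add: intfam_def fps_mult_nth intpoly_sum intpoly.mult)

lemma intfam_const: "\<phi> \<in> intpoly \<Longrightarrow> (\<lambda>p. fps_const (\<phi> p)) \<in> intfam"
  by (auto simp: intfam_def intro!: intpoly_if intpoly_0)

lemma intfam_X: "(\<lambda>p. fps_X) \<in> intfam"
  by (auto simp: intfam_def fps_X_def intro!: intpoly_if intpoly_0 intpoly_1)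

lemma intfam_power: "G \<in> intfam \<Longrightarrow> (\<lambda>p. G p ^ n) \<in> intfam"
proof (induction n)
  case 0
  then show ?case using intfam_const[OF intpoly_1] by simp
qed (auto intro: intfam_mult)

lemma intfam_sum: "(\<And>i. i \<in> A \<Longrightarrow> G i \<in> intfam) \<Longrightarrow> (\<lambda>p. \<Sum>i\<in>A. G i p) \<in> intfam"
  using intfam_const[OF intpoly_0]
  by (induction A rule: infinite_finite_induct) (auto intro: intfam_add)

lemma intfam_cutoff: "(\<And>j. j < n \<Longrightarrow> (\<lambda>p. G p $ j) \<in> intpoly) \<Longrightarrow> (\<lambda>p. fps_cutoff n (G p)) \<in> intfam"
  by (auto simp: intfam_def intro!: intpoly_if intpoly_0)

definition famcg :: "nat \<Rightarrow> ('c \<times> 'c \<times> 'c \<Rightarrow> 'c fps) \<Rightarrow> ('c \<times> 'c \<times> 'c \<Rightarrow> 'c fps) \<Rightarrow> bool" where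
  "famcg j G H \<longleftrightarrow> (\<exists>K\<in>intfam. \<forall>p. G p = H p + fps_const (\<pi> ^ j) * K p)"

lemma famcgI: "K \<in> intfam \<Longrightarrow> (\<And>p. G p = H p + fps_const (\<pi> ^ j) * K p) \<Longrightarrow> famcg j G H"
  by (auto simp: famcg_def)

lemma famcg_trans: "famcg j G H \<Longrightarrow> famcg j H K \<Longrightarrow> famcg j G K"
proof -
  assume "famcg j G H" "famcg j H K"
  then obtain A B where "A \<in> intfam" "B \<in> intfam" "\<And>p. G p = H p + fps_const (\<pi> ^ j) * A p"
    "\<And>p. H p = K p + fps_const (\<pi> ^ j) * B p" by (auto simp: famcg_def)
  then show ?thesis by (intro famcgI[of "\<lambda>p. A p + B p"] intfam_add) (auto simp: algebra_simps)
qed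

text \<open>The binomial theorem: every middle coefficient provides one \<pi>, and every middle term
  contains at least one factor \<pi>^j, so the subtraction in the exponents of \<open>K\<close> is a
  true one.\<close>

lemma fam_frob:
  assumes A: "A \<in> intfam" and B: "B \<in> intfam"
  shows "\<exists>K\<in>intfam. \<forall>p. (A p + fps_const (\<pi> ^ j) * B p) ^ q
        = A p ^ q + fps_const (\<pi> ^ (j * q)) * B p ^ q + fps_const (\<pi> ^ (j + 1)) * K p"
proof -
  have "\<exists>c. \<forall>k\<in>{0<..<q}. c k \<in> OF S \<and> of_nat (q choose k) = \<pi> * c k"
    by (rule bchoice) (metis binom_pi greaterThanLessThan_iff)
  then obtain c where c: "\<And>k. k \<in> {0<..<q} \<Longrightarrow> c k \<in> OF S"
    "\<And>k. k \<in> {0<..<q} \<Longrightarrow> of_nat (q choose k) = \<pi> * c k" by metis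
  define K where "K p = (\<Sum>k\<in>{0<..<q}. fps_const (c k * \<pi> ^ (j * (q - k) - j)) * (A p ^ k * B p ^ (q - k)))" for p
  have "K \<in> intfam" unfolding K_def
    by (intro intfam_sum intfam_mult intfam_const intpoly.const intfam_power OF_mult OF_power A B c OF_pi)
  moreover have "(A p + fps_const (\<pi> ^ j) * B p) ^ q
        = A p ^ q + fps_const (\<pi> ^ (j * q)) * B p ^ q + fps_const (\<pi> ^ (j + 1)) * K p" for p
  proof -
    let ?P = "fps_const (\<pi> ^ j)"
    have dj: "{..q} = {0<..<q} \<union> {0, q}" using q_pos by auto
    have "(A p + ?P * B p) ^ q = (\<Sum>k\<le>q. of_nat (q choose k) * A p ^ k * (?P * B p) ^ (q - k))"
      by (rule binomial_ring)
    also have "\<dots> = (\<Sum>k\<in>{0<..<q}. of_nat (q choose k) * A p ^ k * (?P * B p) ^ (q - k))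
        + (\<Sum>k\<in>{0, q}. of_nat (q choose k) * A p ^ k * (?P * B p) ^ (q - k))"
      unfolding dj by (subst sum.union_disjoint) auto
    also have "(\<Sum>k\<in>{0, q}. of_nat (q choose k) * A p ^ k * (?P * B p) ^ (q - k))
        = A p ^ q + fps_const (\<pi> ^ (j * q)) * B p ^ q"
      using q_pos by (simp add: power_mult_distrib power_mult fps_const_power)
    also have "(\<Sum>k\<in>{0<..<q}. of_nat (q choose k) * A p ^ k * (?P * B p) ^ (q - k)) = fps_const (\<pi> ^ (j + 1)) * K p"
      unfolding K_def sum_distrib_left
    proof (rule sum.cong)
      fix k assume k: "k \<in> {0<..<q}"
      have "j * 1 \<le> j * (q - k)" using k by (intro mult_left_mono) auto
      then have "j + 1 + (j * (q - k) - j) = 1 + j * (q - k)" by simp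
      then have pw: "\<pi> ^ (j + 1) * \<pi> ^ (j * (q - k) - j) = \<pi> * \<pi> ^ (j * (q - k))"
        by (simp flip: power_add power_Suc)
      have "of_nat (q choose k) * A p ^ k * (?P * B p) ^ (q - k)
          = fps_const (\<pi> * c k * \<pi> ^ (j * (q - k))) * (A p ^ k * B p ^ (q - k))"
        by (simp add: fps_of_nat[symmetric] c(2)[OF k] power_mult_distrib fps_const_power
            flip: power_mult fps_const_mult) 
      also have "\<pi> * c k * \<pi> ^ (j * (q - k)) = \<pi> ^ (j + 1) * (c k * \<pi> ^ (j * (q - k) - j))"
        using pw by (simp add: algebra_simps)
      finally show "of_nat (q choose k) * A p ^ k * (?P * B p) ^ (q - k)
          = fps_const (\<pi> ^ (j + 1)) * (fps_const (c k * \<pi> ^ (j * (q - k) - j)) * (A p ^ k * B p ^ (q - k)))"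
        by (simp add: mult.assoc flip: fps_const_mult)
    qed simp
    finally show ?thesis by (simp add: algebra_simps)
  qed
  ultimately show ?thesis by blast
qed

text \<open>One more \<pi> is gained: the middle terms have it from the binomial coefficients, the
  last term because j q is at least j + 1 for positive j.\<close>

lemma famcg_power_q:
  assumes "famcg j G H" "H \<in> intfam" "0 < j"
  shows "famcg (Suc j) (\<lambda>p. G p ^ q) (\<lambda>p. H p ^ q)"
proof -
  obtain B where B: "B \<in> intfam" "\<And>p. G p = H p + fps_const (\<pi> ^ j) * B p"
    using assms(1) by (auto simp: famcg_def)
  obtain K where K: "K \<in> intfam" "\<And>p. (H p + fps_const (\<pi> ^ j) * B p) ^ q
        = H p ^ q + fps_const (\<pi> ^ (j * q)) * B p ^ q + fps_const (\<pi> ^ (j + 1)) * K p"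
    using fam_frob[OF assms(2) B(1), of j] by blast
  have "j * 2 \<le> j * q" using q_ge_3 by (intro mult_left_mono) auto
  moreover have "Suc j \<le> j * 2" using assms(3) by simp
  ultimately have "Suc j \<le> j * q" by (rule order_trans[rotated])
  then have jq: "j * q = Suc j + (j * q - Suc j)" by (rule le_add_diff_inverse[symmetric])
  show ?thesis
  proof (rule famcgI)
    show "(\<lambda>p. fps_const (\<pi> ^ (j * q - Suc j)) * B p ^ q + K p) \<in> intfam"
      by (intro intfam_add intfam_mult intfam_const intpoly.const intfam_power OF_power B K OF_pi)
    show "G p ^ q = H p ^ q + fps_const (\<pi> ^ Suc j) * (fps_const (\<pi> ^ (j * q - Suc j)) * B p ^ q + K p)" for p
    proof -
      have e: "fps_const (\<pi> ^ (j * q)) = fps_const (\<pi> ^ Suc j) * fps_const (\<pi> ^ (j * q - Suc j))"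
        by (subst jq) (simp add: power_add)
      show ?thesis unfolding B(2) K(2) e by (simp add: algebra_simps)
    qed
  qed
qed

lemma famcg_power_qk:
  assumes "famcg 1 G H" "H \<in> intfam"
  shows "famcg (Suc k) (\<lambda>p. G p ^ (q ^ k)) (\<lambda>p. H p ^ (q ^ k))"
proof (induction k)
  case (Suc k)
  have "famcg (Suc (Suc k)) (\<lambda>p. (G p ^ (q ^ k)) ^ q) (\<lambda>p. (H p ^ (q ^ k)) ^ q)"
    by (rule famcg_power_q[OF Suc]) (auto intro: intfam_power assms)
  then show ?case by (simp add: mult.commute flip: power_mult)
qed (use assms in simp)

text \<open>The Frobenius lift on families: \<open>sig\<close> on the parameters and X to X^q.
  Constants from \<open>OF S\<close> stay fixed, being congruent to their q-th powers modulo
  \<pi>.\<close>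

definition famsig :: "('c \<times> 'c \<times> 'c \<Rightarrow> 'c fps) \<Rightarrow> 'c \<times> 'c \<times> 'c \<Rightarrow> 'c fps" where
  "famsig G p = G (sig p) oo fps_X ^ q"

lemma compose_Xq_nth: "((g :: 'c fps) oo fps_X ^ q) $ n = (if q dvd n then g $ (n div q) else 0)"
proof -
  have q0: "q \<noteq> 0" using q_ge_3 by simp
  have p: "((fps_X ^ q) ^ i :: 'c fps) $ n = (if n = q * i then 1 else 0)" for i
    by (simp add: fps_X_power_nth flip: power_mult)
  have "(g oo fps_X ^ q) $ n = (\<Sum>i=0..n. if n = q * i then g $ i else 0)"
    unfolding fps_compose_nth p by (intro sum.cong) auto
  also have "\<dots> = (if q dvd n then g $ (n div q) else 0)"
  proof (cases "q dvd n")
    case True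
    then obtain m where m: "n = q * m" by blast
    have "(\<Sum>i=0..n. if n = q * i then g $ i else 0) = (\<Sum>i=0..n. if i = m then g $ i else 0)"
      using m q0 by (intro sum.cong) auto
    moreover have "m \<le> n" using m q0 by simp
    ultimately show ?thesis using m q0 by simp
  next
    case False
    then have "(\<Sum>i=0..n. if n = q * i then g $ i else 0) = 0" by (intro sum.neutral) auto
    then show ?thesis using False by simp
  qed
  finally show ?thesis .
qed

lemma famsig_nth: "famsig G p $ n = (if q dvd n then G (sig p) $ (n div q) else 0)"
  by (simp add: famsig_def compose_Xq_nth)

lemma famsig_intfam: "G \<in> intfam \<Longrightarrow> famsig G \<in> intfam"
  unfolding intfam_def
proof safe
  fix n assume G: "\<forall>n. (\<lambda>p. G p $ n) \<in> intpoly"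
  show "(\<lambda>p. famsig G p $ n) \<in> intpoly" unfolding famsig_nth
    using intpoly_sig[OF G[rule_format, of "n div q"]] by (intro intpoly_if intpoly_0)
qed

text \<open>Induction on the polynomial: Fermat's congruence for constants, equality for the
  variables, and \<open>fam_frob\<close> on constant series for sums.\<close>

lemma intpoly_frob: "\<phi> \<in> intpoly \<Longrightarrow> \<exists>\<psi>\<in>intpoly. \<forall>p. \<phi> p ^ q = \<phi> (sig p) + \<pi> * \<psi> p"
proof (induction rule: intpoly.induct)
  case (const a)
  have "0 < v (a ^ q - a)" using OF_fermat[OF const] by (auto intro: less_le_trans[of _ "ereal 1"])
  then have "(a ^ q - a) / \<pi> \<in> OF S" using const by (intro OF_divide_pi OF_diff OF_power)
  then show ?case by (intro bexI[of _ "\<lambda>p. (a ^ q - a) / \<pi>"]) (auto intro: intpoly.const)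
next
  case (add \<phi> \<psi>)
  obtain \<phi>' \<psi>' where *: "\<phi>' \<in> intpoly" "\<psi>' \<in> intpoly" "\<And>p. \<phi> p ^ q = \<phi> (sig p) + \<pi> * \<phi>' p"
    "\<And>p. \<psi> p ^ q = \<psi> (sig p) + \<pi> * \<psi>' p" using add.IH by blast
  obtain K where K: "K \<in> intfam" "\<And>p. (fps_const (\<phi> p) + fps_const (\<pi> ^ 0) * fps_const (\<psi> p)) ^ q
        = fps_const (\<phi> p) ^ q + fps_const (\<pi> ^ (0 * q)) * fps_const (\<psi> p) ^ q + fps_const (\<pi> ^ (0 + 1)) * K p"
    using fam_frob[OF intfam_const[OF add.hyps(1)] intfam_const[OF add.hyps(2)], of 0] by blast
  have "(\<phi> p + \<psi> p) ^ q = \<phi> p ^ q + \<psi> p ^ q + \<pi> * K p $ 0" for p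
    using arg_cong[OF K(2)[of p], of "\<lambda>g. g $ 0"] by (simp add: fps_const_power)
  then show ?case using intfam_nth[OF K(1), of 0]
    by (intro bexI[of _ "\<lambda>p. \<phi>' p + \<psi>' p + K p $ 0"] intpoly.add *) (auto simp: * algebra_simps)
next
  case (mult \<phi> \<psi>)
  obtain \<phi>' \<psi>' where *: "\<phi>' \<in> intpoly" "\<psi>' \<in> intpoly" "\<And>p. \<phi> p ^ q = \<phi> (sig p) + \<pi> * \<phi>' p"
    "\<And>p. \<psi> p ^ q = \<psi> (sig p) + \<pi> * \<psi>' p" using mult.IH by blast
  show ?case
    by (intro bexI[of _ "\<lambda>p. \<phi>' p * \<psi> (sig p) + \<phi> p ^ q * \<psi>' p"] intpoly.add intpoly.mult * intpoly_power mult.hyps intpoly_sig)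
       (auto simp: power_mult_distrib * algebra_simps)
qed (auto simp: sig_def intro!: bexI[OF _ intpoly_0])

text \<open>Splitting off the constant term, G = X R + G(0), reduces the coefficient n of G^q to the
  coefficient n - q of R^q; the constant term is covered by \<open>intpoly_frob\<close>.\<close>

lemma fam_power_q_sig:
  assumes "G \<in> intfam"
  shows "famcg 1 (\<lambda>p. G p ^ q) (famsig G)"
proof -
  have "\<exists>\<psi>\<in>intpoly. \<forall>p. (G p ^ q) $ n = famsig G p $ n + \<pi> * \<psi> p" for n
    using assms
  proof (induction n arbitrary: G rule: less_induct)
    case (less n)
    define R where "R p = fps_shift 1 (G p)" for p
    have GR: "G p = fps_X * R p + fps_const (\<pi> ^ 0) * fps_const (G p $ 0)" for p
      using fps_shift_cutoff'[of 1 "G p"] by (auto simp: R_def fps_eq_iff)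
    have R: "R \<in> intfam" using less.prems by (auto simp: intfam_def R_def)
    obtain K where K: "K \<in> intfam" "\<And>p. (fps_X * R p + fps_const (\<pi> ^ 0) * fps_const (G p $ 0)) ^ q
        = (fps_X * R p) ^ q + fps_const (\<pi> ^ (0 * q)) * fps_const (G p $ 0) ^ q + fps_const (\<pi> ^ (0 + 1)) * K p"
      using fam_frob[OF intfam_mult[OF intfam_X R] intfam_const[OF intfam_nth[OF less.prems]], of 0 0] by blast
    have Gq: "(G p ^ q) $ n = (if n < q then 0 else (R p ^ q) $ (n - q)) + (if n = 0 then (G p $ 0) ^ q else 0) + \<pi> * K p $ n" for p
      by (subst GR, subst K(2)) (simp add: power_mult_distrib fps_X_power_mult_nth fps_const_power)
    obtain \<psi>0 where p0: "\<psi>0 \<in> intpoly" "\<And>p. (G p $ 0) ^ q = G (sig p) $ 0 + \<pi> * \<psi>0 p"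
      using intpoly_frob[OF intfam_nth[OF less.prems, of 0]] by blast
    show ?case
    proof (cases "n < q")
      case True
      show ?thesis
      proof (cases "n = 0")
        case True
        then show ?thesis using q_pos p0 Gq
          by (intro bexI[of _ "\<lambda>p. \<psi>0 p + K p $ n"] intpoly.add intfam_nth K) (auto simp: famsig_nth algebra_simps)
      next
        case False
        then have "\<not> q dvd n" using True by (auto dest: dvd_imp_le)
        then show ?thesis using Gq True False
          by (intro bexI[of _ "\<lambda>p. K p $ n"] intfam_nth K) (auto simp: famsig_nth)
      qed
    next
      case False
      then have "n - q < n" using q_ge_3 by linarith
      from less.IH[OF this R] obtain \<psi> where ps: "\<psi> \<in> intpoly"
        "\<And>p. (R p ^ q) $ (n - q) = famsig R p $ (n - q) + \<pi> * \<psi> p" by blast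
      have "famsig R p $ (n - q) = famsig G p $ n" for p
      proof -
        have "q dvd n - q \<longleftrightarrow> q dvd n" using False by (simp add: dvd_minus_self)
        moreover have "Suc ((n - q) div q) = n div q" using False q_pos by (simp add: le_div_geq not_less)
        ultimately show ?thesis by (simp add: famsig_nth R_def)
      qed
      then show ?thesis using False Gq ps q_pos
        by (intro bexI[of _ "\<lambda>p. \<psi> p + K p $ n"] intpoly.add intfam_nth K) (auto simp: algebra_simps)
    qed
  qed
  then obtain \<psi> where ps: "\<And>n. \<psi> n \<in> intpoly" "\<And>n p. (G p ^ q) $ n = famsig G p $ n + \<pi> * \<psi> n p" by metis
  show ?thesis
    by (rule famcgI[of "\<lambda>p. Abs_fps (\<lambda>n. \<psi> n p)"]) (auto simp: intfam_def ps fps_eq_iff)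
qed

lemma b_intpoly: "\<exists>\<psi>\<in>intpoly. \<forall>p. \<pi> ^ k * lb (fst p) k = \<psi> p"
proof (induction k rule: less_induct)
  case (less k)
  consider "k = 0" | "k = 1" | j where "k = Suc (Suc j)" by (metis One_nat_def old.nat.exhaust)
  then show ?case
  proof cases
    case 1 then show ?thesis by (intro bexI[OF _ intpoly_1]) auto
  next
    case 2 then show ?thesis by (intro bexI[OF _ intpoly.u]) auto
  next
    case 3
    obtain \<psi>1 where 1: "\<psi>1 \<in> intpoly" "\<And>p. \<pi> ^ Suc j * lb (fst p) (Suc j) = \<psi>1 p"
      using less[of "Suc j"] 3 by auto
    obtain \<psi>2 where 2: "\<psi>2 \<in> intpoly" "\<And>p. \<pi> ^ j * lb (fst p) j = \<psi>2 p"
      using less[of j] 3 by auto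
    have "\<pi> ^ k * lb (fst p) k = \<psi>1 p * fst p ^ (q ^ Suc j) + \<pi> * \<psi>2 p" for p
    proof -
      have "\<pi> ^ k * lb (fst p) k = \<pi> ^ Suc j * (\<pi> * lb (fst p) (Suc (Suc j)))" unfolding 3 by simp
      then show ?thesis unfolding 1(2)[symmetric] 2(2)[symmetric] b_rec by (simp add: algebra_simps)
    qed
    then show ?thesis
      by (intro bexI[of _ "\<lambda>p. \<psi>1 p * fst p ^ (q ^ Suc j) + \<pi> * \<psi>2 p"] intpoly.add intpoly.mult 1 2 intpoly_power intpoly.u intpoly.const OF_pi) auto
  qed
qed

text \<open>b_k has denominator \<pi>^k, while the q^k-th powers of families congruent modulo \<pi>
  agree modulo \<pi>^(k+1); one factor \<pi> is left over. The substitution \<tau> allows b_k to be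
  taken at u^q and u^(q^2).\<close>

lemma b_famcg:
  assumes "famcg 1 G H" "H \<in> intfam"
    and \<tau>: "\<And>\<phi>. \<phi> \<in> intpoly \<Longrightarrow> (\<lambda>p. \<phi> (\<tau> p)) \<in> intpoly"
  shows "\<exists>\<psi>\<in>intpoly. \<forall>p. lb (fst (\<tau> p)) k * ((G p ^ (q ^ k)) $ n - (H p ^ (q ^ k)) $ n) = \<pi> * \<psi> p"
proof -
  obtain K where K: "K \<in> intfam" "\<And>p. G p ^ (q ^ k) = H p ^ (q ^ k) + fps_const (\<pi> ^ Suc k) * K p"
    using famcg_power_qk[OF assms(1,2), of k] by (auto simp: famcg_def)
  obtain \<psi> where p: "\<psi> \<in> intpoly" "\<And>p. \<pi> ^ k * lb (fst p) k = \<psi> p" using b_intpoly by blast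
  have "lb (fst (\<tau> p)) k * ((G p ^ (q ^ k)) $ n - (H p ^ (q ^ k)) $ n) = \<pi> * (\<psi> (\<tau> p) * K p $ n)" for p
    unfolding K(2) p(2)[symmetric] by simp
  then show ?thesis
    by (intro bexI[of _ "\<lambda>p. \<psi> (\<tau> p) * K p $ n"] intpoly.mult \<tau> p intfam_nth K) auto
qed

lemma f_compose_famcg:
  assumes "famcg 1 G H" "H \<in> intfam" "\<And>p. G p $ 0 = 0" "\<And>p. H p $ 0 = 0"
    and \<tau>: "\<And>\<phi>. \<phi> \<in> intpoly \<Longrightarrow> (\<lambda>p. \<phi> (\<tau> p)) \<in> intpoly"
  shows "\<exists>\<psi>\<in>intpoly. \<forall>p. (lg (fst (\<tau> p)) oo G p) $ n - (lg (fst (\<tau> p)) oo H p) $ n = \<pi> * \<psi> p"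
proof -
  have "\<forall>k. \<exists>\<psi>\<in>intpoly. \<forall>p. lb (fst (\<tau> p)) k * ((G p ^ (q ^ k)) $ n - (H p ^ (q ^ k)) $ n) = \<pi> * \<psi> p"
    by (intro allI b_famcg[OF assms(1,2)] \<tau>)
  then have "\<exists>\<psi>. \<forall>k. \<psi> k \<in> intpoly \<and>
      (\<forall>p. lb (fst (\<tau> p)) k * ((G p ^ (q ^ k)) $ n - (H p ^ (q ^ k)) $ n) = \<pi> * \<psi> k p)"
    unfolding Bex_def by (rule choice)
  then obtain \<psi> where ps: "\<And>k. \<psi> k \<in> intpoly"
    "\<And>k p. lb (fst (\<tau> p)) k * ((G p ^ (q ^ k)) $ n - (H p ^ (q ^ k)) $ n) = \<pi> * \<psi> k p" by blast
  have "(lg (fst (\<tau> p)) oo G p) $ n - (lg (fst (\<tau> p)) oo H p) $ n = \<pi> * (\<Sum>k\<le>n. \<psi> k p)" for p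
    using ps(2)[of p] by (simp add: f_compose_nth[OF _ order_refl] assms algebra_simps sum_distrib_left
        flip: sum_subtractf)
  then show ?thesis by (intro bexI[of _ "\<lambda>p. \<Sum>k\<le>n. \<psi> k p"] intpoly_sum ps) auto
qed

lemma famcg_mono: assumes "famcg i G H" "j \<le> i" shows "famcg j G H"
proof -
  obtain K where K: "K \<in> intfam" "\<And>p. G p = H p + fps_const (\<pi> ^ i) * K p"
    using assms(1) by (auto simp: famcg_def)
  have "\<pi> ^ i = \<pi> ^ j * \<pi> ^ (i - j)" using assms(2) by (simp flip: power_add)
  then show ?thesis
    by (intro famcgI[of "\<lambda>p. fps_const (\<pi> ^ (i - j)) * K p"] intfam_mult intfam_const intpoly.const OF_power K OF_pi)
       (simp add: K(2) algebra_simps flip: fps_const_mult)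
qed

lemma fst_sig [simp]: "fst (sig p) = fst p ^ q"
  by (simp add: sig_def)

text \<open>Hazewinkel's functional equation lemma, with \<open>sig\<close> and \<open>fps_X \<mapsto> fps_X ^ q\<close> as Frobenius lift.\<close>

lemma functional_equation_lemma:
  assumes L0: "\<And>p. L p $ 0 = 0"
    and D: "(\<lambda>p. fps_const \<pi> * L p - fps_const (fst p) * famsig L p - famsig (famsig L) p)
      \<in> (\<lambda>G p. fps_const \<pi> * G p) ` intfam"
  shows "(\<lambda>p. fps_inv (lg (fst p)) oo L p) \<in> intfam"
proof -
  obtain E where E: "E \<in> intfam"
    "\<And>p. fps_const \<pi> * L p - fps_const (fst p) * famsig L p - famsig (famsig L) p = fps_const \<pi> * E p"
    using D by (auto dest: fun_cong)
  define G where "G p = fps_inv (lg (fst p)) oo L p" for p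
  have G0: "G p $ 0 = 0" for p by (simp add: G_def)
  have fG: "lg (fst p) oo G p = L p" for p by (simp add: G_def f_fps_inv_compose L0)
  have X0: "((fps_X :: 'c fps) ^ q) $ 0 = 0" by simp
  have sL: "famsig L p = lg (fst p ^ q) oo famsig G p" for p
    using fps_compose_assoc[OF X0 G0, of "lg (fst p ^ q)" "sig p"] fG[of "sig p"] by (simp add: famsig_def)
  have sG0: "famsig G p $ 0 = 0" for p by (simp add: famsig_def G0)
  have pp: "(fst p ^ q) ^ q = fst p ^ q\<^sup>2" for p :: "'c \<times> 'c \<times> 'c"
    by (simp add: power2_eq_square power_mult)
  have ssL: "famsig (famsig L) p = lg (fst p ^ (q\<^sup>2)) oo famsig (famsig G) p" for p
  proof -
    have "famsig (famsig L) p = (lg ((fst p ^ q) ^ q) oo famsig G (sig p)) oo fps_X ^ q"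
      using sL[of "sig p"] by (simp add: famsig_def[of "famsig L"])
    also have "\<dots> = lg ((fst p ^ q) ^ q) oo famsig (famsig G) p"
      using fps_compose_assoc[OF X0 sG0] by (simp add: famsig_def[of "famsig G"])
    finally show ?thesis by (simp add: pp)
  qed
  have ssG0: "famsig (famsig G) p $ 0 = 0" for p using sG0 by (simp add: famsig_def[of "famsig G"])
  have "(\<lambda>p. G p $ n) \<in> intpoly" for n
  proof (induction n rule: less_induct)
    case (less n)
    show ?case
    proof (cases "n = 0")
      case True then show ?thesis using G0 intpoly_0 by simp
    next
      case False
      \<comment> \<open>Integrality is known only below degree n, so G is cut off there. In every
        term except \<pi>G itself the coefficient n depends only on those lower coefficients: G
        enters through powers of exponent at least 2 or through coefficients whose index was divided
        by q.\<close>
      define H where "H p = fps_cutoff n (G p)" for p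
      have H: "H \<in> intfam" using intfam_cutoff[of n G] less by (simp add: H_def[abs_def])
      have H0: "H p $ 0 = 0" for p by (simp add: H_def G0)
      have ag: "agree (n - 1) (G p) (H p)" for p using False by (auto simp: agree_def H_def)
      have agq: "agree n (G p ^ m) (H p ^ m)" if "2 \<le> m" for p m
        using agree_power_start0[OF ag G0 H0 that] False by simp
      have div: "j div q < n" if "j \<le> n" for j
      proof -
        have "j div q \<le> n div q" using that by (rule div_le_mono)
        also have "\<dots> < n" using False q_ge_3 by (intro div_less_dividend) auto
        finally show ?thesis .
      qed
      have ags: "agree n (famsig G p) (famsig H p)" for p
        using div by (auto simp: agree_def famsig_nth H_def)
      have agss: "agree n (famsig (famsig G) p) (famsig (famsig H) p)" for p
        using div ags[of "sig p"] less_imp_le[OF div] by (auto simp: agree_def famsig_nth[of "famsig G"] famsig_nth[of "famsig H"])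
      have sH: "famsig H \<in> intfam" by (rule famsig_intfam[OF H])
      have c1: "famcg 1 (\<lambda>p. H p ^ q) (famsig H)" by (rule fam_power_q_sig[OF H])
      have "famcg 2 (\<lambda>p. (H p ^ q) ^ q) (\<lambda>p. famsig H p ^ q)"
        using famcg_power_q[OF c1 sH] by (simp add: numeral_2_eq_2)
      then have c2: "famcg 1 (\<lambda>p. H p ^ (q\<^sup>2)) (famsig (famsig H))"
        using famcg_trans[OF famcg_mono[of 2 _ _ 1] fam_power_q_sig[OF sH]] by (simp add: power2_eq_square power_mult)
      have H00: "(H p ^ q) $ 0 = 0" "(H p ^ (q\<^sup>2)) $ 0 = 0" "famsig H p $ 0 = 0" "famsig (famsig H) p $ 0 = 0" for p
        using H0 by (simp_all add: startsby_zero_power famsig_nth)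
      obtain \<psi>1 where 1: "\<psi>1 \<in> intpoly"
        "\<And>p. (lg (fst (sig p)) oo H p ^ q) $ n - (lg (fst (sig p)) oo famsig H p) $ n = \<pi> * \<psi>1 p"
        using f_compose_famcg[OF c1 sH H00(1,3), of sig n] intpoly_sig by blast
      obtain \<psi>2 where 2: "\<psi>2 \<in> intpoly"
        "\<And>p. (lg (fst (sig (sig p))) oo H p ^ (q\<^sup>2)) $ n - (lg (fst (sig (sig p))) oo famsig (famsig H) p) $ n = \<pi> * \<psi>2 p"
        using f_compose_famcg[OF c2 famsig_intfam[OF sH] H00(2,4), of "\<lambda>p. sig (sig p)" n] intpoly_sig by blast
      have qq2: "2 \<le> q" "2 \<le> q\<^sup>2" using q_ge_3 by (auto simp: power2_eq_square intro: order_trans[of 2 "3 * 3"] mult_le_mono)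
      \<comment> \<open>The functional equation for G minus the hypothesis on L. What remains
        besides \<pi>G are differences of logarithms at G^q and at the twist of G, both divisible by
        \<pi>.\<close>
      have "\<pi> * (G p $ n) = \<pi> * (E p $ n - fst p * \<psi>1 p - \<psi>2 p)" for p
      proof -
        have "fps_const \<pi> * L p = fps_const \<pi> * G p + fps_const (fst p) * (lg (fst p ^ q) oo (G p ^ q))
            + (lg (fst p ^ (q\<^sup>2)) oo (G p ^ (q\<^sup>2)))"
          using f_left_equation[OF G0, of "fst p" p] by (simp add: fG)
        then have "fps_const \<pi> * E p = fps_const \<pi> * G p
            + fps_const (fst p) * ((lg (fst p ^ q) oo (G p ^ q)) - (lg (fst p ^ q) oo famsig G p))
            + ((lg (fst p ^ (q\<^sup>2)) oo (G p ^ (q\<^sup>2))) - (lg (fst p ^ (q\<^sup>2)) oo famsig (famsig G) p))"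
          using E(2)[of p] by (simp add: sL ssL algebra_simps)
        from arg_cong[OF this, of "\<lambda>g. g $ n"]
        have "\<pi> * E p $ n = \<pi> * G p $ n
            + fst p * ((lg (fst p ^ q) oo (G p ^ q)) $ n - (lg (fst p ^ q) oo famsig G p) $ n)
            + ((lg (fst p ^ (q\<^sup>2)) oo (G p ^ (q\<^sup>2))) $ n - (lg (fst p ^ (q\<^sup>2)) oo famsig (famsig G) p) $ n)"
          by simp
        moreover have "(lg (fst p ^ q) oo (G p ^ q)) $ n = (lg (fst p ^ q) oo (H p ^ q)) $ n"
          using agree_compose[OF agq[OF qq2(1)]] by (simp add: agree_def)
        moreover have "(lg (fst p ^ (q\<^sup>2)) oo (G p ^ (q\<^sup>2))) $ n = (lg (fst p ^ (q\<^sup>2)) oo (H p ^ (q\<^sup>2))) $ n"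
          using agree_compose[OF agq[OF qq2(2)]] by (simp add: agree_def)
        moreover have "(lg (fst p ^ q) oo famsig G p) $ n = (lg (fst p ^ q) oo famsig H p) $ n"
          using agree_compose[OF ags] by (simp add: agree_def)
        moreover have "(lg (fst p ^ (q\<^sup>2)) oo famsig (famsig G) p) $ n = (lg (fst p ^ (q\<^sup>2)) oo famsig (famsig H) p) $ n"
          using agree_compose[OF agss] by (simp add: agree_def)
        ultimately show ?thesis using 1(2)[of p] 2(2)[of p] by (simp add: pp algebra_simps)
      qed
      then have "(\<lambda>p. G p $ n) = (\<lambda>p. E p $ n - fst p * \<psi>1 p - \<psi>2 p)" by simp
      then show ?thesis by (simp only:) (intro intpoly_diff intpoly.mult intpoly.u 1 2 intfam_nth E(1))
    qed
  qed
  then show ?thesis by (simp add: intfam_def G_def)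
qed

text \<open>The combination a f(xX) + c f(yX). Integrality of its image under f^-1 covers [a]_u,
  with x = 1 and c = 0, and also the group law, read off degree by degree with a = c = y =
  1.\<close>

definition logcomb :: "'c \<Rightarrow> 'c \<Rightarrow> 'c \<times> 'c \<times> 'c \<Rightarrow> 'c fps" where
  "logcomb a c p = fps_const a * (lg (fst p) oo (fps_const (fst (snd p)) * fps_X))
     + fps_const c * (lg (fst p) oo (fps_const (snd (snd p)) * fps_X))"

lemma logcomb_famsig:
  "famsig (logcomb a c) p = fps_const a * (lg (fst p ^ q) oo (fps_const (fst (snd p)) * fps_X) ^ q)
     + fps_const c * (lg (fst p ^ q) oo (fps_const (snd (snd p)) * fps_X) ^ q)"
proof -
  have "(lg w oo (fps_const (z ^ q) * fps_X)) oo fps_X ^ q = lg w oo (fps_const z * fps_X) ^ q" for w z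
  proof -
    have "(fps_const (z ^ q) * fps_X) oo fps_X ^ q = (fps_const z * fps_X) ^ q"
      by (simp add: fps_compose_mult_distrib power_mult_distrib fps_const_power)
    then show ?thesis by (subst fps_compose_assoc[symmetric]) simp_all
  qed
  then show ?thesis
    by (simp add: famsig_def logcomb_def fps_compose_add_distrib fps_compose_mult_distrib sig_def)
qed

lemma logcomb_famsig2:
  "famsig (famsig (logcomb a c)) p = fps_const a * (lg (fst p ^ (q\<^sup>2)) oo (fps_const (fst (snd p)) * fps_X) ^ (q\<^sup>2))
     + fps_const c * (lg (fst p ^ (q\<^sup>2)) oo (fps_const (snd (snd p)) * fps_X) ^ (q\<^sup>2))"
proof -
  have "(lg w oo (fps_const (z ^ q) * fps_X) ^ q) oo fps_X ^ q = lg w oo (fps_const z * fps_X) ^ (q\<^sup>2)" for w z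
  proof -
    have "((fps_const (z ^ q) * fps_X) ^ q) oo fps_X ^ q = ((fps_const (z ^ q) * fps_X) oo fps_X ^ q) ^ q"
      by (rule fps_compose_power[symmetric]) simp
    also have "(fps_const (z ^ q) * fps_X) oo fps_X ^ q = (fps_const z * fps_X) ^ q"
      by (simp add: fps_compose_mult_distrib power_mult_distrib fps_const_power)
    finally have "((fps_const (z ^ q) * fps_X) ^ q) oo fps_X ^ q = (fps_const z * fps_X) ^ (q\<^sup>2)"
      by (simp add: power2_eq_square power_mult)
    then show ?thesis by (subst fps_compose_assoc[symmetric]) (simp_all add: startsby_zero_power)
  qed
  moreover have "(fst p ^ q) ^ q = fst p ^ (q\<^sup>2)" by (simp add: power2_eq_square power_mult)
  ultimately show ?thesis
    by (subst famsig_def) (simp add: logcomb_famsig fps_compose_add_distrib fps_compose_mult_distrib sig_def)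
qed

text \<open>The functional equation of f at xX and yX leaves \<pi>(ax + cy)X once the two twists are
  subtracted, which is \<pi> times an integral family.\<close>

lemma logcomb_integral:
  assumes "a \<in> OF S" "c \<in> OF S"
  shows "(\<lambda>p. fps_inv (lg (fst p)) oo logcomb a c p) \<in> intfam"
proof (rule functional_equation_lemma)
  define E where "E p = fps_const (a * fst (snd p)) * fps_X + fps_const (c * snd (snd p)) * fps_X" for p :: "'c \<times> 'c \<times> 'c"
  have "E \<in> intfam" unfolding E_def
    by (intro intfam_add intfam_mult intfam_const intfam_X intpoly.mult intpoly.const intpoly.x intpoly.y assms)
  moreover have "fps_const \<pi> * logcomb a c p - fps_const (fst p) * famsig (logcomb a c) p - famsig (famsig (logcomb a c)) p
      = fps_const \<pi> * E p" for p
  proof -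
    have X0: "(fps_const z * fps_X) $ 0 = 0" for z :: 'c by simp
    have "fps_const \<pi> * logcomb a c p = fps_const a * (fps_const \<pi> * (lg (fst p) oo (fps_const (fst (snd p)) * fps_X)))
      + fps_const c * (fps_const \<pi> * (lg (fst p) oo (fps_const (snd (snd p)) * fps_X)))"
      by (simp add: logcomb_def algebra_simps)
    then show ?thesis
      unfolding f_left_equation[OF X0] logcomb_famsig logcomb_famsig2 E_def
      by (simp add: algebra_simps flip: fps_const_mult)
  qed
  ultimately show "(\<lambda>p. fps_const \<pi> * logcomb a c p - fps_const (fst p) * famsig (logcomb a c) p - famsig (famsig (logcomb a c)) p)
      \<in> (\<lambda>G p. fps_const \<pi> * G p) ` intfam" by (intro image_eqI[of _ _ E]) auto
qed (simp add: logcomb_def)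

lemma lt_mult_series_intpoly:
  assumes "a \<in> OF S" shows "(\<lambda>p. lt_mult_series S (fst p) a $ n) \<in> intpoly"
proof -
  have "lt_mult_series S u a = fps_inv (lg u) oo logcomb a 0 (u, 1, 0)" for u
    by (simp add: lt_mult_series_def logcomb_def)
  then show ?thesis using intpoly_fst[OF intfam_nth[OF logcomb_integral[OF assms OF_zero], of n]] by simp
qed

subsection \<open>The coefficients of the formal group law\<close>

text \<open>Connects the coefficientwise definition of the group law with composition of series in
  one variable. Only i + j at most n contributes, as g and h have no constant term; the free bound
  \<open>N\<close> gives one truncation for all degrees up to N.\<close>

lemma add_coeff_formula:
  assumes g: "g $ 0 = 0" and h: "h $ 0 = 0" and N: "n \<le> N"
  shows "(fps_inv (lg u) oo ((lg u oo g) + (lg u oo h))) $ n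
    = (\<Sum>i\<le>N. \<Sum>j\<le>N. lt_add_coeff S u i j * (g ^ i * h ^ j) $ n)"
proof -
  define c where "c = fps_nth (fps_inv (lg u))"
  define A where "A m k i j = of_nat (m choose k) * (lg u ^ k) $ i * (lg u ^ (m - k)) $ j" for m k i j
  let ?D = "{(i, j). i + j \<le> n}"
  have finD: "finite ?D" by (rule finite_subset[of _ "{..n} \<times> {..n}"]) auto
  have A0: "A m k i j = 0" if "i + j < m" "k \<le> m" for m k i j
  proof -
    have "i < k \<or> j < m - k" using that by linarith
    then show ?thesis using startsby_zero_power_prefix[of "lg u" k] startsby_zero_power_prefix[of "lg u" "m - k"]
      by (auto simp: A_def)
  qed
  have pw: "((((lg u oo g) + (lg u oo h)) ^ m) $ n) = (\<Sum>(i, j)\<in>?D. (\<Sum>k\<le>m. A m k i j) * (g ^ i * h ^ j) $ n)" for m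
  proof -
    have "(((lg u oo g) + (lg u oo h)) ^ m) $ n = (\<Sum>k\<le>m. of_nat (m choose k) * ((lg u ^ k oo g) * (lg u ^ (m - k) oo h)) $ n)"
      by (simp add: binomial_ring fps_sum_nth fps_compose_power[OF g] fps_compose_power[OF h] mult.assoc flip: fps_of_nat)
    also have "\<dots> = (\<Sum>k\<le>m. \<Sum>(i, j)\<in>?D. A m k i j * (g ^ i * h ^ j) $ n)"
      unfolding product_composition_lemma[OF g h] A_def
      by (intro sum.cong refl) (simp add: sum_distrib_left case_prod_unfold mult.assoc)
    also have "\<dots> = (\<Sum>(i, j)\<in>?D. \<Sum>k\<le>m. A m k i j * (g ^ i * h ^ j) $ n)"
      by (subst sum.swap) (simp add: case_prod_unfold)
    finally show ?thesis by (simp add: sum_distrib_right)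
  qed
  have "(fps_inv (lg u) oo ((lg u oo g) + (lg u oo h))) $ n
      = (\<Sum>m\<le>n. \<Sum>(i, j)\<in>?D. c m * ((\<Sum>k\<le>m. A m k i j) * (g ^ i * h ^ j) $ n))"
    by (simp add: fps_compose_nth pw c_def sum_distrib_left atLeast0AtMost case_prod_unfold)
  also have "\<dots> = (\<Sum>(i, j)\<in>?D. (\<Sum>m\<le>n. c m * (\<Sum>k\<le>m. A m k i j)) * (g ^ i * h ^ j) $ n)"
    by (subst sum.swap) (simp add: case_prod_unfold sum_distrib_right mult.assoc)
  also have "\<dots> = (\<Sum>(i, j)\<in>?D. lt_add_coeff S u i j * (g ^ i * h ^ j) $ n)"
  proof (rule sum.cong[OF refl], clarify)
    fix i j assume ij: "i + j \<le> n"
    have "lt_add_coeff S u i j = (\<Sum>m\<le>i + j. c m * (\<Sum>k\<le>m. A m k i j))"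
      by (simp add: lt_add_coeff_def c_def A_def)
    also have "\<dots> = (\<Sum>m\<le>n. c m * (\<Sum>k\<le>m. A m k i j))"
      using ij A0 by (intro sum.mono_neutral_left) (auto intro!: sum.neutral)
    finally show "(\<Sum>m\<le>n. c m * (\<Sum>k\<le>m. A m k i j)) * (g ^ i * h ^ j) $ n
      = lt_add_coeff S u i j * (g ^ i * h ^ j) $ n" by simp
  qed
  also have "\<dots> = (\<Sum>(i, j)\<in>{..N} \<times> {..N}. lt_add_coeff S u i j * (g ^ i * h ^ j) $ n)"
  proof (rule sum.mono_neutral_left)
    have z: "(g ^ i * h ^ j) $ n = 0" if "\<not> i + j \<le> n" for i j
    proof -
      have "(g ^ i * h ^ j) $ n = (\<Sum>r=0..n. (g ^ i) $ r * (h ^ j) $ (n - r))" by (rule fps_mult_nth)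
      also have "\<dots> = 0"
      proof (rule sum.neutral, clarify)
        fix r assume "r \<in> {0..n}"
        then have "r < i \<or> n - r < j" using that by auto
        then show "(g ^ i) $ r * (h ^ j) $ (n - r) = 0"
          using startsby_zero_power_prefix[OF g, of i] startsby_zero_power_prefix[OF h, of j] by auto
      qed
      finally show ?thesis .
    qed
    show "\<forall>x\<in>{..N} \<times> {..N} - ?D. (case x of (i, j) \<Rightarrow> lt_add_coeff S u i j * (g ^ i * h ^ j) $ n) = 0"
    proof
      fix x assume "x \<in> {..N} \<times> {..N} - ?D"
      moreover obtain i j where "x = (i, j)" by (cases x)
      ultimately show "(case x of (i, j) \<Rightarrow> lt_add_coeff S u i j * (g ^ i * h ^ j) $ n) = 0"
        using z[of i j] by simp
    qed
  qed (use N in auto)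
  finally show ?thesis by (simp add: sum.cartesian_product)
qed

lemma infinite_C: "infinite (UNIV :: 'c set)"
proof -
  have "inj (\<lambda>n::nat. \<pi> ^ n)"
  proof (rule injI)
    fix m n :: nat assume "\<pi> ^ m = \<pi> ^ n"
    then have "v (\<pi> ^ m) = v (\<pi> ^ n)" by (rule arg_cong)
    then show "m = n" unfolding v_power[OF v_pi'] by simp
  qed
  then have "infinite (range (\<lambda>n::nat. \<pi> ^ n))" by (rule range_inj_infinite)
  then show ?thesis using finite_subset[OF subset_UNIV] by blast
qed

lemma poly_eqI_C: fixes P Q :: "'c poly" assumes "\<And>x. poly P x = poly Q x" shows "P = Q"
proof (rule ccontr)
  assume "P \<noteq> Q"
  then have "finite {x. poly (P - Q) x = 0}" by (intro poly_roots_finite) simp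
  moreover have "{x. poly (P - Q) x = 0} = UNIV" using assms by auto
  ultimately show False using infinite_C by simp
qed

text \<open>Serves to extract a single coefficient of the group law, integral in u, from an
  expression known only as a function of x.\<close>

lemma intpoly_poly:
  "\<phi> \<in> intpoly \<Longrightarrow> \<exists>P. (\<forall>i. (\<lambda>p. coeff (P (fst p)) i) \<in> intpoly) \<and> (\<forall>u x. \<phi> (u, x, 1) = poly (P u) x)"
proof (induction rule: intpoly.induct)
  case (const a)
  then show ?case by (intro exI[of _ "\<lambda>u. [:a:]"]) (auto simp: coeff_pCons split: nat.splits intro: intpoly.const)
next
  case u
  have "(\<lambda>p::'c\<times>'c\<times>'c. coeff [:fst p:] i) \<in> intpoly" for i
    by (cases i) (auto intro: intpoly.u intpoly_0)
  then show ?case by (intro exI[of _ "\<lambda>u. [:u:]"]) auto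
next
  case x
  have "(\<lambda>p::'c\<times>'c\<times>'c. coeff [:0, 1:] i) \<in> intpoly" for i
    by (auto simp: coeff_pCons split: nat.splits intro: intpoly.const)
  then show ?case by (intro exI[of _ "\<lambda>u. [:0, 1:]"]) auto
next
  case y
  have "(\<lambda>p::'c\<times>'c\<times>'c. coeff 1 i) \<in> intpoly" for i by (auto intro: intpoly.const)
  then show ?case by (intro exI[of _ "\<lambda>u. 1"]) auto
next
  case (add \<phi> \<psi>)
  then obtain P Q where "\<forall>i. (\<lambda>p. coeff (P (fst p)) i) \<in> intpoly" "\<forall>u x. \<phi> (u, x, 1) = poly (P u) x"
    "\<forall>i. (\<lambda>p. coeff (Q (fst p)) i) \<in> intpoly" "\<forall>u x. \<psi> (u, x, 1) = poly (Q u) x" by blast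
  then show ?case by (intro exI[of _ "\<lambda>u. P u + Q u"]) (auto intro: intpoly.add)
next
  case (mult \<phi> \<psi>)
  then obtain P Q where "\<forall>i. (\<lambda>p. coeff (P (fst p)) i) \<in> intpoly" "\<forall>u x. \<phi> (u, x, 1) = poly (P u) x"
    "\<forall>i. (\<lambda>p. coeff (Q (fst p)) i) \<in> intpoly" "\<forall>u x. \<psi> (u, x, 1) = poly (Q u) x" by blast
  then show ?case by (intro exI[of _ "\<lambda>u. P u * Q u"]) (auto simp: coeff_mult intro!: intpoly_sum intpoly.mult)
qed

text \<open>The homogeneous part of degree n of the group law with the second variable set to
  1.\<close>

definition add_poly :: "'c \<Rightarrow> nat \<Rightarrow> 'c poly" where
  "add_poly u n = (\<Sum>i\<le>n. monom (lt_add_coeff S u i (n - i)) i)"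

lemma coeff_add_poly: "i \<le> n \<Longrightarrow> coeff (add_poly u n) i = lt_add_coeff S u i (n - i)"
  by (simp add: add_poly_def coeff_sum)

lemma add_linear_nth:
  "(fps_inv (lg u) oo logcomb 1 1 (u, x, 1)) $ n = poly (add_poly u n) x"
proof -
  have pw: "((fps_const x * fps_X) ^ i * (fps_const 1 * fps_X) ^ j) $ n = (if n = i + j then x ^ i else 0)" for i j
    by (simp add: power_mult_distrib fps_const_power mult.assoc flip: power_add)
  have "(fps_inv (lg u) oo logcomb 1 1 (u, x, 1)) $ n
      = (\<Sum>i\<le>n. \<Sum>j\<le>n. lt_add_coeff S u i j * ((fps_const x * fps_X) ^ i * (fps_const 1 * fps_X) ^ j) $ n)"
    using add_coeff_formula[of "fps_const x * fps_X" "fps_const 1 * fps_X" n n u] by (simp add: logcomb_def)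
  also have "\<dots> = (\<Sum>i\<le>n. \<Sum>j\<le>n. if j = n - i then lt_add_coeff S u i (n - i) * x ^ i else 0)"
    unfolding pw by (intro sum.cong refl) auto
  also have "\<dots> = poly (add_poly u n) x" by (simp add: add_poly_def poly_sum poly_monom)
  finally show ?thesis .
qed

text \<open>The degree n part of the group law is an integral function of (u, x) by
  \<open>logcomb_integral\<close>, and over an infinite field a polynomial in x is determined by its
  values, so its coefficients are the integral ones.\<close>

lemma lt_add_coeff_intpoly: "(\<lambda>p. lt_add_coeff S (fst p) i j) \<in> intpoly"
proof -
  define n where "n = i + j"
  obtain P where P: "\<forall>i. (\<lambda>p. coeff (P (fst p)) i) \<in> intpoly"
    "\<forall>u x. (fps_inv (lg u) oo logcomb 1 1 (u, x, 1)) $ n = poly (P u) x"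
    using intpoly_poly[OF intfam_nth[OF logcomb_integral[OF OF_one OF_one], of n]] by auto
  have "P u = add_poly u n" for u
    by (rule poly_eqI_C) (use P(2) add_linear_nth in simp)
  then have "coeff (P u) i = lt_add_coeff S u i j" for u
    using coeff_add_poly[of i n u] by (simp add: n_def)
  then show ?thesis using P(1)[rule_format, of i] by simp
qed

lemma lt_add_coeff_right_0: "lt_add_coeff S u i 0 = (if i = 1 then 1 else 0)"
proof -
  have pw: "(fps_X ^ k * (0 :: 'c fps) ^ j) $ i = (if k = i \<and> j = 0 then 1 else 0)" for k j
    by (cases j) auto
  have "(fps_inv (lg u) oo ((lg u oo fps_X) + (lg u oo 0))) $ i
    = (\<Sum>k\<le>i. \<Sum>j\<le>i. lt_add_coeff S u k j * (fps_X ^ k * 0 ^ j) $ i)"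
    by (rule add_coeff_formula) auto
  also have "\<dots> = (\<Sum>k\<le>i. \<Sum>j\<le>i. if j = 0 then (if k = i then lt_add_coeff S u i 0 else 0) else 0)"
    unfolding pw by (intro sum.cong refl) auto
  also have "\<dots> = lt_add_coeff S u i 0" by simp
  finally show ?thesis by (simp add: fps_inv_f)
qed

lemma lt_add_coeff_left_0: "lt_add_coeff S u 0 j = (if j = 1 then 1 else 0)"
proof -
  have pw: "((0 :: 'c fps) ^ k * fps_X ^ i) $ j = (if i = j \<and> k = 0 then 1 else 0)" for k i
    by (cases k) auto
  have "(fps_inv (lg u) oo ((lg u oo 0) + (lg u oo fps_X))) $ j
    = (\<Sum>k\<le>j. \<Sum>i\<le>j. lt_add_coeff S u k i * (0 ^ k * fps_X ^ i) $ j)"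
    by (rule add_coeff_formula) auto
  also have "\<dots> = (\<Sum>k\<le>j. \<Sum>i\<le>j. if k = 0 then (if i = j then lt_add_coeff S u 0 j else 0) else 0)"
    unfolding pw by (intro sum.cong refl) auto
  also have "\<dots> = (\<Sum>i\<le>j. \<Sum>k\<le>j. if k = 0 then (if i = j then lt_add_coeff S u 0 j else 0) else 0)"
    by (rule sum.swap)
  also have "\<dots> = lt_add_coeff S u 0 j" by simp
  finally show ?thesis by (simp add: fps_inv_f)
qed

text \<open>At \<open>u = 0\<close> the logarithm is \<open>X + X^{q^2}/\<pi> + \<dots>\<close>, so the group law is additive below degree \<open>q\<^sup>2\<close>.\<close>

lemma lt_add_coeff_at_0:
  assumes "2 \<le> i + j" "i + j < q\<^sup>2" shows "lt_add_coeff S 0 i j = 0"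
proof -
  define n where "n = i + j"
  have f0: "(lg 0 oo g) $ n = g $ n" if g: "g $ 0 = 0" for g
  proof -
    have "(lg 0 oo g) $ n = (\<Sum>k\<le>n. lb 0 k * (g ^ (q ^ k)) $ n)" by (rule f_compose_nth[OF g order_refl])
    also have "\<dots> = (\<Sum>k\<in>{0}. lb 0 k * (g ^ (q ^ k)) $ n)"
    proof (rule sum.mono_neutral_right)
      show "\<forall>k\<in>{..n} - {0}. lb 0 k * (g ^ (q ^ k)) $ n = 0"
      proof
        fix k assume "k \<in> {..n} - {0}"
        then consider "k = Suc 0" | "2 \<le> k" by fastforce
        then show "lb 0 k * (g ^ (q ^ k)) $ n = 0"
        proof cases
          case 2
          then have "q\<^sup>2 \<le> q ^ k" by (intro power_increasing) auto
          then show ?thesis using power_nth_small[OF g, of n k] assms by (simp add: n_def)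
        qed simp
      qed
    qed auto
    finally show ?thesis by simp
  qed
  have "poly (add_poly 0 n) x = 0" for x
  proof -
    define G where "G = fps_inv (lg 0) oo logcomb 1 1 (0, x, 1)"
    have "lg 0 oo G = logcomb 1 1 (0, x, 1)" unfolding G_def by (rule f_fps_inv_compose) (simp add: logcomb_def)
    then have "G $ n = logcomb 1 1 (0, x, 1) $ n" using f0[of G] by (simp add: G_def)
    also have "\<dots> = 0" using f0[of "fps_const x * fps_X"] f0[of "fps_X"] assms by (simp add: logcomb_def n_def)
    finally show ?thesis by (simp add: G_def add_linear_nth)
  qed
  then have "add_poly 0 n = 0" by (intro poly_eqI_C) simp
  then show ?thesis using coeff_add_poly[of i n 0] by (simp add: n_def)
qed

lemma intpoly_at_0:
  "\<phi> \<in> intpoly \<Longrightarrow> 0 \<le> \<mu> \<Longrightarrow> ge \<mu> u \<Longrightarrow> ge 0 x \<Longrightarrow> ge 0 y \<Longrightarrow> cg \<mu> (\<phi> (u, x, y)) (\<phi> (0, x, y))"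
proof (induction rule: intpoly.induct)
  case (mult \<phi> \<psi>)
  have "ge 0 u" by (rule ge_mono[OF mult.prems(2,1)])
  then show ?case using mult intpoly_ge[OF mult.hyps(1), of "(u, x, y)"] intpoly_ge[OF mult.hyps(2), of "(0, x, y)"]
    by (intro cg_mult) auto
next
  case (add \<phi> \<psi>)
  then show ?case by (intro cg_add) auto
qed (auto simp: cg_def)

lemma lt_add_coeff_ge: "ge 0 u \<Longrightarrow> ge 0 (lt_add_coeff S u i j)"
  using intpoly_ge[OF lt_add_coeff_intpoly, of "(u, 0, 0)"] by simp

text \<open>In these degrees the coefficient vanishes at u = 0, and an integral polynomial in u
  changes only by a multiple of u when u is replaced by 0.\<close>

lemma lt_add_coeff_ge_u:
  assumes "0 \<le> \<mu>" "ge \<mu> u" "2 \<le> i + j" "i + j < q\<^sup>2" shows "ge \<mu> (lt_add_coeff S u i j)"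
  using intpoly_at_0[OF lt_add_coeff_intpoly assms(1,2), of 0 0 i j] lt_add_coeff_at_0[OF assms(3,4)]
  by (simp add: cg_0_iff)

lemma lt_mult_series_ge: "a \<in> OF S \<Longrightarrow> ge 0 u \<Longrightarrow> ge 0 (lt_mult_series S u a $ n)"
  using intpoly_ge[OF lt_mult_series_intpoly, of a "(u, 0, 0)"] by simp

end

subsection \<open>Evaluation of power series\<close>

context valued
begin

text \<open>Coefficients decaying at the rate of a point of valuation at least \<rho>; for positive
  \<rho> the series can be evaluated at 1.\<close>

definition rser :: "real \<Rightarrow> 'c fps \<Rightarrow> bool" where
  "rser \<rho> g \<longleftrightarrow> (\<forall>n. ge (real n * \<rho>) (g $ n))"

definition psum :: "'c fps \<Rightarrow> nat \<Rightarrow> 'c" where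
  "psum g N = (\<Sum>n\<le>N. g $ n)"

text \<open>A point \<open>x\<close> of the maximal ideal is the value at \<open>1\<close> of the series \<open>xX\<close>; in this way identities
  between power series in one variable give the module axioms on points.\<close>

definition ev :: "'c fps \<Rightarrow> 'c" where
  "ev g = vlim v (psum g)"

lemma rser_nth: "rser \<rho> g \<Longrightarrow> ge (real n * \<rho>) (g $ n)" by (simp add: rser_def)

lemma rser_0: "rser \<rho> 0" by (simp add: rser_def)

lemma rser_add: "rser \<rho> g \<Longrightarrow> rser \<rho> h \<Longrightarrow> rser \<rho> (g + h)"
  by (simp add: rser_def ge_add)

lemma rser_diff: "rser \<rho> g \<Longrightarrow> rser \<rho> h \<Longrightarrow> rser \<rho> (g - h)"
  by (simp add: rser_def ge_diff)

lemma rser_cmult: "rser \<rho> g \<Longrightarrow> ge 0 c \<Longrightarrow> rser \<rho> (fps_const c * g)"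
  by (simp add: rser_def ge_mult_right)

lemma rser_mult:
  assumes "rser \<rho> g" "rser \<rho> h" shows "rser \<rho> (g * h)"
  unfolding rser_def fps_mult_nth
proof (intro allI ge_sum)
  fix n i :: nat assume i: "i \<in> {0..n}"
  have "real i * \<rho> + real (n - i) * \<rho> = real n * \<rho>" using i by (simp add: of_nat_diff algebra_simps)
  then show "ge (real n * \<rho>) (g $ i * h $ (n - i))"
    using ge_mult[OF rser_nth[OF assms(1), of i] rser_nth[OF assms(2), of "n - i"]] by simp
qed

lemma rser_1: "rser \<rho> 1" by (simp add: rser_def)

lemma rser_power: "rser \<rho> g \<Longrightarrow> rser \<rho> (g ^ n)"
  by (induction n) (auto intro: rser_mult rser_1)

lemma rser_sum: "(\<And>i. i \<in> A \<Longrightarrow> rser \<rho> (g i)) \<Longrightarrow> rser \<rho> (sum g A)"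
  by (induction A rule: infinite_finite_induct) (auto intro: rser_0 rser_add)

lemma rser_linear: "ge \<rho> x \<Longrightarrow> rser \<rho> (fps_const x * fps_X)"
  by (auto simp: rser_def le_Suc_eq)

end

locale complete_valued = valued +
  assumes complete: "vcauchy v X \<Longrightarrow> \<exists>l. vtends v X l"
begin

lemma ev_vtends: assumes "0 < \<rho>" "rser \<rho> g" shows "vtends v (psum g) (ev g)"
proof -
  have "vcauchy v (psum g)"
  proof (rule vcauchy_of_steps)
    show "ge (\<rho> + \<rho> * real n) (psum g (Suc n) - psum g n)" for n
      using rser_nth[OF assms(2), of "Suc n"] by (simp add: psum_def algebra_simps)
  qed (use assms in simp)
  then obtain l where "vtends v (psum g) l" using complete by blast
  then show ?thesis by (simp add: ev_def vlim_eq)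
qed

lemma ev_eqI: "vtends v (psum g) l \<Longrightarrow> ev g = l"
  by (simp add: ev_def vlim_eq)

lemma ev_add: assumes "0 < \<rho>" "rser \<rho> g" "rser \<rho> h" shows "ev (g + h) = ev g + ev h"
  using vtends_add[OF ev_vtends[OF assms(1,2)] ev_vtends[OF assms(1,3)]]
  by (intro ev_eqI) (simp add: psum_def[abs_def] sum.distrib)

lemma ev_diff: assumes "0 < \<rho>" "rser \<rho> g" "rser \<rho> h" shows "ev (g - h) = ev g - ev h"
  using vtends_diff[OF ev_vtends[OF assms(1,2)] ev_vtends[OF assms(1,3)]]
  by (intro ev_eqI) (simp add: psum_def[abs_def] sum_subtractf)

lemma ev_finite: assumes "\<And>n. N < n \<Longrightarrow> g $ n = 0" shows "ev g = psum g N"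
proof (rule ev_eqI)
  have "psum g M = psum g N" if "N \<le> M" for M
    unfolding psum_def using that assms by (intro sum.mono_neutral_right) auto
  then have "eventually (\<lambda>M. psum g M = psum g N) sequentially" by (rule eventually_sequentiallyI)
  then show "vtends v (psum g) (psum g N)"
    unfolding vtends_def by (intro allI) (erule eventually_mono, simp)
qed

lemma ev_cX: "ev (fps_const c * fps_X ^ i) = c"
proof -
  have "ev (fps_const c * fps_X ^ i) = psum (fps_const c * fps_X ^ i) i" by (rule ev_finite) simp
  also have "\<dots> = (\<Sum>n\<le>i. if n = i then c else 0)" unfolding psum_def by (intro sum.cong) auto
  finally show ?thesis by simp
qed

lemma ev_linear: "ev (fps_const x * fps_X) = x" using ev_cX[of x 1] by simp
lemma ev_const: "ev (fps_const x) = x" using ev_cX[of x 0] by simp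
lemma ev_0 [simp]: "ev 0 = 0" using ev_const[of 0] by simp
lemma ev_1: "ev 1 = 1" using ev_const[of 1] by simp

lemma ev_tail: assumes "0 < \<rho>" "rser \<rho> g" "\<And>n. n < N \<Longrightarrow> g $ n = 0" "\<And>n. N \<le> n \<Longrightarrow> ge r (g $ n)" shows "ge r (ev g)"
proof (rule vtends_ge[OF ev_vtends[OF assms(1,2)]])
  show "\<forall>\<^sub>F n in sequentially. ge r (psum g n)"
    unfolding psum_def using assms(3,4) by (intro always_eventually allI ge_sum) (metis ge_zero not_le)
qed

lemma ev_tail': assumes "0 < \<rho>" "rser \<rho> g" "\<And>n. n < N \<Longrightarrow> g $ n = 0" shows "ge (real N * \<rho>) (ev g)"
proof (rule ev_tail[OF assms])
  show "ge (real N * \<rho>) (g $ n)" if "N \<le> n" for n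
    by (rule ge_mono[OF rser_nth[OF assms(2), of n]]) (use that assms(1) in \<open>auto intro: mult_right_mono\<close>)
qed

lemma ev_cX_mult:
  assumes "0 < \<rho>" "rser \<rho> h"
  shows "ev (fps_const c * fps_X ^ i * h) = c * ev h"
proof (rule ev_eqI)
  have nth: "(fps_const c * fps_X ^ i * h) $ n = (if n < i then 0 else c * h $ (n - i))" for n
    by (simp add: mult.assoc fps_X_power_mult_nth)
  have ps: "psum (fps_const c * fps_X ^ i * h) (N + i) = c * psum h N" for N
  proof -
    have "psum (fps_const c * fps_X ^ i * h) (N + i) = (\<Sum>n\<in>{i..N + i}. c * h $ (n - i))"
      unfolding psum_def nth by (intro sum.mono_neutral_cong_right) auto
    also have "\<dots> = (\<Sum>n\<in>{0..N}. c * h $ n)"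
      using sum.shift_bounds_cl_nat_ivl[of "\<lambda>n. c * h $ (n - i)" 0 i N] by simp
    finally show ?thesis by (simp add: psum_def sum_distrib_left atLeast0AtMost)
  qed
  have "vtends v (\<lambda>N. psum (fps_const c * fps_X ^ i * h) (N + i)) (c * ev h)"
    unfolding ps by (rule vtends_mult_const[OF ev_vtends[OF assms]])
  then show "vtends v (psum (fps_const c * fps_X ^ i * h)) (c * ev h)"
    unfolding vtends_def
    by (simp add: eventually_sequentially_seg[of "\<lambda>n. ge N (psum (fps_const c * fps_X ^ i * h) n - c * ev h)" i for N])
qed

text \<open>Exact for truncations of g by linearity. Cutting g after degree N changes the value of
  the product by at least (N + 1)\<rho> in valuation, and both sides are limits of the truncated
  products.\<close>

lemma ev_mult: assumes "0 < \<rho>" "rser \<rho> g" "rser \<rho> h" shows "ev (g * h) = ev g * ev h"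
proof -
  have r: "rser \<rho> (fps_const (g $ i) * fps_X ^ i * h)" for i
    by (rule rser_mult[OF _ assms(3)]) (use rser_nth[OF assms(2), of i] in \<open>simp add: rser_def\<close>)
  have cut: "ev (fps_cutoff (Suc N) g * h) = psum g N * ev h" for N
  proof -
    have "ev ((\<Sum>i\<le>M. fps_const (g $ i) * fps_X ^ i) * h) = psum g M * ev h \<and>
        rser \<rho> ((\<Sum>i\<le>M. fps_const (g $ i) * fps_X ^ i) * h)" for M
    proof (induction M)
      case 0
      then show ?case using ev_cX_mult[OF assms(1,3), of "g $ 0" 0] r[of 0] by (simp add: psum_def)
    next
      case (Suc M)
      then show ?case using ev_cX_mult[OF assms(1,3), of "g $ Suc M" "Suc M"] r[of "Suc M"]
          ev_add[OF assms(1), of "(\<Sum>i\<le>M. fps_const (g $ i) * fps_X ^ i) * h" "fps_const (g $ Suc M) * fps_X ^ Suc M * h"]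
        by (simp add: psum_def algebra_simps rser_add del: power_Suc)
    qed
    moreover have "(\<Sum>i\<le>N. fps_const (g $ i) * fps_X ^ i) = fps_cutoff (Suc N) g"
    proof (rule fps_ext)
      fix n
      have "(\<Sum>i\<le>N. fps_const (g $ i) * fps_X ^ i) $ n = (\<Sum>i\<le>N. if i = n then g $ n else 0)"
        unfolding fps_sum_nth by (intro sum.cong) auto
      then show "(\<Sum>i\<le>N. fps_const (g $ i) * fps_X ^ i) $ n = fps_cutoff (Suc N) g $ n" by simp
    qed
    ultimately show ?thesis by metis
  qed
  have "vtends v (\<lambda>N. psum g N * ev h) (ev g * ev h)"
    using vtends_mult_const[OF ev_vtends[OF assms(1,2)], of "ev h"] by (simp add: mult.commute)
  moreover have "vtends v (\<lambda>N. psum g N * ev h) (ev (g * h))"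
    unfolding vtends_def
  proof
    fix K :: real
    obtain N0 :: nat where N0: "K / \<rho> \<le> real N0" using real_arch_simple by blast
    have "ge K (psum g N * ev h - ev (g * h))" if "N0 \<le> N" for N
    proof -
      have r: "rser \<rho> (fps_cutoff (Suc N) g * h)"
        by (rule rser_mult[OF _ assms(3)]) (use rser_nth[OF assms(2)] in \<open>simp add: rser_def\<close>)
      have "ge (real (Suc N) * \<rho>) (ev (g * h - fps_cutoff (Suc N) g * h))"
        by (intro ev_tail' rser_diff r rser_mult assms) (simp add: fps_cutoff_left_mult_nth)
      then have "ge (real (Suc N) * \<rho>) (ev (g * h) - psum g N * ev h)"
        by (simp add: ev_diff[OF assms(1) rser_mult[OF assms(2,3)] r] cut)
      moreover have "K \<le> real (Suc N) * \<rho>"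
      proof -
        have "K \<le> real N0 * \<rho>" using N0 assms(1) by (simp add: field_simps)
        also have "\<dots> \<le> real (Suc N) * \<rho>" using that assms(1) by (intro mult_right_mono) auto
        finally show ?thesis .
      qed
      ultimately have "ge K (ev (g * h) - psum g N * ev h)" by (rule ge_mono)
      then show ?thesis by (subst v_minus_commute)
    qed
    then show "\<forall>\<^sub>F N in sequentially. ge K (psum g N * ev h - ev (g * h))"
      by (auto simp: eventually_sequentially)
  qed
  ultimately show ?thesis using vtends_unique by blast
qed

lemma ev_power: assumes "0 < \<rho>" "rser \<rho> g" shows "ev (g ^ n) = ev g ^ n"
  by (induction n) (auto simp: ev_1 ev_mult[OF assms(1) assms(2) rser_power[OF assms(2)]])

lemma ev_cmult: assumes "0 < \<rho>" "rser \<rho> g" shows "ev (fps_const c * g) = c * ev g"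
  using ev_cX_mult[OF assms, of c 0] by simp

lemma ev_sum:
  assumes "0 < \<rho>" "\<And>i. i \<in> A \<Longrightarrow> rser \<rho> (g i)" shows "ev (sum g A) = (\<Sum>i\<in>A. ev (g i))"
  using assms(2)
proof (induction A rule: infinite_finite_induct)
  case (insert x F)
  then show ?case using ev_add[OF assms(1), of "g x" "sum g F"] rser_sum[of F \<rho> g] by simp
qed auto

end

subsection \<open>The module in characteristic \<open>0\<close>\<close>

context lt_fld
begin

sublocale complete_valued "valu S"
  by unfold_locales (rule vcomplete_C)

definition sadd :: "'c \<Rightarrow> 'c \<Rightarrow> 'c \<Rightarrow> 'c" where
  "sadd u x y = vlim v (\<lambda>N. \<Sum>i\<le>N. \<Sum>j\<le>N. lt_add_coeff S u i j * x ^ i * y ^ j)"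

definition smul :: "'c \<Rightarrow> 'c \<Rightarrow> 'c \<Rightarrow> 'c" where
  "smul u a x = vlim v (\<lambda>N. \<Sum>n\<le>N. fps_nth (lt_mult_series S u a) n * x ^ n)"

text \<open>The module operations lifted to power series. Under f they become ordinary addition and
  scaling, so the axioms hold for series at once and only have to be carried to points by
  \<open>ev\<close>.\<close>

definition gadd :: "'c \<Rightarrow> 'c fps \<Rightarrow> 'c fps \<Rightarrow> 'c fps" where
  "gadd u g h = fps_inv (lg u) oo ((lg u oo g) + (lg u oo h))"

definition gmul :: "'c \<Rightarrow> 'c \<Rightarrow> 'c fps \<Rightarrow> 'c fps" where
  "gmul u a g = fps_inv (lg u) oo (fps_const a * (lg u oo g))"

definition pser :: "real \<Rightarrow> 'c fps \<Rightarrow> bool" where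
  "pser \<rho> g \<longleftrightarrow> rser \<rho> g \<and> g $ 0 = 0"

lemma pser_linear: "ge \<rho> x \<Longrightarrow> pser \<rho> (fps_const x * fps_X)"
  by (simp add: pser_def rser_linear)

lemma ge_rho_ev: "0 < \<rho> \<Longrightarrow> pser \<rho> g \<Longrightarrow> ge \<rho> (ev g)"
  using ev_tail'[of \<rho> g 1] by (simp add: pser_def)

lemma f_gadd: "lg u oo gadd u g h = (lg u oo g) + (lg u oo h)"
  unfolding gadd_def by (rule f_fps_inv_compose) simp

lemma f_gmul: "lg u oo gmul u a g = fps_const a * (lg u oo g)"
  unfolding gmul_def by (rule f_fps_inv_compose) simp

lemma gadd_0 [simp]: "gadd u g h $ 0 = 0" and gmul_0 [simp]: "gmul u a g $ 0 = 0"
  by (simp_all add: gadd_def gmul_def)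

lemma gmul_series: assumes "g $ 0 = 0" shows "gmul u a g = lt_mult_series S u a oo g"
proof -
  have "lt_mult_series S u a oo g = fps_inv (lg u) oo ((fps_const a * lg u) oo g)"
    unfolding lt_mult_series_def by (rule fps_compose_assoc[symmetric]) (use assms in auto)
  then show ?thesis by (simp add: gmul_def fps_compose_mult_distrib assms)
qed

text \<open>The formal sum agrees through degree N with a polynomial in g and h whose coefficients
  are those of the group law, so the values differ only by a tail. This makes the double sum in
  \<open>sadd\<close> converge to the value of the formal sum.\<close>

lemma gadd_partial:
  assumes u: "ge 0 u" and r: "0 < \<rho>" and g: "pser \<rho> g" and h: "pser \<rho> h"
  shows "pser \<rho> (gadd u g h)"
    and "ge (real (Suc N) * \<rho>) (ev (gadd u g h) - (\<Sum>i\<le>N. \<Sum>j\<le>N. lt_add_coeff S u i j * ev g ^ i * ev h ^ j))"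
proof -
  define P where "P N = (\<Sum>i\<le>N. \<Sum>j\<le>N. fps_const (lt_add_coeff S u i j) * (g ^ i * h ^ j))" for N
  have rt: "rser \<rho> (g ^ i * h ^ j)" for i j
    using g h by (auto simp: pser_def intro!: rser_mult rser_power)
  have rP: "rser \<rho> (P N)" for N
    unfolding P_def by (intro rser_sum rser_cmult rt lt_add_coeff_ge u)
  have nth: "gadd u g h $ n = P N $ n" if "n \<le> N" for n N
    using add_coeff_formula[of g h n N u] g h that by (simp add: gadd_def P_def pser_def fps_sum_nth)
  then have rG: "rser \<rho> (gadd u g h)" using rP unfolding rser_def by (metis order_refl)
  then show "pser \<rho> (gadd u g h)" by (simp add: pser_def)
  have rr: "rser \<rho> (\<Sum>j\<le>N. fps_const (lt_add_coeff S u i j) * (g ^ i * h ^ j))" for i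
    by (intro rser_sum rser_cmult rt lt_add_coeff_ge u)
  have "ev (P N) = (\<Sum>i\<le>N. \<Sum>j\<le>N. lt_add_coeff S u i j * ev g ^ i * ev h ^ j)"
  proof -
    have "ev (P N) = (\<Sum>i\<le>N. ev (\<Sum>j\<le>N. fps_const (lt_add_coeff S u i j) * (g ^ i * h ^ j)))"
      unfolding P_def by (rule ev_sum[OF r rr])
    also have "\<dots> = (\<Sum>i\<le>N. \<Sum>j\<le>N. ev (fps_const (lt_add_coeff S u i j) * (g ^ i * h ^ j)))"
      by (intro sum.cong refl ev_sum[OF r] rser_cmult rt lt_add_coeff_ge u)
    also have "\<dots> = (\<Sum>i\<le>N. \<Sum>j\<le>N. lt_add_coeff S u i j * ev g ^ i * ev h ^ j)"
    proof (intro sum.cong refl)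
      fix i j
      have "rser \<rho> g" "rser \<rho> h" using g h by (auto simp: pser_def)
      then show "ev (fps_const (lt_add_coeff S u i j) * (g ^ i * h ^ j)) = lt_add_coeff S u i j * ev g ^ i * ev h ^ j"
        by (simp add: ev_cmult[OF r rt] ev_mult[OF r] rser_power ev_power[OF r])
    qed
    finally show ?thesis .
  qed
  moreover have "ge (real (Suc N) * \<rho>) (ev (gadd u g h - P N))"
    by (intro ev_tail' r rser_diff rG rP) (simp add: nth[of _ N])
  ultimately show "ge (real (Suc N) * \<rho>) (ev (gadd u g h) - (\<Sum>i\<le>N. \<Sum>j\<le>N. lt_add_coeff S u i j * ev g ^ i * ev h ^ j))"
    by (simp add: ev_diff[OF r rG rP])
qed

lemma gmul_partial:
  assumes u: "ge 0 u" and a: "a \<in> OF S" and r: "0 < \<rho>" and g: "pser \<rho> g"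
  shows "pser \<rho> (gmul u a g)"
    and "ge (real (Suc N) * \<rho>) (ev (gmul u a g) - (\<Sum>n\<le>N. lt_mult_series S u a $ n * ev g ^ n))"
proof -
  define P where "P N = (\<Sum>n\<le>N. fps_const (lt_mult_series S u a $ n) * g ^ n)" for N
  have g': "rser \<rho> g" "g $ 0 = 0" using g by (auto simp: pser_def)
  have rP: "rser \<rho> (P N)" for N
    unfolding P_def by (intro rser_sum rser_cmult rser_power g' lt_mult_series_ge a u)
  have nth: "gmul u a g $ n = P N $ n" if "n \<le> N" for n N
  proof -
    have "gmul u a g $ n = (\<Sum>i=0..n. lt_mult_series S u a $ i * (g ^ i) $ n)"
      by (simp add: gmul_series g' fps_compose_nth)
    also have "\<dots> = (\<Sum>i\<le>N. lt_mult_series S u a $ i * (g ^ i) $ n)"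
      using that startsby_zero_power_prefix[OF g'(2)] by (intro sum.mono_neutral_left) auto
    finally show ?thesis by (simp add: P_def fps_sum_nth)
  qed
  then have rG: "rser \<rho> (gmul u a g)" using rP unfolding rser_def by (metis order_refl)
  then show "pser \<rho> (gmul u a g)" by (simp add: pser_def)
  have "ev (P N) = (\<Sum>n\<le>N. ev (fps_const (lt_mult_series S u a $ n) * g ^ n))"
    unfolding P_def by (rule ev_sum[OF r]) (intro rser_cmult rser_power g' lt_mult_series_ge a u)
  also have "\<dots> = (\<Sum>n\<le>N. lt_mult_series S u a $ n * ev g ^ n)"
    by (simp add: ev_cmult[OF r rser_power[OF g'(1)]] ev_power[OF r g'(1)])
  moreover have "ge (real (Suc N) * \<rho>) (ev (gmul u a g - P N))"
    by (intro ev_tail' r rser_diff rG rP) (simp add: nth[of _ N])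
  ultimately show "ge (real (Suc N) * \<rho>) (ev (gmul u a g) - (\<Sum>n\<le>N. lt_mult_series S u a $ n * ev g ^ n))"
    by (simp add: ev_diff[OF r rG rP])
qed

lemma vtends_linear_bound:
  assumes "0 < \<rho>" "\<And>N. ge (real (Suc N) * \<rho>) (l - X N)" shows "vtends v X l"
  unfolding vtends_def
proof
  fix K :: real
  obtain N0 :: nat where N0: "K / \<rho> \<le> real N0" using real_arch_simple by blast
  have "ge K (X N - l)" if "N0 \<le> N" for N
  proof -
    have "K \<le> real N0 * \<rho>" using N0 assms(1) by (simp add: field_simps)
    also have "\<dots> \<le> real (Suc N) * \<rho>" using that assms(1) by (intro mult_right_mono) auto
    finally have "ge K (l - X N)" by (rule ge_mono[OF assms(2)])
    then show ?thesis by (subst v_minus_commute)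
  qed
  then show "\<forall>\<^sub>F n in sequentially. ge K (X n - l)" by (auto simp: eventually_sequentially)
qed

lemma sadd_ev:
  assumes "ge 0 u" "0 < \<rho>" "pser \<rho> g" "pser \<rho> h"
  shows "sadd u (ev g) (ev h) = ev (gadd u g h)"
  unfolding sadd_def by (rule vlim_eq, rule vtends_linear_bound[OF assms(2)], rule gadd_partial(2)[OF assms])

lemma smul_ev:
  assumes "ge 0 u" "a \<in> OF S" "0 < \<rho>" "pser \<rho> g"
  shows "smul u a (ev g) = ev (gmul u a g)"
  unfolding smul_def by (rule vlim_eq, rule vtends_linear_bound[OF assms(3)], rule gmul_partial(2)[OF assms])

lemma ge_rep: assumes "ge \<rho> x" obtains g where "pser \<rho> g" "ev g = x"
  using pser_linear[OF assms] ev_linear[of x] by blast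

lemma sadd_approx:
  assumes "ge 0 u" "0 < \<rho>" "ge \<rho> x" "ge \<rho> y"
  shows "ge (real (Suc N) * \<rho>) (sadd u x y - (\<Sum>i\<le>N. \<Sum>j\<le>N. lt_add_coeff S u i j * x ^ i * y ^ j))"
proof -
  obtain g where g1: "pser \<rho> g" "ev g = x" by (rule ge_rep[OF assms(3)])
  obtain h where h1: "pser \<rho> h" "ev h = y" by (rule ge_rep[OF assms(4)])
  note gh = g1 h1
  then show ?thesis using gadd_partial(2)[OF assms(1,2) gh(1,3), of N] sadd_ev[OF assms(1,2) gh(1,3)] by simp
qed

lemma smul_approx:
  assumes "ge 0 u" "a \<in> OF S" "0 < \<rho>" "ge \<rho> x"
  shows "ge (real (Suc N) * \<rho>) (smul u a x - (\<Sum>n\<le>N. lt_mult_series S u a $ n * x ^ n))"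
proof -
  obtain g where g: "pser \<rho> g" "ev g = x" by (rule ge_rep[OF assms(4)])
  then show ?thesis using gmul_partial(2)[OF assms(1-3) g(1), of N] smul_ev[OF assms(1-3) g(1)] by simp
qed

section \<open>The module axioms on points of the maximal ideal\<close>

context
  fixes u :: "'c" and \<rho> :: real assumes u: "ge 0 u" and r: "0 < \<rho>"
begin

lemma sadd_ge: "ge \<rho> x \<Longrightarrow> ge \<rho> y \<Longrightarrow> ge \<rho> (sadd u x y)"
proof -
  assume a: "ge \<rho> x" "ge \<rho> y"
  obtain g where g1: "pser \<rho> g" "ev g = x" by (rule ge_rep[OF a(1)])
  obtain h where h1: "pser \<rho> h" "ev h = y" by (rule ge_rep[OF a(2)])
  note gh = g1 h1
  then show ?thesis using sadd_ev[OF u r gh(1,3)] ge_rho_ev[OF r gadd_partial(1)[OF u r gh(1,3)]] by simp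
qed

lemma smul_ge: "a \<in> OF S \<Longrightarrow> ge \<rho> x \<Longrightarrow> ge \<rho> (smul u a x)"
proof -
  assume a: "a \<in> OF S" "ge \<rho> x"
  obtain g where g: "pser \<rho> g" "ev g = x" by (rule ge_rep[OF a(2)])
  then show ?thesis using smul_ev[OF u a(1) r g(1)] ge_rho_ev[OF r gmul_partial(1)[OF u a(1) r g(1)]] by simp
qed

lemma sadd_commute: assumes "ge \<rho> x" "ge \<rho> y" shows "sadd u x y = sadd u y x"
proof -
  obtain g where g1: "pser \<rho> g" "ev g = x" by (rule ge_rep[OF assms(1)])
  obtain h where h1: "pser \<rho> h" "ev h = y" by (rule ge_rep[OF assms(2)])
  note gh = g1 h1
  have "gadd u g h = gadd u h g" by (simp add: gadd_def add.commute)
  then show ?thesis using sadd_ev[OF u r gh(1,3)] sadd_ev[OF u r gh(3,1)] gh by simp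
qed

text \<open>Under f the identity of series is associativity of +; \<open>f_inject\<close> removes f
  and \<open>ev\<close> carries the identity to points. The axioms that follow have the same
  pattern.\<close>

lemma sadd_assoc: assumes "ge \<rho> x" "ge \<rho> y" "ge \<rho> z"
  shows "sadd u (sadd u x y) z = sadd u x (sadd u y z)"
proof -
  obtain g where g1: "pser \<rho> g" "ev g = x" by (rule ge_rep[OF assms(1)])
  obtain h where h1: "pser \<rho> h" "ev h = y" by (rule ge_rep[OF assms(2)])
  obtain k where k1: "pser \<rho> k" "ev k = z" by (rule ge_rep[OF assms(3)])
  note gh = g1 h1 k1
  have "gadd u (gadd u g h) k = gadd u g (gadd u h k)"
    by (rule f_inject[of _ _ u]) (simp_all add: f_gadd add.assoc)
  then show ?thesis
    using sadd_ev[OF u r gh(1,3)] sadd_ev[OF u r gh(3,5)] gh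
      sadd_ev[OF u r gadd_partial(1)[OF u r gh(1,3)] gh(5)] sadd_ev[OF u r gh(1) gadd_partial(1)[OF u r gh(3,5)]]
    by simp
qed

lemma sadd_0: assumes "ge \<rho> x" shows "sadd u x 0 = x"
proof -
  obtain g where g1: "pser \<rho> g" "ev g = x" by (rule ge_rep[OF assms(1)])
  note g = g1
  have z: "pser \<rho> 0" by (simp add: pser_def rser_0)
  have "gadd u g 0 = g" by (rule f_inject[of _ _ u]) (use g in \<open>simp_all add: f_gadd pser_def\<close>)
  then show ?thesis using sadd_ev[OF u r g(1) z] g by simp
qed

lemma smul_add: assumes "a \<in> OF S" "ge \<rho> x" "ge \<rho> y"
  shows "smul u a (sadd u x y) = sadd u (smul u a x) (smul u a y)"
proof -
  obtain g where g1: "pser \<rho> g" "ev g = x" by (rule ge_rep[OF assms(2)])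
  obtain h where h1: "pser \<rho> h" "ev h = y" by (rule ge_rep[OF assms(3)])
  note gh = g1 h1
  have "gmul u a (gadd u g h) = gadd u (gmul u a g) (gmul u a h)"
    by (rule f_inject[of _ _ u]) (simp_all add: f_gadd f_gmul algebra_simps)
  then show ?thesis
    using sadd_ev[OF u r gh(1,3)] smul_ev[OF u assms(1) r gh(1)] smul_ev[OF u assms(1) r gh(3)]
      smul_ev[OF u assms(1) r gadd_partial(1)[OF u r gh(1,3)]] gh
      sadd_ev[OF u r gmul_partial(1)[OF u assms(1) r gh(1)] gmul_partial(1)[OF u assms(1) r gh(3)]]
    by simp
qed

lemma add_smul: assumes "a \<in> OF S" "c \<in> OF S" "ge \<rho> x"
  shows "smul u (a + c) x = sadd u (smul u a x) (smul u c x)"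
proof -
  obtain g where g1: "pser \<rho> g" "ev g = x" by (rule ge_rep[OF assms(3)])
  note g = g1
  have "gmul u (a + c) g = gadd u (gmul u a g) (gmul u c g)"
    by (rule f_inject[of _ _ u]) (simp_all add: f_gadd f_gmul algebra_simps flip: fps_const_add)
  then show ?thesis
    using smul_ev[OF u assms(1) r g(1)] smul_ev[OF u assms(2) r g(1)] smul_ev[OF u OF_add[OF assms(1,2)] r g(1)] g
      sadd_ev[OF u r gmul_partial(1)[OF u assms(1) r g(1)] gmul_partial(1)[OF u assms(2) r g(1)]]
    by simp
qed

lemma mult_smul: assumes "a \<in> OF S" "c \<in> OF S" "ge \<rho> x"
  shows "smul u (a * c) x = smul u a (smul u c x)"
proof -
  obtain g where g1: "pser \<rho> g" "ev g = x" by (rule ge_rep[OF assms(3)])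
  note g = g1
  have "gmul u (a * c) g = gmul u a (gmul u c g)"
    by (rule f_inject[of _ _ u]) (simp_all add: f_gmul mult.assoc flip: fps_const_mult)
  then show ?thesis
    using smul_ev[OF u assms(2) r g(1)] smul_ev[OF u OF_mult[OF assms(1,2)] r g(1)] g
      smul_ev[OF u assms(1) r gmul_partial(1)[OF u assms(2) r g(1)]]
    by simp
qed

text \<open>f has only exponents q^k and a^(q^k) = a, hence f(aX) = a f(X).\<close>

lemma smul_mu0: assumes "a \<in> mu0 S" "ge \<rho> x" shows "smul u a x = a * x"
proof -
  let ?g = "fps_const x * fps_X" 
  have ax: "ge \<rho> (a * x)" using assms by (intro ge_mult_right mu0_ge)
  have aq: "a ^ (q ^ k) = a" for k
    by (induction k) (simp_all add: power_mult mu0_power_q[OF assms(1)])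
  have "lg u oo (fps_const (a * x) * fps_X) = fps_const a * (lg u oo ?g)"
  proof (rule fps_ext)
    fix n
    show "(lg u oo (fps_const (a * x) * fps_X)) $ n = (fps_const a * (lg u oo ?g)) $ n"
    proof (cases "\<exists>k. n = q ^ k")
      case True
      then show ?thesis by (auto simp: power_mult_distrib aq)
    next
      case False
      then show ?thesis by (simp add: f_nth_other)
    qed
  qed
  then have "gmul u a ?g = fps_const (a * x) * fps_X"
    by (intro f_inject[of "gmul u a ?g" "fps_const (a * x) * fps_X" u]) (simp_all add: f_gmul)
  then show ?thesis using smul_ev[OF u mu0_OF[OF assms(1)] r pser_linear[OF assms(2)]]
    by (simp add: ev_linear)
qed

lemma b_ge: "ge (- real k) (lb u k)"
proof -
  obtain \<psi> where p: "\<psi> \<in> intpoly" "\<And>p. \<pi> ^ k * lb (fst p) k = \<psi> p" using b_intpoly by blast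
  have "ge 0 (lb u k * \<pi> ^ k)"
    using p(2)[of "(u, 0, 0)"] intpoly_ge[OF p(1), of "(u, 0, 0)"] u by (simp add: mult.commute)
  from ge_cancel[OF v_power[OF v_pi', of k] this] show ?thesis by simp
qed

text \<open>The equation f(e) = \<pi>xX determines the coefficients of e recursively. A term b_k
  e^(q^k) loses at most k through b_k and gains q^k, at least k + 1, from its factors e; so every
  coefficient of e retains a factor \<pi>.\<close>

lemma inverse_log_pi_ge:
  assumes x: "ge \<rho> x" and e: "e = fps_inv (lg u) oo (fps_const (\<pi> * x) * fps_X)"
  shows "ge (1 + real n * \<rho>) (e $ n)"
proof (induction n rule: less_induct)
  case (less n)
  have e0: "e $ 0 = 0" by (simp add: e)
  show ?case
  proof (cases "n = 0")
    case True then show ?thesis using e0 by simp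
  next
    case False
    define h where "h = fps_cutoff n e"
    have h0: "h $ 0 = 0" by (simp add: h_def e0)
    have hn: "ge (1 + real j * \<rho>) (h $ j)" for j using less by (simp add: h_def)
    have hp: "ge (real m + real j * \<rho>) ((h ^ m) $ j)" for m j
    proof (induction m arbitrary: j)
      case (Suc m)
      show ?case unfolding power_Suc fps_mult_nth
      proof (rule ge_sum)
        fix i assume i: "i \<in> {0..j}"
        have "ge ((1 + real i * \<rho>) + (real m + real (j - i) * \<rho>)) (h $ i * (h ^ m) $ (j - i))"
          by (intro ge_mult hn Suc)
        then show "ge (real (Suc m) + real j * \<rho>) (h $ i * (h ^ m) $ (j - i))"
          by (rule ge_mono) (use i in \<open>simp add: of_nat_diff algebra_simps\<close>)
      qed
    qed auto
    have "agree (n - 1) e h" using False by (auto simp: agree_def h_def)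
    then have ag: "agree n (e ^ m) (h ^ m)" if "2 \<le> m" for m
      using agree_power_start0[OF \<open>agree (n - 1) e h\<close> e0 h0 that] False by simp
    have "(lg u oo e) $ n = (\<Sum>k\<le>n. lb u k * (e ^ (q ^ k)) $ n)" by (rule f_compose_nth[OF e0 order_refl])
    also have "\<dots> = e $ n + (\<Sum>k\<in>{..n} - {0}. lb u k * (e ^ (q ^ k)) $ n)"
      by (subst sum.remove[of _ 0]) auto
    finally have en: "e $ n = (fps_const (\<pi> * x) * fps_X) $ n - (\<Sum>k\<in>{..n} - {0}. lb u k * (e ^ (q ^ k)) $ n)"
      by (simp add: e f_fps_inv_compose)
    show ?thesis unfolding en
    proof (intro ge_diff ge_sum)
      have "ge (1 + \<rho>) (\<pi> * x)" by (intro ge_mult ge_pi x)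
      then show "ge (1 + real n * \<rho>) ((fps_const (\<pi> * x) * fps_X) $ n)" by (cases "n = 1") auto
      fix k assume k: "k \<in> {..n} - {0}"
      have q2: "2 \<le> q ^ k" using q_power_gt[of k] k by auto
      have "ge (- real k + (real (q ^ k) + real n * \<rho>)) (lb u k * (h ^ (q ^ k)) $ n)"
        by (intro ge_mult b_ge hp)
      moreover have "1 + real k \<le> real (q ^ k)" using q_power_gt[of k] by linarith
      ultimately have "ge (1 + real n * \<rho>) (lb u k * (h ^ (q ^ k)) $ n)" by (elim ge_mono) linarith
      then show "ge (1 + real n * \<rho>) (lb u k * (e ^ (q ^ k)) $ n)" using ag[OF q2] by (simp add: agree_def)
    qed
  qed
qed

end

text \<open>The pure terms are x and y, and every mixed term contains y, of valuation at least
  \<beta>. In degree below q^2 its coefficient adds \<mu>; in higher degree at least q^2 - 1 further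
  factors add \<alpha> each.\<close>

lemma sadd_bound:
  assumes "0 \<le> \<mu>" "ge \<mu> u" "0 < \<alpha>" "\<alpha> \<le> \<beta>" "ge \<alpha> x" "ge \<beta> y"
    "\<tau> \<le> \<beta> + \<mu>" "\<tau> \<le> \<beta> + ((real q)\<^sup>2 - 1) * \<alpha>"
  shows "ge \<tau> (sadd u x y - x - y)" "ge \<tau> (sadd u y x - x - y)"
proof -
  have u0: "ge 0 u" by (rule ge_mono[OF assms(2,1)])
  have y: "ge \<alpha> y" by (rule ge_mono[OF assms(6,4)])
  have tm: "ge \<tau> (lt_add_coeff S u i j * x ^ i * y ^ j)" if ij: "1 \<le> i" "1 \<le> j" for i j
  proof -
    have xy: "ge (real i * \<alpha> + real j * \<beta>) (x ^ i * y ^ j)" by (intro ge_mult ge_power assms)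
    have "real i * \<alpha> \<ge> 0" using assms by simp
    have jb: "\<beta> \<le> real j * \<beta>" using ij assms by (simp add: mult_le_cancel_right1)
    show ?thesis
    proof (cases "i + j < q\<^sup>2")
      case True
      then have "ge \<mu> (lt_add_coeff S u i j)" using ij assms by (intro lt_add_coeff_ge_u) auto
      from ge_mult[OF this xy] have "ge \<tau> (lt_add_coeff S u i j * (x ^ i * y ^ j))"
        by (rule ge_mono) (use assms(7) jb \<open>0 \<le> real i * \<alpha>\<close> in linarith)
      then show ?thesis by (simp add: mult.assoc)
    next
      case False
      have "real j * \<alpha> - \<alpha> \<le> real j * \<beta> - \<beta>"
      proof -
        have "(real j - 1) * \<alpha> \<le> (real j - 1) * \<beta>" using ij assms by (intro mult_left_mono) auto
        then show ?thesis by (simp add: algebra_simps)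
      qed
      moreover have "((real q)\<^sup>2 - 1) * \<alpha> \<le> (real i + real j - 1) * \<alpha>"
      proof (rule mult_right_mono)
        have "q\<^sup>2 \<le> i + j" using False by simp
        then have "real (q\<^sup>2) \<le> real (i + j)" by (rule of_nat_mono)
        then show "(real q)\<^sup>2 - 1 \<le> real i + real j - 1" by simp
      qed (use assms in simp)
      ultimately have "\<tau> \<le> real i * \<alpha> + real j * \<beta>" using assms(8) by (simp add: left_diff_distrib distrib_right)
      then have "ge \<tau> (x ^ i * y ^ j)" by (rule ge_mono[OF xy])
      from ge_mult_right[OF lt_add_coeff_ge[OF u0] this] show ?thesis by (simp add: mult.assoc)
    qed
  qed
  define A where "A N = (\<Sum>i\<le>N. \<Sum>j\<le>N. lt_add_coeff S u i j * x ^ i * y ^ j)" for N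
  have Ab: "ge \<tau> (A (Suc N) - x - y)" for N
  proof -
    let ?T = "\<lambda>i j. lt_add_coeff S u i j * x ^ i * y ^ j"
    have dec: "{..Suc N} = insert 0 {1..Suc N}" by auto
    have split: "sum F {..Suc N} = F 0 + sum F {1..Suc N}" for F :: "nat \<Rightarrow> 'c"
      unfolding dec by (rule sum.insert) auto
    have "sum (?T 0) {..Suc N} = (\<Sum>j\<le>Suc N. if j = 1 then y else 0)"
      by (intro sum.cong) (auto simp: lt_add_coeff_left_0)
    then have row0: "sum (?T 0) {..Suc N} = y" by (simp only: sum.delta finite_atMost) simp
    have row: "sum (?T i) {..Suc N} = (if i = 1 then x else 0) + sum (?T i) {1..Suc N}" for i
      using split[of "?T i"] by (simp only: lt_add_coeff_right_0) simp
    have one: "(\<Sum>i\<in>{1..Suc N}. if i = 1 then x else 0) = x" by (simp only: sum.delta finite_atLeastAtMost) simp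
    have "A (Suc N) = sum (?T 0) {..Suc N} + (\<Sum>i\<in>{1..Suc N}. sum (?T i) {..Suc N})"
      unfolding A_def by (rule split)
    also have "\<dots> = y + (x + (\<Sum>i\<in>{1..Suc N}. sum (?T i) {1..Suc N}))"
      unfolding row0 row sum.distrib one ..
    finally have "A (Suc N) - x - y = (\<Sum>i\<in>{1..Suc N}. sum (?T i) {1..Suc N})" by (simp only:) simp
    moreover have "ge \<tau> (\<Sum>i\<in>{1..Suc N}. sum (?T i) {1..Suc N})"
      by (intro ge_sum tm) auto
    ultimately show ?thesis by (simp only:)
  qed
  have "vtends v A (sadd u x y)"
    unfolding A_def using sadd_approx[OF u0 assms(3,5) y] by (intro vtends_linear_bound[OF assms(3)])
  then have "vtends v (\<lambda>N. A N - x - y) (sadd u x y - x - y)" by (intro vtends_diff vtends_const)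
  then show "ge \<tau> (sadd u x y - x - y)"
  proof (rule vtends_ge)
    show "\<forall>\<^sub>F N in sequentially. ge \<tau> (A N - x - y)"
      using Ab by (intro eventually_sequentiallyI[of 1]) (metis Suc_le_D One_nat_def)
  qed
  then show "ge \<tau> (sadd u y x - x - y)" using sadd_commute[OF u0 assms(3,5) y] by simp
qed

text \<open>\<open>f_right_equation\<close> presents [\<pi>]_u(x) as the formal sum of a value of
  f^-1(\<pi>X), of ux^q and of x^(q^2). The first two have valuation at least 1 + \<rho> and \<mu> +
  q\<rho> and thus belong to the error.\<close>

lemma smul_pi:
  assumes "0 \<le> \<mu>" "ge \<mu> u" "0 < \<rho>" "ge \<rho> x" "\<tau> \<le> 1 + \<rho>" "\<tau> \<le> \<mu> + real q * \<rho>" "0 < \<tau>"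
  shows "ge \<tau> (smul u \<pi> x - x ^ (q\<^sup>2))"
proof -
  have u0: "ge 0 u" by (rule ge_mono[OF assms(2,1)])
  let ?X = "fps_const x * fps_X"
  define e where "e = fps_inv (lg u) oo (fps_const (\<pi> * x) * fps_X)"
  define A where "A = fps_const u * ?X ^ q"
  define B where "B = ?X ^ (q\<^sup>2)"
  have en: "ge (1 + real n * \<rho>) (e $ n)" for n
    by (rule inverse_log_pi_ge[OF u0 assms(3,4) e_def])
  then have re: "rser \<rho> e" unfolding rser_def by (auto intro: ge_mono[OF en])
  then have pe: "pser \<rho> e" by (simp add: pser_def e_def)
  have rX: "rser \<rho> ?X" by (rule rser_linear[OF assms(4)])
  have pA: "pser \<rho> A" unfolding A_def pser_def using u0 rX by (auto intro: rser_cmult rser_power)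
  have pB: "pser \<rho> B" unfolding B_def pser_def using rX by (auto intro: rser_power simp: startsby_zero_power)
  have fe: "lg u oo e = fps_const \<pi> * ?X" unfolding e_def by (subst f_fps_inv_compose) auto
  have "lg u oo gmul u \<pi> ?X = lg u oo gadd u (gadd u e A) B"
    unfolding f_gmul f_gadd fe A_def B_def by (rule f_right_equation) simp
  then have eq: "gmul u \<pi> ?X = gadd u (gadd u e A) B" by (rule f_inject[rotated 2]) auto
  have evA: "ev A = u * x ^ q" unfolding A_def using rX assms(3)
    by (simp add: ev_cmult rser_power ev_power ev_linear)
  have evB: "ev B = x ^ (q\<^sup>2)" unfolding B_def using rX assms(3) by (simp add: ev_power ev_linear)
  have "smul u \<pi> x = ev (gmul u \<pi> ?X)"
    using smul_ev[OF u0 OF_pi assms(3) pser_linear[OF assms(4)]] by (simp add: ev_linear)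
  also have "\<dots> = sadd u (sadd u (ev e) (ev A)) (ev B)"
    unfolding eq using sadd_ev[OF u0 assms(3) gadd_partial(1)[OF u0 assms(3) pe pA] pB] sadd_ev[OF u0 assms(3) pe pA] by simp
  finally have sm: "smul u \<pi> x = sadd u (sadd u (ev e) (u * x ^ q)) (x ^ (q\<^sup>2))" by (simp add: evA evB)
  have t1: "ge \<tau> (ev e)"
  proof (rule ev_tail[OF assms(3) re, of 1])
    show "e $ n = 0" if "n < 1" for n using that by (simp add: e_def)
    show "ge \<tau> (e $ n)" if "1 \<le> n" for n
    proof (rule ge_mono[OF en[of n]])
      have "\<rho> \<le> real n * \<rho>" using that assms(3) by (simp add: mult_le_cancel_right1)
      then show "\<tau> \<le> 1 + real n * \<rho>" using assms(5) by simp
    qed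
  qed
  have t2: "ge \<tau> (u * x ^ q)" by (rule ge_mono[OF ge_mult[OF assms(2) ge_power[OF assms(4)]] assms(6)])
  have t3: "ge \<tau> (sadd u (ev e) (u * x ^ q))" by (rule sadd_ge[OF u0 assms(7) t1 t2])
  let ?a = "sadd u (ev e) (u * x ^ q)"
  have xq: "ge (real (q\<^sup>2) * \<rho>) (x ^ (q\<^sup>2))" by (rule ge_power[OF assms(4)])
  \<comment> \<open>\<open>sadd_bound\<close> wants \<alpha> to be at most the bound \<tau> of the
    other summand, which the valuation of x^(q^2) may exceed. Its parameter \<mu> is taken to be 0:
    integrality of the group law is enough here.\<close>
  define \<alpha> where "\<alpha> = min \<tau> (real (q\<^sup>2) * \<rho>)"
  have "0 < real (q\<^sup>2) * \<rho>" using assms(3) by simp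
  then have a: "0 < \<alpha>" "\<alpha> \<le> \<tau>" "\<alpha> \<le> real (q\<^sup>2) * \<rho>" using assms(7) by (auto simp: \<alpha>_def)
  have q1: "0 \<le> (real q)\<^sup>2 - 1" using q_ge_3 by simp
  have "ge \<tau> (sadd u ?a (x ^ (q\<^sup>2)) - x ^ (q\<^sup>2) - ?a)"
    by (rule sadd_bound(2)[OF order_refl u0 a(1,2) ge_mono[OF xq a(3)] t3]) (use q1 a in auto)
  from ge_add[OF this t3] show ?thesis by (simp add: sm)
qed

subsection \<open>The module in characteristic \<open>p\<close>\<close>

lemma char_eq: assumes "CHAR('c) \<noteq> 0" shows "CHAR('k) = CHAR('c)"
proof -
  have "of_nat CHAR('c) = (0 :: 'k)" using br_of_nat[of "CHAR('c)"] by simp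
  then have "CHAR('k) dvd CHAR('c)" by (simp add: of_nat_eq_0_iff_char_dvd)
  moreover have "prime CHAR('c)" using assms prime_CHAR_semidom[where 'a='c] by simp
  moreover have "CHAR('k) \<noteq> 1" by simp
  ultimately show ?thesis using prime_nat_iff by blast
qed

context
  assumes char_p: "CHAR('c) \<noteq> 0"
begin

lemma binom_zero: assumes "0 < j" "j < q" shows "of_nat (q choose j) = (0::'c)"
  using binom_char[OF assms] char_eq[OF char_p] by (simp add: of_nat_eq_0_iff_char_dvd)

lemma frobenius_add: "((x::'c) + y) ^ q = x ^ q + y ^ q"
proof -
  have dj: "{..q} = {0<..<q} \<union> {0, q}" by auto
  have "(x + y) ^ q = (\<Sum>k\<le>q. of_nat (q choose k) * x ^ k * y ^ (q - k))"
    by (rule binomial_ring)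
  also have "\<dots> = (\<Sum>k\<in>{0<..<q}. of_nat (q choose k) * x ^ k * y ^ (q - k))
      + (\<Sum>k\<in>{0, q}. of_nat (q choose k) * x ^ k * y ^ (q - k))"
    unfolding dj by (subst sum.union_disjoint) auto
  also have "(\<Sum>k\<in>{0<..<q}. of_nat (q choose k) * x ^ k * y ^ (q - k)) = 0"
    by (intro sum.neutral) (auto simp: binom_zero)
  also have "(\<Sum>k\<in>{0, q}. of_nat (q choose k) * x ^ k * y ^ (q - k)) = y ^ q + x ^ q" by simp
  finally show ?thesis by (simp add: add.commute)
qed

lemma mu0_add: "x \<in> mu0 S \<Longrightarrow> y \<in> mu0 S \<Longrightarrow> x + y \<in> mu0 S"
  by (simp add: mu0_iff OF_add frobenius_add)

text \<open>In characteristic p the Teichmueller elements with 0 form a field, so digits add without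
  carries.\<close>

lemma teich_add: "z \<in> Fq S \<Longrightarrow> w \<in> Fq S \<Longrightarrow> teich S (z + w) = teich S z + teich S w"
  by (rule mu0_inj) (auto simp: teich_mu0 mu0_add br_teich Fq_add br_add mu0_ge)

abbreviation "lP u \<equiv> lt_pi_p S u"

lemma P_0 [simp]: "lP u 0 = 0" by (simp add: lt_pi_p_def power_0_left)

lemma P_add: "lP u (x + y) = lP u x + lP u y"
  by (simp add: lt_pi_p_def power2_eq_square power_mult frobenius_add algebra_simps)

lemma P_mu0: "a \<in> mu0 S \<Longrightarrow> lP u (a * x) = a * lP u x"
  by (simp add: lt_pi_p_def power2_eq_square power_mult power_mult_distrib mu0_power_q algebra_simps)

lemma P_minus: "lP u (- x) = - lP u x"
  using P_add[of u x "- x"] by (simp add: eq_neg_iff_add_eq_0 add.commute)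

lemma P_diff: "lP u (x - y) = lP u x - lP u y"
  using P_add[of u x "- y"] by (simp add: P_minus)

lemma P_sum: "lP u (\<Sum>i\<in>A. g i) = (\<Sum>i\<in>A. lP u (g i))"
  by (induction A rule: infinite_finite_induct) (auto simp: P_add)

lemma P_ge: assumes "ge 0 u" "0 < \<rho>" "\<rho> \<le> s" "ge s x" shows "ge (s + min 1 \<rho>) (lP u x)"
proof -
  have s: "s + s \<le> real m * s" if "2 \<le> m" for m
    using mult_right_mono[of 2 "real m" s] that assms by simp
  have 1: "ge (s + min 1 \<rho>) (\<pi> * x)" by (rule ge_mult'[OF ge_pi assms(4)]) simp
  have 2: "ge (s + min 1 \<rho>) (u * x ^ q)"
    by (rule ge_mult'[OF assms(1) ge_power[OF assms(4)]]) (use s[of q] q_ge_3 assms in linarith)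
  have "2 \<le> q\<^sup>2" using q_ge_3 by (auto simp: power2_eq_square intro: order_trans[of 2 "3 * 3"] mult_le_mono)
  then have 3: "ge (s + min 1 \<rho>) (x ^ (q\<^sup>2))"
    by (intro ge_mono[OF ge_power[OF assms(4)]]) (use s[of "q\<^sup>2"] assms in linarith)
  show ?thesis unfolding lt_pi_p_def by (intro ge_add 1 2 3)
qed

lemma P_pow_ge: assumes "ge 0 u" "0 < \<rho>" "ge \<rho> x" shows "ge (\<rho> + min 1 \<rho> * real k) ((lP u ^^ k) x)"
proof (induction k)
  case (Suc k)
  have "ge (\<rho> + min 1 \<rho> * real k + min 1 \<rho>) (lP u ((lP u ^^ k) x))"
    by (rule P_ge[OF assms(1,2) _ Suc]) (use assms in simp)
  then show ?case by (simp add: algebra_simps)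
qed (use assms in simp)

lemma P_pow_add: "(lP u ^^ k) (x + y) = (lP u ^^ k) x + (lP u ^^ k) y"
  by (induction k) (auto simp: P_add)

lemma digit_rest_OF: "a \<in> OF S \<Longrightarrow> digit_rest S a k \<in> OF S"
  by (induction k) (auto intro: OF_teich_diff)

lemma digit_mu0: "a \<in> OF S \<Longrightarrow> digit S a k \<in> mu0 S"
  by (simp add: digit_def digit_rest_OF Fq_bar teich_mu0)

lemma digit_rest_add: "a \<in> OF S \<Longrightarrow> c \<in> OF S \<Longrightarrow> digit_rest S (a + c) k = digit_rest S a k + digit_rest S c k"
proof (induction k)
  case (Suc k)
  then show ?case
    using digit_rest_OF[of a k] digit_rest_OF[of c k]
    by (simp add: br_add OF_ge teich_add Fq_bar diff_divide_distrib add_divide_distrib)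
qed simp

lemma digit_add: "a \<in> OF S \<Longrightarrow> c \<in> OF S \<Longrightarrow> digit S (a + c) k = digit S a k + digit S c k"
  using digit_rest_OF[of a k] digit_rest_OF[of c k]
  by (simp add: digit_def digit_rest_add br_add OF_ge teich_add Fq_bar)

lemma digit_rest_mu0: "z \<in> mu0 S \<Longrightarrow> a \<in> OF S \<Longrightarrow> digit_rest S (z * a) k = z * digit_rest S a k"
proof (induction k)
  case (Suc k)
  then show ?case
    using digit_rest_OF[of a k]
    by (simp add: br_mult OF_ge mu0_OF teich_mult Fq_bar teich_br right_diff_distrib)
qed simp

lemma digit_mu0_mult: "z \<in> mu0 S \<Longrightarrow> a \<in> OF S \<Longrightarrow> digit S (z * a) k = z * digit S a k"
  using digit_rest_OF[of a k]
  by (simp add: digit_def digit_rest_mu0 br_mult OF_ge mu0_OF teich_mult Fq_bar teich_br)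

lemma digit_rest_Suc: "digit_rest S (digit_rest S a 1) k = digit_rest S a (Suc k)"
  by (induction k) auto

lemma digit_Suc: "digit S (digit_rest S a 1) k = digit S a (Suc k)"
  unfolding digit_def digit_rest_Suc ..

lemma digit_rest_pi: assumes "a \<in> OF S" shows "digit_rest S (\<pi> * a) 1 = a" "digit S (\<pi> * a) 0 = 0"
proof -
  have "br (\<pi> * a) = 0" using assms v_pi by (simp add: br_mult OF_ge br_eq_0_iff)
  then show "digit_rest S (\<pi> * a) 1 = a" "digit S (\<pi> * a) 0 = 0" by (simp_all add: teich_0 digit_def)
qed

definition pmul :: "'c \<Rightarrow> 'c \<Rightarrow> 'c \<Rightarrow> 'c" where
  "pmul u a x = vlim v (\<lambda>N. \<Sum>k\<le>N. digit S a k * (lP u ^^ k) x)"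

context
  fixes u :: 'c and \<rho> :: real assumes u: "ge 0 u" and r: "0 < \<rho>"
begin

lemma digit_P_ge:
  assumes "a \<in> OF S" "ge \<rho> x" shows "ge (\<rho> + min 1 \<rho> * real k) (digit S a k * (lP u ^^ k) x)"
  by (intro ge_mult_right mu0_ge digit_mu0 assms P_pow_ge u r)

lemma pmul_vtends:
  assumes "a \<in> OF S" "ge \<rho> x"
  shows "vtends v (\<lambda>N. \<Sum>k\<le>N. digit S a k * (lP u ^^ k) x) (pmul u a x)"
proof -
  have "vcauchy v (\<lambda>N. \<Sum>k\<le>N. digit S a k * (lP u ^^ k) x)"
  proof (rule vcauchy_of_steps)
    show "0 < min 1 \<rho>" using r by simp
    show "ge (\<rho> + min 1 \<rho> * real n) ((\<Sum>k\<le>Suc n. digit S a k * (lP u ^^ k) x) - (\<Sum>k\<le>n. digit S a k * (lP u ^^ k) x))" for n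
    proof -
      have "ge (\<rho> + min 1 \<rho> * real n) (digit S a (Suc n) * (lP u ^^ Suc n) x)"
        by (rule ge_mono[OF digit_P_ge[OF assms]]) (use r in simp)
      then show ?thesis by simp
    qed
  qed
  then obtain l where "vtends v (\<lambda>N. \<Sum>k\<le>N. digit S a k * (lP u ^^ k) x) l" using vcomplete_C by blast
  then show ?thesis unfolding pmul_def by (simp only: vlim_eq)
qed

lemma pmul_ge: assumes "a \<in> OF S" "ge \<rho> x" shows "ge \<rho> (pmul u a x)"
proof (rule vtends_ge[OF pmul_vtends[OF assms]])
  have "ge \<rho> (digit S a k * (lP u ^^ k) x)" for k
    by (rule ge_mono[OF digit_P_ge[OF assms]]) (use r in simp)
  then show "\<forall>\<^sub>F N in sequentially. ge \<rho> (\<Sum>k\<le>N. digit S a k * (lP u ^^ k) x)"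
    by (intro always_eventually allI ge_sum)
qed

lemma pmul_approx: assumes "a \<in> OF S" "ge \<rho> x"
  shows "ge (\<rho> + min 1 \<rho> * real N) (pmul u a x - (\<Sum>k\<le>N. digit S a k * (lP u ^^ k) x))"
proof -
  let ?X = "\<lambda>N. \<Sum>k\<le>N. digit S a k * (lP u ^^ k) x"
  have "vtends v (\<lambda>M. ?X M - ?X N) (pmul u a x - ?X N)"
    by (intro vtends_diff vtends_const pmul_vtends assms)
  then show ?thesis
  proof (rule vtends_ge)
    have "ge (\<rho> + min 1 \<rho> * real N) (?X M - ?X N)" if "N \<le> M" for M
    proof -
      have "?X M = ?X N + (\<Sum>k\<in>{N<..M}. digit S a k * (lP u ^^ k) x)"
        using that by (subst sum.union_disjoint[symmetric]) (auto intro!: sum.cong)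
      moreover have "ge (\<rho> + min 1 \<rho> * real N) (\<Sum>k\<in>{N<..M}. digit S a k * (lP u ^^ k) x)"
        by (rule ge_sum, rule ge_mono[OF digit_P_ge[OF assms]]) (use r in \<open>auto intro: mult_left_mono\<close>)
      ultimately show ?thesis by simp
    qed
    then show "\<forall>\<^sub>F M in sequentially. ge (\<rho> + min 1 \<rho> * real N) (?X M - ?X N)"
      by (rule eventually_sequentiallyI)
  qed
qed

lemma pmul_add: assumes "a \<in> OF S" "ge \<rho> x" "ge \<rho> y" shows "pmul u a (x + y) = pmul u a x + pmul u a y"
proof -
  have "(\<Sum>k\<le>N. digit S a k * (lP u ^^ k) (x + y)) = (\<Sum>k\<le>N. digit S a k * (lP u ^^ k) x) + (\<Sum>k\<le>N. digit S a k * (lP u ^^ k) y)" for N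
    by (simp add: P_pow_add algebra_simps sum.distrib)
  then show ?thesis
    using vtends_add[OF pmul_vtends[OF assms(1,2)] pmul_vtends[OF assms(1,3)]] pmul_vtends[OF assms(1) ge_add[OF assms(2,3)]]
      vtends_unique by simp
qed

lemma add_pmul: assumes "a \<in> OF S" "c \<in> OF S" "ge \<rho> x" shows "pmul u (a + c) x = pmul u a x + pmul u c x"
proof -
  have "(\<Sum>k\<le>N. digit S (a + c) k * (lP u ^^ k) x) = (\<Sum>k\<le>N. digit S a k * (lP u ^^ k) x) + (\<Sum>k\<le>N. digit S c k * (lP u ^^ k) x)" for N
    by (simp add: digit_add assms algebra_simps sum.distrib)
  then show ?thesis
    using vtends_add[OF pmul_vtends[OF assms(1,3)] pmul_vtends[OF assms(2,3)]] pmul_vtends[OF OF_add[OF assms(1,2)] assms(3)]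
      vtends_unique by simp
qed

lemma mu0_pmul: assumes "z \<in> mu0 S" "a \<in> OF S" "ge \<rho> x" shows "pmul u (z * a) x = z * pmul u a x"
proof -
  have "(\<Sum>k\<le>N. digit S (z * a) k * (lP u ^^ k) x) = z * (\<Sum>k\<le>N. digit S a k * (lP u ^^ k) x)" for N
    by (simp add: digit_mu0_mult assms sum_distrib_left mult.assoc)
  then show ?thesis
    using vtends_mult_const[OF pmul_vtends[OF assms(2,3)], of z] pmul_vtends[OF OF_mult[OF mu0_OF[OF assms(1)] assms(2)] assms(3)]
      vtends_unique by simp
qed

lemma P_ge': "ge s x \<Longrightarrow> \<rho> \<le> s \<Longrightarrow> ge s (lP u x)"
  by (rule ge_mono[OF P_ge[OF u r]]) (use r in auto)

lemma P_pmul: assumes "a \<in> OF S" "ge \<rho> x" shows "lP u (pmul u a x) = pmul u a (lP u x)"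
proof -
  let ?X = "\<lambda>N. \<Sum>k\<le>N. digit S a k * (lP u ^^ k) x"
  have "vtends v (\<lambda>N. lP u (?X N)) (lP u (pmul u a x))"
    unfolding vtends_def
  proof
    fix K
    have "\<forall>\<^sub>F N in sequentially. ge (max K \<rho>) (?X N - pmul u a x)"
      using pmul_vtends[OF assms] unfolding vtends_def by (rule spec)
    then show "\<forall>\<^sub>F N in sequentially. ge K (lP u (?X N) - lP u (pmul u a x))"
    proof (rule eventually_mono)
      fix N assume "ge (max K \<rho>) (?X N - pmul u a x)"
      then have "ge (max K \<rho>) (lP u (?X N - pmul u a x))" by (rule P_ge') simp
      then show "ge K (lP u (?X N) - lP u (pmul u a x))" unfolding P_diff by (rule ge_mono) simp
    qed
  qed
  moreover have "lP u (?X N) = (\<Sum>k\<le>N. digit S a k * (lP u ^^ k) (lP u x))" for N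
    by (simp add: P_sum P_mu0 digit_mu0 assms funpow_swap1)
  ultimately show ?thesis
    using pmul_vtends[OF assms(1) P_ge'[OF assms(2) order_refl]] vtends_unique by simp
qed

lemma pmul_unfold: assumes "a \<in> OF S" "ge \<rho> x"
  shows "pmul u a x = digit S a 0 * x + pmul u (digit_rest S a 1) (lP u x)"
proof -
  let ?X = "\<lambda>N. \<Sum>k\<le>N. digit S a k * (lP u ^^ k) x"
  have "?X (Suc N) = digit S a 0 * x + (\<Sum>k\<le>N. digit S (digit_rest S a 1) k * (lP u ^^ k) (lP u x))" for N
    unfolding digit_Suc by (simp add: sum.atMost_Suc_shift funpow_swap1 del: sum.atMost_Suc)
  moreover have "vtends v (\<lambda>N. digit S a 0 * x + (\<Sum>k\<le>N. digit S (digit_rest S a 1) k * (lP u ^^ k) (lP u x)))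
      (digit S a 0 * x + pmul u (digit_rest S a 1) (lP u x))"
    by (intro vtends_add vtends_const pmul_vtends digit_rest_OF assms P_ge' order_refl)
  ultimately have "vtends v (\<lambda>N. ?X (Suc N)) (digit S a 0 * x + pmul u (digit_rest S a 1) (lP u x))" by simp
  moreover have "vtends v (\<lambda>N. ?X (Suc N)) (pmul u a x)"
    by (rule vtends_Suc[OF pmul_vtends[OF assms]])
  ultimately show ?thesis using vtends_unique by blast
qed

lemma pmul_0: assumes "ge \<rho> x" shows "pmul u 0 x = 0"
  using mu0_pmul[of 0 0 x] assms by simp

lemma pmul_pi_mult: assumes "a \<in> OF S" "ge \<rho> x" shows "pmul u (\<pi> * a) x = pmul u a (lP u x)"
  using pmul_unfold[OF OF_mult[OF OF_pi assms(1)] assms(2)] digit_rest_pi[OF assms(1)] by simp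

lemma pmul_mu0: assumes "z \<in> mu0 S" "ge \<rho> x" shows "pmul u z x = z * x"
proof -
  have "digit_rest S 1 1 = 0" "digit S 1 0 = 1" using teich_br[of 1] by (simp_all add: digit_def)
  then have "pmul u 1 x = x"
    using pmul_unfold[OF OF_one assms(2)] pmul_0[OF P_ge'[OF assms(2) order_refl]] by simp
  then show ?thesis using mu0_pmul[OF assms(1) OF_one assms(2)] by simp
qed

lemma pmul_pi: assumes "ge \<rho> x" shows "pmul u \<pi> x = lP u x"
  using pmul_pi_mult[OF OF_one assms] pmul_mu0[OF mu0_1 P_ge'[OF assms order_refl]] by simp

end

text \<open>The digits of a product have no simple formula. Instead one digit of a is split off: the
  defect of multiplicativity for (a, y) equals that for the remaining digits a' and the point
  [\<pi>]_u(y), whose valuation is larger by \<delta>. Repeating this makes the defect infinitely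
  small, hence the generalization over a, s and y in \<open>key\<close>.\<close>

lemma mult_pmul:
  assumes u: "ge 0 u" and r: "0 < \<rho>" and ac: "a \<in> OF S" "c \<in> OF S" and x: "ge \<rho> x"
  shows "pmul u (a * c) x = pmul u a (pmul u c x)"
proof -
  define \<delta> where "\<delta> = min 1 \<rho>"
  have \<delta>: "0 < \<delta>" using r by (simp add: \<delta>_def)
  have key: "ge (s + \<delta> * real n) (pmul u (a * c) y - pmul u a (pmul u c y))"
    if "a \<in> OF S" "\<rho> \<le> s" "ge s y" for n a s y
    using that
  proof (induction n arbitrary: a s y)
    case 0
    have s: "0 < s" using r 0 by simp
    show ?case using 0 ac by (simp add: ge_diff pmul_ge[OF u s] OF_mult)
  next
    case (Suc n)
    have s: "0 < s" using r Suc by simp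
    define a' where "a' = digit_rest S a 1"
    have a': "a' \<in> OF S" unfolding a'_def by (rule digit_rest_OF[OF Suc.prems(1)])
    have d0: "digit S a 0 \<in> mu0 S" by (rule digit_mu0[OF Suc.prems(1)])
    have a_eq: "a * c = digit S a 0 * c + \<pi> * (a' * c)"
      by (simp add: a'_def digit_def field_simps)
    have Py: "ge (s + \<delta>) (lP u y)"
      by (rule ge_mono[OF P_ge[OF u s order_refl Suc.prems(3)]]) (use Suc.prems in \<open>simp add: \<delta>_def\<close>)
    have Pys: "ge s (lP u y)" by (rule ge_mono[OF Py]) (use \<delta> in simp)
    have cy: "ge s (pmul u c y)" by (rule pmul_ge[OF u s ac(2) Suc.prems(3)])
    have "pmul u (a * c) y = digit S a 0 * pmul u c y + pmul u (a' * c) (lP u y)"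
      unfolding a_eq
      by (simp add: add_pmul[OF u s _ _ Suc.prems(3)] OF_mult mu0_OF d0 ac a' mu0_pmul[OF u s d0 ac(2) Suc.prems(3)]
          pmul_pi_mult[OF u s _ Suc.prems(3)])
    moreover have "pmul u a (pmul u c y) = digit S a 0 * pmul u c y + pmul u a' (pmul u c (lP u y))"
      using pmul_unfold[OF u s Suc.prems(1) cy] P_pmul[OF u s ac(2) Suc.prems(3)] by (simp add: a'_def)
    ultimately have "pmul u (a * c) y - pmul u a (pmul u c y) = pmul u (a' * c) (lP u y) - pmul u a' (pmul u c (lP u y))"
      by simp
    moreover have "ge (s + \<delta> + \<delta> * real n) (pmul u (a' * c) (lP u y) - pmul u a' (pmul u c (lP u y)))"
      by (rule Suc.IH[OF a' _ Py]) (use Suc.prems \<delta> in simp)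
    moreover have "s + \<delta> + \<delta> * real n = s + \<delta> * real (Suc n)" by (simp add: algebra_simps)
    ultimately show ?case by (simp only:)
  qed
  have "ge K (pmul u (a * c) x - pmul u a (pmul u c x))" for K
  proof -
    obtain n :: nat where n: "(K - \<rho>) / \<delta> \<le> real n" using real_arch_simple by blast
    then have "K \<le> \<rho> + \<delta> * real n" using \<delta> by (simp add: field_simps)
    then show ?thesis using ge_mono[OF key[OF ac(1) order_refl x]] by blast
  qed
  then show ?thesis using zero_if_ge_all by fastforce
qed

lemma P_pow_intpoly: "(\<lambda>p. (lP (fst p) ^^ k) (fst (snd p))) \<in> intpoly"
proof (induction k)
  case (Suc k)
  then show ?case
    unfolding funpow.simps comp_def lt_pi_p_def
    by (intro intpoly.add intpoly.mult intpoly_power intpoly.const OF_pi intpoly.u)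
qed (simp add: intpoly.x)

end

subsection \<open>The module structure in both characteristics\<close>

lemma lt_add_char_0: "CHAR('c) = 0 \<Longrightarrow> lt_add S u x y = sadd u x y"
  by (simp add: lt_add_def sadd_def)

lemma lt_add_char_p: "CHAR('c) \<noteq> 0 \<Longrightarrow> lt_add S u x y = x + y"
  by (simp add: lt_add_def)

lemma lt_mult_char_0: "CHAR('c) = 0 \<Longrightarrow> lt_mult S u a x = smul u a x"
  by (simp add: lt_mult_def smul_def)

lemma lt_mult_char_p: "CHAR('c) \<noteq> 0 \<Longrightarrow> lt_mult S u a x = pmul u a x"
  by (simp add: lt_mult_def pmul_def)

context
  fixes u :: 'c and \<rho> :: real assumes u: "ge 0 u" and r: "0 < \<rho>"
begin

lemma lt_add_ge: "ge \<rho> x \<Longrightarrow> ge \<rho> y \<Longrightarrow> ge \<rho> (lt_add S u x y)"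
  by (cases "CHAR('c) = 0") (simp_all add: lt_add_char_0 lt_add_char_p sadd_ge[OF u r] ge_add)

lemma lt_mult_ge: "a \<in> OF S \<Longrightarrow> ge \<rho> x \<Longrightarrow> ge \<rho> (lt_mult S u a x)"
  by (cases "CHAR('c) = 0") (simp_all add: lt_mult_char_0 lt_mult_char_p smul_ge[OF u r] pmul_ge[OF _ u r])

lemma lt_add_commute: assumes "ge \<rho> x" "ge \<rho> y" shows "lt_add S u x y = lt_add S u y x"
  by (cases "CHAR('c) = 0") (simp_all add: lt_add_char_0 lt_add_char_p sadd_commute[OF u r assms] add.commute)

lemma lt_add_assoc: assumes "ge \<rho> x" "ge \<rho> y" "ge \<rho> z"
  shows "lt_add S u (lt_add S u x y) z = lt_add S u x (lt_add S u y z)"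
  by (cases "CHAR('c) = 0") (simp_all add: lt_add_char_0 lt_add_char_p sadd_assoc[OF u r assms] add.assoc)

lemma lt_add_0: "ge \<rho> x \<Longrightarrow> lt_add S u x 0 = x"
  by (cases "CHAR('c) = 0") (simp_all add: lt_add_char_0 lt_add_char_p sadd_0[OF u r])

lemma lt_mult_add: assumes "a \<in> OF S" "ge \<rho> x" "ge \<rho> y"
  shows "lt_mult S u a (lt_add S u x y) = lt_add S u (lt_mult S u a x) (lt_mult S u a y)"
  by (cases "CHAR('c) = 0")
     (simp_all add: lt_add_char_0 lt_add_char_p lt_mult_char_0 lt_mult_char_p smul_add[OF u r assms] pmul_add[OF _ u r assms])

lemma add_lt_mult: assumes "a \<in> OF S" "c \<in> OF S" "ge \<rho> x"
  shows "lt_mult S u (a + c) x = lt_add S u (lt_mult S u a x) (lt_mult S u c x)"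
  by (cases "CHAR('c) = 0")
     (simp_all add: lt_add_char_0 lt_add_char_p lt_mult_char_0 lt_mult_char_p add_smul[OF u r assms] add_pmul[OF _ u r assms])

lemma mult_lt_mult: assumes "a \<in> OF S" "c \<in> OF S" "ge \<rho> x"
  shows "lt_mult S u (a * c) x = lt_mult S u a (lt_mult S u c x)"
  by (cases "CHAR('c) = 0")
     (simp_all add: lt_mult_char_0 lt_mult_char_p mult_smul[OF u r assms] mult_pmul[OF _ u r assms])

lemma lt_mult_mu0: assumes "a \<in> mu0 S" "ge \<rho> x" shows "lt_mult S u a x = a * x"
  by (cases "CHAR('c) = 0")
     (simp_all add: lt_mult_char_0 lt_mult_char_p smul_mu0[OF u r assms] pmul_mu0[OF _ u r assms])

text \<open>One integral polynomial serves all u and all points of valuation at least \<rho>. This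
  uniformity is what makes the action of the group analytic on an affinoid.\<close>

lemma lt_add_approx: "\<exists>\<Phi>\<in>intpoly. \<forall>u x y. ge 0 u \<and> ge \<rho> x \<and> ge \<rho> y \<longrightarrow> ge K (lt_add S u x y - \<Phi> (u, x, y))"
proof (cases "CHAR('c) = 0")
  case True
  obtain N :: nat where N: "K / \<rho> \<le> real N" using real_arch_simple by blast
  have "K \<le> real N * \<rho>" using N r by (simp add: field_simps)
  also have "\<dots> \<le> real (Suc N) * \<rho>" using r by (intro mult_right_mono) auto
  finally have K: "K \<le> real (Suc N) * \<rho>" .
  define \<Phi> where "\<Phi> p = (\<Sum>i\<le>N. \<Sum>j\<le>N. lt_add_coeff S (fst p) i j * fst (snd p) ^ i * snd (snd p) ^ j)" for p
  have "\<Phi> \<in> intpoly" unfolding \<Phi>_def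
    by (intro intpoly_sum intpoly.mult intpoly_power intpoly.x intpoly.y lt_add_coeff_intpoly)
  moreover have "ge K (lt_add S u x y - \<Phi> (u, x, y))" if "ge 0 u" "ge \<rho> x" "ge \<rho> y" for u x y
    unfolding \<Phi>_def lt_add_char_0[OF True] using ge_mono[OF sadd_approx[OF that(1) r that(2,3), of N] K] by simp
  ultimately show ?thesis by blast
next
  case False
  then show ?thesis
    by (intro bexI[of _ "\<lambda>p. fst (snd p) + snd (snd p)"] intpoly.add intpoly.x intpoly.y) (simp add: lt_add_char_p)
qed

lemma lt_mult_approx: assumes a: "a \<in> OF S"
  shows "\<exists>\<Phi>\<in>intpoly. \<forall>u x. ge 0 u \<and> ge \<rho> x \<longrightarrow> ge K (lt_mult S u a x - \<Phi> (u, x, 0))"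
proof (cases "CHAR('c) = 0")
  case True
  obtain N :: nat where N: "K / \<rho> \<le> real N" using real_arch_simple by blast
  have "K \<le> real N * \<rho>" using N r by (simp add: field_simps)
  also have "\<dots> \<le> real (Suc N) * \<rho>" using r by (intro mult_right_mono) auto
  finally have K: "K \<le> real (Suc N) * \<rho>" .
  define \<Phi> where "\<Phi> p = (\<Sum>n\<le>N. lt_mult_series S (fst p) a $ n * fst (snd p) ^ n)" for p :: "'c \<times> 'c \<times> 'c"
  have "\<Phi> \<in> intpoly" unfolding \<Phi>_def
    by (intro intpoly_sum intpoly.mult intpoly_power intpoly.x lt_mult_series_intpoly a)
  moreover have "ge K (lt_mult S u a x - \<Phi> (u, x, 0))" if "ge 0 u" "ge \<rho> x" for u x
    unfolding \<Phi>_def lt_mult_char_0[OF True] using ge_mono[OF smul_approx[OF that(1) a r that(2), of N] K] by simp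
  ultimately show ?thesis by blast
next
  case False
  define \<delta> where "\<delta> = min 1 \<rho>"
  have \<delta>: "0 < \<delta>" using r by (simp add: \<delta>_def)
  obtain N :: nat where N: "(K - \<rho>) / \<delta> \<le> real N" using real_arch_simple by blast
  then have K: "K \<le> \<rho> + min 1 \<rho> * real N" using \<delta> by (simp add: field_simps flip: \<delta>_def)
  define \<Phi> where "\<Phi> p = (\<Sum>k\<le>N. digit S a k * (lt_pi_p S (fst p) ^^ k) (fst (snd p)))" for p :: "'c \<times> 'c \<times> 'c"
  have "\<Phi> \<in> intpoly" unfolding \<Phi>_def
    by (intro intpoly_sum intpoly.mult intpoly.const P_pow_intpoly False mu0_OF digit_mu0 a)
  moreover have "ge K (lt_mult S u a x - \<Phi> (u, x, 0))" if "ge 0 u" "ge \<rho> x" for u x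
    unfolding \<Phi>_def lt_mult_char_p[OF False] using ge_mono[OF pmul_approx[OF False that(1) r a that(2), of N] K] by simp
  ultimately show ?thesis by blast
qed

end

lemma lt_add_bound:
  assumes "0 \<le> \<mu>" "ge \<mu> u" "0 < \<alpha>" "\<alpha> \<le> \<beta>" "ge \<alpha> x" "ge \<beta> y"
    "\<tau> \<le> \<beta> + \<mu>" "\<tau> \<le> \<beta> + ((real q)\<^sup>2 - 1) * \<alpha>"
  shows "cg \<tau> (lt_add S u x y) (x + y)" "cg \<tau> (lt_add S u y x) (x + y)"
  using sadd_bound[OF assms] by (cases "CHAR('c) = 0";
    simp add: cg_def lt_add_char_0 lt_add_char_p algebra_simps)+

lemma lt_mult_pi:
  assumes "0 \<le> \<mu>" "ge \<mu> u" "0 < \<rho>" "ge \<rho> x" "\<tau> \<le> 1 + \<rho>" "\<tau> \<le> \<mu> + real q * \<rho>" "0 < \<tau>"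
  shows "cg \<tau> (lt_mult S u \<pi> x) (x ^ (q\<^sup>2))"
proof (cases "CHAR('c) = 0")
  case True
  then show ?thesis using smul_pi[OF assms] by (simp add: cg_def lt_mult_char_0)
next
  case False
  have u0: "ge 0 u" by (rule ge_mono[OF assms(2,1)])
  have "ge \<tau> (\<pi> * x + u * x ^ q)"
    by (intro ge_add ge_mult'[OF ge_pi assms(4)] ge_mult'[OF assms(2) ge_power[OF assms(4)]] assms)
  then show ?thesis using pmul_pi[OF False u0 assms(3,4)] False by (simp add: cg_def lt_mult_char_p lt_pi_p_def)
qed

end

subsection \<open>The equation of the reduced curve\<close>

text \<open>Here \<open>k\<close> stands for \<open>\<kappa>\<^sub>1\<close>, of valuation \<open>1\<close>, so that \<open>VP\<close> is the valuation of \<open>\<pi>\<close>;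
  then \<open>\<gamma> = k ^ (q\<^sup>2 * (q - 1)\<^sup>2)\<close>.\<close>

locale frob_valued = valued v for v :: "'c::field \<Rightarrow> ereal" +
  fixes q :: nat and k :: 'c
  assumes q3: "3 \<le> q" and vk: "v k = ereal 1"
    and frob: "ge 0 x \<Longrightarrow> ge 0 y \<Longrightarrow> cg (2 * real q ^ 4 * (real q - 1)) ((x + y) ^ q) (x ^ q + y ^ q)"
begin

abbreviation "Q \<equiv> real q"
abbreviation "VP \<equiv> 2 * Q ^ 4 * (Q - 1)"

lemma Q3: "3 \<le> Q" using q3 by simp

lemma real_q1 [simp]: "real (q - Suc 0) = Q - 1" "real (q - 1) = Q - 1"
  using q3 by (simp_all add: of_nat_diff)

lemma k_nonzero [simp]: "k \<noteq> 0" using vk by auto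

lemma v_kpow: "v (k ^ n) = ereal (real n)" using v_power[OF vk, of n] by simp

lemma ge_kpow: "r \<le> real n \<Longrightarrow> ge r (k ^ n)" by (simp add: v_kpow)

lemma frob_minus: assumes "ge 0 x" "ge 0 y" shows "cg VP ((x - y) ^ q) (x ^ q - y ^ q)"
proof -
  have "ge VP (x ^ q - ((x - y) ^ q + y ^ q))"
    using frob[of "x - y" y] assms ge_diff[of 0 x y] by (simp add: cg_def)
  then show ?thesis unfolding cg_def by (subst v_minus_commute) (simp add: algebra_simps)
qed

text \<open>(x - y)^q is x^q - y^q up to \<open>VP\<close>, so a congruence of q-th powers passes to
  the roots with its exponent divided by Q, as long as it is no finer than
  \<open>VP\<close>.\<close>

lemma frob_root: assumes "ge 0 x" "ge 0 y" "cg (Q * r) (x ^ q) (y ^ q)" "Q * r \<le> VP" shows "cg r x y"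
proof -
  have "cg (Q * r) ((x - y) ^ q) (x ^ q - y ^ q)" by (rule cg_mono[OF frob_minus[OF assms(1,2)] assms(4)])
  then have "ge (Q * r) ((x - y) ^ q)" by (rule cg_ge) (use assms(3) in \<open>simp add: cg_def\<close>)
  then show ?thesis unfolding cg_def by (rule ge_root[rotated]) (use q3 in simp)
qed

lemma Q_ineqs:
  "Q * (Q - 1)\<^sup>2 \<le> Q\<^sup>2 * (Q\<^sup>2 - 1)" "2 * Q * (Q - 1)\<^sup>2 \<le> Q\<^sup>2 * (Q\<^sup>2 - 1)"
  "Q\<^sup>2 * (Q - 1)\<^sup>2 \<le> 2 * Q ^ 3 * (Q - 1)" "2 * Q ^ 3 * (Q - 1) \<le> VP"
  "Q\<^sup>2 * (Q - 1)\<^sup>2 \<le> VP" "Q\<^sup>2 * (Q\<^sup>2 - 1) \<le> VP" "2 * Q ^ 3 * (Q - 1)\<^sup>2 \<le> VP"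
  "3 * Q * (Q - 1) / 2 \<le> Q * (Q - 1)\<^sup>2" "3 * Q * (Q - 1) / 2 \<le> VP"
  "0 \<le> Q * (Q - 1)\<^sup>2" "0 \<le> (Q - 1)\<^sup>2"
proof -
  \<comment> \<open>After Q = R + 3 with R at least 0, each difference of the two sides is a
    polynomial in R with nonnegative coefficients.\<close>
  define R where "R = Q - 3"
  have R: "Q = R + 3" "0 \<le> R" using Q3 by (auto simp: R_def)
  note simps = R(1) power2_eq_square power3_eq_cube power4_eq_xxxx algebra_simps
  have nn: "0 \<le> R * R" "0 \<le> R * (R * R)" "0 \<le> R * (R * (R * R))" "0 \<le> R * (R * (R * (R * R)))" using R(2) by auto
  show "Q * (Q - 1)\<^sup>2 \<le> Q\<^sup>2 * (Q\<^sup>2 - 1)" "2 * Q * (Q - 1)\<^sup>2 \<le> Q\<^sup>2 * (Q\<^sup>2 - 1)"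
    "Q\<^sup>2 * (Q - 1)\<^sup>2 \<le> 2 * Q ^ 3 * (Q - 1)" "2 * Q ^ 3 * (Q - 1) \<le> VP"
    "Q\<^sup>2 * (Q - 1)\<^sup>2 \<le> VP" "Q\<^sup>2 * (Q\<^sup>2 - 1) \<le> VP" "2 * Q ^ 3 * (Q - 1)\<^sup>2 \<le> VP"
    "3 * Q * (Q - 1) / 2 \<le> Q * (Q - 1)\<^sup>2" "3 * Q * (Q - 1) / 2 \<le> VP"
    using nn R(2) by (simp_all add: simps)
  show "0 \<le> Q * (Q - 1)\<^sup>2" "0 \<le> (Q - 1)\<^sup>2" by auto
qed

text \<open>\<gamma>0 is integral, since with negative valuation its q-th power would outweigh the
  other terms of its equation. Then its q-th power is 1 up to \<gamma>^(2q), and each of the two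
  q-th roots leading to \<gamma>0 and \<theta> divides the exponent of the error by Q.\<close>

lemma gamma0_theta:
  assumes g0: "\<gamma>0 ^ q - k ^ (2 * q ^ 3 * (q - 1)\<^sup>2) * \<gamma>0 = 1" and th: "\<theta> ^ q = \<gamma>0"
  shows "cg (2 * Q\<^sup>2 * (Q - 1)\<^sup>2) \<gamma>0 1" "cg (2 * Q * (Q - 1)\<^sup>2) \<theta> 1"
proof -
  let ?c = "k ^ (2 * q ^ 3 * (q - 1)\<^sup>2)"
  have vc: "v ?c = ereal (2 * Q ^ 3 * (Q - 1)\<^sup>2)" by (simp add: v_kpow)
  have c0: "0 \<le> 2 * Q ^ 3 * (Q - 1)\<^sup>2" by simp
  have i: "ge 0 \<gamma>0"
  proof (rule ccontr)
    assume neg: "\<not> ge 0 \<gamma>0"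
    then have "\<gamma>0 \<noteq> 0" by auto
    then obtain s where s: "v \<gamma>0 = ereal s" by (rule v_real)
    then have s0: "s < 0" using neg by simp
    have "ge s (?c * \<gamma>0 + 1)"
      by (intro ge_add ge_mult') (use s0 vc s c0 in \<open>auto intro: ge_mono[OF ge_one]\<close>)
    moreover have "\<gamma>0 ^ q = ?c * \<gamma>0 + 1" using g0 by (simp add: algebra_simps)
    ultimately have "s \<le> Q * s" using v_power[OF s, of q] by simp
    then have "(Q - 1) * s \<ge> 0" by (simp add: algebra_simps)
    then show False using s0 Q3 by (simp add: zero_le_mult_iff)
  qed
  have "cg (2 * Q ^ 3 * (Q - 1)\<^sup>2) (\<gamma>0 ^ q) (1 ^ q)"
  proof -
    have "\<gamma>0 ^ q - 1 ^ q = ?c * \<gamma>0" using g0 by (simp add: algebra_simps)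
    moreover have "ge (2 * Q ^ 3 * (Q - 1)\<^sup>2) (?c * \<gamma>0)" by (rule ge_mult_left) (use vc i in auto)
    ultimately show ?thesis by (simp only: cg_def)
  qed
  moreover have e1: "2 * Q ^ 3 * (Q - 1)\<^sup>2 = Q * (2 * Q\<^sup>2 * (Q - 1)\<^sup>2)" by (simp add: power3_eq_cube power2_eq_square)
  ultimately show G: "cg (2 * Q\<^sup>2 * (Q - 1)\<^sup>2) \<gamma>0 1"
    using Q_ineqs(7) by (intro frob_root[OF i ge_one]) (simp_all only:)
  have it: "ge 0 \<theta>" by (rule ge_root[of q]) (use i th q3 in auto)
  have e2: "2 * Q\<^sup>2 * (Q - 1)\<^sup>2 = Q * (2 * Q * (Q - 1)\<^sup>2)" by (simp add: power2_eq_square)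
  have "2 * Q\<^sup>2 * (Q - 1)\<^sup>2 * 1 \<le> 2 * Q\<^sup>2 * (Q - 1)\<^sup>2 * Q" using Q3 by (intro mult_left_mono) auto
  then have "2 * Q\<^sup>2 * (Q - 1)\<^sup>2 \<le> 2 * Q ^ 3 * (Q - 1)\<^sup>2" by (simp add: power3_eq_cube power2_eq_square algebra_simps)
  then have l: "2 * Q\<^sup>2 * (Q - 1)\<^sup>2 \<le> VP" using Q_ineqs(7) by linarith
  show "cg (2 * Q * (Q - 1)\<^sup>2) \<theta> 1"
  proof (rule frob_root[OF it ge_one])
    show "cg (Q * (2 * Q * (Q - 1)\<^sup>2)) (\<theta> ^ q) (1 ^ q)" using G unfolding e2[symmetric] th by simp
    show "Q * (2 * Q * (Q - 1)\<^sup>2) \<le> VP" using l unfolding e2[symmetric] .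
  qed
qed

text \<open>The hypothesis reads m^q = z\<gamma>0 + \<gamma>A - \<gamma>^(2q/(q-1))n with A = mt^q +
  z/t^q. With m = z\<theta> + \<gamma>^(1/q)Z1 it gives Z1^q close to A. Subtracting the q-th power
  of z(t + 1/t) leaves (m - z)t^q, which is close to \<gamma>^(1/q)t^qZ1; division by
  \<gamma>^(1/q)t^q shows that Z2^q is close to Z1.\<close>

lemma component_estimates:
  assumes g0: "\<gamma>0 ^ q - k ^ (2 * q ^ 3 * (q - 1)\<^sup>2) * \<gamma>0 = 1" and th: "\<theta> ^ q = \<gamma>0"
    and vx: "v x = 0" and vy: "v y = 0" and vz: "v z = 0" and zq: "z ^ q = z" and n: "ge 0 n"
    and H: "(x * y ^ q) ^ q - k ^ (q\<^sup>2 * (q - 1)\<^sup>2) * (x * y ^ (q ^ 3) + z * inverse (y ^ (q * (q\<^sup>2 - 1))))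
      = z * \<gamma>0 - k ^ (2 * q ^ 3 * (q - 1)) * n"
    and m: "m = x * y ^ q" and t: "t = y ^ (q\<^sup>2 - 1)"
    and Z1: "Z1 = (m - z * \<theta>) / k ^ (q * (q - 1)\<^sup>2)"
    and Z2: "Z2 = (Z1 - z * (t + inverse t)) / (k ^ ((q - 1)\<^sup>2) * t)"
  shows "cg (Q * (Q - 1)\<^sup>2) m z" "ge 0 Z1" "ge 0 Z2" "cg (Q * (Q - 1)\<^sup>2) (Z2 ^ q) Z1"
    "cg (Q\<^sup>2 * (Q - 1)\<^sup>2) (m ^ q) z"
    "Z1 = z * (t + inverse t) + k ^ ((q - 1)\<^sup>2) * t * Z2" "m = z * \<theta> + k ^ (q * (q - 1)\<^sup>2) * Z1"
proof -
  let ?\<gamma> = "k ^ (q\<^sup>2 * (q - 1)\<^sup>2)" and ?K = "k ^ (q * (q - 1)\<^sup>2)" and ?g = "k ^ ((q - 1)\<^sup>2)"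
    and ?N = "k ^ (2 * q ^ 3 * (q - 1))"
  have v\<gamma>: "v ?\<gamma> = ereal (Q\<^sup>2 * (Q - 1)\<^sup>2)" and vK: "v ?K = ereal (Q * (Q - 1)\<^sup>2)"
    and vg: "v ?g = ereal ((Q - 1)\<^sup>2)" and vN: "v ?N = ereal (2 * Q ^ 3 * (Q - 1))"
    by (simp_all add: v_kpow)
  have Kq: "?K ^ q = ?\<gamma>" and gq: "?g ^ q = ?K" by (simp_all add: power2_eq_square algebra_simps flip: power_mult)
  have gt: "cg (2 * Q\<^sup>2 * (Q - 1)\<^sup>2) \<gamma>0 1" "cg (2 * Q * (Q - 1)\<^sup>2) \<theta> 1" by (rule gamma0_theta[OF g0 th])+
  have i\<theta>: "ge 0 \<theta>" by (rule cg_ge'[OF gt(2)]) auto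
  have i\<gamma>0: "ge 0 \<gamma>0" by (rule cg_ge'[OF gt(1)]) auto
  have vt: "v t = 0" unfolding t by (rule v_power_0[OF vy])
  have vm: "v m = 0" unfolding m by (intro v_mult_0 v_power_0 vx vy)
  have y0: "y \<noteq> 0" and t0: "t \<noteq> 0" using vy vt by auto
  note unit = ge_unit[OF vx] ge_unit[OF vy] ge_unit[OF vz] ge_unit[OF vt] ge_unit[OF vm]
    ge_unit[OF v_inverse_0[OF vt]] ge_unit[OF v_inverse_0[OF vy]]
  define A where "A = m * t ^ q + z * inverse (t ^ q)"
  have iA: "ge 0 A" unfolding A_def
    by (intro ge_add ge_mult_left ge_power0 unit ge_unit[OF v_inverse_0[OF v_power_0[OF vt]]])
  have q3e: "q ^ 3 = q + q * (q\<^sup>2 - 1)"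
  proof -
    have "1 \<le> q\<^sup>2" using q3 by simp
    then have "q * (q\<^sup>2 - 1) = q * q\<^sup>2 - q" by (simp add: diff_mult_distrib2)
    moreover have "q \<le> q * q\<^sup>2" using \<open>1 \<le> q\<^sup>2\<close> by simp
    ultimately show ?thesis by (simp add: power3_eq_cube power2_eq_square)
  qed
  have tq: "t ^ q = y ^ (q * (q\<^sup>2 - 1))" unfolding t by (simp add: mult.commute flip: power_mult)
  have A_eq: "x * y ^ (q ^ 3) + z * inverse (y ^ (q * (q\<^sup>2 - 1))) = A"
    unfolding A_def tq q3e m power_add by (simp add: mult.assoc)
  have mq: "m ^ q = z * \<gamma>0 + (?\<gamma> * A - ?N * n)"
    using H unfolding A_eq m[symmetric] by (simp add: algebra_simps)
  have zt: "(z * \<theta>) ^ q = z * \<gamma>0" by (simp add: power_mult_distrib zq th)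
  have e: "ge (Q\<^sup>2 * (Q - 1)\<^sup>2) (?\<gamma> * A - ?N * n)"
  proof (rule ge_diff)
    show "ge (Q\<^sup>2 * (Q - 1)\<^sup>2) (?\<gamma> * A)" by (rule ge_mult_left) (use v\<gamma> iA in auto)
    show "ge (Q\<^sup>2 * (Q - 1)\<^sup>2) (?N * n)" by (rule ge_mult_left) (use vN n Q_ineqs(3) in auto)
  qed
  have e1: "Q\<^sup>2 * (Q - 1)\<^sup>2 = Q * (Q * (Q - 1)\<^sup>2)" by (simp add: power2_eq_square)
  have mz: "cg (Q * (Q - 1)\<^sup>2) m (z * \<theta>)"
  proof (rule frob_root)
    show "cg (Q * (Q * (Q - 1)\<^sup>2)) (m ^ q) ((z * \<theta>) ^ q)"
      unfolding zt mq e1[symmetric] by (rule cg_drop[OF e])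
    show "Q * (Q * (Q - 1)\<^sup>2) \<le> VP" using Q_ineqs(5) unfolding e1 .
  qed (intro unit ge_mult_left i\<theta>)+
  show "cg (Q\<^sup>2 * (Q - 1)\<^sup>2) (m ^ q) z"
  proof -
    have "cg (Q\<^sup>2 * (Q - 1)\<^sup>2) (z * \<gamma>0) (z * 1)"
      by (rule cg_mult_left'[OF gt(1) unit(3)]) simp
    then show ?thesis using cg_trans[OF cg_drop[OF e]] unfolding mq by simp
  qed
  show iZ1: "ge 0 Z1" unfolding Z1 using ge_divide[OF _ vK, of "Q * (Q - 1)\<^sup>2" "m - z * \<theta>"] mz by (simp add: cg_def)
  show m_eq: "m = z * \<theta> + ?K * Z1" unfolding Z1 by simp
  have iKZ: "ge (Q * (Q - 1)\<^sup>2) (?K * Z1)" by (rule ge_mult_left) (use vK iZ1 in auto)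
  have iKZ0: "ge 0 (?K * Z1)" by (rule ge_mono[OF iKZ]) simp
  have z\<theta>: "ge (2 * Q * (Q - 1)\<^sup>2) (z * (\<theta> - 1))" by (rule ge_mult_right) (use unit gt(2) in \<open>auto simp: cg_def\<close>)
  have mz': "m - z = z * (\<theta> - 1) + ?K * Z1" by (subst m_eq) (simp add: algebra_simps)
  have "ge (Q * (Q - 1)\<^sup>2) (m - z)"
    unfolding mz' by (intro ge_add iKZ ge_mono[OF z\<theta>]) simp
  then show mz1: "cg (Q * (Q - 1)\<^sup>2) m z" by (simp add: cg_def)
  \<comment> \<open>The function n is only known to be integral, so nothing is known beyond
    2Q^3(Q-1); dividing by \<gamma> leaves exactly Q^2(Q^2-1).\<close>
  have Zq: "cg (Q\<^sup>2 * (Q\<^sup>2 - 1)) (Z1 ^ q) A"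
  proof (rule cg_cancel'[OF v\<gamma>])
    have "cg VP (m ^ q) ((z * \<theta>) ^ q + (?K * Z1) ^ q)"
      unfolding m_eq by (rule frob) (intro ge_mult_left unit i\<theta> iKZ0)+
    moreover have "(?K * Z1) ^ q = ?\<gamma> * Z1 ^ q" unfolding power_mult_distrib Kq ..
    ultimately have 1: "cg (2 * Q ^ 3 * (Q - 1)) (z * \<gamma>0 + (?\<gamma> * A - ?N * n)) (z * \<gamma>0 + ?\<gamma> * Z1 ^ q)"
      unfolding zt mq[symmetric] by (intro cg_mono[OF _ Q_ineqs(4)]) (simp only:)
    have 2: "cg (2 * Q ^ 3 * (Q - 1)) (z * \<gamma>0 + ?\<gamma> * A) (z * \<gamma>0 + (?\<gamma> * A - ?N * n))"
      using ge_mult_left[of "2 * Q ^ 3 * (Q - 1)" ?N n] vN n by (simp add: cg_def)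
    from cg_sym[OF cg_trans[OF 2 1]] show "cg (2 * Q ^ 3 * (Q - 1)) (?\<gamma> * Z1 ^ q) (?\<gamma> * A)" by (simp add: cg_def)
    show "Q\<^sup>2 * (Q\<^sup>2 - 1) \<le> 2 * Q ^ 3 * (Q - 1) - Q\<^sup>2 * (Q - 1)\<^sup>2"
      by (simp add: power2_eq_square power3_eq_cube algebra_simps)
  qed
  define D where "D = Z1 - z * (t + inverse t)"
  have it: "ge 0 (t + inverse t)" by (intro ge_add unit)
  have Dq: "cg (Q\<^sup>2 * (Q\<^sup>2 - 1)) (D ^ q) ((m - z) * t ^ q)"
  proof -
    have 1: "cg VP (D ^ q) (Z1 ^ q - (z * (t + inverse t)) ^ q)"
      unfolding D_def by (intro frob_minus iZ1 ge_mult_left unit it)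
    have 2: "cg VP ((z * (t + inverse t)) ^ q) (z * (t ^ q + inverse t ^ q))"
      unfolding power_mult_distrib zq by (rule cg_mult_left'[OF frob, of _ _ 0]) (use unit in auto)
    have "cg (Q\<^sup>2 * (Q\<^sup>2 - 1)) (D ^ q) (Z1 ^ q - (z * (t + inverse t)) ^ q)"
      by (rule cg_mono[OF 1 Q_ineqs(6)])
    also have "cg (Q\<^sup>2 * (Q\<^sup>2 - 1)) \<dots> (A - z * (t ^ q + inverse t ^ q))"
      by (intro cg_diff Zq cg_mono[OF 2 Q_ineqs(6)])
    also have "A - z * (t ^ q + inverse t ^ q) = (m - z) * t ^ q"
      by (simp add: A_def algebra_simps power_inverse)
    finally show ?thesis .
  qed
  have vtq: "v (t ^ q) = 0" by (rule v_power_0[OF vt])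
  have "ge (Q * (Q - 1)\<^sup>2) ((m - z) * t ^ q)"
    by (rule ge_mult_left) (use mz1 ge_unit[OF vtq] in \<open>auto simp: cg_def\<close>)
  then have "ge (Q * (Q - 1)\<^sup>2) (D ^ q)" by (rule cg_ge[OF cg_mono[OF Dq Q_ineqs(1)]])
  then have iD: "ge ((Q - 1)\<^sup>2) D" by (rule ge_root[rotated]) (use q3 in simp)
  have vgt: "v (?g * t) = ereal ((Q - 1)\<^sup>2)" using vg vt by (simp add: v_mult)
  show iZ2: "ge 0 Z2" unfolding Z2 D_def[symmetric] using ge_divide[OF iD vgt] by simp
  have D_eq: "D = ?g * t * Z2" unfolding Z2 D_def[symmetric] using t0 by simp
  then show "Z1 = z * (t + inverse t) + ?g * t * Z2" by (simp add: D_def algebra_simps)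
  show "cg (Q * (Q - 1)\<^sup>2) (Z2 ^ q) Z1"
  proof (rule cg_cancel')
    show "v (?K * t ^ q) = ereal (Q * (Q - 1)\<^sup>2)" using vK vtq by (simp add: v_mult)
    have "D ^ q = (?K * t ^ q) * Z2 ^ q" unfolding D_eq power_mult_distrib gq by simp
    then have "cg (2 * Q * (Q - 1)\<^sup>2) ((?K * t ^ q) * Z2 ^ q) ((m - z) * t ^ q)"
      using cg_mono[OF Dq Q_ineqs(2)] by simp
    also have "(m - z) * t ^ q = (?K * t ^ q) * Z1 + z * (\<theta> - 1) * t ^ q"
      unfolding mz' by (simp add: algebra_simps)
    also have "cg (2 * Q * (Q - 1)\<^sup>2) \<dots> ((?K * t ^ q) * Z1)"
      by (rule cg_drop, rule ge_mult_left[OF z\<theta> ge_unit[OF vtq]])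
    finally show "cg (2 * Q * (Q - 1)\<^sup>2) ((?K * t ^ q) * Z2 ^ q) ((?K * t ^ q) * Z1)" .
    show "Q * (Q - 1)\<^sup>2 \<le> 2 * Q * (Q - 1)\<^sup>2 - Q * (Q - 1)\<^sup>2" by simp
  qed
qed

text \<open>a is a root of the monic polynomial T^q - bT - (a^q - ab) with integral
  coefficients.\<close>

lemma integral_root: assumes "ge 0 b" "ge 0 (a ^ q - a * b)" shows "ge 0 a"
proof (rule ccontr)
  assume neg: "\<not> ge 0 a"
  then have "a \<noteq> 0" by auto
  then obtain s where s: "v a = ereal s" by (rule v_real)
  then have s0: "s < 0" using neg by simp
  have "ge s (a ^ q - a * b + a * b)"
    by (rule ge_add) (use s s0 assms in \<open>auto intro: ge_mult_left ge_mono[OF assms(2)]\<close>)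
  then have "s \<le> Q * s" using v_power[OF s, of q] by simp
  then have "0 \<le> (Q - 1) * s" by (simp add: algebra_simps)
  then show False using s0 Q3 by (simp add: zero_le_mult_iff)
qed

text \<open>h^q has valuation at least 3e because q is at least 3. The first q-th power reaches the
  bound, the second preserves it.\<close>

lemma near_unit_power:
  assumes h: "ge e h" "0 \<le> e" "3 * e \<le> VP"
    shows "cg (3 * e) ((1 + h) ^ (q\<^sup>2)) 1"
proof -
  have h0: "ge 0 h" by (rule ge_mono[OF h(1,2)])
  have "cg (3 * e) ((1 + h) ^ q) (1 ^ q + h ^ q)" by (rule cg_mono[OF frob[OF ge_one h0] h(3)])
  also have "cg (3 * e) (1 ^ q + h ^ q) 1"
  proof -
    have "3 * e \<le> Q * e" using Q3 h(2) by (rule mult_right_mono)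
    from ge_mono[OF ge_power[OF h(1)] this] show ?thesis by (simp add: cg_def)
  qed
  finally have "cg (3 * e) (((1 + h) ^ q) ^ q) (1 ^ q)"
    by (intro cg_power ge_power0 ge_add ge_one h0)
  then show ?thesis by (simp add: power2_eq_square power_mult)
qed

lemma e2_bounds: "0 \<le> Q * (Q - 1) / 2" "1 \<le> Q * (Q - 1) / 2" "3 * (Q * (Q - 1) / 2) \<le> VP"
  "3 * (Q * (Q - 1) / 2) \<le> Q * (Q - 1)\<^sup>2"
proof -
  have "3 * 2 \<le> Q * (Q - 1)" using Q3 by (intro mult_mono) auto
  then show "0 \<le> Q * (Q - 1) / 2" "1 \<le> Q * (Q - 1) / 2" by auto
  show "3 * (Q * (Q - 1) / 2) \<le> VP" "3 * (Q * (Q - 1) / 2) \<le> Q * (Q - 1)\<^sup>2"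
    using Q_ineqs(8,9) by (auto simp: mult.assoc)
qed

text \<open>With Z2 = z\<delta> + W the relation between Z2^q and Z1 reads, up to the error,
  z\<delta>^q + W^q = z(r^2t + 1/t) + \<gamma>^(1/q^2)tW. The function r^2t + 1/t has at t0 =
  \<iota>/r a critical point with value 2\<iota>r = \<delta>^q; \<delta> and y0 are chosen for this.
  Only the square of h = (y - y0)/y0 survives, and w and w1 normalize W^q, the term linear in W and
  this square to a^q, a and s^2. All this is done modulo 3e with e the valuation of w1, because the
  division by w^q costs 2e.\<close>

lemma curve_equation:
  assumes vy: "v y = 0" and vz: "v z = 0" and zq: "z ^ q = z"
    and iZ2: "ge 0 Z2" and Zq: "cg (Q * (Q - 1)\<^sup>2) (Z2 ^ q) Z1" and t: "t = y ^ (q\<^sup>2 - 1)"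
    and Z12: "Z1 = z * (t + inverse t) + k ^ ((q - 1)\<^sup>2) * t * Z2"
    and \<iota>: "\<iota>\<^sup>2 = 1" and vr: "v r = 0" and r: "r\<^sup>2 = 1 + k ^ ((q - 1)\<^sup>2) * \<delta>" and \<delta>: "\<delta> ^ q = 2 * \<iota> * r"
    and vy0: "v y0 = 0" and y0: "y0 ^ (q\<^sup>2 - 1) = \<iota> * inverse r"
    and w: "w = y0 ^ (q + 1) * k ^ (q - 1)"
    and w1: "y0 ^ (q\<^sup>2 - 3) * (z + k ^ ((q - 1)\<^sup>2) * (z * \<delta>)) * w1\<^sup>2 = w ^ q"
    and yy: "ge (Q * (Q - 1) / 2) (y - y0)"
    and a: "a = (Z2 - z * \<delta>) / w" and s: "s = (y - y0) / w1"
  shows "v w = ereal (Q - 1)" "v w1 = ereal (Q * (Q - 1) / 2)" "ge 0 \<delta>"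
    "cg (Q * (Q - 1) / 2) t (y0 ^ (q\<^sup>2 - 1))"
    "ge 0 a" "ge 0 s" "cg (Q * (Q - 1) / 2) (a ^ q - a) (s\<^sup>2)"
proof -
  let ?g = "k ^ ((q - 1)\<^sup>2)" and ?e = "Q * (Q - 1) / 2"
  let ?R = "3 * ?e"
  have eR: "?e \<le> ?R" "2 * ?e \<le> ?R" using e2_bounds by auto
  have v\<iota>: "v \<iota> = 0" by (rule v_unit_root[of 2]) (simp_all add: \<iota>)
  have r0: "r \<noteq> 0" and \<iota>0: "\<iota> \<noteq> 0" and y00: "y0 \<noteq> 0" and yn0: "y \<noteq> 0" and z0: "z \<noteq> 0"
    using vr v\<iota> vy0 vy vz by auto
  have i2: "ge 0 (2 :: 'c)" using ge_of_nat[of 2] by simp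
  show i\<delta>: "ge 0 \<delta>"
    by (rule ge_root[of q]) (use q3 \<delta> ge_mult_left[OF ge_mult_left[OF i2 ge_unit[OF v\<iota>]] ge_unit[OF vr]] in auto)
  define t0 where "t0 = \<iota> * inverse r"
  have vt0: "v t0 = 0" unfolding t0_def by (intro v_mult_0 v\<iota> v_inverse_0 vr)
  have vt: "v t = 0" unfolding t by (rule v_power_0[OF vy])
  have tn: "t \<noteq> 0" "t0 \<noteq> 0" using vt vt0 by auto
  have \<iota>i: "inverse \<iota> = \<iota>" by (rule inverse_unique) (use \<iota> in \<open>simp add: power2_eq_square\<close>)
  have t0i: "inverse t0 = \<iota> * r" by (simp add: t0_def \<iota>i)
  have t0r: "t0 * r\<^sup>2 = \<iota> * r" using r0 by (simp add: t0_def power2_eq_square)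
  show vw: "v w = ereal (Q - 1)" unfolding w using v_power_0[OF vy0, of "q + 1"] by (simp add: v_mult v_kpow)
  have w0: "w \<noteq> 0" using vw by auto
  have vwq: "v (w ^ q) = ereal (2 * ?e)" using v_power[OF vw, of q] by simp
  have q23: "q\<^sup>2 - 3 + 2 = q\<^sup>2 - 1" "1 \<le> q\<^sup>2"
  proof -
    have "3 * 3 \<le> q * q" using q3 by (intro mult_le_mono)
    then have "9 \<le> q\<^sup>2" by (simp add: power2_eq_square)
    then show "q\<^sup>2 - 3 + 2 = q\<^sup>2 - 1" "1 \<le> q\<^sup>2" by arith+
  qed
  have yq23: "y0 ^ (q\<^sup>2 - 3) * y0\<^sup>2 = t0" unfolding power_add[symmetric] q23(1) y0 t0_def ..
  have zr: "z + ?g * (z * \<delta>) = z * r\<^sup>2" unfolding r by (simp add: algebra_simps)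
  have w1': "(y0 ^ (q\<^sup>2 - 3) * (z * r\<^sup>2)) * w1\<^sup>2 = w ^ q" using w1 unfolding zr .
  have "v (w1\<^sup>2) = ereal (2 * ?e)"
  proof -
    have "v (y0 ^ (q\<^sup>2 - 3) * (z * r\<^sup>2)) = 0" by (intro v_mult_0 v_power_0 vy0 vz vr)
    then show ?thesis using vwq unfolding w1'[symmetric] by (simp add: v_mult)
  qed
  then show vw1: "v w1 = ereal ?e" using v_root[of 2 w1 ?e] by simp
  have w10: "w1 \<noteq> 0" using vw1 by auto
  show i_s: "ge 0 s" unfolding s using ge_divide[OF yy vw1] by simp
  define h where "h = (y - y0) / y0"
  have h: "ge ?e h" unfolding h_def using ge_divide[OF yy, of y0 0] vy0 by (simp add: zero_ereal_def)
  have h0: "ge 0 h" by (rule ge_mono[OF h e2_bounds(1)])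
  have yh: "y = y0 * (1 + h)" using y00 by (simp add: h_def field_simps)
  have vh: "v (1 + h) = 0"
    using v_add_dominant[of 1 0 ?e h] h e2_bounds(2) by (simp add: zero_ereal_def)
  have h1: "1 + h \<noteq> 0" using vh by auto
  define i where "i = inverse (1 + h)"
  have vi: "v i = 0" unfolding i_def by (rule v_inverse_0[OF vh])
  have hi: "i * (1 + h) = 1" using h1 by (simp add: i_def)
  \<comment> \<open>t = t0(1 + h)^(q^2-1), and (1 + h)^(q^2) is 1 up to the error, so t behaves like
    t0/(1 + h).\<close>
  have "t * (1 + h) = t0 * (1 + h) ^ (q\<^sup>2)"
  proof -
    have "(1 + h) ^ (q\<^sup>2 - 1 + 1) = (1 + h) ^ (q\<^sup>2 - 1) * (1 + h)" by simp
    moreover have "q\<^sup>2 - 1 + 1 = q\<^sup>2" using q23(2) by (rule le_add_diff_inverse2)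
    ultimately have "(1 + h) ^ (q\<^sup>2) = (1 + h) ^ (q\<^sup>2 - 1) * (1 + h)" by (simp only:)
    then show ?thesis unfolding t yh power_mult_distrib y0 t0_def by simp
  qed
  also have "cg ?R (t0 * (1 + h) ^ (q\<^sup>2)) (t0 * 1)"
    by (rule cg_mult_left'[OF near_unit_power[OF h e2_bounds(1,3)] ge_unit[OF vt0]]) simp
  finally have "cg ?R (i * (t * (1 + h))) (i * (t0 * 1))"
    by (rule cg_mult_left'[OF _ ge_unit[OF vi]]) simp
  moreover have "i * (t * (1 + h)) = t" using hi by (simp add: mult.left_commute)
  ultimately have tR: "cg ?R t (t0 * i)" by (simp add: mult.commute)
  have vti: "v (t0 * i) = 0" by (intro v_mult_0 vt0 vi)
  have itR: "cg ?R (inverse t) (\<iota> * r * (1 + h))"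
    using cg_inverse[OF tR vt vti] by (simp add: t0i i_def)
  have iR: "cg ?R i (1 - h + h\<^sup>2)"
  proof -
    have "(1 - h + h\<^sup>2) * (1 + h) = 1 + h ^ 3" by (simp add: algebra_simps power2_eq_square power3_eq_cube)
    then have "i - (1 - h + h\<^sup>2) = - (h ^ 3 * i)"
    proof -
      have "(i - (1 - h + h\<^sup>2)) * (1 + h) = - (h ^ 3 * i) * (1 + h)"
        using hi \<open>(1 - h + h\<^sup>2) * (1 + h) = 1 + h ^ 3\<close>
        by (simp add: left_diff_distrib mult.assoc)
      then show ?thesis by (rule mult_right_cancel[OF h1, THEN iffD1])
    qed
    moreover have "ge ?R (h ^ 3 * i)" by (rule ge_mult_left) (use ge_power[OF h, of 3] ge_unit[OF vi] in auto)
    ultimately show ?thesis by (simp add: cg_def)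
  qed
  have tR': "cg ?R t (t0 * (1 - h + h\<^sup>2))"
    by (rule cg_trans[OF tR cg_mult_left'[OF iR ge_unit[OF vt0]]]) simp
  have te: "cg ?e t t0"
  proof (rule cg_trans[OF cg_mono[OF tR' eR(1)]])
    have "cg ?e (t0 * (1 + (h\<^sup>2 - h))) (t0 * 1)"
      by (rule cg_mult_left'[of ?e _ _ 0])
         (use vt0 e2_bounds(1) h in \<open>auto intro!: cg_drop ge_diff ge_power_le simp: zero_ereal_def\<close>)
    then show "cg ?e (t0 * (1 - h + h\<^sup>2)) t0" by (simp add: algebra_simps)
  qed
  then show "cg ?e t (y0 ^ (q\<^sup>2 - 1))" by (simp only: y0 t0_def)
  define W where "W = Z2 - z * \<delta>"
  have iz\<delta>: "ge 0 (z * \<delta>)" by (intro ge_mult_left ge_unit[OF vz] i\<delta>)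
  have iW: "ge 0 W" unfolding W_def by (intro ge_diff iZ2 iz\<delta>)
  have Wa: "W = w * a" unfolding a W_def using w0 by simp
  have "cg ?R (Z2 ^ q) (z * \<iota> * r * (2 + h\<^sup>2) + ?g * t * W)"
  proof -
    \<comment> \<open>The terms linear in h cancel because t0 r^2 and 1/t0 are both
      \<iota>r.\<close>
    have "cg ?R (t * r\<^sup>2 + inverse t) ((t0 * (1 - h + h\<^sup>2)) * r\<^sup>2 + \<iota> * r * (1 + h))"
    proof (rule cg_add[OF _ itR])
      have "cg ?R (r\<^sup>2 * t) (r\<^sup>2 * (t0 * (1 - h + h\<^sup>2)))"
        by (rule cg_mult_left'[OF tR' ge_unit[OF v_power_0[OF vr]]]) simp
      then show "cg ?R (t * r\<^sup>2) ((t0 * (1 - h + h\<^sup>2)) * r\<^sup>2)" by (simp add: mult.commute)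
    qed
    also have "(t0 * (1 - h + h\<^sup>2)) * r\<^sup>2 + \<iota> * r * (1 + h) = \<iota> * r * (2 + h\<^sup>2)"
    proof -
      have "(t0 * (1 - h + h\<^sup>2)) * r\<^sup>2 = (t0 * r\<^sup>2) * (1 - h + h\<^sup>2)" by (simp add: mult_ac)
      then show ?thesis unfolding t0r by (simp add: algebra_simps)
    qed
    finally have "cg ?R (z * (t * r\<^sup>2 + inverse t)) (z * (\<iota> * r * (2 + h\<^sup>2)))"
      by (rule cg_mult_left'[OF _ ge_unit[OF vz]]) simp
    then have "cg ?R (z * (t * r\<^sup>2 + inverse t) + ?g * t * W) (z * (\<iota> * r * (2 + h\<^sup>2)) + ?g * t * W)"
      by (intro cg_add cg_refl)
    moreover have "z * (t * r\<^sup>2 + inverse t) + ?g * t * W = Z1"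
      unfolding Z12 W_def r by (simp add: algebra_simps)
    ultimately show ?thesis using cg_trans[OF cg_mono[OF Zq e2_bounds(4)]] by (simp add: mult.assoc)
  qed
  moreover have "cg ?R (Z2 ^ q) (z * (2 * \<iota> * r) + W ^ q)"
  proof -
    have "cg VP ((z * \<delta> + W) ^ q) ((z * \<delta>) ^ q + W ^ q)" by (rule frob[OF iz\<delta> iW])
    then show ?thesis using cg_mono[OF _ e2_bounds(3)] by (simp add: W_def power_mult_distrib zq \<delta>)
  qed
  ultimately have "cg ?R (z * (2 * \<iota> * r) + W ^ q) (z * \<iota> * r * (2 + h\<^sup>2) + ?g * t * W)"
    by (rule cg_trans[OF cg_sym, rotated])
  then have WR: "cg ?R (W ^ q) (z * \<iota> * r * h\<^sup>2 + ?g * t * W)" by (simp add: cg_def algebra_simps)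
  have hs: "z * \<iota> * r * h\<^sup>2 = w ^ q * s\<^sup>2"
  proof -
    have "w ^ q * s\<^sup>2 = y0 ^ (q\<^sup>2 - 3) * (z * r\<^sup>2) * (w1 * s)\<^sup>2" unfolding w1'[symmetric] by (simp add: power_mult_distrib)
    also have "w1 * s = y0 * h" using w10 y00 by (simp add: s h_def)
    also have "y0 ^ (q\<^sup>2 - 3) * (z * r\<^sup>2) * (y0 * h)\<^sup>2 = (y0 ^ (q\<^sup>2 - 3) * y0\<^sup>2) * r\<^sup>2 * z * h\<^sup>2"
      by (simp add: power_mult_distrib mult_ac)
    also have "\<dots> = z * \<iota> * r * h\<^sup>2" unfolding yq23 t0r by (simp add: mult_ac)
    finally show ?thesis ..
  qed
  \<comment> \<open>Since w^(q-1) is \<gamma>^(1/q^2)t0, the term linear in W becomes w^q a up to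
    the factor \<tau> = t/t0, which is close to 1.\<close>
  have wq1: "w ^ q = ?g * t0 * w"
  proof -
    have "w ^ (q - 1) = y0 ^ ((q + 1) * (q - 1)) * ?g"
      unfolding w power_mult_distrib power2_eq_square by (simp only: power_mult)
    moreover have "(q + 1) * (q - 1) = q\<^sup>2 - 1" by (simp add: power2_eq_square algebra_simps)
    ultimately have "w ^ (q - 1) = t0 * ?g" by (simp only: y0 t0_def)
    moreover have "w ^ q = w ^ (q - 1) * w" using q3 by (intro power_minus_mult[symmetric]) simp
    ultimately show ?thesis by (simp add: mult_ac)
  qed
  define \<tau> where "\<tau> = t * inverse t0"
  have it0: "ge 0 (inverse t0)" by (rule ge_unit[OF v_inverse_0[OF vt0]])
  have "cg ?e (inverse t0 * t) (inverse t0 * t0)"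
    by (rule cg_mult_left'[OF te it0]) simp
  then have \<tau>1: "cg ?e \<tau> 1" using tn by (simp add: \<tau>_def mult.commute)
  have i\<tau>: "ge 0 \<tau>" unfolding \<tau>_def by (intro ge_mult_left ge_unit[OF vt] it0)
  have gW: "?g * t * W = w ^ q * (a * \<tau>)"
    unfolding Wa wq1 \<tau>_def using tn by (simp add: field_simps)
  have "cg ?R (w ^ q * a ^ q) (w ^ q * (s\<^sup>2 + a * \<tau>))"
    using WR unfolding gW hs unfolding Wa by (simp add: power_mult_distrib algebra_simps)
  then have main: "cg ?e (a ^ q) (s\<^sup>2 + a * \<tau>)"
    by (rule cg_cancel'[OF vwq]) simp
  \<comment> \<open>Integrality of a comes first: only then may \<tau> be replaced by 1 in the
    product with a.\<close>
  have "cg 0 (a ^ q - a * \<tau>) (s\<^sup>2)" using cg_mono[OF main e2_bounds(1)] by (simp add: cg_def algebra_simps)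
  then have "ge 0 (a ^ q - a * \<tau>)" by (rule cg_ge) (rule ge_power0[OF i_s])
  then show ia: "ge 0 a" by (rule integral_root[OF i\<tau>])
  have "cg ?e (a ^ q - a) (s\<^sup>2 + a * \<tau> - a)" by (intro cg_diff main cg_refl)
  also have "cg ?e (s\<^sup>2 + a * \<tau> - a) (s\<^sup>2 + a * 1 - a)"
    by (intro cg_diff cg_add cg_refl cg_mult_left'[OF \<tau>1 ia]) simp
  finally show "cg ?e (a ^ q - a) (s\<^sup>2)" by simp
qed

lemma cg_pow_q:
  assumes "cg r x y" "ge 0 y" "0 \<le> r" "s \<le> VP" "s \<le> Q * r" shows "cg s (x ^ q) (y ^ q)"
proof -
  have d: "ge r (x - y)" using assms(1) by (simp add: cg_def)
  have "cg VP ((y + (x - y)) ^ q) (y ^ q + (x - y) ^ q)" by (rule frob[OF assms(2) ge_mono[OF d assms(3)]])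
  then have "cg s (x ^ q) (y ^ q + (x - y) ^ q)" using cg_mono[OF _ assms(4)] by simp
  also have "cg s (y ^ q + (x - y) ^ q) (y ^ q)" by (rule cg_drop, rule ge_mono[OF ge_power[OF d] assms(5)])
  finally show ?thesis .
qed

lemma frob3:
  assumes "ge 0 a" "ge 0 b" "ge 0 c" shows "cg VP ((a + b + c) ^ q) (a ^ q + b ^ q + c ^ q)"
proof -
  have "cg VP ((a + b + c) ^ q) ((a + b) ^ q + c ^ q)" by (intro frob ge_add assms)
  also have "cg VP ((a + b) ^ q + c ^ q) (a ^ q + b ^ q + c ^ q)" by (intro cg_add cg_refl frob assms)
  finally show ?thesis .
qed

text \<open>The budget of accuracies for the action: Q^4 - Q^2 + 1 for x', Q^3 - Q + 1 for y',
  2Q^3(Q-1) + 1 for the function defining the component and Q^2(Q-1) + 1 for xy^q. Each is one more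
  than the size of the last term kept.\<close>

lemma exponent_bounds:
  "Q ^ 4 - Q\<^sup>2 + 1 \<le> VP" "Q ^ 4 - Q\<^sup>2 + 1 \<le> Q * (Q ^ 3 - Q + 1)"
  "2 * Q ^ 3 * (Q - 1) + 1 \<le> VP" "2 * Q ^ 3 * (Q - 1) + 1 \<le> Q * (Q ^ 4 - Q\<^sup>2 + 1)"
  "2 * Q ^ 3 * (Q - 1) + 1 \<le> Q ^ 3 * (Q - 1) * (Q + 1)"
  "Q ^ 4 - Q\<^sup>2 + 1 \<le> Q * (Q ^ 3 * (Q - 1))" "Q ^ 3 * (Q - 1) \<le> 2 * Q ^ 3 * (Q - 1) + 1"
  "2 * Q ^ 3 * (Q - 1) + 1 \<le> Q ^ 3 * (Q - 1) + Q ^ 3 * (Q - 1)\<^sup>2" "Q ^ 3 * (Q - 1)\<^sup>2 \<le> VP"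
  "Q\<^sup>2 * (Q - 1) + 1 \<le> Q ^ 4 - Q\<^sup>2 + 1" "Q\<^sup>2 * (Q - 1) + 1 \<le> Q\<^sup>2 * (Q - 1) * (Q + 1)"
  "Q\<^sup>2 * (Q - 1) + 1 \<le> 2 * (Q\<^sup>2 * (Q - 1))" "0 \<le> Q ^ 4 - Q\<^sup>2 + 1" "0 \<le> Q ^ 3 - Q + 1"
  "Q * (Q - 1) \<le> Q ^ 3 - Q + 1" "Q * (Q - 1) \<le> Q * (Q - 1) * (Q + 1)" "Q \<le> Q * (Q - 1)"
  "1 \<le> Q * (Q - 1)\<^sup>2" "1 \<le> Q ^ 3 * (Q - 1)\<^sup>2" "0 \<le> Q\<^sup>2 * (Q - 1)\<^sup>2" "0 \<le> Q ^ 3 * (Q - 1)"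
  "0 \<le> 2 * Q ^ 3 * (Q - 1)" "1 \<le> Q ^ 4 - Q\<^sup>2 + 1" "1 \<le> Q\<^sup>2 * (Q - 1)" "1 \<le> Q\<^sup>2 * (Q - 1) * (Q + 1)"
proof -
  define R where "R = Q - 3"
  have R: "Q = R + 3" "0 \<le> R" using Q3 by (auto simp: R_def)
  note simps = R(1) power2_eq_square power3_eq_cube power4_eq_xxxx algebra_simps
  have nn: "0 \<le> R * R" "0 \<le> R * (R * R)" "0 \<le> R * (R * (R * R))" "0 \<le> R * (R * (R * (R * R)))" using R(2) by auto
  show
  "Q ^ 4 - Q\<^sup>2 + 1 \<le> VP" "Q ^ 4 - Q\<^sup>2 + 1 \<le> Q * (Q ^ 3 - Q + 1)"
  "2 * Q ^ 3 * (Q - 1) + 1 \<le> VP" "2 * Q ^ 3 * (Q - 1) + 1 \<le> Q * (Q ^ 4 - Q\<^sup>2 + 1)"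
  "2 * Q ^ 3 * (Q - 1) + 1 \<le> Q ^ 3 * (Q - 1) * (Q + 1)"
  "Q ^ 4 - Q\<^sup>2 + 1 \<le> Q * (Q ^ 3 * (Q - 1))" "Q ^ 3 * (Q - 1) \<le> 2 * Q ^ 3 * (Q - 1) + 1"
  "2 * Q ^ 3 * (Q - 1) + 1 \<le> Q ^ 3 * (Q - 1) + Q ^ 3 * (Q - 1)\<^sup>2" "Q ^ 3 * (Q - 1)\<^sup>2 \<le> VP"
  "Q\<^sup>2 * (Q - 1) + 1 \<le> Q ^ 4 - Q\<^sup>2 + 1" "Q\<^sup>2 * (Q - 1) + 1 \<le> Q\<^sup>2 * (Q - 1) * (Q + 1)"
  "Q\<^sup>2 * (Q - 1) + 1 \<le> 2 * (Q\<^sup>2 * (Q - 1))" "0 \<le> Q ^ 4 - Q\<^sup>2 + 1" "0 \<le> Q ^ 3 - Q + 1"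
  "Q * (Q - 1) \<le> Q ^ 3 - Q + 1" "Q * (Q - 1) \<le> Q * (Q - 1) * (Q + 1)" "Q \<le> Q * (Q - 1)"
  "1 \<le> Q * (Q - 1)\<^sup>2" "1 \<le> Q ^ 3 * (Q - 1)\<^sup>2" "0 \<le> Q\<^sup>2 * (Q - 1)\<^sup>2" "0 \<le> Q ^ 3 * (Q - 1)"
  "0 \<le> 2 * Q ^ 3 * (Q - 1)" "1 \<le> Q ^ 4 - Q\<^sup>2 + 1" "1 \<le> Q\<^sup>2 * (Q - 1)" "1 \<le> Q\<^sup>2 * (Q - 1) * (Q + 1)"
    using nn R(2) by (simp_all add: simps)
qed

lemma kpow_mult: "k ^ i * k ^ j = k ^ (i + j)" by (simp add: power_add)

lemma nat_exponents:
  "q\<^sup>2 * (q - 1) * q = q ^ 3 * (q - 1)"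
  "q\<^sup>2 * (q - 1)\<^sup>2 + q\<^sup>2 * (q - 1) = q ^ 3 * (q - 1)"
  "q\<^sup>2 * (q - 1)\<^sup>2 + q\<^sup>2 * (q - 1) * (q + 1) = 2 * q ^ 3 * (q - 1)"
  "q ^ 3 * (q - 1) + q ^ 3 * (q - 1) = 2 * q ^ 3 * (q - 1)"
  "q * (q - 1)\<^sup>2 + q * (q - 1) = q\<^sup>2 * (q - 1)"
  "(q - 1)\<^sup>2 + (q - 1) = q * (q - 1)"
  "q * (q\<^sup>2 - 1) + q = q ^ 3"
proof -
  obtain p where p: "q = Suc p" using q3 by (cases q) auto
  show "q\<^sup>2 * (q - 1) * q = q ^ 3 * (q - 1)"
  "q\<^sup>2 * (q - 1)\<^sup>2 + q\<^sup>2 * (q - 1) = q ^ 3 * (q - 1)"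
  "q\<^sup>2 * (q - 1)\<^sup>2 + q\<^sup>2 * (q - 1) * (q + 1) = 2 * q ^ 3 * (q - 1)"
  "q ^ 3 * (q - 1) + q ^ 3 * (q - 1) = 2 * q ^ 3 * (q - 1)"
  "q * (q - 1)\<^sup>2 + q * (q - 1) = q\<^sup>2 * (q - 1)"
  "(q - 1)\<^sup>2 + (q - 1) = q * (q - 1)"
  "q * (q\<^sup>2 - 1) + q = q ^ 3"
    unfolding p by (simp_all add: power2_eq_square power3_eq_cube algebra_simps)
qed

end

subsection \<open>The transformation of the coordinates\<close>

text \<open>One point (x, y) and its image (x', y') in normalized coordinates, linked only through
  truncated expansions; the formal group no longer occurs. The powers of k arise from the expansion
  of X_2 and Y_2 when it is divided by \<kappa>_1^(q^2) and \<kappa>_1^q.\<close>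

locale transformation = frob_valued +
  fixes a0 a1 b0 c1 d0 d1 x y x' y' z m t :: 'a
  assumes mu: "e \<in> {a0, a1, b0, c1, d0, d1} \<Longrightarrow> ge 0 e \<and> e ^ q = e"
    and va0: "v a0 = 0" and vd0: "v d0 = 0"
    and vx: "v x = 0" and vy: "v y = 0" and vz: "v z = 0" and zq: "z ^ q = z"
    and X: "cg (Q ^ 4 - Q\<^sup>2 + 1) x' (a0 * x + c1 * k ^ (q\<^sup>2 * (q - 1)) * y ^ (q\<^sup>2)
        + a1 * k ^ (q\<^sup>2 * (q - 1) * (q + 1)) * x ^ (q\<^sup>2))"
    and Y: "cg (Q ^ 3 - Q + 1) y' (d0 * y + b0 * k ^ (q * (q - 1)) * x
        + d1 * k ^ (q * (q - 1) * (q + 1)) * y ^ (q\<^sup>2))"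
    and m: "m = x * y ^ q" and t: "t = y ^ (q\<^sup>2 - 1)"
    and mz: "cg (Q * (Q - 1)\<^sup>2) m z" and mqz: "cg (Q\<^sup>2 * (Q - 1)\<^sup>2) (m ^ q) z"
begin

lemma mu_simps: "ge 0 a0" "ge 0 a1" "ge 0 b0" "ge 0 c1" "ge 0 d0" "ge 0 d1"
  "a0 ^ q = a0" "a1 ^ q = a1" "b0 ^ q = b0" "c1 ^ q = c1" "d0 ^ q = d0" "d1 ^ q = d1"
  using mu[of a0] mu[of a1] mu[of b0] mu[of c1] mu[of d0] mu[of d1] by auto

lemma units: "ge 0 x" "ge 0 y" "ge 0 z" "ge 0 (x ^ n)" "ge 0 (y ^ n)" "v (x ^ n) = 0" "v (y ^ n) = 0" "ge 0 (k ^ n)"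
  using vx vy vz by (auto intro: ge_unit v_power_0 ge_power0 ge_kpow)

abbreviation "F1 \<equiv> k ^ (q * (q - 1))"
abbreviation "F2 \<equiv> k ^ (q\<^sup>2 * (q - 1))"
abbreviation "F3 \<equiv> k ^ (q ^ 3 * (q - 1))"
abbreviation "H1 \<equiv> k ^ (q * (q - 1) * (q + 1))"
abbreviation "H2 \<equiv> k ^ (q\<^sup>2 * (q - 1) * (q + 1))"
abbreviation "H3 \<equiv> k ^ (q ^ 3 * (q - 1) * (q + 1))"
abbreviation "N \<equiv> k ^ (2 * q ^ 3 * (q - 1))"
abbreviation "\<gamma> \<equiv> k ^ (q\<^sup>2 * (q - 1)\<^sup>2)"

lemma k_simps: "F1 ^ q = F2" "F2 ^ q = F3" "H1 ^ q = H2" "H2 ^ q = H3"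
  "\<gamma> * F2 = F3" "\<gamma> * H2 = N" "F3 * F3 = N"
proof -
  show "F1 ^ q = F2" "F2 ^ q = F3" "H1 ^ q = H2" "H2 ^ q = H3"
    by (simp_all flip: power_mult) (simp_all add: power2_eq_square power3_eq_cube algebra_simps)
  show "\<gamma> * F2 = F3" "\<gamma> * H2 = N" "F3 * F3 = N" unfolding kpow_mult nat_exponents by (rule refl)+
qed

lemma power_q_q: "((w :: 'a) ^ q) ^ q = w ^ (q\<^sup>2)" "(w ^ (q\<^sup>2)) ^ q = w ^ (q ^ 3)"
  by (simp_all add: power2_eq_square power3_eq_cube mult_ac flip: power_mult)

section \<open>Frobenius powers of the expansions of x' and y'\<close>

lemma Yq: "cg (Q ^ 4 - Q\<^sup>2 + 1) (y' ^ q) (d0 * y ^ q + b0 * F2 * x ^ q + d1 * H2 * y ^ (q ^ 3))"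
proof -
  have i: "ge 0 (d0 * y)" "ge 0 (b0 * F1 * x)" "ge 0 (d1 * H1 * y ^ (q\<^sup>2))"
    by (intro ge_mult_left mu_simps units)+
  have "cg (Q ^ 4 - Q\<^sup>2 + 1) (y' ^ q) ((d0 * y + b0 * F1 * x + d1 * H1 * y ^ (q\<^sup>2)) ^ q)"
    by (rule cg_pow_q[OF Y _ exponent_bounds(14,1,2)]) (intro ge_add i)
  also have "cg (Q ^ 4 - Q\<^sup>2 + 1) \<dots> ((d0 * y) ^ q + (b0 * F1 * x) ^ q + (d1 * H1 * y ^ (q\<^sup>2)) ^ q)"
    by (rule cg_mono[OF frob3[OF i] exponent_bounds(1)])
  finally show ?thesis by (simp only: power_mult_distrib mu_simps k_simps power_q_q)
qed

lemma iy': "ge 0 (y' ^ q)"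
  by (rule cg_ge'[OF Yq _ exponent_bounds(13)]) (intro ge_add ge_mult_left mu_simps units)

text \<open>Each q-th power multiplies the exponents of k by q. The term with \<open>d1\<close>
  passes the accuracy here, the term with \<open>b0\<close> only in \<open>Yqqq\<close>.\<close>

lemma Yqq: "cg (2 * Q ^ 3 * (Q - 1) + 1) (y' ^ (q\<^sup>2)) (d0 * y ^ (q\<^sup>2) + b0 * F3 * x ^ (q\<^sup>2))"
proof -
  let ?R = "2 * Q ^ 3 * (Q - 1) + 1"
  have i: "ge 0 (d0 * y ^ q)" "ge 0 (b0 * F2 * x ^ q)" "ge 0 (d1 * H2 * y ^ (q ^ 3))"
    by (intro ge_mult_left mu_simps units)+
  have "cg ?R ((y' ^ q) ^ q) ((d0 * y ^ q + b0 * F2 * x ^ q + d1 * H2 * y ^ (q ^ 3)) ^ q)"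
    by (rule cg_pow_q[OF Yq _ exponent_bounds(13,3,4)]) (intro ge_add i)
  also have "cg ?R \<dots> ((d0 * y ^ q) ^ q + (b0 * F2 * x ^ q) ^ q + (d1 * H2 * y ^ (q ^ 3)) ^ q)"
    by (rule cg_mono[OF frob3[OF i] exponent_bounds(3)])
  also have "cg ?R \<dots> ((d0 * y ^ q) ^ q + (b0 * F2 * x ^ q) ^ q)"
  proof (rule cg_drop)
    have "ge ?R H3"
      by (rule ge_kpow) (simp only: of_nat_mult of_nat_power of_nat_add of_nat_1 real_q1 exponent_bounds(5))
    then have "ge ?R (d1 * H3 * (y ^ (q ^ 3)) ^ q)" by (intro ge_mult_left ge_mult_right mu_simps ge_power0 units)
    then show "ge ?R ((d1 * H2 * y ^ (q ^ 3)) ^ q)" by (simp only: power_mult_distrib mu_simps k_simps)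
  qed
  finally show ?thesis by (simp only: power_mult_distrib mu_simps k_simps power_q_q)
qed

lemma Yqqq: "cg (Q ^ 4 - Q\<^sup>2 + 1) (y' ^ (q ^ 3)) (d0 * y ^ (q ^ 3))"
proof -
  have "cg (Q ^ 3 * (Q - 1)) (y' ^ (q\<^sup>2)) (d0 * y ^ (q\<^sup>2) + b0 * F3 * x ^ (q\<^sup>2))"
    by (rule cg_mono[OF Yqq exponent_bounds(7)])
  also have "cg (Q ^ 3 * (Q - 1)) \<dots> (d0 * y ^ (q\<^sup>2))"
    by (rule cg_drop, intro ge_mult_left ge_mult_right mu_simps units ge_kpow) simp
  finally have "cg (Q ^ 4 - Q\<^sup>2 + 1) ((y' ^ (q\<^sup>2)) ^ q) ((d0 * y ^ (q\<^sup>2)) ^ q)"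
    by (rule cg_pow_q[OF _ _ exponent_bounds(21,1,6)]) (intro ge_mult_left mu_simps units)
  then show ?thesis by (simp only: power_mult_distrib mu_simps power_q_q)
qed

lemma Xq: "cg (2 * Q ^ 3 * (Q - 1) + 1) (x' ^ q) (a0 * x ^ q + c1 * F3 * y ^ (q ^ 3))"
proof -
  let ?R = "2 * Q ^ 3 * (Q - 1) + 1"
  have i: "ge 0 (a0 * x)" "ge 0 (c1 * F2 * y ^ (q\<^sup>2))" "ge 0 (a1 * H2 * x ^ (q\<^sup>2))"
    by (intro ge_mult_left mu_simps units)+
  have "cg ?R (x' ^ q) ((a0 * x + c1 * F2 * y ^ (q\<^sup>2) + a1 * H2 * x ^ (q\<^sup>2)) ^ q)"
    by (rule cg_pow_q[OF X _ exponent_bounds(13,3,4)]) (intro ge_add i)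
  also have "cg ?R \<dots> ((a0 * x) ^ q + (c1 * F2 * y ^ (q\<^sup>2)) ^ q + (a1 * H2 * x ^ (q\<^sup>2)) ^ q)"
    by (rule cg_mono[OF frob3[OF i] exponent_bounds(3)])
  also have "cg ?R \<dots> ((a0 * x) ^ q + (c1 * F2 * y ^ (q\<^sup>2)) ^ q)"
  proof (rule cg_drop)
    have "ge ?R H3"
      by (rule ge_kpow) (simp only: of_nat_mult of_nat_power of_nat_add of_nat_1 real_q1 exponent_bounds(5))
    then have "ge ?R (a1 * H3 * (x ^ (q\<^sup>2)) ^ q)" by (intro ge_mult_left ge_mult_right mu_simps ge_power0 units)
    then show "ge ?R ((a1 * H2 * x ^ (q\<^sup>2)) ^ q)" by (simp only: power_mult_distrib mu_simps k_simps)
  qed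
  finally show ?thesis by (simp only: power_mult_distrib mu_simps k_simps power_q_q)
qed

lemma vy3: "v (d0 * y ^ (q ^ 3)) = 0"
  by (intro v_mult_0 vd0 units)

lemma vy'3: "v (y' ^ (q ^ 3)) = 0"
  by (rule cg_unit[OF Yqqq less_le_trans[OF zero_less_one exponent_bounds(23)] vy3])

lemma vy': "v y' = 0" by (rule v_unit_root[of "q ^ 3"]) (use vy'3 q3 in auto)

lemma vx': "v x' = 0"
proof -
  have "cg 1 x' (a0 * x)"
  proof (rule cg_trans[OF cg_mono[OF X]])
    show "1 \<le> Q ^ 4 - Q\<^sup>2 + 1" using exponent_bounds(10,24) by linarith
    have "ge 1 (c1 * F2 * y ^ (q\<^sup>2) + a1 * H2 * x ^ (q\<^sup>2))"
      by (intro ge_add ge_mult_left ge_mult_right mu_simps units ge_kpow)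
         (simp_all only: of_nat_mult of_nat_power of_nat_add of_nat_1 real_q1 exponent_bounds(24,25))
    then show "cg 1 (a0 * x + c1 * F2 * y ^ (q\<^sup>2) + a1 * H2 * x ^ (q\<^sup>2)) (a0 * x)"
      by (simp add: cg_def add.assoc)
  qed
  then show ?thesis by (rule cg_unit) (auto intro: v_mult_0 va0 vx)
qed

text \<open>Expanded to one unit beyond \<open>N\<close>, the terms of size \<open>F3\<close> with
  \<open>c1\<close> cancel between the first two products. Those with \<open>b0\<close> combine to a
  multiple of x^(q^2) - z/y^(q^3), which is small because x^(q^2)y^(q^3) is the q^2-th power of m
  and so close to z. There remains \<open>N\<close> times a combination of the products c1 b0, a1 d0
  and a0 d1.\<close>

lemma calZ_transform:
  defines "C \<equiv> (x * y ^ q) ^ q - \<gamma> * (x * y ^ (q ^ 3) + z * inverse (y ^ (q * (q\<^sup>2 - 1))))"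
    and "C' \<equiv> (x' * y' ^ q) ^ q - \<gamma> * (x' * y' ^ (q ^ 3) + a0 * d0 * z * inverse (y' ^ (q * (q\<^sup>2 - 1))))"
  shows "cg (2 * Q ^ 3 * (Q - 1) + 1) C' (a0 * d0 * C + N * ((c1 * b0 - a1 * d0 - a0 * d1) * z))"
proof -
  let ?R = "2 * Q ^ 3 * (Q - 1) + 1" and ?T = "Q ^ 4 - Q\<^sup>2 + 1"
  define I where "I = inverse (y ^ (q ^ 3))"
  have y0: "y \<noteq> 0" "y' \<noteq> 0" "d0 \<noteq> 0" using vy vy' vd0 by auto
  have I: "y ^ (q ^ 3) * I = 1" unfolding I_def using y0 by simp
  have iI: "ge 0 I" unfolding I_def by (intro ge_unit v_inverse_0 units)
  define M where "M = x ^ (q\<^sup>2) * y ^ (q ^ 3)"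
  \<comment> \<open>The factor \<gamma> raises the accuracy Q^4 - Q^2 + 1 of x' and y'^q to exactly
    2Q^3(Q-1) + 1.\<close>
  have mult_\<gamma>: "cg ?R (\<gamma> * w) (\<gamma> * w')" if "cg ?T w w'" for w w'
  proof (rule cg_mult_left'[OF that])
    show "ge (Q\<^sup>2 * (Q - 1)\<^sup>2) \<gamma>" by (rule ge_kpow) simp
    show "?R \<le> Q\<^sup>2 * (Q - 1)\<^sup>2 + ?T" by (simp add: power2_eq_square power3_eq_cube power4_eq_xxxx algebra_simps)
  qed
  have inv_split: "inverse (w ^ (q * (q\<^sup>2 - 1))) = w ^ q * inverse (w ^ (q ^ 3))" if "w \<noteq> 0" for w :: 'a
    unfolding nat_exponents(7)[symmetric] power_add using that by (simp add: field_simps)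
  have 1: "cg ?R ((x' * y' ^ q) ^ q)
     (a0 * d0 * (x * y ^ q) ^ q + F3 * (c1 * d0 * y ^ (q ^ 3) * y ^ (q\<^sup>2) + a0 * b0 * x ^ q * x ^ (q\<^sup>2)) + N * (c1 * b0 * M))"
  proof -
    have "cg ?R (x' ^ q * y' ^ (q\<^sup>2)) ((a0 * x ^ q + c1 * F3 * y ^ (q ^ 3)) * (d0 * y ^ (q\<^sup>2) + b0 * F3 * x ^ (q\<^sup>2)))"
      by (intro cg_mult Xq Yqq ge_power0 ge_unit[OF vx'] ge_add ge_mult_left mu_simps units)
    also have "(a0 * x ^ q + c1 * F3 * y ^ (q ^ 3)) * (d0 * y ^ (q\<^sup>2) + b0 * F3 * x ^ (q\<^sup>2))
      = a0 * d0 * (x * y ^ q) ^ q + F3 * (c1 * d0 * y ^ (q ^ 3) * y ^ (q\<^sup>2) + a0 * b0 * x ^ q * x ^ (q\<^sup>2)) + (F3 * F3) * (c1 * b0 * M)"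
      unfolding M_def power_mult_distrib power_q_q by (simp add: algebra_simps)
    finally show ?thesis by (simp only: power_mult_distrib power_q_q k_simps)
  qed
  have 2: "cg ?R (\<gamma> * (x' * y' ^ (q ^ 3)))
     (a0 * d0 * (\<gamma> * (x * y ^ (q ^ 3))) + F3 * (c1 * d0 * y ^ (q ^ 3) * y ^ (q\<^sup>2)) + N * (a1 * d0 * M))"
  proof -
    have "cg ?R (\<gamma> * (x' * y' ^ (q ^ 3)))
       (\<gamma> * ((a0 * x + c1 * F2 * y ^ (q\<^sup>2) + a1 * H2 * x ^ (q\<^sup>2)) * (d0 * y ^ (q ^ 3))))"
      by (intro mult_\<gamma> cg_mult X Yqqq ge_unit[OF vx'] ge_mult_left mu_simps units)
    also have "\<gamma> * ((a0 * x + c1 * F2 * y ^ (q\<^sup>2) + a1 * H2 * x ^ (q\<^sup>2)) * (d0 * y ^ (q ^ 3)))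
      = a0 * d0 * (\<gamma> * (x * y ^ (q ^ 3))) + (\<gamma> * F2) * (c1 * d0 * y ^ (q ^ 3) * y ^ (q\<^sup>2)) + (\<gamma> * H2) * (a1 * d0 * M)"
      unfolding M_def by (simp add: algebra_simps)
    finally show ?thesis by (simp only: k_simps)
  qed
  have 3: "cg ?R (\<gamma> * (a0 * d0 * z * inverse (y' ^ (q * (q\<^sup>2 - 1)))))
     (a0 * d0 * (\<gamma> * (z * inverse (y ^ (q * (q\<^sup>2 - 1))))) + F3 * (a0 * b0 * x ^ q * z * I) + N * (a0 * d1 * z))"
  proof -
    have inv: "cg ?T (inverse (y' ^ (q ^ 3))) (inverse (d0 * y ^ (q ^ 3)))"
      by (rule cg_inverse[OF Yqqq vy'3 vy3])
    have "cg ?T (y' ^ q * inverse (y' ^ (q ^ 3))) ((d0 * y ^ q + b0 * F2 * x ^ q + d1 * H2 * y ^ (q ^ 3)) * inverse (d0 * y ^ (q ^ 3)))"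
      by (intro cg_mult Yq inv iy' ge_unit[OF v_inverse_0[OF vy3]])
    then have "cg ?T (a0 * d0 * z * (y' ^ q * inverse (y' ^ (q ^ 3))))
      (a0 * d0 * z * ((d0 * y ^ q + b0 * F2 * x ^ q + d1 * H2 * y ^ (q ^ 3)) * inverse (d0 * y ^ (q ^ 3))))"
      by (rule cg_mult_left'[of _ _ _ 0]) (auto intro: ge_mult_left mu_simps units)
    from mult_\<gamma>[OF this]
    have "cg ?R (\<gamma> * (a0 * d0 * z * (y' ^ q * inverse (y' ^ (q ^ 3)))))
      (\<gamma> * (a0 * d0 * z * ((d0 * y ^ q + b0 * F2 * x ^ q + d1 * H2 * y ^ (q ^ 3)) * inverse (d0 * y ^ (q ^ 3)))))" .
    also have "\<gamma> * (a0 * d0 * z * ((d0 * y ^ q + b0 * F2 * x ^ q + d1 * H2 * y ^ (q ^ 3)) * inverse (d0 * y ^ (q ^ 3))))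
      = a0 * d0 * (\<gamma> * (z * (y ^ q * I))) + (\<gamma> * F2) * (a0 * b0 * x ^ q * z * I) + (\<gamma> * H2) * (a0 * d1 * z * (y ^ (q ^ 3) * I))"
    proof -
      have d: "d0 * inverse (d0 * y ^ (q ^ 3)) = I" using y0 by (simp add: I_def)
      have e: "\<gamma> * (a0 * d0 * z * ((d0 * y ^ q + b0 * F2 * x ^ q + d1 * H2 * y ^ (q ^ 3)) * inverse (d0 * y ^ (q ^ 3))))
        = \<gamma> * (a0 * z * ((d0 * y ^ q + b0 * F2 * x ^ q + d1 * H2 * y ^ (q ^ 3)) * (d0 * inverse (d0 * y ^ (q ^ 3)))))"
        by (simp only: mult_ac)
      show ?thesis unfolding e d by (simp add: algebra_simps)
    qed
    finally show ?thesis unfolding k_simps I by (simp only: inv_split[OF y0(1)] inv_split[OF y0(2)] I_def[symmetric] mult_1_right)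
  qed
  have Mz: "cg (Q ^ 3 * (Q - 1)\<^sup>2) M z"
  proof -
    have "cg (Q ^ 3 * (Q - 1)\<^sup>2) ((m ^ q) ^ q) (z ^ q)"
      by (rule cg_pow_q[OF mqz units(3) exponent_bounds(20,9)]) (simp add: power2_eq_square power3_eq_cube)
    moreover have "(m ^ q) ^ q = M" unfolding m M_def power_mult_distrib power_q_q ..
    ultimately show ?thesis by (simp only: zq)
  qed
  have "cg ?R C' (a0 * d0 * C + F3 * (a0 * b0 * x ^ q * (x ^ (q\<^sup>2) - z * I)) + N * ((c1 * b0 - a1 * d0) * M - a0 * d1 * z))"
  proof -
    have "C' = (x' * y' ^ q) ^ q - \<gamma> * (x' * y' ^ (q ^ 3)) - \<gamma> * (a0 * d0 * z * inverse (y' ^ (q * (q\<^sup>2 - 1))))"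
      unfolding C'_def by (simp add: algebra_simps)
    also have "cg ?R \<dots>
     ((a0 * d0 * (x * y ^ q) ^ q + F3 * (c1 * d0 * y ^ (q ^ 3) * y ^ (q\<^sup>2) + a0 * b0 * x ^ q * x ^ (q\<^sup>2)) + N * (c1 * b0 * M))
      - (a0 * d0 * (\<gamma> * (x * y ^ (q ^ 3))) + F3 * (c1 * d0 * y ^ (q ^ 3) * y ^ (q\<^sup>2)) + N * (a1 * d0 * M))
      - (a0 * d0 * (\<gamma> * (z * inverse (y ^ (q * (q\<^sup>2 - 1))))) + F3 * (a0 * b0 * x ^ q * z * I) + N * (a0 * d1 * z)))"
      by (intro cg_diff 1 2 3)
    also have "\<dots> = a0 * d0 * C + F3 * (a0 * b0 * x ^ q * (x ^ (q\<^sup>2) - z * I)) + N * ((c1 * b0 - a1 * d0) * M - a0 * d1 * z)"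
      unfolding C_def by (simp only: right_diff_distrib left_diff_distrib distrib_left distrib_right) (simp add: mult_ac)
    finally show ?thesis .
  qed
  also have "cg ?R \<dots> (a0 * d0 * C + 0 + N * ((c1 * b0 - a1 * d0) * z - a0 * d1 * z))"
  proof (intro cg_add cg_refl)
    have "x ^ (q\<^sup>2) - z * I = (M - z) * I" unfolding M_def using I by (simp add: algebra_simps)
    then have e: "F3 * (a0 * b0 * x ^ q * (x ^ (q\<^sup>2) - z * I)) = F3 * ((M - z) * (a0 * b0 * x ^ q * I))" by (simp add: mult_ac)
    have "ge (Q ^ 3 * (Q - 1) + Q ^ 3 * (Q - 1)\<^sup>2) (F3 * ((M - z) * (a0 * b0 * x ^ q * I)))"
      by (intro ge_mult ge_kpow ge_mult_left mu_simps units iI) (use Mz in \<open>auto simp: cg_def\<close>)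
    then show "cg ?R (F3 * (a0 * b0 * x ^ q * (x ^ (q\<^sup>2) - z * I))) 0"
      unfolding e cg_0_iff by (rule ge_mono[OF _ exponent_bounds(8)])
    have "cg 1 ((c1 * b0 - a1 * d0) * M - a0 * d1 * z) ((c1 * b0 - a1 * d0) * z - a0 * d1 * z)"
    proof (intro cg_diff cg_refl)
      show "cg 1 ((c1 * b0 - a1 * d0) * M) ((c1 * b0 - a1 * d0) * z)"
        by (rule cg_mult_left'[OF cg_mono[OF Mz exponent_bounds(19)], of 0]) (auto intro: ge_diff ge_mult_left mu_simps)
    qed
    then show "cg ?R (N * ((c1 * b0 - a1 * d0) * M - a0 * d1 * z)) (N * ((c1 * b0 - a1 * d0) * z - a0 * d1 * z))"
      by (rule cg_mult_left'[of _ _ _ "2 * Q ^ 3 * (Q - 1)"]) (simp_all add: v_kpow)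
  qed
  finally show ?thesis by (simp add: algebra_simps)
qed

text \<open>a1 d0 + a0 d1 - b0 c1 is the coefficient of \<pi> in det g modulo \<pi>^2, so the second
  invariant of the component moves as multiplication by det g prescribes.\<close>

lemma index_transform:
  assumes H: "(x * y ^ q) ^ q - \<gamma> * (x * y ^ (q ^ 3) + z * inverse (y ^ (q * (q\<^sup>2 - 1)))) = z * \<gamma>0 - N * n"
    and n': "N * n' = a0 * d0 * z * \<gamma>0
      - ((x' * y' ^ q) ^ q - \<gamma> * (x' * y' ^ (q ^ 3) + a0 * d0 * z * inverse (y' ^ (q * (q\<^sup>2 - 1)))))"
  shows "cg 1 n' (a0 * d0 * n + (a1 * d0 + a0 * d1 - b0 * c1) * z)"
proof -
  let ?R = "2 * Q ^ 3 * (Q - 1) + 1"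
  have "cg ?R (N * n') (a0 * d0 * z * \<gamma>0 - (a0 * d0 * (z * \<gamma>0 - N * n) + N * ((c1 * b0 - a1 * d0 - a0 * d1) * z)))"
    using cg_diff[OF cg_refl calZ_transform] unfolding H n' .
  also have "a0 * d0 * z * \<gamma>0 - (a0 * d0 * (z * \<gamma>0 - N * n) + N * ((c1 * b0 - a1 * d0 - a0 * d1) * z))
    = N * (a0 * d0 * n + (a1 * d0 + a0 * d1 - b0 * c1) * z)"
    by (simp only: distrib_left distrib_right right_diff_distrib left_diff_distrib) (simp add: mult_ac)
  finally show ?thesis
    by (rule cg_cancel'[rotated, where s = "2 * Q ^ 3 * (Q - 1)"]) (simp_all add: v_kpow)
qed

section \<open>The action on xy^q, Z1, Z2 and the coordinates a and s\<close>

abbreviation "B \<equiv> c1 * d0 * y ^ (q\<^sup>2 + q) + a0 * b0 * x ^ (q + 1)"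

text \<open>\<open>B\<close> collects the two products of size \<open>F2\<close>: the c1 term of x'
  with d0 y^q, and a0 x with the b0 term of y'^q. It ends up as the translation of a.\<close>

lemma xy_transform: "cg (Q\<^sup>2 * (Q - 1) + 1) (x' * y' ^ q) (a0 * d0 * m + F2 * B)"
proof -
  let ?R = "Q\<^sup>2 * (Q - 1) + 1"
  have H2: "ge ?R H2" by (rule ge_kpow) (simp only: of_nat_mult of_nat_power of_nat_add of_nat_1 real_q1 exponent_bounds(11))
  have "cg ?R x' (a0 * x + c1 * F2 * y ^ (q\<^sup>2) + a1 * H2 * x ^ (q\<^sup>2))"
    by (rule cg_mono[OF X exponent_bounds(10)])
  also have "cg ?R \<dots> (a0 * x + c1 * F2 * y ^ (q\<^sup>2))"
    by (rule cg_drop) (intro ge_mult_left ge_mult_right mu_simps units H2)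
  finally have 1: "cg ?R x' (a0 * x + c1 * F2 * y ^ (q\<^sup>2))" .
  have "cg ?R (y' ^ q) (d0 * y ^ q + b0 * F2 * x ^ q + d1 * H2 * y ^ (q ^ 3))"
    by (rule cg_mono[OF Yq exponent_bounds(10)])
  also have "cg ?R \<dots> (d0 * y ^ q + b0 * F2 * x ^ q)"
    by (rule cg_drop) (intro ge_mult_left ge_mult_right mu_simps units H2)
  finally have 2: "cg ?R (y' ^ q) (d0 * y ^ q + b0 * F2 * x ^ q)" .
  have "cg ?R (x' * y' ^ q) ((a0 * x + c1 * F2 * y ^ (q\<^sup>2)) * (d0 * y ^ q + b0 * F2 * x ^ q))"
    by (intro cg_mult 1 2 ge_unit[OF vx'] ge_add ge_mult_left mu_simps units)
  also have "\<dots> = a0 * d0 * m + F2 * B + (F2 * F2) * (c1 * b0 * y ^ (q\<^sup>2) * x ^ q)"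
    unfolding m power_add by (simp add: algebra_simps)
  also have "cg ?R \<dots> (a0 * d0 * m + F2 * B)"
  proof (rule cg_drop)
    have "ge ?R (F2 * F2)" unfolding kpow_mult by (rule ge_kpow)
      (use exponent_bounds(12) in \<open>simp only: of_nat_mult of_nat_power of_nat_add of_nat_1 real_q1 mult_2\<close>)
    then show "ge ?R ((F2 * F2) * (c1 * b0 * y ^ (q\<^sup>2) * x ^ q))"
      by (rule ge_mult_left) (intro ge_mult_left mu_simps units)
  qed
  finally show ?thesis .
qed

lemma iB: "ge 0 B" by (intro ge_add ge_mult_left mu_simps units)

lemma xy_reduction: "cg 1 (x' * y' ^ q) (a0 * d0 * z)"
proof (rule cg_trans[OF cg_mono[OF xy_transform]])
  have F2: "ge 1 F2" by (rule ge_kpow) (simp only: of_nat_mult of_nat_power real_q1 exponent_bounds(24))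
  have "cg 1 (a0 * d0 * m + F2 * B) (a0 * d0 * m)"
    by (rule cg_drop) (intro ge_mult_left F2 iB)
  also have "cg 1 (a0 * d0 * m) (a0 * d0 * z)"
    by (rule cg_mult_left'[OF cg_mono[OF mz exponent_bounds(18)], of 0]) (auto intro: ge_mult_left mu_simps)
  finally show "cg 1 (a0 * d0 * m + F2 * B) (a0 * d0 * z)" .
qed (use exponent_bounds(24) in linarith)

lemma y_transform: "cg (Q * (Q - 1)) y' (d0 * y)"
proof (rule cg_trans[OF cg_mono[OF Y exponent_bounds(15)]])
  have "ge (Q * (Q - 1)) F1" by (rule ge_kpow) simp
  moreover have "ge (Q * (Q - 1)) H1"
    by (rule ge_kpow) (simp only: of_nat_mult of_nat_power of_nat_add of_nat_1 real_q1 exponent_bounds(16))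
  ultimately have "ge (Q * (Q - 1)) (b0 * F1 * x + d1 * H1 * y ^ (q\<^sup>2))"
    by (intro ge_add ge_mult_left ge_mult_right mu_simps units)
  then show "cg (Q * (Q - 1)) (d0 * y + b0 * F1 * x + d1 * H1 * y ^ (q\<^sup>2)) (d0 * y)"
    by (simp add: cg_def add.assoc)
qed

lemma d0_power: "d0 ^ (q\<^sup>2 - 1) = 1"
proof -
  have d: "d0 \<noteq> 0" using vd0 by auto
  have q2: "q\<^sup>2 - 1 + 1 = q\<^sup>2" by (rule le_add_diff_inverse2) (use q3 in simp)
  have "d0 ^ (q\<^sup>2 - 1) * d0 = d0 ^ (q\<^sup>2 - 1 + 1)" by simp
  also have "\<dots> = (d0 ^ q) ^ q" unfolding q2 power_q_q ..
  also have "\<dots> = 1 * d0" by (simp add: mu_simps)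
  finally show ?thesis by (rule mult_right_cancel[OF d, THEN iffD1])
qed

abbreviation "t' \<equiv> y' ^ (q\<^sup>2 - 1)"

lemma vt: "v t = 0" unfolding t by (rule units)
lemma vt': "v t' = 0" by (rule v_power_0[OF vy'])

lemma t_transform: "cg (Q * (Q - 1)) t' t"
proof -
  have "cg (Q * (Q - 1)) t' ((d0 * y) ^ (q\<^sup>2 - 1))"
    by (intro cg_power y_transform ge_unit[OF vy'] ge_mult_left mu_simps units)
  then show ?thesis by (simp only: power_mult_distrib d0_power t mult_1_left)
qed

text \<open>The subtraction of z(t + 1/t) must be accurate beyond the size Q(Q-1) of
  \<open>F1\<close>, while t' and t agree only to that size. The hypothesis \<open>tt\<close>
  supplies the missing unit: t + 1/t is stationary at 1 and -1, which is visible in the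
  factorization of the difference by (t' - t)(t't - 1).\<close>

lemma Z2_transform:
  assumes Z1: "Z1 = (m - z * \<theta>) / k ^ (q * (q - 1)\<^sup>2)"
    and Z2: "Z2 = (Z1 - z * (t + inverse t)) / (k ^ ((q - 1)\<^sup>2) * t)"
    and Z1': "Z1' = (x' * y' ^ q - a0 * d0 * z * \<theta>) / k ^ (q * (q - 1)\<^sup>2)"
    and Z2': "Z2' = (Z1' - a0 * d0 * z * (t' + inverse t')) / (k ^ ((q - 1)\<^sup>2) * t')"
    and iZ2: "ge 0 Z2" and tt: "cg 1 (t * t) 1"
  shows "cg Q Z2' (a0 * d0 * Z2 + k ^ (q - 1) * B * inverse t)"
proof -
  let ?K = "k ^ (q * (q - 1)\<^sup>2)" and ?g = "k ^ ((q - 1)\<^sup>2)" and ?R = "Q * (Q - 1) + 1"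
  have t0: "t \<noteq> 0" "t' \<noteq> 0" by (rule unit_nonzero[OF vt], rule unit_nonzero[OF vt'])
  have it: "ge 0 t" "ge 0 t'" "ge 0 (inverse t)" "ge 0 (inverse t')"
    by (rule ge_unit[OF vt], rule ge_unit[OF vt'], rule ge_unit[OF v_inverse_0[OF vt]],
        rule ge_unit[OF v_inverse_0[OF vt']])
  have q1: "1 \<le> Q * (Q - 1)" "0 \<le> Q * (Q - 1)" using e2_bounds by auto
  have F2K: "F2 = ?K * F1" unfolding kpow_mult nat_exponents ..
  have F1g: "F1 = ?g * k ^ (q - 1)" unfolding kpow_mult nat_exponents ..
  have "cg (Q\<^sup>2 * (Q - 1) + 1) (?K * Z1') (?K * (a0 * d0 * Z1 + F1 * B))"
  proof -
    have e1: "?K * Z1' = x' * y' ^ q - a0 * d0 * z * \<theta>" unfolding Z1' by simp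
    have "a0 * d0 * m + F2 * B - a0 * d0 * z * \<theta> = a0 * d0 * (m - z * \<theta>) + ?K * (F1 * B)"
      unfolding F2K by (simp only: right_diff_distrib) (simp add: mult_ac)
    also have "m - z * \<theta> = ?K * Z1" unfolding Z1 by simp
    finally have e2: "a0 * d0 * m + F2 * B - a0 * d0 * z * \<theta> = ?K * (a0 * d0 * Z1 + F1 * B)"
      by (simp only: distrib_left) (simp add: mult_ac)
    show ?thesis unfolding e1 e2[symmetric] by (intro cg_diff xy_transform cg_refl)
  qed
  then have Z: "cg ?R Z1' (a0 * d0 * Z1 + F1 * B)"
  proof (rule cg_cancel'[rotated])
    show "v ?K = ereal (Q * (Q - 1)\<^sup>2)" by (simp add: v_kpow)
    show "?R \<le> Q\<^sup>2 * (Q - 1) + 1 - Q * (Q - 1)\<^sup>2" by (simp add: power2_eq_square algebra_simps)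
  qed
  have tti: "cg ?R (t' + inverse t') (t + inverse t)"
  proof -
    have "cg 1 (t' * t) (t * t)"
      by (rule cg_mult[OF cg_mono[OF t_transform q1(1)] cg_refl it(2,1)])
    then have "cg 1 (t' * t) 1" using tt by (rule cg_trans)
    then have "ge (Q * (Q - 1) + 1) ((t' - t) * (t' * t - 1) * (inverse t' * inverse t))"
      using t_transform it by (intro ge_mult_left ge_mult) (auto simp: cg_def)
    moreover have "(t' - t) * (t' * t - 1) * (inverse t' * inverse t) = t' + inverse t' - (t + inverse t)"
      using t0 by (simp add: field_simps)
    ultimately show ?thesis by (simp only: cg_def)
  qed
  have eZ1: "Z1 = z * (t + inverse t) + ?g * t * Z2" unfolding Z2 using t0 by simp
  have eZ1': "Z1' = a0 * d0 * z * (t' + inverse t') + ?g * t' * Z2'" unfolding Z2' using t0 by simp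
  have "cg ?R (?g * (t' * Z2')) (?g * (a0 * d0 * t * Z2 + k ^ (q - 1) * B))"
  proof -
    have "cg ?R (Z1' - a0 * d0 * z * (t' + inverse t')) (a0 * d0 * Z1 + F1 * B - a0 * d0 * z * (t + inverse t))"
      by (intro cg_diff Z cg_mult_left'[OF tti, of 0]) (auto intro: ge_mult_left mu_simps units)
    moreover have "a0 * d0 * Z1 + F1 * B - a0 * d0 * z * (t + inverse t) = ?g * (a0 * d0 * t * Z2 + k ^ (q - 1) * B)"
      unfolding F1g eZ1 by (simp only: distrib_left right_diff_distrib) (simp add: mult_ac)
    moreover have "Z1' - a0 * d0 * z * (t' + inverse t') = ?g * (t' * Z2')" unfolding eZ1' by (simp add: mult_ac)
    ultimately show ?thesis by (simp only:)
  qed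
  then have tZ: "cg Q (t' * Z2') (a0 * d0 * t * Z2 + k ^ (q - 1) * B)"
  proof (rule cg_cancel'[rotated])
    show "v ?g = ereal ((Q - 1)\<^sup>2)" by (simp add: v_kpow)
    show "Q \<le> ?R - (Q - 1)\<^sup>2" by (simp add: power2_eq_square algebra_simps)
  qed
  have iE: "ge 0 (a0 * d0 * t * Z2 + k ^ (q - 1) * B)" by (intro ge_add ge_mult_left mu_simps units it iZ2 iB)
  have "cg Q (inverse t' * (t' * Z2')) (inverse t' * (a0 * d0 * t * Z2 + k ^ (q - 1) * B))"
    by (rule cg_mult_left'[OF tZ it(4)]) simp
  also have "cg Q \<dots> (inverse t * (a0 * d0 * t * Z2 + k ^ (q - 1) * B))"
    by (intro cg_mult cg_refl it iE cg_mono[OF cg_inverse[OF t_transform vt' vt] exponent_bounds(17)])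
  also have "\<dots> = a0 * d0 * Z2 + k ^ (q - 1) * B * inverse t" using t0 by (simp add: field_simps)
  finally have "cg Q (inverse t' * (t' * Z2')) (a0 * d0 * Z2 + k ^ (q - 1) * B * inverse t)" .
  moreover have "inverse t' * (t' * Z2') = Z2'"
    unfolding mult.assoc[symmetric] left_inverse[OF t0(2)] by (rule mult_1_left)
  ultimately show ?thesis by (simp only:)
qed

text \<open>Z2' is known to accuracy Q and w has valuation Q - 1, so a' is known to accuracy 1. In
  \<open>B / t\<close> the element T = y0^(q^2-1) drops out because its square is close to 1, and
  x^(q+1) is expressed by y and by m^(q+1), which is close to z^(q+1) = z^2.\<close>

lemma coordinates_transform:
  assumes Z1: "Z1 = (m - z * \<theta>) / k ^ (q * (q - 1)\<^sup>2)"
    and Z2: "Z2 = (Z1 - z * (t + inverse t)) / (k ^ ((q - 1)\<^sup>2) * t)"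
    and Z1': "Z1' = (x' * y' ^ q - a0 * d0 * z * \<theta>) / k ^ (q * (q - 1)\<^sup>2)"
    and Z2': "Z2' = (Z1' - a0 * d0 * z * (t' + inverse t')) / (k ^ ((q - 1)\<^sup>2) * t')"
    and iZ2: "ge 0 Z2"
    and vy0: "v y0 = 0" and yy: "ge (Q * (Q - 1) / 2) (y - y0)"
    and ty: "cg (Q * (Q - 1) / 2) t (y0 ^ (q\<^sup>2 - 1))" and yy1: "cg 1 ((y0 ^ (q\<^sup>2 - 1))\<^sup>2) 1"
    and w: "w = y0 ^ (q + 1) * k ^ (q - 1)"
    and vw1: "v w1 = ereal (Q * (Q - 1) / 2)" and rt: "rt\<^sup>2 = a0 / d0"
  shows "cg 1 ((Z2' - a0 * d0 * z * \<delta>) / (d0\<^sup>2 * w))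
      (a0 / d0 * ((Z2 - z * \<delta>) / w + c1 / a0 + b0 / d0 * (z / y0 ^ (q + 1))\<^sup>2))"
    and "ge (Q * (Q - 1) / 2) (y' - d0 * y0)"
    and "cg 1 ((y' - d0 * y0) / (d0 * inverse rt * w1)) (rt * ((y - y0) / w1))"
proof -
  let ?e = "Q * (Q - 1) / 2"
  have e: "1 \<le> ?e" "0 \<le> ?e" using e2_bounds by auto
  have n0: "a0 \<noteq> 0" "d0 \<noteq> 0" "y0 \<noteq> 0" "y \<noteq> 0" "t \<noteq> 0" using va0 vd0 vy0 vy vt by auto
  have vw: "v w = ereal (Q - 1)" unfolding w using v_power_0[OF vy0, of "q + 1"] by (simp add: v_mult v_kpow)
  have w0: "w \<noteq> 0" using vw by auto
  have iy0: "ge 0 y0" by (rule ge_unit[OF vy0])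
  have y1: "cg 1 y y0" using yy e by (auto simp: cg_def intro: ge_mono)
  have t1: "cg 1 t (y0 ^ (q\<^sup>2 - 1))" by (rule cg_mono[OF ty e(1)])
  have vt0: "v (y0 ^ (q\<^sup>2 - 1)) = 0" by (rule v_power_0[OF vy0])
  define T where "T = y0 ^ (q\<^sup>2 - 1)"
  have iT: "ge 0 T" unfolding T_def by (rule ge_unit[OF vt0])
  have tt: "cg 1 (t * t) 1"
  proof (rule cg_trans)
    show "cg 1 (t * t) (T * T)" unfolding T_def by (intro cg_mult t1 ge_unit[OF vt] ge_unit[OF vt0])
    show "cg 1 (T * T) 1" using yy1 by (simp only: power2_eq_square T_def)
  qed
  have vd2: "v (d0\<^sup>2) = 0" by (rule v_power_0[OF vd0])
  have vdw: "v (d0\<^sup>2 * w) = ereal (Q - 1)" using vd2 vw by (simp add: v_mult)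
  have dw0: "d0\<^sup>2 * w \<noteq> 0" using n0 w0 by simp
  have "cg Q (Z2' - a0 * d0 * z * \<delta>) (a0 * d0 * Z2 + k ^ (q - 1) * B * inverse t - a0 * d0 * z * \<delta>)"
    by (intro cg_diff cg_refl Z2_transform[OF Z1 Z2 Z1' Z2' iZ2 tt])
  then have "cg Q (d0\<^sup>2 * w * ((Z2' - a0 * d0 * z * \<delta>) / (d0\<^sup>2 * w)))
     (d0\<^sup>2 * w * ((a0 * d0 * Z2 + k ^ (q - 1) * B * inverse t - a0 * d0 * z * \<delta>) / (d0\<^sup>2 * w)))"
    using dw0 by simp
  then have A: "cg 1 ((Z2' - a0 * d0 * z * \<delta>) / (d0\<^sup>2 * w))
     ((a0 * d0 * Z2 + k ^ (q - 1) * B * inverse t - a0 * d0 * z * \<delta>) / (d0\<^sup>2 * w))"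
    by (rule cg_cancel'[OF vdw]) simp
  let ?J = "inverse (d0\<^sup>2 * y0 ^ (q + 1))"
  have vJ: "v ?J = 0" by (intro v_inverse_0 v_mult_0 vd2 v_power_0 vy0)
  have iJ: "ge 0 ?J" by (rule ge_unit[OF vJ])
  have split: "(a0 * d0 * Z2 + k ^ (q - 1) * B * inverse t - a0 * d0 * z * \<delta>) / (d0\<^sup>2 * w)
      = a0 / d0 * ((Z2 - z * \<delta>) / w) + B * inverse t * ?J"
  proof -
    have "k ^ (q - 1) * B * inverse t / (d0\<^sup>2 * w) = B * inverse t * ?J"
      unfolding w by (simp add: divide_inverse mult_ac del: power_Suc)
    moreover have "(a0 * d0 * Z2 - a0 * d0 * z * \<delta>) / (d0\<^sup>2 * w) = a0 / d0 * ((Z2 - z * \<delta>) / w)"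
      using n0 w0 by (simp add: field_simps power2_eq_square)
    ultimately show ?thesis by (simp add: add_divide_distrib diff_divide_distrib)
  qed
  have nexp: "q\<^sup>2 + q = (q\<^sup>2 - 1) + (q + 1)" using q3 by simp
  define P where "P = y0 ^ (q + 1)"
  have iP: "ge 0 P" "v P = 0" unfolding P_def by (rule ge_unit[OF v_power_0[OF vy0]], rule v_power_0[OF vy0])
  have P0: "P \<noteq> 0" "T \<noteq> 0" by (rule unit_nonzero[OF iP(2)], rule unit_nonzero[OF vt0[folded T_def]])
  have yE: "cg 1 (y ^ (q\<^sup>2 + q)) (T * P)"
    unfolding T_def P_def power_add[symmetric] nexp[symmetric] by (intro cg_power y1 units iy0)
  have vTP: "v (T * P) = 0" unfolding T_def by (intro v_mult_0 vt0 iP)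
  have xE: "cg 1 (x ^ (q + 1)) (z\<^sup>2 * inverse (T * P))"
  proof -
    have "m ^ (q + 1) = x ^ (q + 1) * y ^ (q\<^sup>2 + q)"
      unfolding m power_mult_distrib by (simp add: power_add power2_eq_square flip: power_mult)
    then have "x ^ (q + 1) = m ^ (q + 1) * inverse (y ^ (q\<^sup>2 + q))" using n0 by simp
    also have "cg 1 \<dots> (z ^ (q + 1) * inverse (T * P))"
    proof (rule cg_mult)
      have im: "ge 0 m" unfolding m by (intro ge_mult_left units)
      show "cg 1 (m ^ (q + 1)) (z ^ (q + 1))"
        by (intro cg_power cg_mono[OF mz exponent_bounds(18)] im units)
      show "cg 1 (inverse (y ^ (q\<^sup>2 + q))) (inverse (T * P))" by (intro cg_inverse yE units vTP)
      show "ge 0 (m ^ (q + 1))" by (rule ge_power0[OF im])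
      show "ge 0 (inverse (T * P))" by (rule ge_unit[OF v_inverse_0[OF vTP]])
    qed
    finally show ?thesis by (simp add: zq power2_eq_square)
  qed
  have BE: "cg 1 B (c1 * d0 * (T * P) + a0 * b0 * (z\<^sup>2 * inverse (T * P)))"
    by (intro cg_add cg_mult_left'[OF yE, of 0] cg_mult_left'[OF xE, of 0]) (auto intro: ge_mult_left mu_simps)
  have iBE: "ge 0 (c1 * d0 * (T * P) + a0 * b0 * (z\<^sup>2 * inverse (T * P)))"
    by (rule cg_ge'[OF cg_sym[OF BE] iB]) simp
  have "cg 1 (B * inverse t) ((c1 * d0 * (T * P) + a0 * b0 * (z\<^sup>2 * inverse (T * P))) * inverse T)"
    unfolding T_def[symmetric]
    by (intro cg_mult BE iB cg_inverse t1[folded T_def] vt vt0[folded T_def] ge_unit[OF v_inverse_0[OF vt0[folded T_def]]])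
  also have "(c1 * d0 * (T * P) + a0 * b0 * (z\<^sup>2 * inverse (T * P))) * inverse T
      = c1 * d0 * P + a0 * b0 * z\<^sup>2 * inverse P * inverse (T\<^sup>2)"
    using P0 by (simp add: field_simps power2_eq_square)
  also have "cg 1 \<dots> (c1 * d0 * P + a0 * b0 * z\<^sup>2 * inverse P * inverse 1)"
  proof (intro cg_add cg_refl cg_mult_left')
    show "cg 1 (inverse (T\<^sup>2)) (inverse 1)"
      by (rule cg_inverse[OF yy1[folded T_def] v_power_0[OF vt0[folded T_def]] v_one])
    show "ge 0 (a0 * b0 * z\<^sup>2 * inverse P)"
      by (intro ge_mult_left mu_simps ge_power0 units ge_unit[OF v_inverse_0[OF iP(2)]])
  qed simp
  finally have "cg 1 (?J * (B * inverse t)) (?J * (c1 * d0 * P + a0 * b0 * z\<^sup>2 * inverse P * inverse 1))"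
    by (rule cg_mult_left'[OF _ iJ]) simp
  moreover have "?J * (c1 * d0 * P + a0 * b0 * z\<^sup>2 * inverse P * inverse 1)
      = a0 / d0 * (c1 / a0 + b0 / d0 * (z / y0 ^ (q + 1))\<^sup>2)"
    unfolding P_def[symmetric] using n0 P0 by (simp add: field_simps power2_eq_square)
  ultimately have "cg 1 (B * inverse t * ?J) (a0 / d0 * (c1 / a0 + b0 / d0 * (z / y0 ^ (q + 1))\<^sup>2))"
    by (simp only: mult.commute)
  then have "cg 1 (a0 / d0 * ((Z2 - z * \<delta>) / w) + B * inverse t * ?J)
    (a0 / d0 * ((Z2 - z * \<delta>) / w) + a0 / d0 * (c1 / a0 + b0 / d0 * (z / y0 ^ (q + 1))\<^sup>2))"
    by (intro cg_add cg_refl)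
  from cg_trans[OF A[unfolded split] this]
  show "cg 1 ((Z2' - a0 * d0 * z * \<delta>) / (d0\<^sup>2 * w))
      (a0 / d0 * ((Z2 - z * \<delta>) / w + c1 / a0 + b0 / d0 * (z / y0 ^ (q + 1))\<^sup>2))"
    by (simp only: distrib_left add.assoc)
  have yd: "ge (Q * (Q - 1)) (y' - d0 * y)" using y_transform by (simp only: cg_def)
  have "ge ?e (y' - d0 * y + d0 * (y - y0))"
    by (intro ge_add ge_mult_right mu_simps yy ge_mono[OF yd]) (use e in simp)
  then show "ge ?e (y' - d0 * y0)" by (simp add: algebra_simps)
  have vrt: "v rt = 0"
    by (rule v_unit_root[of 2]) (use v_divide[of a0 0 d0 0] va0 vd0 in \<open>simp_all add: rt zero_ereal_def\<close>)
  have rt0: "rt \<noteq> 0" using vrt by auto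
  have w10: "w1 \<noteq> 0" using vw1 by auto
  have vD: "v (d0 * inverse rt * w1) = ereal ?e"
    using vd0 vw1 v_inverse_0[OF vrt] by (simp add: v_mult)
  have "(y' - d0 * y0) / (d0 * inverse rt * w1) - rt * ((y - y0) / w1) = (y' - d0 * y) / (d0 * inverse rt * w1)"
    using n0 rt0 w10 by (simp add: field_simps)
  moreover have "ge 1 ((y' - d0 * y) / (d0 * inverse rt * w1))"
    by (rule ge_divide'[OF yd vD]) (use e in simp)
  ultimately show "cg 1 ((y' - d0 * y0) / (d0 * inverse rt * w1)) (rt * ((y - y0) / w1))"
    by (simp only: cg_def)
qed

end

context lt_fld
begin

subsection \<open>Analytic functions\<close>

text \<open>On an arbitrary set rational functions need not be bounded; bounded coordinates ensure
  that products of uniform approximations are again uniform approximations.\<close>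

definition bounded_coords :: "'c point set \<Rightarrow> bool" where
  "bounded_coords W \<longleftrightarrow> (\<exists>B. \<forall>(X, Y, u)\<in>W. ge B X \<and> ge B Y \<and> ge B u)"

definition approximable :: "'c point set \<Rightarrow> ('c point \<Rightarrow> 'c) \<Rightarrow> bool" where
  "approximable W f \<longleftrightarrow> (\<forall>N. \<exists>r\<in>rational_functions S W. \<forall>P\<in>W. ge N (f P - r P))"

lemma analytic_iff: "f \<in> analytic_functions S W \<longleftrightarrow> f \<in> extensional W \<and> approximable W f"
  by (simp add: analytic_functions_def approximable_def)

lemma rational_bounded:
  assumes "bounded_coords W" "f \<in> rational_functions S W" shows "\<exists>B. \<forall>P\<in>W. ge B (f P)"
  using assms(2)
proof (induction rule: rational_functions.induct)
  case (const c)
  then show ?case by (cases "c = 0") (auto elim!: v_real intro: exI[of _ 0])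
next
  case (add f g)
  then obtain B C where BC: "\<forall>P\<in>W. ge B (f P)" "\<forall>P\<in>W. ge C (g P)" by blast
  have "ge (min B C) (f P + g P)" if "P \<in> W" for P
    by (rule ge_add; rule ge_mono[OF BC(1)[rule_format, OF that]] ge_mono[OF BC(2)[rule_format, OF that]]) simp_all
  then show ?case by blast
next
  case (mult f g)
  then obtain B C where "\<forall>P\<in>W. ge B (f P)" "\<forall>P\<in>W. ge C (g P)" by blast
  then show ?case by (intro exI[of _ "B + C"] ballI ge_mult) auto
next
  case (inverse f)
  then obtain B :: real where B: "\<forall>P\<in>W. v (f P) \<le> ereal B" by blast
  have "ge (- B) (inverse (f P))" if "P \<in> W" for P
  proof -
    have "f P \<noteq> 0" using B that by fastforce
    then obtain s where s: "v (f P) = ereal s" by (rule v_real)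
    then show ?thesis using B that v_inverse[OF s] by auto
  qed
  then show ?case by blast
qed (use assms(1) in \<open>fastforce simp: bounded_coords_def\<close>)+

lemma approximable_bounded:
  assumes "bounded_coords W" "approximable W f" shows "\<exists>B. \<forall>P\<in>W. ge B (f P)"
proof -
  obtain r where r: "r \<in> rational_functions S W" "\<forall>P\<in>W. ge 0 (f P - r P)" using assms(2) by (auto simp: approximable_def)
  obtain B where B: "\<forall>P\<in>W. ge B (r P)" using rational_bounded[OF assms(1) r(1)] by blast
  have "ge (min 0 B) (f P)" if "P \<in> W" for P
  proof -
    have "ge (min 0 B) (f P - r P)" by (rule ge_mono[OF r(2)[rule_format, OF that]]) simp
    moreover have "ge (min 0 B) (r P)" by (rule ge_mono[OF B[rule_format, OF that]]) simp
    ultimately show ?thesis using ge_add[of "min 0 B" "f P - r P" "r P"] by simp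
  qed
  then show ?thesis by blast
qed

lemma approximable_rational: "f \<in> rational_functions S W \<Longrightarrow> approximable W f"
  unfolding approximable_def by (intro allI bexI[of _ f]) auto

lemma approximable_const: "approximable W (\<lambda>P. c)"
  by (intro approximable_rational rational_functions.const)

lemma approximable_cong: "approximable W f \<Longrightarrow> (\<And>P. P \<in> W \<Longrightarrow> f P = g P) \<Longrightarrow> approximable W g"
  by (simp add: approximable_def)

lemma approximable_add:
  assumes "approximable W f" "approximable W g" shows "approximable W (\<lambda>P. f P + g P)"
  unfolding approximable_def
proof
  fix N :: real
  obtain r s where rs: "r \<in> rational_functions S W" "\<forall>P\<in>W. ge N (f P - r P)"
    "s \<in> rational_functions S W" "\<forall>P\<in>W. ge N (g P - s P)" using assms unfolding approximable_def by meson
  have "ge N (f P + g P - (r P + s P))" if "P \<in> W" for P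
    using ge_add[OF rs(2)[rule_format, OF that] rs(4)[rule_format, OF that]] by (simp add: algebra_simps)
  then show "\<exists>r\<in>rational_functions S W. \<forall>P\<in>W. ge N (f P + g P - r P)"
    by (intro bexI[OF _ rational_functions.add[OF rs(1,3)]] ballI)
qed

lemma approximable_mult:
  assumes W: "bounded_coords W" and "approximable W f" "approximable W g"
  shows "approximable W (\<lambda>P. f P * g P)"
  unfolding approximable_def
proof
  fix N :: real
  obtain B where B: "\<forall>P\<in>W. ge B (f P)" using approximable_bounded[OF W assms(2)] by blast
  obtain s where s: "s \<in> rational_functions S W" "\<forall>P\<in>W. ge (N - B) (g P - s P)"
    using assms(3) unfolding approximable_def by meson
  obtain C where C: "\<forall>P\<in>W. ge C (s P)" using rational_bounded[OF W s(1)] by blast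
  obtain r where r: "r \<in> rational_functions S W" "\<forall>P\<in>W. ge (N - C) (f P - r P)"
    using assms(2) unfolding approximable_def by meson
  have "ge N (f P * g P - r P * s P)" if "P \<in> W" for P
  proof -
    have "ge N (f P * (g P - s P))"
      by (rule ge_mult'[OF B[rule_format, OF that] s(2)[rule_format, OF that]]) simp
    moreover have "ge N ((f P - r P) * s P)"
      by (rule ge_mult'[OF r(2)[rule_format, OF that] C[rule_format, OF that]]) simp
    ultimately have "ge N (f P * (g P - s P) + (f P - r P) * s P)" by (rule ge_add)
    then show ?thesis by (simp add: algebra_simps)
  qed
  then show "\<exists>r\<in>rational_functions S W. \<forall>P\<in>W. ge N (f P * g P - r P)"
    by (intro bexI[OF _ rational_functions.mult[OF r(1) s(1)]] ballI)
qed

lemma approximable_diff: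
  assumes "bounded_coords W" "approximable W f" "approximable W g" shows "approximable W (\<lambda>P. f P - g P)"
  using approximable_add[OF assms(2) approximable_mult[OF assms(1) approximable_const[of W "-1"] assms(3)]] by simp

lemma approximable_power:
  "bounded_coords W \<Longrightarrow> approximable W f \<Longrightarrow> approximable W (\<lambda>P. f P ^ n)"
  by (induction n) (auto intro: approximable_const approximable_mult)

lemma approximable_inverse:
  assumes W: "bounded_coords W" and f: "approximable W f" and B: "\<forall>P\<in>W. v (f P) \<le> ereal B"
  shows "approximable W (\<lambda>P. inverse (f P))"
  unfolding approximable_def
proof
  fix N :: real
  \<comment> \<open>Agreement beyond B + 1 gives the approximant r the same valuation as f, at most
    B, so that \<open>inverse (r P)\<close> is an admissible rational function; N + B + B pays for
    the division by f r.\<close>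
  define M where "M = max (B + 1) (N + B + B)"
  obtain r where r: "r \<in> rational_functions S W" "\<forall>P\<in>W. ge M (f P - r P)" using f unfolding approximable_def by meson
  have vr: "v (r P) = v (f P)" "\<exists>s\<le>B. v (f P) = ereal s" if "P \<in> W" for P
  proof -
    have "f P \<noteq> 0" using B that by fastforce
    then obtain s where s: "v (f P) = ereal s" by (rule v_real)
    then have "s \<le> B" using B that by auto
    then show "\<exists>s\<le>B. v (f P) = ereal s" using s by blast
    have "ge M (r P - f P)" using r(2) that by (subst v_minus_commute) auto
    then show "v (r P) = v (f P)"
      using v_add_dominant[OF s, of M "r P - f P"] s \<open>s \<le> B\<close> by (simp add: M_def)
  qed
  have "ge N (inverse (f P) - inverse (r P))" if P: "P \<in> W" for P
  proof -
    obtain s where s: "s \<le> B" "v (f P) = ereal s" "v (r P) = ereal s" using vr[OF P] by auto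
    then have n: "f P \<noteq> 0" "r P \<noteq> 0" by auto
    have "ge M (r P - f P)" using r(2) P by (subst v_minus_commute) auto
    then have "ge N ((r P - f P) / (f P * r P))"
      by (rule ge_divide'[OF _ v_prod[OF s(2,3)]]) (use s(1) in \<open>simp add: M_def\<close>)
    moreover have "inverse (f P) - inverse (r P) = (r P - f P) / (f P * r P)" using n by (simp add: field_simps)
    ultimately show ?thesis by simp
  qed
  moreover have "(\<lambda>P. inverse (r P)) \<in> rational_functions S W"
    by (intro rational_functions.inverse r exI[of _ B]) (use vr B in auto)
  ultimately show "\<exists>r\<in>rational_functions S W. \<forall>P\<in>W. ge N (inverse (f P) - r P)"
    by (intro bexI[of _ "\<lambda>P. inverse (r P)"] ballI)
qed

lemma approximable_limit:
  assumes "\<And>N. \<exists>g. approximable W g \<and> (\<forall>P\<in>W. ge N (f P - g P))" shows "approximable W f"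
  unfolding approximable_def
proof
  fix N :: real
  obtain g where g: "approximable W g" "\<forall>P\<in>W. ge N (f P - g P)" using assms by blast
  obtain r where r: "r \<in> rational_functions S W" "\<forall>P\<in>W. ge N (g P - r P)" using g(1) unfolding approximable_def by meson
  have "ge N (f P - r P)" if "P \<in> W" for P
    using ge_add[of N "f P - g P" "g P - r P"] g(2) r(2) that by simp
  then show "\<exists>r\<in>rational_functions S W. \<forall>P\<in>W. ge N (f P - r P)" using r(1) by blast
qed

lemma approximable_intpoly:
  assumes W: "bounded_coords W" and "\<phi> \<in> intpoly" "approximable W f" "approximable W g" "approximable W h"
  shows "approximable W (\<lambda>P. \<phi> (f P, g P, h P))"
  using assms(2)
  by (induction rule: intpoly.induct)
     (auto intro: approximable_const assms approximable_add approximable_mult[OF W])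

text \<open>Induction on a rational approximant on W'. A denominator bounded away from 0 on W' stays
  so after composition, because h maps W into W'.\<close>

lemma approximable_compose:
  assumes W: "bounded_coords W" and W': "bounded_coords W'" and h: "h \<in> W \<rightarrow> W'"
    and c: "approximable W (\<lambda>P. fst (h P))" "approximable W (\<lambda>P. fst (snd (h P)))" "approximable W (\<lambda>P. snd (snd (h P)))"
    and f: "approximable W' f"
  shows "approximable W (f \<circ> h)"
proof (rule approximable_limit)
  fix N :: real
  obtain r where r: "r \<in> rational_functions S W'" "\<forall>P\<in>W'. ge N (f P - r P)" using f unfolding approximable_def by meson
  have "approximable W (\<lambda>P. r (h P))" using r(1)
  proof (induction rule: rational_functions.induct)
    case (const c)
    then show ?case by (rule approximable_const)
  next
    case (add f g)
    show ?case by (rule approximable_add[OF add.IH])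
  next
    case (mult f g)
    show ?case by (rule approximable_mult[OF W mult.IH])
  next
    case (inverse f)
    then obtain B where "\<forall>P\<in>W'. v (f P) \<le> ereal B" by blast
    then show ?case using h by (intro approximable_inverse[OF W inverse.IH, of B]) auto
  qed (use c in \<open>simp_all add: case_prod_unfold\<close>)
  then show "\<exists>g. approximable W g \<and> (\<forall>P\<in>W. ge N ((f \<circ> h) P - g P))"
    using r(2) h by (intro exI[of _ "\<lambda>P. r (h P)"]) auto
qed

lemma power_bounded_iff: "power_bounded S W f \<longleftrightarrow> (\<forall>P\<in>W. ge 0 (f P))"
proof
  assume "power_bounded S W f"
  then obtain B where B: "\<And>n P. P \<in> W \<Longrightarrow> ge B (f P ^ n)" by (auto simp: power_bounded_def)
  show "\<forall>P\<in>W. ge 0 (f P)"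
  proof (rule ccontr, clarsimp)
    fix X Y u assume P: "(X, Y, u) \<in> W" and neg: "\<not> ge 0 (f (X, Y, u))"
    then have "f (X, Y, u) \<noteq> 0" by auto
    then obtain s where s: "v (f (X, Y, u)) = ereal s" by (rule v_real)
    then have s0: "s < 0" using neg by simp
    obtain n :: nat where "(1 - B) / (- s) \<le> real n" using real_arch_simple by blast
    then have "real n * s \<le> B - 1" using s0 by (simp add: field_simps)
    moreover have "B \<le> real n * s" using B[OF P, of n] v_power[OF s, of n] by simp
    ultimately show False by simp
  qed
next
  assume "\<forall>P\<in>W. ge 0 (f P)"
  then show "power_bounded S W f" unfolding power_bounded_def by (intro exI[of _ 0]) (auto intro: ge_power0)
qed

text \<open>A power f^(n+1) of valuation at least 1 on all of W forces valuation at least 1/(n+1)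
  for f; conversely a uniform gap e grows linearly with the exponent.\<close>

lemma topologically_nilpotent_iff:
  "topologically_nilpotent S W f \<longleftrightarrow> (\<exists>e>0. \<forall>P\<in>W. ge e (f P))"
proof
  assume "topologically_nilpotent S W f"
  then have "\<forall>\<^sub>F n in sequentially. \<forall>P\<in>W. ge 1 (f P ^ n)"
    unfolding topologically_nilpotent_def by (rule spec)
  then obtain n where n: "\<And>m. n \<le> m \<Longrightarrow> \<forall>P\<in>W. ge 1 (f P ^ m)" by (auto simp: eventually_sequentially)
  have "ge (1 / real (Suc n)) (f P)" if "P \<in> W" for P
    by (rule ge_root[of "Suc n"]) (use n[of "Suc n"] that in auto)
  then show "\<exists>e>0. \<forall>P\<in>W. ge e (f P)" by (intro exI[of _ "1 / real (Suc n)"]) auto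
next
  assume "\<exists>e>0. \<forall>P\<in>W. ge e (f P)"
  then obtain e where e: "0 < e" "\<forall>P\<in>W. ge e (f P)" by blast
  show "topologically_nilpotent S W f" unfolding topologically_nilpotent_def
  proof
    fix N :: real
    obtain n0 :: nat where n0: "N / e \<le> real n0" using real_arch_simple by blast
    have "ge N (f P ^ n)" if "n0 \<le> n" "P \<in> W" for n P
    proof (rule ge_mono[OF ge_power])
      show "ge e (f P)" using e that by blast
      have "N \<le> real n0 * e" using n0 e by (simp add: field_simps)
      also have "\<dots> \<le> real n * e" using that e by (intro mult_right_mono) auto
      finally show "N \<le> real n * e" .
    qed
    then show "\<forall>\<^sub>F n in sequentially. \<forall>P\<in>W. ge N (f P ^ n)"
      by (intro eventually_sequentiallyI[of n0] ballI)
  qed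
qed

subsection \<open>The reduction\<close>

definition integral_on :: "'c point set \<Rightarrow> ('c point \<Rightarrow> 'c) \<Rightarrow> bool" where
  "integral_on W f \<longleftrightarrow> approximable W f \<and> (\<forall>P\<in>W. ge 0 (f P))"

abbreviation "PB W \<equiv> power_bounded_ring S W"
abbreviation "TN W \<equiv> nilpotent_ideal S W"

lemma integral_on_const: "ge 0 c \<Longrightarrow> integral_on W (\<lambda>P. c)"
  by (simp add: integral_on_def approximable_const)

lemma integral_on_add: "integral_on W f \<Longrightarrow> integral_on W g \<Longrightarrow> integral_on W (\<lambda>P. f P + g P)"
  by (simp add: integral_on_def approximable_add ge_add)

lemma integral_on_mult:
  "bounded_coords W \<Longrightarrow> integral_on W f \<Longrightarrow> integral_on W g \<Longrightarrow> integral_on W (\<lambda>P. f P * g P)"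
  by (simp add: integral_on_def approximable_mult ge_mult_left)

lemma integral_on_diff:
  "bounded_coords W \<Longrightarrow> integral_on W f \<Longrightarrow> integral_on W g \<Longrightarrow> integral_on W (\<lambda>P. f P - g P)"
  by (simp add: integral_on_def approximable_diff ge_diff)

lemma integral_on_minus: "bounded_coords W \<Longrightarrow> integral_on W f \<Longrightarrow> integral_on W (\<lambda>P. - f P)"
  using integral_on_diff[OF _ integral_on_const[of 0], of W f] by simp

lemma integral_on_power: "bounded_coords W \<Longrightarrow> integral_on W f \<Longrightarrow> integral_on W (\<lambda>P. f P ^ n)"
  by (simp add: integral_on_def approximable_power ge_power0)

lemma integral_on_cong: "integral_on W f \<Longrightarrow> (\<And>P. P \<in> W \<Longrightarrow> f P = g P) \<Longrightarrow> integral_on W g"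
  by (auto simp: integral_on_def intro: approximable_cong)

lemma PB_carrier: "f \<in> carrier (PB W) \<longleftrightarrow> f \<in> extensional W \<and> integral_on W f"
  by (simp add: power_bounded_ring_def analytic_iff power_bounded_iff integral_on_def)

lemma restrict_carrier: "restrict f W \<in> carrier (PB W) \<longleftrightarrow> integral_on W f"
proof -
  have "integral_on W (restrict f W) \<longleftrightarrow> integral_on W f"
    by (auto intro: integral_on_cong[of W "restrict f W"] integral_on_cong[of W f])
  then show ?thesis by (simp add: PB_carrier)
qed

lemma PB_simps:
  "f \<otimes>\<^bsub>PB W\<^esub> g = restrict (\<lambda>P. f P * g P) W" "f \<oplus>\<^bsub>PB W\<^esub> g = restrict (\<lambda>P. f P + g P) W"
  "\<one>\<^bsub>PB W\<^esub> = restrict (\<lambda>P. 1) W" "\<zero>\<^bsub>PB W\<^esub> = restrict (\<lambda>P. 0) W"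
  by (simp_all add: power_bounded_ring_def)

lemma TN_iff: "f \<in> TN W \<longleftrightarrow> f \<in> extensional W \<and> approximable W f \<and> (\<exists>e>0. \<forall>P\<in>W. ge e (f P))"
  by (simp add: nilpotent_ideal_def analytic_iff topologically_nilpotent_iff conj_assoc)

lemma TN_carrier: "f \<in> TN W \<Longrightarrow> f \<in> carrier (PB W)"
  by (auto simp: TN_iff PB_carrier integral_on_def intro: ge_mono less_imp_le)

context
  fixes W :: "'c point set"
  assumes W: "bounded_coords W"
begin

lemma PB_closed:
  "f \<in> carrier (PB W) \<Longrightarrow> g \<in> carrier (PB W) \<Longrightarrow> f \<oplus>\<^bsub>PB W\<^esub> g \<in> carrier (PB W)"
  "f \<in> carrier (PB W) \<Longrightarrow> g \<in> carrier (PB W) \<Longrightarrow> f \<otimes>\<^bsub>PB W\<^esub> g \<in> carrier (PB W)"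
  "\<zero>\<^bsub>PB W\<^esub> \<in> carrier (PB W)" "\<one>\<^bsub>PB W\<^esub> \<in> carrier (PB W)"
  by (simp_all only: PB_simps restrict_carrier)
     (simp_all add: PB_carrier integral_on_add integral_on_mult[OF W] integral_on_const)

lemma PB_eqI: "f \<in> extensional W \<Longrightarrow> g \<in> extensional W \<Longrightarrow> (\<And>P. P \<in> W \<Longrightarrow> f P = g P) \<Longrightarrow> f = g"
  by (rule extensionalityI)

lemma PB_ext: "f \<in> carrier (PB W) \<Longrightarrow> f \<in> extensional W"
  by (simp add: PB_carrier)

lemma PB_cring: "cring (PB W)"
proof (rule cringI)
  show "abelian_group (PB W)"
  proof (rule abelian_groupI)
    fix f assume f: "f \<in> carrier (PB W)"
    then have i: "integral_on W f" by (simp add: PB_carrier)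
    show "\<zero>\<^bsub>PB W\<^esub> \<oplus>\<^bsub>PB W\<^esub> f = f"
      by (rule PB_eqI) (use PB_ext[OF f] in \<open>simp_all add: PB_simps\<close>)
    show "\<exists>g\<in>carrier (PB W). g \<oplus>\<^bsub>PB W\<^esub> f = \<zero>\<^bsub>PB W\<^esub>"
    proof
      show "restrict (\<lambda>P. - f P) W \<in> carrier (PB W)"
        unfolding restrict_carrier by (rule integral_on_minus[OF W i])
      show "restrict (\<lambda>P. - f P) W \<oplus>\<^bsub>PB W\<^esub> f = \<zero>\<^bsub>PB W\<^esub>"
        by (rule PB_eqI) (simp_all add: PB_simps)
    qed
    fix g assume g: "g \<in> carrier (PB W)"
    show "f \<oplus>\<^bsub>PB W\<^esub> g = g \<oplus>\<^bsub>PB W\<^esub> f" by (simp add: PB_simps add.commute)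
    fix h assume h: "h \<in> carrier (PB W)"
    show "f \<oplus>\<^bsub>PB W\<^esub> g \<oplus>\<^bsub>PB W\<^esub> h = f \<oplus>\<^bsub>PB W\<^esub> (g \<oplus>\<^bsub>PB W\<^esub> h)"
      by (rule PB_eqI) (simp_all add: PB_simps add.assoc)
  qed (rule PB_closed, assumption+, rule PB_closed)
  show "comm_monoid (PB W)"
  proof (rule comm_monoidI)
    fix f g h assume f: "f \<in> carrier (PB W)" and "g \<in> carrier (PB W)" "h \<in> carrier (PB W)"
    show "f \<otimes>\<^bsub>PB W\<^esub> g \<otimes>\<^bsub>PB W\<^esub> h = f \<otimes>\<^bsub>PB W\<^esub> (g \<otimes>\<^bsub>PB W\<^esub> h)"
      by (rule PB_eqI) (simp_all add: PB_simps mult.assoc)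
  next
    fix f assume f: "f \<in> carrier (PB W)"
    show "\<one>\<^bsub>PB W\<^esub> \<otimes>\<^bsub>PB W\<^esub> f = f"
      by (rule PB_eqI) (use PB_ext[OF f] in \<open>simp_all add: PB_simps\<close>)
    fix g
    show "f \<otimes>\<^bsub>PB W\<^esub> g = g \<otimes>\<^bsub>PB W\<^esub> f" by (simp add: PB_simps mult.commute)
  qed (rule PB_closed, assumption+, rule PB_closed)
  fix f g h assume "f \<in> carrier (PB W)" "g \<in> carrier (PB W)" "h \<in> carrier (PB W)"
  show "(f \<oplus>\<^bsub>PB W\<^esub> g) \<otimes>\<^bsub>PB W\<^esub> h = f \<otimes>\<^bsub>PB W\<^esub> h \<oplus>\<^bsub>PB W\<^esub> g \<otimes>\<^bsub>PB W\<^esub> h"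
    by (rule PB_eqI) (simp_all add: PB_simps distrib_right)
qed

lemma PB_a_inv: assumes "f \<in> carrier (PB W)" shows "\<ominus>\<^bsub>PB W\<^esub> f = restrict (\<lambda>P. - f P) W"
proof -
  interpret cring "PB W" by (rule PB_cring)
  have i: "integral_on W f" using assms by (simp add: PB_carrier)
  have c: "restrict (\<lambda>P. - f P) W \<in> carrier (PB W)"
    unfolding restrict_carrier by (rule integral_on_minus[OF W i])
  have "restrict (\<lambda>P. - f P) W \<oplus>\<^bsub>PB W\<^esub> f = \<zero>\<^bsub>PB W\<^esub>" by (rule PB_eqI) (simp_all add: PB_simps)
  then show ?thesis using minus_equality[OF _ assms c] by simp
qed

lemma TN_ideal: "ideal (TN W) (PB W)"
proof (rule idealI)
  interpret cring "PB W" by (rule PB_cring)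
  show "ring (PB W)" by (rule ring_axioms)
  show "subgroup (TN W) (add_monoid (PB W))"
  proof (rule add.subgroupI)
    show "TN W \<subseteq> carrier (PB W)" using TN_carrier by auto
    have "\<zero>\<^bsub>PB W\<^esub> \<in> TN W"
      by (auto simp: TN_iff PB_simps intro: exI[of _ 1] approximable_cong[OF approximable_const])
    then show "TN W \<noteq> {}" by blast
    show "\<ominus>\<^bsub>PB W\<^esub> f \<in> TN W" if "f \<in> TN W" for f
      using that PB_a_inv[OF TN_carrier[OF that]] approximable_diff[OF W approximable_const[of W 0], of f]
      by (auto simp: TN_iff intro: approximable_cong)
    fix f g assume fg: "f \<in> TN W" "g \<in> TN W"
    then obtain d e where de: "0 < d" "\<forall>P\<in>W. ge d (f P)" "0 < e" "\<forall>P\<in>W. ge e (g P)" by (auto simp: TN_iff)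
    have "ge (min d e) (f P + g P)" if "P \<in> W" for P
      by (rule ge_add; rule ge_mono[OF de(2)[rule_format, OF that]] ge_mono[OF de(4)[rule_format, OF that]]) simp_all
    then show "f \<oplus>\<^bsub>PB W\<^esub> g \<in> TN W" using fg de
      by (auto simp: TN_iff PB_simps intro: approximable_cong[OF approximable_add] intro!: exI[of _ "min d e"])
  qed
  fix f g assume f: "f \<in> TN W" and g: "g \<in> carrier (PB W)"
  then show "g \<otimes>\<^bsub>PB W\<^esub> f \<in> TN W"
    by (auto simp: TN_iff PB_carrier integral_on_def PB_simps
        intro: approximable_cong[OF approximable_mult[OF W]] ge_mult_right)
  then show "f \<otimes>\<^bsub>PB W\<^esub> g \<in> TN W" by (simp add: PB_simps mult.commute)
qed

lemma reduction_cring: "cring (reduction S W)"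
  unfolding reduction_def by (rule ideal.quotient_is_cring[OF TN_ideal PB_cring])

lemma reduce_hom: "(\<lambda>f. TN W +>\<^bsub>PB W\<^esub> f) \<in> ring_hom (PB W) (reduction S W)"
  unfolding reduction_def by (rule ideal.rcos_ring_hom[OF TN_ideal])

lemma reduce_closed: "integral_on W f \<Longrightarrow> reduce S W f \<in> carrier (reduction S W)"
  unfolding reduce_def by (rule ring_hom_closed[OF reduce_hom]) (simp add: restrict_carrier)

lemma reduce_add: assumes "integral_on W f" "integral_on W g"
  shows "reduce S W (\<lambda>P. f P + g P) = reduce S W f \<oplus>\<^bsub>reduction S W\<^esub> reduce S W g"
proof -
  have "restrict (\<lambda>P. f P + g P) W = restrict f W \<oplus>\<^bsub>PB W\<^esub> restrict g W" by (auto simp: PB_simps)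
  then show ?thesis using ring_hom_add[OF reduce_hom, of "restrict f W" "restrict g W"] assms
    by (simp add: reduce_def restrict_carrier)
qed

lemma reduce_mult: assumes "integral_on W f" "integral_on W g"
  shows "reduce S W (\<lambda>P. f P * g P) = reduce S W f \<otimes>\<^bsub>reduction S W\<^esub> reduce S W g"
proof -
  have "restrict (\<lambda>P. f P * g P) W = restrict f W \<otimes>\<^bsub>PB W\<^esub> restrict g W" by (auto simp: PB_simps)
  then show ?thesis using ring_hom_mult[OF reduce_hom, of "restrict f W" "restrict g W"] assms
    by (simp add: reduce_def restrict_carrier)
qed

lemma reduce_one: "reduce S W (\<lambda>P. 1) = \<one>\<^bsub>reduction S W\<^esub>"
  using ring_hom_one[OF reduce_hom] by (simp add: reduce_def PB_simps)

lemma reduce_power: assumes "integral_on W f"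
  shows "reduce S W (\<lambda>P. f P ^ n) = reduce S W f [^]\<^bsub>reduction S W\<^esub> (n::nat)"
proof (induction n)
  case 0
  then show ?case using reduce_one by simp
next
  case (Suc n)
  have "reduce S W (\<lambda>P. f P ^ n * f P) = reduce S W (\<lambda>P. f P ^ n) \<otimes>\<^bsub>reduction S W\<^esub> reduce S W f"
    by (intro reduce_mult integral_on_power W assms)
  then show ?case using Suc by (simp add: mult.commute)
qed

lemma reduce_diff: assumes "integral_on W f" "integral_on W g"
  shows "reduce S W (\<lambda>P. f P - g P) = reduce S W f \<ominus>\<^bsub>reduction S W\<^esub> reduce S W g"
proof -
  interpret cring "reduction S W" by (rule reduction_cring)
  have d: "integral_on W (\<lambda>P. f P - g P)" by (intro integral_on_diff W assms)
  have "reduce S W f = reduce S W (\<lambda>P. f P - g P) \<oplus>\<^bsub>reduction S W\<^esub> reduce S W g"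
    using reduce_add[OF d assms(2)] by simp
  then show ?thesis using reduce_closed[OF d] reduce_closed[OF assms(2)]
    by (simp add: a_minus_def a_assoc r_neg)
qed

lemma reduce_eqI: assumes "integral_on W f" "integral_on W g" "0 < e" "\<And>P. P \<in> W \<Longrightarrow> ge e (f P - g P)"
  shows "reduce S W f = reduce S W g"
proof -
  interpret ideal "TN W" "PB W" by (rule TN_ideal)
  define d where "d = restrict (\<lambda>P. f P - g P) W"
  have "d \<in> TN W"
    unfolding d_def TN_iff using assms
    by (auto simp: integral_on_def intro!: exI[of _ e] intro: approximable_cong[OF approximable_diff[OF W]])
  moreover have "restrict f W = d \<oplus>\<^bsub>PB W\<^esub> restrict g W" by (auto simp: d_def PB_simps)
  ultimately have "restrict f W \<in> TN W +>\<^bsub>PB W\<^esub> restrict g W"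
    by (auto simp: a_r_coset_def')
  then show ?thesis unfolding reduce_def
    using a_repr_independence'[of "restrict f W" "restrict g W"] assms by (simp add: restrict_carrier)
qed

text \<open>Equal cosets yield a uniform gap; this is what makes a map of reductions defined by
  representatives independent of their choice.\<close>

lemma reduce_eqD: assumes "integral_on W f" "integral_on W g" "reduce S W f = reduce S W g"
  shows "\<exists>e>0. \<forall>P\<in>W. ge e (f P - g P)"
proof -
  interpret ideal "TN W" "PB W" by (rule TN_ideal)
  have "restrict f W \<in> TN W +>\<^bsub>PB W\<^esub> restrict f W"
    by (rule a_rcos_self) (simp add: restrict_carrier assms)
  then have "restrict f W \<in> TN W +>\<^bsub>PB W\<^esub> restrict g W" using assms(3) by (simp add: reduce_def)
  then obtain d where d: "d \<in> TN W" "restrict f W = d \<oplus>\<^bsub>PB W\<^esub> restrict g W" by (auto simp: a_r_coset_def')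
  have "f P - g P = d P" if "P \<in> W" for P
    using fun_cong[OF d(2), of P] that by (simp add: PB_simps)
  then show ?thesis using d(1) by (simp add: TN_iff)
qed

lemma reduction_carrierE: assumes "A \<in> carrier (reduction S W)"
  obtains f where "f \<in> carrier (PB W)" "A = reduce S W f"
proof -
  obtain f where f: "f \<in> carrier (PB W)" "A = TN W +>\<^bsub>PB W\<^esub> f"
    using assms by (auto simp: reduction_def FactRing_def A_RCOSETS_def')
  have "restrict f W = f" using f(1) by (simp add: PB_carrier extensional_restrict)
  then show ?thesis using f that by (simp add: reduce_def)
qed

end

lemma bar_lift: "ge 0 (SOME x. 0 \<le> v x \<and> br x = z)" "br (SOME x. 0 \<le> v x \<and> br x = z) = z"
proof -
  have "\<exists>x. 0 \<le> v x \<and> br x = z" using br_surj[of z] by (simp add: zero_ereal_def)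
  from someI_ex[OF this] show "ge 0 (SOME x. 0 \<le> v x \<and> br x = z)" "br (SOME x. 0 \<le> v x \<and> br x = z) = z"
    by (simp_all add: zero_ereal_def)
qed

lemma scalar_eq: assumes W: "bounded_coords W" and "ge 0 c" "br c = z"
  shows "scalar S W z = reduce S W (\<lambda>P. c)"
proof -
  have "0 < v ((SOME x. 0 \<le> v x \<and> br x = z) - c)"
    using br_eq_iff[OF bar_lift(1)[of z] assms(2)] bar_lift(2)[of z] assms(3) by simp
  then obtain e where "0 < e" "ge e ((SOME x. 0 \<le> v x \<and> br x = z) - c)" by (rule ge_positive)
  then show ?thesis unfolding scalar_def
    by (intro reduce_eqI[OF W, of _ _ e] integral_on_const bar_lift assms) auto
qed

lemma curve_coordinatesI:
  assumes W: "bounded_coords W" and a: "integral_on W a" and s: "integral_on W s" and e: "0 < e"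
    and eq: "\<And>P. P \<in> W \<Longrightarrow> cg e (a P ^ q - a P) (s P ^ 2)"
  shows "curve_coordinates S W a s"
proof -
  have "reduce S W (\<lambda>P. a P ^ q - a P) = reduce S W (\<lambda>P. s P ^ 2)"
    by (rule reduce_eqI[OF W _ _ e]) (use eq a s W in \<open>auto simp: cg_def intro: integral_on_diff integral_on_power\<close>)
  then show ?thesis unfolding curve_coordinates_def
    using a s by (simp add: restrict_carrier reduce_diff[OF W integral_on_power[OF W a] a] reduce_power[OF W])
qed

text \<open>\<phi> composes an arbitrary representative of a coset with h. Two representatives
  differ by a function with a positive gap on W', and the gap survives composition.\<close>

lemma induces_on_reductionsI:
  assumes W: "bounded_coords W" and W': "bounded_coords W'" and h: "h \<in> W \<rightarrow> W'"
    and c: "approximable W (\<lambda>P. fst (h P))" "approximable W (\<lambda>P. fst (snd (h P)))" "approximable W (\<lambda>P. snd (snd (h P)))"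
  shows "\<exists>\<phi>. induces_on_reductions S h W W' \<phi>"
proof -
  define \<phi> where "\<phi> A = reduce S W ((SOME f. f \<in> carrier (PB W') \<and> A = reduce S W' f) \<circ> h)" for A
  have int: "integral_on W (f \<circ> h)" if "integral_on W' f" for f
    using approximable_compose[OF W W' h c, of f] that h by (auto simp: integral_on_def)
  have \<phi>: "\<phi> (reduce S W' f) = reduce S W (f \<circ> h)" if f: "integral_on W' f" for f
  proof -
    define g where "g = (SOME g. g \<in> carrier (PB W') \<and> reduce S W' f = reduce S W' g)"
    have "\<exists>g. g \<in> carrier (PB W') \<and> reduce S W' f = reduce S W' g"
      by (intro exI[of _ "restrict f W'"]) (simp add: restrict_carrier f reduce_def)
    from someI_ex[OF this] have g: "integral_on W' g" "reduce S W' f = reduce S W' g"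
      by (auto simp: g_def PB_carrier)
    obtain e where e: "0 < e" "\<forall>P\<in>W'. ge e (g P - f P)" using reduce_eqD[OF W' g(1) f g(2)[symmetric]] by blast
    have "reduce S W (g \<circ> h) = reduce S W (f \<circ> h)"
      by (rule reduce_eqI[OF W int[OF g(1)] int[OF f] e(1)]) (use e h in auto)
    then show ?thesis by (simp add: \<phi>_def g_def)
  qed
  have hom: "\<phi> \<in> ring_hom (reduction S W') (reduction S W)"
  proof (rule ring_hom_memI)
    fix A assume "A \<in> carrier (reduction S W')"
    then obtain f where f: "f \<in> carrier (PB W')" "A = reduce S W' f" by (rule reduction_carrierE[OF W'])
    then have fi: "integral_on W' f" by (simp add: PB_carrier)
    show "\<phi> A \<in> carrier (reduction S W)" unfolding f(2) \<phi>[OF fi] by (rule reduce_closed[OF W int[OF fi]])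
    fix B assume "B \<in> carrier (reduction S W')"
    then obtain g where g: "g \<in> carrier (PB W')" "B = reduce S W' g" by (rule reduction_carrierE[OF W'])
    then have gi: "integral_on W' g" by (simp add: PB_carrier)
    show "\<phi> (A \<otimes>\<^bsub>reduction S W'\<^esub> B) = \<phi> A \<otimes>\<^bsub>reduction S W\<^esub> \<phi> B"
      unfolding f(2) g(2) reduce_mult[OF W' fi gi, symmetric] \<phi>[OF fi] \<phi>[OF gi]
        \<phi>[OF integral_on_mult[OF W' fi gi]] reduce_mult[OF W int[OF fi] int[OF gi], symmetric]
      by (simp add: comp_def)
    show "\<phi> (A \<oplus>\<^bsub>reduction S W'\<^esub> B) = \<phi> A \<oplus>\<^bsub>reduction S W\<^esub> \<phi> B"
      unfolding f(2) g(2) reduce_add[OF W' fi gi, symmetric] \<phi>[OF fi] \<phi>[OF gi]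
        \<phi>[OF integral_on_add[OF fi gi]] reduce_add[OF W int[OF fi] int[OF gi], symmetric]
      by (simp add: comp_def)
  next
    show "\<phi> \<one>\<^bsub>reduction S W'\<^esub> = \<one>\<^bsub>reduction S W\<^esub>"
      unfolding reduce_one[OF W', symmetric] reduce_one[OF W, symmetric] by (subst \<phi>) (auto simp: comp_def intro: integral_on_const)
  qed
  have "induces_on_reductions S h W W' \<phi>" unfolding induces_on_reductions_def
  proof (intro conjI ballI h hom)
    fix f assume "f \<in> carrier (PB W')"
    then have f: "integral_on W' f" by (simp add: PB_carrier)
    show "restrict (f \<circ> h) W \<in> carrier (PB W)" unfolding restrict_carrier by (rule int[OF f])
    show "\<phi> (reduce S W' f) = reduce S W (f \<circ> h)" by (rule \<phi>[OF f])
  qed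
  then show ?thesis by blast
qed

end

no_notation fps_nth (infixl "$" 75)
unbundle vec_syntax

context lt_fld
begin

subsection \<open>The group action on bases of the torsion\<close>

context
  fixes u :: 'c and \<rho> :: real assumes u: "ge 0 u" and r: "0 < \<rho>"
begin

lemma lt_mult_zero_left: "ge \<rho> x \<Longrightarrow> lt_mult S u 0 x = 0"
  using lt_mult_mu0[OF u r mu0_0] by simp

lemma lt_mult_zero_right: "a \<in> OF S \<Longrightarrow> lt_mult S u a 0 = 0"
  using mult_lt_mult[OF u r, of a 0 0] by (simp add: lt_mult_zero_left)

lemma lt_comb_ge:
  "a \<in> OF S \<Longrightarrow> b \<in> OF S \<Longrightarrow> ge \<rho> X \<Longrightarrow> ge \<rho> Y \<Longrightarrow> ge \<rho> (lt_add S u (lt_mult S u a X) (lt_mult S u b Y))"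
  by (intro lt_add_ge[OF u r] lt_mult_ge[OF u r])

lemma lt_add_swap:
  assumes "ge \<rho> x" "ge \<rho> y" "ge \<rho> z" "ge \<rho> t"
  shows "lt_add S u (lt_add S u x y) (lt_add S u z t) = lt_add S u (lt_add S u x z) (lt_add S u y t)"
proof -
  note A = lt_add_assoc[OF u r] and G = lt_add_ge[OF u r]
  have "lt_add S u (lt_add S u x y) (lt_add S u z t) = lt_add S u x (lt_add S u (lt_add S u y z) t)"
    using A[OF assms(1,2) G[OF assms(3,4)]] A[OF assms(2,3,4)] by simp
  also have "lt_add S u y z = lt_add S u z y" by (rule lt_add_commute[OF u r assms(2,3)])
  also have "lt_add S u x (lt_add S u (lt_add S u z y) t) = lt_add S u (lt_add S u x z) (lt_add S u y t)"
    using A[OF assms(1,3) G[OF assms(2,4)]] A[OF assms(3,2,4)] by simp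
  finally show ?thesis .
qed

lemma lt_comb_mult:
  assumes "a \<in> OF S" "b \<in> OF S" "p \<in> OF S" "ge \<rho> X" "ge \<rho> Y"
  shows "lt_mult S u p (lt_add S u (lt_mult S u a X) (lt_mult S u b Y))
    = lt_add S u (lt_mult S u (p * a) X) (lt_mult S u (p * b) Y)"
  using assms
  by (simp add: lt_mult_add[OF u r assms(3) lt_mult_ge[OF u r assms(1,4)] lt_mult_ge[OF u r assms(2,5)]]
      mult_lt_mult[OF u r])

lemma lt_comb_add:
  assumes "a \<in> OF S" "b \<in> OF S" "c \<in> OF S" "d \<in> OF S" "ge \<rho> X" "ge \<rho> Y"
  shows "lt_add S u (lt_add S u (lt_mult S u a X) (lt_mult S u b Y)) (lt_add S u (lt_mult S u c X) (lt_mult S u d Y))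
    = lt_add S u (lt_mult S u (a + c) X) (lt_mult S u (b + d) Y)"
proof -
  note M = lt_mult_ge[OF u r]
  show ?thesis
    unfolding lt_add_swap[OF M[OF assms(1,5)] M[OF assms(2,6)] M[OF assms(3,5)] M[OF assms(4,6)]]
      add_lt_mult[OF u r assms(1,3,5)] add_lt_mult[OF u r assms(2,4,6)] ..
qed

lemma lt_comb_comb:
  assumes "a \<in> OF S" "b \<in> OF S" "c \<in> OF S" "d \<in> OF S" "p \<in> OF S" "t \<in> OF S" "ge \<rho> X" "ge \<rho> Y"
  shows "lt_add S u (lt_mult S u p (lt_add S u (lt_mult S u a X) (lt_mult S u c Y)))
      (lt_mult S u t (lt_add S u (lt_mult S u b X) (lt_mult S u d Y)))
    = lt_add S u (lt_mult S u (p * a + t * b) X) (lt_mult S u (p * c + t * d) Y)"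
  unfolding lt_comb_mult[OF assms(1,3,5,7,8)] lt_comb_mult[OF assms(2,4,6,7,8)]
  by (rule lt_comb_add) (auto intro: OF_mult assms)

lemma lt_torsionI: "ge \<rho> x \<Longrightarrow> lt_mult S u (\<pi>\<^sup>2) x = 0 \<Longrightarrow> x \<in> lt_torsion S u"
  using r by (auto simp: lt_torsion_def intro: less_le_trans[of 0 "ereal \<rho>"])

lemma lt_torsion_comb:
  assumes "X \<in> lt_torsion S u" "Y \<in> lt_torsion S u" "ge \<rho> X" "ge \<rho> Y" "a \<in> OF S" "b \<in> OF S"
  shows "lt_add S u (lt_mult S u a X) (lt_mult S u b Y) \<in> lt_torsion S u"
proof (rule lt_torsionI)
  show "ge \<rho> (lt_add S u (lt_mult S u a X) (lt_mult S u b Y))" by (rule lt_comb_ge[OF assms(5,6,3,4)])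
  have p: "\<pi>\<^sup>2 \<in> OF S" by (intro OF_power OF_pi)
  have "lt_mult S u (\<pi>\<^sup>2 * a) X = 0" "lt_mult S u (\<pi>\<^sup>2 * b) Y = 0"
    using mult_lt_mult[OF u r assms(5) p assms(3)] mult_lt_mult[OF u r assms(6) p assms(4)] assms
    by (simp_all add: mult.commute lt_torsion_def lt_mult_zero_right)
  then show "lt_mult S u (\<pi>\<^sup>2) (lt_add S u (lt_mult S u a X) (lt_mult S u b Y)) = 0"
    unfolding lt_comb_mult[OF assms(5,6) p assms(3,4)] using lt_add_0[OF u r, of 0] by simp
qed

lemma lt_mult_cong_pi2:
  assumes "X \<in> lt_torsion S u" "ge \<rho> X" "b \<in> OF S" "cong_pi2 S a b"
  shows "lt_mult S u a X = lt_mult S u b X"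
proof -
  obtain c where c: "c \<in> OF S" "a - b = \<pi>\<^sup>2 * c" using assms by (auto simp: cong_pi2_def)
  then have a: "a = b + c * \<pi>\<^sup>2" by (simp add: algebra_simps)
  have p: "\<pi>\<^sup>2 \<in> OF S" by (intro OF_power OF_pi)
  have "lt_mult S u (c * \<pi>\<^sup>2) X = 0"
    using mult_lt_mult[OF u r c(1) p assms(2)] assms c by (simp add: lt_torsion_def lt_mult_zero_right)
  then show ?thesis unfolding a
    using add_lt_mult[OF u r assms(3) OF_mult[OF c(1) p] assms(2)] lt_add_0[OF u r lt_mult_ge[OF u r assms(3,2)]] by simp
qed

text \<open>For an inverse h of g modulo \<pi>^2, the coefficients of a torsion point in the new
  basis are h applied to the old ones, and h also recovers a relation's coefficients from those in
  the old basis. Congruence modulo \<pi>^2 suffices because \<pi>^2 annihilates the torsion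
  points.\<close>

lemma lt_basis_act:
  assumes B: "lt_basis S u X Y" and X: "ge \<rho> X" and Y: "ge \<rho> Y" and g: "g \<in> G2F S"
  shows "lt_basis S u (lt_add S u (lt_mult S u (g $ 1 $ 1) X) (lt_mult S u (g $ 2 $ 1) Y))
    (lt_add S u (lt_mult S u (g $ 1 $ 2) X) (lt_mult S u (g $ 2 $ 2) Y))"
proof -
  define a b c d where "a = g $ 1 $ 1" and "b = g $ 1 $ 2" and "c = g $ 2 $ 1" and "d = g $ 2 $ 2"
  obtain h where h: "integral_matrix S h"
    "\<And>i j. cong_pi2 S ((g ** h) $ i $ j) (mat 1 $ i $ j)" "\<And>i j. cong_pi2 S ((h ** g) $ i $ j) (mat 1 $ i $ j)"
    using g by (auto simp: G2F_def)
  define a' b' c' d' where "a' = h $ 1 $ 1" and "b' = h $ 1 $ 2" and "c' = h $ 2 $ 1" and "d' = h $ 2 $ 2"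
  have int: "a \<in> OF S" "b \<in> OF S" "c \<in> OF S" "d \<in> OF S" "a' \<in> OF S" "b' \<in> OF S" "c' \<in> OF S" "d' \<in> OF S"
    using g h(1) by (auto simp: a_def b_def c_def d_def a'_def b'_def c'_def d'_def G2F_def integral_matrix_def)
  have gh: "cong_pi2 S (a * a' + b * c') 1" "cong_pi2 S (a * b' + b * d') 0"
    "cong_pi2 S (c * a' + d * c') 0" "cong_pi2 S (c * b' + d * d') 1"
    using h(2)[of 1 1] h(2)[of 1 2] h(2)[of 2 1] h(2)[of 2 2]
    by (simp_all add: matrix_matrix_mult_def mat_def sum_2 a_def b_def c_def d_def a'_def b'_def c'_def d'_def)
  have hg: "cong_pi2 S (a' * a + b' * c) 1" "cong_pi2 S (a' * b + b' * d) 0"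
    "cong_pi2 S (c' * a + d' * c) 0" "cong_pi2 S (c' * b + d' * d) 1"
    using h(3)[of 1 1] h(3)[of 1 2] h(3)[of 2 1] h(3)[of 2 2]
    by (simp_all add: matrix_matrix_mult_def mat_def sum_2 a_def b_def c_def d_def a'_def b'_def c'_def d'_def)
  have lin: "cong_pi2 S (x * s + y * t) (p * s + o' * t)"
    if C: "cong_pi2 S x p" "cong_pi2 S y o'" "s \<in> OF S" "t \<in> OF S" for x y p o' s t
  proof -
    obtain w z where w: "w \<in> OF S" "x - p = \<pi>\<^sup>2 * w" and z: "z \<in> OF S" "y - o' = \<pi>\<^sup>2 * z"
      using C(1,2) unfolding cong_pi2_def by blast
    have "(x * s + y * t) - (p * s + o' * t) = (x - p) * s + (y - o') * t" by (simp add: algebra_simps)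
    also have "\<dots> = \<pi>\<^sup>2 * (w * s + z * t)" unfolding w(2) z(2) by (simp add: algebra_simps)
    finally show ?thesis unfolding cong_pi2_def
      using OF_add[OF OF_mult[OF w(1) C(3)] OF_mult[OF z(1) C(4)]] by blast
  qed
  define X' Y' where "X' = lt_add S u (lt_mult S u a X) (lt_mult S u c Y)" and "Y' = lt_add S u (lt_mult S u b X) (lt_mult S u d Y)"
  have T: "X \<in> lt_torsion S u" "Y \<in> lt_torsion S u" using B by (auto simp: lt_basis_def)
  have comb: "lt_add S u (lt_mult S u p X') (lt_mult S u t Y')
      = lt_add S u (lt_mult S u (p * a + t * b) X) (lt_mult S u (p * c + t * d) Y)"
    if "p \<in> OF S" "t \<in> OF S" for p t
    unfolding X'_def Y'_def by (rule lt_comb_comb) (use int that X Y in auto)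
  have "lt_basis S u X' Y'" unfolding lt_basis_def
  proof (intro conjI ballI impI)
    show "X' \<in> lt_torsion S u" "Y' \<in> lt_torsion S u"
      unfolding X'_def Y'_def by (intro lt_torsion_comb T X Y int)+
  next
    fix z assume "z \<in> lt_torsion S u"
    then obtain \<alpha> \<beta> where z: "\<alpha> \<in> OF S" "\<beta> \<in> OF S" "z = lt_add S u (lt_mult S u \<alpha> X) (lt_mult S u \<beta> Y)"
      using B unfolding lt_basis_def by blast
    define p t where "p = a' * \<alpha> + b' * \<beta>" and "t = c' * \<alpha> + d' * \<beta>"
    have pt: "p \<in> OF S" "t \<in> OF S" unfolding p_def t_def by (intro OF_add OF_mult int z)+
    have e: "p * a + t * b = (a * a' + b * c') * \<alpha> + (a * b' + b * d') * \<beta>"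
      "p * c + t * d = (c * a' + d * c') * \<alpha> + (c * b' + d * d') * \<beta>"
      by (simp_all add: p_def t_def algebra_simps)
    have "cong_pi2 S (p * a + t * b) \<alpha>" "cong_pi2 S (p * c + t * d) \<beta>"
      using lin[OF gh(1,2) z(1,2)] lin[OF gh(3,4) z(1,2)] unfolding e by simp_all
    then have "lt_add S u (lt_mult S u p X') (lt_mult S u t Y') = z"
      unfolding comb[OF pt] z(3) using lt_mult_cong_pi2 T X Y z by simp
    then show "\<exists>p\<in>OF S. \<exists>t\<in>OF S. z = lt_add S u (lt_mult S u p X') (lt_mult S u t Y')" using pt by blast
  next
    fix p t assume pt: "p \<in> OF S" "t \<in> OF S" and 0: "lt_add S u (lt_mult S u p X') (lt_mult S u t Y') = 0"
    have "p * a + t * b \<in> OF S" "p * c + t * d \<in> OF S" by (intro OF_add OF_mult int pt)+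
    then have c0: "cong_pi2 S (p * a + t * b) 0" "cong_pi2 S (p * c + t * d) 0"
      using B 0 unfolding comb[OF pt] lt_basis_def by blast+
    have tr: "cong_pi2 S x 0" if C: "cong_pi2 S z x" "cong_pi2 S z 0" for x z
    proof -
      obtain w w' where w: "w \<in> OF S" "z - x = \<pi>\<^sup>2 * w" "w' \<in> OF S" "z - 0 = \<pi>\<^sup>2 * w'"
        using C unfolding cong_pi2_def by blast
      have "x - 0 = (z - 0) - (z - x)" by simp
      also have "\<dots> = \<pi>\<^sup>2 * (w' - w)" unfolding w by (simp add: algebra_simps)
      finally show ?thesis unfolding cong_pi2_def using OF_diff[OF w(3,1)] by blast
    qed
    have e: "(a' * a + b' * c) * p + (a' * b + b' * d) * t = (p * a + t * b) * a' + (p * c + t * d) * b'"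
      "(c' * a + d' * c) * p + (c' * b + d' * d) * t = (p * a + t * b) * c' + (p * c + t * d) * d'"
      by (simp_all add: algebra_simps)
    show "cong_pi2 S p 0"
      by (rule tr[of "(a' * a + b' * c) * p + (a' * b + b' * d) * t"])
         (use lin[OF hg(1,2) pt] lin[OF c0 int(5,6)] e in simp_all)
    show "cong_pi2 S t 0"
      by (rule tr[of "(c' * a + d' * c) * p + (c' * b + d' * d) * t"])
         (use lin[OF hg(3,4) pt] lin[OF c0 int(7,8)] e in simp_all)
  qed
  then show ?thesis unfolding X'_def Y'_def a_def b_def c_def d_def .
qed

end

lemma lt_act_curve: assumes "P \<in> lt_curve S" "g \<in> G2F S" shows "lt_act S g P \<in> lt_curve S"
proof -
  obtain X Y u where P: "P = (X, Y, u)" by (cases P) auto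
  have u: "0 < v u" and B: "lt_basis S u X Y" using assms(1) by (auto simp: P lt_curve_def)
  have "0 < v X" "0 < v Y" using B by (auto simp: lt_basis_def lt_torsion_def)
  then obtain \<rho> \<sigma> where \<rho>: "0 < \<rho>" "ge \<rho> X" "0 < \<sigma>" "ge \<sigma> Y" by (meson ge_positive)
  have "ge (min \<rho> \<sigma>) X" by (rule ge_mono[OF \<rho>(2)]) simp
  moreover have "ge (min \<rho> \<sigma>) Y" by (rule ge_mono[OF \<rho>(4)]) simp
  moreover have "ge 0 u" using u by (simp add: zero_ereal_def)
  ultimately show ?thesis using lt_basis_act[OF _ _ B _ _ assms(2), of "min \<rho> \<sigma>"] \<rho> u
    by (simp add: P lt_act_def lt_curve_def)
qed

lemma approximable_lt_add:
  assumes W: "bounded_coords W" and f: "approximable W f" "approximable W h" "approximable W U"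
    and \<rho>: "0 < \<rho>" "\<And>P. P \<in> W \<Longrightarrow> ge 0 (U P) \<and> ge \<rho> (f P) \<and> ge \<rho> (h P)"
  shows "approximable W (\<lambda>P. lt_add S (U P) (f P) (h P))"
proof (rule approximable_limit)
  fix N :: real
  obtain \<Phi> where \<Phi>: "\<Phi> \<in> intpoly" "\<forall>u x y. ge 0 u \<and> ge \<rho> x \<and> ge \<rho> y \<longrightarrow> ge N (lt_add S u x y - \<Phi> (u, x, y))"
    using lt_add_approx[of 0 \<rho> N] \<rho>(1) by auto
  then show "\<exists>g. approximable W g \<and> (\<forall>P\<in>W. ge N (lt_add S (U P) (f P) (h P) - g P))"
    using approximable_intpoly[OF W \<Phi>(1) f(3,1,2)] \<rho>(2) by (intro exI[of _ "\<lambda>P. \<Phi> (U P, f P, h P)"]) blast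
qed

lemma approximable_lt_mult:
  assumes W: "bounded_coords W" and f: "approximable W f" "approximable W U" and a: "a \<in> OF S"
    and \<rho>: "0 < \<rho>" "\<And>P. P \<in> W \<Longrightarrow> ge 0 (U P) \<and> ge \<rho> (f P)"
  shows "approximable W (\<lambda>P. lt_mult S (U P) a (f P))"
proof (rule approximable_limit)
  fix N :: real
  obtain \<Phi> where \<Phi>: "\<Phi> \<in> intpoly" "\<forall>u x. ge 0 u \<and> ge \<rho> x \<longrightarrow> ge N (lt_mult S u a x - \<Phi> (u, x, 0))"
    using lt_mult_approx[of 0 \<rho> a N] \<rho>(1) a by auto
  then show "\<exists>g. approximable W g \<and> (\<forall>P\<in>W. ge N (lt_mult S (U P) a (f P) - g P))"
    using approximable_intpoly[OF W \<Phi>(1) f(2,1) approximable_const[of W 0]] \<rho>(2)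
    by (intro exI[of _ "\<lambda>P. \<Phi> (U P, f P, 0)"]) blast
qed

lemma approximable_lt_act:
  assumes W: "bounded_coords W" and g: "integral_matrix S g"
    and \<rho>: "0 < \<rho>" "\<And>X Y u. (X, Y, u) \<in> W \<Longrightarrow> ge 0 u \<and> ge \<rho> X \<and> ge \<rho> Y"
  shows "approximable W (\<lambda>P. fst (lt_act S g P))" "approximable W (\<lambda>P. fst (snd (lt_act S g P)))"
    "approximable W (\<lambda>P. snd (snd (lt_act S g P)))"
proof -
  have X: "approximable W (\<lambda>(X, Y, u). X)" and Y: "approximable W (\<lambda>(X, Y, u). Y)" and u: "approximable W (\<lambda>(X, Y, u). u)"
    by (rule approximable_rational, rule rational_functions.intros)+
  have \<rho>': "ge 0 (snd (snd P)) \<and> ge \<rho> (fst P) \<and> ge \<rho> (fst (snd P))" if "P \<in> W" for P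
    using \<rho>(2)[of "fst P" "fst (snd P)" "snd (snd P)"] that by simp
  have OF: "vec_nth (vec_nth g j) k \<in> OF S" for j k using g by (simp add: integral_matrix_def)
  have comb: "approximable W (\<lambda>P. lt_add S (snd (snd P)) (lt_mult S (snd (snd P)) a (fst P)) (lt_mult S (snd (snd P)) b (fst (snd P))))"
    if "a \<in> OF S" "b \<in> OF S" for a b
    by (intro approximable_lt_add[OF W, of _ _ _ \<rho>] approximable_lt_mult[OF W, of _ _ _ \<rho>] that \<rho>(1)
          X[unfolded case_prod_unfold] Y[unfolded case_prod_unfold] u[unfolded case_prod_unfold])
       (use \<rho>' lt_mult_ge[OF _ \<rho>(1)] that in auto)
  show "approximable W (\<lambda>P. fst (lt_act S g P))" "approximable W (\<lambda>P. fst (snd (lt_act S g P)))"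
    using comb OF by (simp_all add: lt_act_def case_prod_unfold)
  show "approximable W (\<lambda>P. snd (snd (lt_act S g P)))"
    using u by (simp add: lt_act_def case_prod_unfold)
qed

lemma cong_pi2_br: assumes "cong_pi2 S x c" "ge 0 c" shows "br x = br c"
proof -
  obtain e where e: "e \<in> OF S" "x - c = \<pi>\<^sup>2 * e" using assms(1) by (auto simp: cong_pi2_def)
  have "v (\<pi>\<^sup>2) = ereal 2" using v_power[OF v_pi', of 2] by simp
  then have "ge 2 (\<pi>\<^sup>2)" by simp
  from ge_mult_left[OF this OF_ge[OF e(1)]] have "cg 2 x c" by (simp add: cg_def e(2))
  then show ?thesis by (rule br_cg) (use assms in auto)
qed

end

subsection \<open>The rescaled valuation\<close>

locale lt_dat =
  fixes S :: "('c::field, 'k::field) lt_data"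
  assumes dat_ax: "lt_data_axioms S"
begin

sublocale lt_fld S
  using dat_ax by unfold_locales (simp add: lt_data_axioms_def)

abbreviation "\<kappa> \<equiv> kappa1 S"

text \<open>The valuation of \<pi> in the scale in which \<open>kappa1 S\<close> has valuation
  1.\<close>

definition scl :: real where "scl = 2 * real q ^ 4 * (real q - 1)"

lemma scl_pos: "0 < scl"
  using q_ge_3 by (simp add: scl_def)

definition sv :: "'c \<Rightarrow> ereal" where "sv x = ereal scl * v x"

lemma sv_zero: "sv 0 = \<infinity>"
  using scl_pos by (simp add: sv_def)

lemma sv_real: "v x = ereal r \<Longrightarrow> sv x = ereal (scl * r)"
  by (simp add: sv_def)

lemma sv_iff: "sv x = ereal r \<longleftrightarrow> v x = ereal (r / scl)"
proof (cases "x = 0")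
  case False
  then obtain s where s: "v x = ereal s" by (rule v_real)
  then show ?thesis using scl_pos by (auto simp: sv_real field_simps)
qed (simp add: sv_zero)

lemma sv_ge_iff: "ereal r \<le> sv x \<longleftrightarrow> ge (r / scl) x"
proof (cases "x = 0")
  case False
  then obtain s where s: "v x = ereal s" by (rule v_real)
  then show ?thesis using scl_pos by (auto simp: sv_real field_simps)
qed (simp add: sv_zero)

lemma sv_0_iff: "sv x = 0 \<longleftrightarrow> v x = 0"
  using sv_iff[of x 0] by (simp add: zero_ereal_def)

text \<open>With the rescaled valuation as a second instance every congruence lemma is available for
  both scales; \<open>sc_cg_iff\<close> and \<open>sv_ge_iff\<close> translate between them.\<close>

sublocale sc: valued sv
proof
  show "is_valuation sv" unfolding is_valuation_def
  proof (intro conjI allI)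
    show inf: "(sv x = \<infinity>) = (x = 0)" for x
      by (cases "x = 0") (auto simp: sv_zero elim!: v_real simp: sv_real)
    show "sv x \<noteq> - \<infinity>" for x
      by (cases "x = 0") (auto simp: sv_zero elim!: v_real simp: sv_real)
    fix x y
    show "sv (x * y) = sv x + sv y"
    proof (cases "x = 0 \<or> y = 0")
      case True
      then show ?thesis using \<open>\<And>x. sv x \<noteq> - \<infinity>\<close> by (auto simp: sv_zero)
    next
      case False
      then obtain r s where "v x = ereal r" "v y = ereal s" by (meson v_real)
      then show ?thesis by (simp add: sv_real v_prod distrib_left)
    qed
    have "ereal scl * min (v x) (v y) \<le> ereal scl * v (x + y)"
      using scl_pos by (intro ereal_mult_left_mono v_add) simp
    moreover have "min (sv x) (sv y) = ereal scl * min (v x) (v y)"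
      using scl_pos ereal_mult_left_mono[of "v x" "v y" "ereal scl"] ereal_mult_left_mono[of "v y" "v x" "ereal scl"]
      by (auto simp: sv_def min_def intro: antisym)
    ultimately show "min (sv x) (sv y) \<le> sv (x + y)" by (simp add: sv_def)
  qed
qed

lemma sc_cg_iff: "sc.cg r x y \<longleftrightarrow> cg (r / scl) x y"
  by (simp add: sc.cg_def cg_def sv_ge_iff)

lemma sv_kappa: "sv \<kappa> = ereal 1"
proof -
  have "\<kappa> ^ (2 * q ^ 4 * (q - 1)) = \<pi>" using dat_ax by (simp add: lt_data_axioms_def)
  then have "v (\<kappa> ^ (2 * q ^ 4 * (q - 1))) = ereal (real (2 * q ^ 4 * (q - 1)) * (1 / scl))"
    using scl_pos q_ge_3 v_pi' by (simp add: scl_def of_nat_diff)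
  then have "v \<kappa> = ereal (1 / scl)" by (rule v_root[rotated]) (use q_ge_3 in simp)
  then show ?thesis by (simp add: sv_iff)
qed

sublocale sc: frob_valued sv q \<kappa>
proof
  show "3 \<le> q" by (rule q_ge_3)
  show "sv \<kappa> = ereal 1" by (rule sv_kappa)
  fix x y assume "sc.ge 0 x" "sc.ge 0 y"
  then show "sc.cg (2 * real q ^ 4 * (real q - 1)) ((x + y) ^ q) (x ^ q + y ^ q)"
    using frob0[of x 0 y] scl_pos unfolding sc_cg_iff by (simp add: sv_ge_iff flip: scl_def)
qed

text \<open>For these four fractional powers of \<gamma> the exponent of \<kappa>_1 is an integer,
  so the floor in \<open>gampow\<close> loses nothing.\<close>

lemma floor_gampow:
  "gampow S (1 / (of_nat q)\<^sup>2) = \<kappa> ^ ((q - 1)\<^sup>2)"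
  "gampow S (1 / of_nat q) = \<kappa> ^ (q * (q - 1)\<^sup>2)"
  "gampow S (1 / ((of_nat q)\<^sup>2 * (of_nat q - 1))) = \<kappa> ^ (q - 1)"
  "gampow S (- (2 * of_nat q / (of_nat q - 1))) = inverse (\<kappa> ^ (2 * q ^ 3 * (q - 1)))"
proof -
  obtain p where p: "q = Suc p" "p \<noteq> 0" using q_ge_3 by (cases q) auto
  have e: "\<lfloor>(of_nat n :: rat)\<rfloor> = int n" "\<lfloor>- (of_nat n :: rat)\<rfloor> = - int n" for n
    by (simp_all add: floor_minus)
  have q0: "(of_nat q :: rat) \<noteq> 0" "(of_nat q - 1 :: rat) = of_nat p" "(of_nat p :: rat) \<noteq> 0" "q - 1 = p" using p by auto
  have "1 / (of_nat q)\<^sup>2 * (of_nat q)\<^sup>2 * (of_nat q - 1)\<^sup>2 = (of_nat ((q - 1)\<^sup>2) :: rat)"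
    "1 / of_nat q * (of_nat q)\<^sup>2 * (of_nat q - 1)\<^sup>2 = (of_nat (q * (q - 1)\<^sup>2) :: rat)"
    "1 / ((of_nat q)\<^sup>2 * (of_nat q - 1)) * (of_nat q)\<^sup>2 * (of_nat q - 1)\<^sup>2 = (of_nat (q - 1) :: rat)"
    "- (2 * of_nat q / (of_nat q - 1)) * (of_nat q)\<^sup>2 * (of_nat q - 1)\<^sup>2 = (- of_nat (2 * q ^ 3 * (q - 1)) :: rat)"
    unfolding q0(2,4) using q0(1,3) by (simp_all add: field_simps power2_eq_square power3_eq_cube)
  then show "gampow S (1 / (of_nat q)\<^sup>2) = \<kappa> ^ ((q - 1)\<^sup>2)"
  "gampow S (1 / of_nat q) = \<kappa> ^ (q * (q - 1)\<^sup>2)"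
  "gampow S (1 / ((of_nat q)\<^sup>2 * (of_nat q - 1))) = \<kappa> ^ (q - 1)"
  "gampow S (- (2 * of_nat q / (of_nat q - 1))) = inverse (\<kappa> ^ (2 * q ^ 3 * (q - 1)))"
    unfolding gampow_def by (simp_all only: e power_int_of_nat power_int_minus)
qed

lemma kappa_gam: "kappa S = \<kappa> ^ q" "kappa S ^ q = \<kappa> ^ (q\<^sup>2)" "gam S = \<kappa> ^ (q\<^sup>2 * (q - 1)\<^sup>2)"
  by (simp_all add: kappa_def gam_def power2_eq_square mult.assoc flip: power_mult)

lemma gamma0_eq: "gamma0 S ^ q - \<kappa> ^ (2 * q ^ 3 * (q - 1)\<^sup>2) * gamma0 S = 1"
proof -
  have "gam S ^ (2 * q) = \<kappa> ^ (2 * q ^ 3 * (q - 1)\<^sup>2)"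
    unfolding kappa_gam by (simp add: power2_eq_square power3_eq_cube mult_ac flip: power_mult)
  then show ?thesis using dat_ax by (simp add: lt_data_axioms_def)
qed

lemma theta_eq: "theta S ^ q = gamma0 S"
  using dat_ax by (simp add: lt_data_axioms_def)

subsection \<open>The point \<open>y\<^sub>0\<close>\<close>

lemma iota: "iota_of S yb \<in> {1, -1}"
  by (simp add: iota_of_def)

lemma iota_facts: "(iota_of S yb)\<^sup>2 = 1" "v (iota_of S yb) = 0"
  using iota[of yb] by auto

lemma br_iota: assumes "yb ^ (2 * (q\<^sup>2 - 1)) = 1" shows "br (iota_of S yb) = yb ^ (q\<^sup>2 - 1)"
proof -
  have "(yb ^ (q\<^sup>2 - 1))\<^sup>2 = 1" using assms by (simp add: mult.commute flip: power_mult)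
  then show ?thesis by (auto simp: iota_of_def power2_eq_1_iff br_minus)
qed

lemma delta_sqrt:
  obtains r where "principal_sqrt S (1 + gampow S (1 / (of_nat q)\<^sup>2) * delta S (iota_of S yb)) r"
    "delta S (iota_of S yb) ^ q = 2 * iota_of S yb * r"
  using dat_ax iota[of yb] unfolding lt_data_axioms_def by blast

text \<open>Otherwise r' = -r, and then -2 = (r - 1) + (r' - 1) would have positive valuation
  although the residue characteristic is odd.\<close>

lemma sqrt_unique: assumes "principal_sqrt S w r" "principal_sqrt S w r'" shows "r = r'"
proof (rule ccontr)
  assume "r \<noteq> r'"
  moreover have "r\<^sup>2 = r'\<^sup>2" using assms by (simp add: principal_sqrt_def)
  ultimately have r': "r' = - r" by (auto simp: power2_eq_iff)
  have "0 < v (r - 1)" "0 < v (r' - 1)" using assms by (auto simp: principal_sqrt_def)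
  then have "0 < min (v (r - 1)) (v (r' - 1))" by simp
  also have "\<dots> \<le> v ((r - 1) + (r' - 1))" by (rule v_add)
  also have "(r - 1) + (r' - 1) = - 2" unfolding r' by simp
  finally show False using v_two by simp
qed

lemma sqrt_unit: assumes "principal_sqrt S w r" shows "v r = 0" "br r = 1"
proof -
  have p: "0 < v (r - 1)" using assms by (simp add: principal_sqrt_def)
  then obtain e where e: "0 < e" "ge e (r - 1)" by (rule ge_positive)
  then have "cg e r 1" by (simp add: cg_def)
  then show "v r = 0" "br r = 1" using cg_unit[of e r 1] br_cg[of e r 1] e by auto
qed

text \<open>One q-th power already gains: the mixed terms 1 through \<pi>, and (x - y)^q at least r,
  which is at least \<rho>. The second q-th power preserves the bound. In contrast to
  \<open>frob_cg\<close>, any positive radius parameter is allowed.\<close>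

lemma frob_contract:
  assumes "0 < \<rho>" "\<rho> \<le> r" "cg r x y" "ge 0 y"
  shows "cg (r + min 1 \<rho>) (x ^ (q\<^sup>2)) (y ^ (q\<^sup>2))"
proof -
  let ?s = "r + min 1 \<rho>"
  have s: "0 \<le> ?s" "0 \<le> r" using assms by auto
  have d: "ge r (x - y)" using assms by (simp add: cg_def)
  have "cg (1 + r) ((y + (x - y)) ^ q) (y ^ q + (x - y) ^ q)" by (rule frob0[OF assms(4) d s(2)])
  then have "cg (1 + r) (x ^ q) (y ^ q + (x - y) ^ q)" by simp
  then have "cg ?s (x ^ q) (y ^ q + (x - y) ^ q)" by (rule cg_mono) simp
  also have "cg ?s (y ^ q + (x - y) ^ q) (y ^ q)"
  proof -
    have "2 * r \<le> real q * r" using q_ge_3 s by (intro mult_right_mono) auto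
    moreover have "?s \<le> 2 * r" using assms(2) by simp
    ultimately have "?s \<le> real q * r" by linarith
    then have "ge ?s ((x - y) ^ q)" by (rule ge_mono[OF ge_power[OF d]])
    then show ?thesis by (simp add: cg_def)
  qed
  finally have c: "cg ?s (x ^ q) (y ^ q)" .
  have "ge 0 (y ^ q)" by (rule ge_power0[OF assms(4)])
  moreover have "ge 0 (x ^ q)" by (rule cg_ge'[OF c calculation s(1)])
  ultimately have "cg ?s ((x ^ q) ^ q) ((y ^ q) ^ q)" by (intro cg_power c)
  then show ?thesis by (simp add: power2_eq_square power_mult)
qed

lemma power_q2: "z ^ (q\<^sup>2) = z ^ (q\<^sup>2 - 1) * (z :: 'x :: monoid_mult)"
proof -
  have "0 < q\<^sup>2" using q_ge_3 by simp
  then show ?thesis by (metis power_minus_mult)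
qed

text \<open>A form of Hensel's lemma by iteration: y to y^(q^2)/c maps the residue disc of
  \<open>yb\<close> to itself and contracts it, and a nonzero fixed point satisfies y^(q^2-1) =
  c.\<close>

lemma root_exists:
  assumes c: "v c = 0" "br c = yb ^ (q\<^sup>2 - 1)" and yb: "yb \<noteq> 0"
  shows "\<exists>y. ge 0 y \<and> br y = yb \<and> y ^ (q\<^sup>2 - 1) = c"
proof -
  have c0: "c \<noteq> 0" using c by auto
  have ic: "ge 0 (inverse c)" using v_inverse[of c 0] c by (simp add: zero_ereal_def)
  obtain y1 where y1: "ge 0 y1" "br y1 = yb" using br_surj by blast
  define Y where "Y = rec_nat y1 (\<lambda>_ y. inverse c * y ^ (q\<^sup>2))"
  have Y0: "Y 0 = y1" and YS: "\<And>n. Y (Suc n) = inverse c * Y n ^ (q\<^sup>2)" by (simp_all add: Y_def)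
  have Yint: "ge 0 (Y n)" and Ybr: "br (Y n) = yb" for n
  proof (induction n)
    case (Suc n)
    { case 1 show ?case unfolding YS by (intro ge_mult_left ic ge_power0 Suc) }
    { case 2
      have "br (Y (Suc n)) = inverse (br c) * br (Y n) ^ (q\<^sup>2)"
        unfolding YS using ic Suc c by (simp add: br_mult br_power ge_power0 br_inverse)
      also have "\<dots> = yb" unfolding c(2) Suc unfolding power_q2 using yb by simp
      finally show ?case . }
  qed (simp_all add: Y0 y1)
  have "0 < v (Y 1 - Y 0)" using br_eq_iff[OF Yint Yint, of 1 0] Ybr by simp
  then obtain \<rho> where \<rho>: "0 < \<rho>" "ge \<rho> (Y 1 - Y 0)" by (rule ge_positive)
  define \<delta> where "\<delta> = min 1 \<rho>"
  have \<delta>: "0 < \<delta>" using \<rho> by (simp add: \<delta>_def)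
  have st: "cg (\<rho> + \<delta> * real n) (Y (Suc n)) (Y n)" for n
  proof (induction n)
    case 0
    then show ?case using \<rho> by (simp add: cg_def)
  next
    case (Suc n)
    have "cg (\<rho> + \<delta> * real n + min 1 \<rho>) (Y (Suc n) ^ (q\<^sup>2)) (Y n ^ (q\<^sup>2))"
      by (rule frob_contract[OF \<rho>(1) _ Suc Yint]) (use \<delta> in simp)
    then have "cg (\<rho> + \<delta> * real n + min 1 \<rho>) (inverse c * Y (Suc n) ^ (q\<^sup>2)) (inverse c * Y n ^ (q\<^sup>2))"
      by (rule cg_mult_left'[OF _ ic]) simp
    moreover have "\<rho> + \<delta> * real n + min 1 \<rho> = \<rho> + \<delta> * real (Suc n)" by (simp add: \<delta>_def algebra_simps)
    ultimately show ?case by (simp only: YS)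
  qed
  have "vcauchy v Y"
    by (rule vcauchy_of_steps[OF \<delta>]) (use st in \<open>simp add: cg_def\<close>)
  then obtain l where l: "vtends v Y l" using vcomplete_C by blast
  have il: "ge 0 l" by (rule vtends_ge[OF l]) (simp add: Yint)
  have "vtends v (\<lambda>n. Y (Suc n)) (inverse c * l ^ (q\<^sup>2))" unfolding YS
  proof (rule vtends_mult_const, unfold vtends_def, rule allI)
    fix N :: real
    have "\<forall>\<^sub>F n in sequentially. ge N (Y n - l)" using l by (auto simp: vtends_def)
    then show "\<forall>\<^sub>F n in sequentially. ge N (Y n ^ (q\<^sup>2) - l ^ (q\<^sup>2))"
    proof (rule eventually_mono)
      fix n assume "ge N (Y n - l)"
      then show "ge N (Y n ^ (q\<^sup>2) - l ^ (q\<^sup>2))" using cg_power[of N "Y n" l "q\<^sup>2"] Yint il by (simp add: cg_def)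
    qed
  qed
  then have fx: "inverse c * l ^ (q\<^sup>2) = l" using vtends_Suc[OF l] by (rule vtends_unique)
  have "vtends v (\<lambda>n. Y n - y1) (l - y1)" by (rule vtends_diff[OF l vtends_const])
  moreover have "ge \<rho> (Y n - y1)" for n
  proof (induction n)
    case (Suc n)
    have "ge \<rho> (Y (Suc n) - Y n)" by (rule ge_mono[OF st[unfolded cg_def]]) (use \<delta> in simp)
    from ge_add[OF this Suc] show ?case by simp
  qed (simp add: Y0)
  ultimately have "ge \<rho> (l - y1)" by (intro vtends_ge) auto
  then have brl: "br l = yb" using br_cg[of \<rho> l y1] \<rho> y1 by (simp add: cg_def)
  then have l0: "l \<noteq> 0" using yb by auto
  have "l ^ (q\<^sup>2) = c * l" using fx c0 by (simp add: field_simps)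
  then have "l ^ (q\<^sup>2 - 1) * l = c * l" by (simp only: power_q2)
  then have "l ^ (q\<^sup>2 - 1) = c" using l0 by simp
  then show ?thesis using il brl by blast
qed

text \<open>Both roots are fixed points of the contraction y^(q^2)/c in the same residue
  disc.\<close>

lemma root_unique:
  assumes c: "v c = 0" and y: "ge 0 y" "y ^ (q\<^sup>2 - 1) = c" "ge 0 y'" "y' ^ (q\<^sup>2 - 1) = c" "br y = br y'"
  shows "y = y'"
proof -
  have ic: "ge 0 (inverse c)" using v_inverse[of c 0] c by (simp add: zero_ereal_def)
  have c0: "c \<noteq> 0" using c by auto
  have f: "y = inverse c * y ^ (q\<^sup>2)" "y' = inverse c * y' ^ (q\<^sup>2)"
    unfolding power_q2 y(2,4) using c0 by simp_all
  have "0 < v (y - y')" using br_eq_iff[OF y(1,3)] y(5) by simp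
  then obtain \<rho> where \<rho>: "0 < \<rho>" "ge \<rho> (y - y')" by (rule ge_positive)
  have "y - y' = 0"
  proof (rule zero_if_ge_increase[of "min 1 \<rho>" \<rho>])
    fix s assume s: "ge s (y - y')" "\<rho> \<le> s"
    have "cg (s + min 1 \<rho>) (y ^ (q\<^sup>2)) (y' ^ (q\<^sup>2))"
      by (rule frob_contract[OF \<rho>(1) s(2) _ y(3)]) (use s in \<open>simp add: cg_def\<close>)
    then have "cg (s + min 1 \<rho>) (inverse c * y ^ (q\<^sup>2)) (inverse c * y' ^ (q\<^sup>2))"
      by (rule cg_mult_left'[OF _ ic]) simp
    then show "ge (s + min 1 \<rho>) (y - y')" unfolding f[symmetric] cg_def .
  qed (use \<rho> in auto)
  then show ?thesis by simp
qed

lemma sqrt_inverse: assumes "principal_sqrt S z r"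
  shows "v (inverse r) = 0" "ge 0 (inverse r)" "v (iota_of S yb * inverse r) = 0"
proof -
  have "v r = ereal 0" using sqrt_unit(1)[OF assms] by (simp add: zero_ereal_def)
  from v_inverse[OF this] show v: "v (inverse r) = 0" by (simp add: zero_ereal_def)
  then show "ge 0 (inverse r)" by (simp add: zero_ereal_def)
  show "v (iota_of S yb * inverse r) = 0" unfolding v_mult v iota_facts(2) by simp
qed

text \<open>Evaluates the definite description of y0: the principal square root is unique, so the
  equation is determined, and the residue class isolates one of its roots.\<close>

lemma y0_ex1:
  assumes yb: "yb ^ (2 * (q\<^sup>2 - 1)) = 1"
    and r: "principal_sqrt S (1 + gampow S (1 / (of_nat q)\<^sup>2) * delta S (iota_of S yb)) r"
    and y: "ge 0 y" "br y = yb" "y ^ (q\<^sup>2 - 1) = iota_of S yb * inverse r"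
  shows "y0_of S yb = y"
  unfolding y0_of_def
proof (rule the_equality)
  show "0 \<le> v y \<and> br y = yb \<and> (\<exists>r. principal_sqrt S (1 + gampow S (1 / (of_nat q)\<^sup>2) * delta S (iota_of S yb)) r \<and>
      y ^ (q\<^sup>2 - 1) = iota_of S yb * inverse r)" using y r by (auto simp: zero_ereal_def)
  fix y' assume *: "0 \<le> v y' \<and> br y' = yb \<and> (\<exists>r. principal_sqrt S (1 + gampow S (1 / (of_nat q)\<^sup>2) * delta S (iota_of S yb)) r \<and>
      y' ^ (q\<^sup>2 - 1) = iota_of S yb * inverse r)"
  then obtain r' where r': "principal_sqrt S (1 + gampow S (1 / (of_nat q)\<^sup>2) * delta S (iota_of S yb)) r'"
    "y' ^ (q\<^sup>2 - 1) = iota_of S yb * inverse r'" by blast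
  have "r' = r" by (rule sqrt_unique[OF r'(1) r])
  then have e: "y' ^ (q\<^sup>2 - 1) = iota_of S yb * inverse r" using r'(2) by (simp only:)
  have g: "ge 0 y'" "br y' = br y" using * y(2) by (simp_all add: zero_ereal_def)
  show "y' = y" by (rule root_unique[OF sqrt_inverse(3)[OF r] g(1) e y(1,3) g(2)])
qed

lemma y0_facts:
  assumes yb: "yb ^ (2 * (q\<^sup>2 - 1)) = 1"
  obtains r where "principal_sqrt S (1 + gampow S (1 / (of_nat q)\<^sup>2) * delta S (iota_of S yb)) r"
    "delta S (iota_of S yb) ^ q = 2 * iota_of S yb * r" "v (y0_of S yb) = 0" "br (y0_of S yb) = yb"
    "y0_of S yb ^ (q\<^sup>2 - 1) = iota_of S yb * inverse r"
proof -
  obtain r where r: "principal_sqrt S (1 + gampow S (1 / (of_nat q)\<^sup>2) * delta S (iota_of S yb)) r"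
    "delta S (iota_of S yb) ^ q = 2 * iota_of S yb * r" by (rule delta_sqrt)
  have q2: "0 < q\<^sup>2 - 1"
  proof -
    have "3 * 3 \<le> q * q" using q_ge_3 by (intro mult_le_mono)
    then show ?thesis by (simp add: power2_eq_square)
  qed
  have yb0: "yb \<noteq> 0" using yb q2 by (auto simp: power_0_left)
  have ii: "ge 0 (iota_of S yb)" using iota_facts(2)[of yb] by (simp add: zero_ereal_def)
  have "br (iota_of S yb * inverse r) = br (iota_of S yb) * inverse (br r)"
    using br_mult[OF ii sqrt_inverse(2)[OF r(1)]] br_inverse[OF sqrt_unit(1)[OF r(1)]] by simp
  also have "\<dots> = yb ^ (q\<^sup>2 - 1)" unfolding sqrt_unit(2)[OF r(1)] br_iota[OF yb] by simp
  finally have "br (iota_of S yb * inverse r) = yb ^ (q\<^sup>2 - 1)" .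
  from root_exists[OF sqrt_inverse(3)[OF r(1)] this yb0] obtain y where y: "ge 0 y" "br y = yb" "y ^ (q\<^sup>2 - 1) = iota_of S yb * inverse r" by blast
  have y0: "y0_of S yb = y" by (rule y0_ex1[OF yb r(1) y])
  have "v y = 0" by (rule br_nonzero_iff[OF y(1), THEN iffD1]) (simp only: y(2) yb0 simp_thms)
  then show ?thesis by (intro that[OF r]) (simp_all only: y0 y)
qed

subsection \<open>Estimates on \<open>\<^bold>Z\<^bsub>1,1,0\<^esub>\<close>\<close>

abbreviation "Q \<equiv> real q"

lemma sc_lt_add_bound:
  assumes "0 \<le> \<mu>" "sc.ge \<mu> u" "0 < \<alpha>" "\<alpha> \<le> \<beta>" "sc.ge \<alpha> x" "sc.ge \<beta> y"
    "\<tau> \<le> \<beta> + \<mu>" "\<tau> \<le> \<beta> + (Q\<^sup>2 - 1) * \<alpha>"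
  shows "sc.cg \<tau> (lt_add S u x y) (x + y)" "sc.cg \<tau> (lt_add S u y x) (x + y)"
proof -
  have 1: "0 \<le> \<mu> / scl" "0 < \<alpha> / scl" "\<alpha> / scl \<le> \<beta> / scl" using assms scl_pos by (simp_all add: divide_right_mono)
  have 2: "\<tau> / scl \<le> \<beta> / scl + \<mu> / scl"
    using divide_right_mono[OF assms(7), of scl] scl_pos by (simp add: add_divide_distrib)
  have 3: "\<tau> / scl \<le> \<beta> / scl + (Q\<^sup>2 - 1) * (\<alpha> / scl)"
    using divide_right_mono[OF assms(8), of scl] scl_pos by (simp add: add_divide_distrib)
  show "sc.cg \<tau> (lt_add S u x y) (x + y)" "sc.cg \<tau> (lt_add S u y x) (x + y)"
    using lt_add_bound[OF 1(1) assms(2)[unfolded sv_ge_iff] 1(2,3) assms(5,6)[unfolded sv_ge_iff] 2 3]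
    by (simp_all only: sc_cg_iff)
qed

lemma sc_lt_mult_pi:
  assumes "0 \<le> \<mu>" "sc.ge \<mu> u" "0 < \<rho>" "sc.ge \<rho> x" "\<tau> \<le> scl + \<rho>" "\<tau> \<le> \<mu> + Q * \<rho>" "0 < \<tau>"
  shows "sc.cg \<tau> (lt_mult S u \<pi> x) (x ^ (q\<^sup>2))"
proof -
  have 1: "0 \<le> \<mu> / scl" "0 < \<rho> / scl" "0 < \<tau> / scl" using assms scl_pos by simp_all
  have 2: "\<tau> / scl \<le> 1 + \<rho> / scl" using divide_right_mono[OF assms(5), of scl] scl_pos by (simp add: add_divide_distrib)
  have 3: "\<tau> / scl \<le> \<mu> / scl + Q * (\<rho> / scl)"
    using divide_right_mono[OF assms(6), of scl] scl_pos by (simp add: add_divide_distrib)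
  show ?thesis
    using lt_mult_pi[OF 1(1) assms(2)[unfolded sv_ge_iff] 1(2) assms(4)[unfolded sv_ge_iff] 2 3 1(3)]
    by (simp only: sc_cg_iff)
qed

lemma Q_bounds:
  "3 \<le> Q" "1 \<le> Q" "Q \<le> Q\<^sup>2" "1 \<le> Q ^ 3" "Q\<^sup>2 \<le> Q ^ 3" "Q ^ 3 \<le> Q ^ 4" "Q ^ 3 + 1 \<le> Q ^ 4" "2 * Q ^ 4 \<le> Q ^ 4 * (Q - 1)"
  "Q ^ 3 + 1 \<le> Q ^ 3 + (Q\<^sup>2 - 1) * Q" "Q ^ 3 + 1 \<le> Q\<^sup>2 + (Q\<^sup>2 - 1) * Q" "Q ^ 4 + 1 \<le> Q ^ 3 + (Q\<^sup>2 - 1) * Q\<^sup>2"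
  "Q ^ 4 + 1 \<le> Q ^ 4 + (Q\<^sup>2 - 1) * Q\<^sup>2"
proof -
  define p where "p = Q - 3"
  have p: "0 \<le> p" "Q = p + 3" using q_ge_3 by (simp_all add: p_def)
  have n: "0 \<le> p ^ n" for n using p by simp
  note n' = n[of 1] n[of 2] n[of 3] n[of 4] n[of 5]
  show "3 \<le> Q" "1 \<le> Q" "Q \<le> Q\<^sup>2" "1 \<le> Q ^ 3" "Q\<^sup>2 \<le> Q ^ 3" "Q ^ 3 \<le> Q ^ 4" "Q ^ 3 + 1 \<le> Q ^ 4" "2 * Q ^ 4 \<le> Q ^ 4 * (Q - 1)"
  "Q ^ 3 + 1 \<le> Q ^ 3 + (Q\<^sup>2 - 1) * Q" "Q ^ 3 + 1 \<le> Q\<^sup>2 + (Q\<^sup>2 - 1) * Q" "Q ^ 4 + 1 \<le> Q ^ 3 + (Q\<^sup>2 - 1) * Q\<^sup>2"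
  "Q ^ 4 + 1 \<le> Q ^ 4 + (Q\<^sup>2 - 1) * Q\<^sup>2"
    unfolding p(2) using n' p(1) by (simp_all add: algebra_simps power2_eq_square power3_eq_cube power4_eq_xxxx eval_nat_numeral)
qed

lemma Z110_iff:
  "(X, Y, u) \<in> Z110 S \<longleftrightarrow> (X, Y, u) \<in> lt_curve S \<and> sv u = ereal (Q ^ 4 * (Q - 1)) \<and>
     sv (lt_mult S u \<pi> X) = ereal (Q ^ 4) \<and> sv X = ereal (Q\<^sup>2) \<and> sv (lt_mult S u \<pi> Y) = ereal (Q ^ 3) \<and> sv Y = ereal Q"
proof -
  have q: "Q \<noteq> 0" "Q - 1 \<noteq> 0" using Q_bounds(1) by auto
  have e: "1 / 2 = Q ^ 4 * (Q - 1) / scl" "1 / (2 * (Q - 1)) = Q ^ 4 / scl" "1 / (2 * Q\<^sup>2 * (Q - 1)) = Q\<^sup>2 / scl"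
    "1 / (2 * Q * (Q - 1)) = Q ^ 3 / scl" "1 / (2 * Q ^ 3 * (Q - 1)) = Q / scl"
    using q by (simp_all add: scl_def divide_simps) (simp_all add: eval_nat_numeral)
  show ?thesis unfolding Z110_def sv_iff e[symmetric]
    by (simp only: mem_Collect_eq Let_def case_prod_conv X1_of_def Y1_of_def)
qed

text \<open>The error is governed by \<pi>x and ux^q, of valuations at least \<open>scl\<close> + Q
  and Q^4(Q-1) + Q^2, both beyond Q^4.\<close>

lemma pi_torsion_approx:
  assumes "sv u = ereal (Q ^ 4 * (Q - 1))" "sc.ge Q x"
  shows "sc.cg (Q ^ 4 + 1) (lt_mult S u \<pi> x) (x ^ (q\<^sup>2))"
proof (rule sc_lt_mult_pi[where \<mu> = "Q ^ 4 * (Q - 1)" and \<rho> = Q])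
  have "scl = 2 * (Q ^ 4 * (Q - 1))" by (simp add: scl_def)
  then show "Q ^ 4 + 1 \<le> scl + Q" "Q ^ 4 + 1 \<le> Q ^ 4 * (Q - 1) + Q * Q" "0 \<le> Q ^ 4 * (Q - 1)" "0 < Q ^ 4 + 1"
    using Q_bounds(2,4,6,8) zero_le_square[of Q] by linarith+
qed (use assms Q_bounds(1) in auto)

text \<open>The conditions on X_1 and Y_1 in \<open>Z110\<close> thus follow from those on u, X_2
  and Y_2; this is how the image of a point under g is recognized.\<close>

lemma pi_torsion_val:
  assumes "sv u = ereal (Q ^ 4 * (Q - 1))"
  shows "sv x = ereal (Q\<^sup>2) \<Longrightarrow> sv (lt_mult S u \<pi> x) = ereal (Q ^ 4)"
    "sv x = ereal Q \<Longrightarrow> sv (lt_mult S u \<pi> x) = ereal (Q ^ 3)"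
proof -
  have *: "sv (lt_mult S u \<pi> x) = ereal s" if "sc.ge Q x" "sv (x ^ (q\<^sup>2)) = ereal s" "s \<le> Q ^ 4" for s
    using sc.v_add_dominant[OF that(2) pi_torsion_approx[OF assms that(1), unfolded sc.cg_def]] that(3) by simp
  show "sv (lt_mult S u \<pi> x) = ereal (Q ^ 4)" if "sv x = ereal (Q\<^sup>2)"
    using sc.v_power[OF that, of "q\<^sup>2"] that Q_bounds(3) by (intro *) (simp_all flip: power_add)
  show "sv (lt_mult S u \<pi> x) = ereal (Q ^ 3)" if "sv x = ereal Q"
    using sc.v_power[OF that, of "q\<^sup>2"] that Q_bounds(6) by (intro *) (simp_all add: power2_eq_square power3_eq_cube)
qed

lemma xc_eq: "xc S (X, Y, u) = X / \<kappa> ^ (q\<^sup>2)" "yc S (X, Y, u) = Y / \<kappa> ^ q"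
  unfolding xc_def yc_def kappa_gam(2) by (simp_all add: kappa_gam(1))

lemma Z110_units: assumes "P \<in> Z110 S" shows "sv (xc S P) = 0" "sv (yc S P) = 0"
proof -
  obtain X Y u where P: "P = (X, Y, u)" by (cases P) auto
  have "sv X = ereal (Q\<^sup>2)" "sv Y = ereal Q" using assms unfolding P Z110_iff by auto
  then show "sv (xc S P) = 0" "sv (yc S P) = 0"
    using sc.v_divide[OF _ sc.v_kpow[of "q\<^sup>2"], of X "Q\<^sup>2"] sc.v_divide[OF _ sc.v_kpow[of q], of Y Q]
    by (simp_all add: P xc_eq zero_ereal_def)
qed

text \<open>The kept terms have valuations at least Q^2, Q^3, Q^4 in X' and Q, Q^2, Q^3 in Y'. In
  each formal sum the summand with the smaller bound plays the role of \<alpha> in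
  \<open>sc_lt_add_bound\<close>, which then replaces it by an ordinary sum up to the required
  accuracy.\<close>

lemma act_expansion:
  assumes P: "(X, Y, u) \<in> Z110 S"
    and mu: "a0 \<in> mu0 S" "a1 \<in> mu0 S" "b0 \<in> mu0 S" "b1 \<in> mu0 S" "c1 \<in> mu0 S" "d0 \<in> mu0 S" "d1 \<in> mu0 S"
    and X': "X' = lt_add S u (lt_mult S u (a0 + a1 * \<pi>) X) (lt_mult S u (c1 * \<pi>) Y)"
    and Y': "Y' = lt_add S u (lt_mult S u (b0 + b1 * \<pi>) X) (lt_mult S u (d0 + d1 * \<pi>) Y)"
  shows "sc.cg (Q ^ 4 + 1) X' (a0 * X + c1 * Y ^ (q\<^sup>2) + a1 * X ^ (q\<^sup>2))"
    "sc.cg (Q ^ 3 + 1) Y' (d0 * Y + b0 * X + d1 * Y ^ (q\<^sup>2))"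
proof -
  let ?U = "Q ^ 4 * (Q - 1)"
  have su: "sv u = ereal ?U" and sX: "sv X = ereal (Q\<^sup>2)" and sY: "sv Y = ereal Q"
    using P unfolding Z110_iff by auto
  define X1 Y1 where "X1 = lt_mult S u \<pi> X" and "Y1 = lt_mult S u \<pi> Y"
  have sX1: "sv X1 = ereal (Q ^ 4)" and sY1: "sv Y1 = ereal (Q ^ 3)"
    unfolding X1_def Y1_def using pi_torsion_val[OF su] sX sY by auto
  have U: "0 \<le> ?U" "sc.ge ?U u" using su Q_bounds(1) by auto
  have u0: "ge 0 u" and \<rho>: "0 < Q / scl" "ge (Q / scl) X" "ge (Q / scl) Y"
    using U sX sY Q_bounds scl_pos by (auto simp: sv_ge_iff[symmetric] intro: sc.ge_mono[of ?U] simp flip: sv_ge_iff[of 0, simplified])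
  have mult: "lt_mult S u (e + f * \<pi>) z = lt_add S u (e * z) (f * lt_mult S u \<pi> z)" "lt_mult S u (f * \<pi>) z = f * lt_mult S u \<pi> z"
    if "e \<in> mu0 S" "f \<in> mu0 S" "ge (Q / scl) z" for e f z
  proof -
    note F = that(1)[THEN mu0_OF] that(2)[THEN mu0_OF]
    have 1: "lt_mult S u (f * \<pi>) z = lt_mult S u f (lt_mult S u \<pi> z)" by (rule mult_lt_mult[OF u0 \<rho>(1) F(2) OF_pi that(3)])
    also have "\<dots> = f * lt_mult S u \<pi> z" by (rule lt_mult_mu0[OF u0 \<rho>(1) that(2) lt_mult_ge[OF u0 \<rho>(1) OF_pi that(3)]])
    finally show 2: "lt_mult S u (f * \<pi>) z = f * lt_mult S u \<pi> z" .
    show "lt_mult S u (e + f * \<pi>) z = lt_add S u (e * z) (f * lt_mult S u \<pi> z)"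
      unfolding add_lt_mult[OF u0 \<rho>(1) F(1) OF_mult[OF F(2) OF_pi] that(3)] 2 lt_mult_mu0[OF u0 \<rho>(1) that(1,3)] ..
  qed
  have m: "sc.ge 0 a0" "sc.ge 0 a1" "sc.ge 0 b0" "sc.ge 0 b1" "sc.ge 0 c1" "sc.ge 0 d0" "sc.ge 0 d1"
    using mu mu0_ge by (auto simp: sv_ge_iff)
  have gX: "sc.ge (Q\<^sup>2) (e * X)" "sc.ge (Q ^ 4) (e * X1)" "sc.ge Q (e * Y)" "sc.ge (Q ^ 3) (e * Y1)" if "sc.ge 0 e" for e
    using sX sY sX1 sY1 by (auto intro: sc.ge_mult_right[OF that])
  have X1: "sc.cg (Q ^ 4 + 1) (e * X1) (e * X ^ (q\<^sup>2))" and Y1: "sc.cg (Q ^ 4 + 1) (e * Y1) (e * Y ^ (q\<^sup>2))" if "sc.ge 0 e" for e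
    unfolding X1_def Y1_def
    by (intro sc.cg_mult_left'[OF pi_torsion_approx[OF su] that]; use sX sY Q_bounds in auto)+
  define A where "A = lt_add S u (a0 * X) (a1 * X1)"
  have A: "sc.cg (Q ^ 4 + 1) A (a0 * X + a1 * X1)" unfolding A_def
    by (rule sc_lt_add_bound(1)[OF U _ _ gX(1)[OF m(1)] gX(2)[OF m(2)]]; use Q_bounds in linarith)
  have gA: "sc.ge (Q\<^sup>2) A"
    by (rule sc.cg_ge'[OF A sc.ge_add[OF gX(1)[OF m(1)] sc.ge_mono[OF gX(2)[OF m(2)]]]]; use Q_bounds in linarith)
  have X'2: "X' = lt_add S u A (c1 * Y1)"
    unfolding X' A_def X1_def Y1_def mult(1)[OF mu(1,2) \<rho>(2)] mult(2)[OF mu0_0 mu(5) \<rho>(3)] ..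
  have "sc.cg (Q ^ 4 + 1) X' (A + c1 * Y1)" unfolding X'2
    by (rule sc_lt_add_bound(1)[OF U _ _ gA gX(4)[OF m(5)]]; use Q_bounds in linarith)
  also have "sc.cg (Q ^ 4 + 1) (A + c1 * Y1) ((a0 * X + a1 * X1) + c1 * Y1)" by (intro sc.cg_add A sc.cg_refl)
  also have "sc.cg (Q ^ 4 + 1) ((a0 * X + a1 * X1) + c1 * Y1) ((a0 * X + a1 * X ^ (q\<^sup>2)) + c1 * Y ^ (q\<^sup>2))"
    by (intro sc.cg_add X1 Y1 m sc.cg_refl)
  finally show "sc.cg (Q ^ 4 + 1) X' (a0 * X + c1 * Y ^ (q\<^sup>2) + a1 * X ^ (q\<^sup>2))" by (simp add: add_ac)
  define B where "B = lt_add S u (b0 * X) (b1 * X1)"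
  have B0: "sc.cg (Q ^ 4) B (b0 * X + b1 * X1)" unfolding B_def
    by (rule sc_lt_add_bound(1)[OF U _ _ gX(1)[OF m(3)] gX(2)[OF m(4)]]; use Q_bounds in linarith)
  also have "sc.cg (Q ^ 4) (b0 * X + b1 * X1) (b0 * X)" by (rule sc.cg_drop[OF gX(2)[OF m(4)]])
  finally have B: "sc.cg (Q ^ 3 + 1) B (b0 * X)" by (rule sc.cg_mono) (rule Q_bounds)
  have gB: "sc.ge (Q\<^sup>2) B" by (rule sc.cg_ge'[OF B gX(1)[OF m(3)]]; use Q_bounds in linarith)
  define D where "D = lt_add S u (d0 * Y) (d1 * Y1)"
  have D: "sc.cg (Q ^ 3 + 1) D (d0 * Y + d1 * Y1)" unfolding D_def
    by (rule sc_lt_add_bound(1)[OF U _ _ gX(3)[OF m(6)] gX(4)[OF m(7)]]; use Q_bounds in linarith)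
  have gD: "sc.ge Q D"
    by (rule sc.cg_ge'[OF D sc.ge_add[OF gX(3)[OF m(6)] sc.ge_mono[OF gX(4)[OF m(7)]]]]; use Q_bounds in linarith)
  have Y'2: "Y' = lt_add S u B D"
    unfolding Y' B_def D_def X1_def Y1_def mult(1)[OF mu(3,4) \<rho>(2)] mult(1)[OF mu(6,7) \<rho>(3)] ..
  have "sc.cg (Q ^ 3 + 1) Y' (D + B)" unfolding Y'2
    by (rule sc_lt_add_bound(2)[OF U _ _ gD gB]; use Q_bounds in linarith)
  also have "sc.cg (Q ^ 3 + 1) (D + B) ((d0 * Y + d1 * Y1) + b0 * X)" by (intro sc.cg_add D B)
  also have "sc.cg (Q ^ 3 + 1) ((d0 * Y + d1 * Y1) + b0 * X) ((d0 * Y + d1 * Y ^ (q\<^sup>2)) + b0 * X)"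
    by (intro sc.cg_add sc.cg_mono[OF Y1] m sc.cg_refl; use Q_bounds in linarith)
  finally show "sc.cg (Q ^ 3 + 1) Y' (d0 * Y + b0 * X + d1 * Y ^ (q\<^sup>2))" by (simp add: add_ac)
qed

subsection \<open>Coordinates on the affinoids \<open>\<^bold>W\<close>\<close>

lemma sc_ge_0_iff: "sc.ge 0 x \<longleftrightarrow> ge 0 x"
  by (simp add: sv_ge_iff)

lemma calZ_eq: "calZ S i P = (xc S P * yc S P ^ q) ^ q - \<kappa> ^ (q\<^sup>2 * (q - 1)\<^sup>2) *
    (xc S P * yc S P ^ (q ^ 3) + teich S (fst i) * inverse (yc S P ^ (q * (q\<^sup>2 - 1))))"
  unfolding calZ_def Let_def kappa_gam(3) ..

text \<open>Clears the factor \<gamma>^(-2q/(q-1)): membership now provides the equation for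
  \<open>calZ\<close> that the estimates start from. Integrality of xy^q is automatic on
  \<open>Z110\<close>.\<close>

lemma component_iff:
  "P \<in> Z110_component S i \<longleftrightarrow> P \<in> Z110 S \<and> br (xc S P * yc S P ^ q) = fst i \<and>
     (\<exists>n. ge 0 n \<and> br n = snd i * fst i \<and>
        calZ S i P = teich S (fst i) * gamma0 S - \<kappa> ^ (2 * q ^ 3 * (q - 1)) * n)"
proof -
  let ?N = "\<kappa> ^ (2 * q ^ 3 * (q - 1))"
  have N: "?N \<noteq> 0" by simp
  have "calZ S i P = teich S (fst i) * gamma0 S - ?N * n \<longleftrightarrow> n = inverse ?N * (teich S (fst i) * gamma0 S - calZ S i P)" for n
    using N by (auto simp: field_simps)
  moreover have "0 \<le> v (xc S P * yc S P ^ q)" if "P \<in> Z110 S"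
    using Z110_units[OF that] by (simp add: sv_0_iff v_mult_0 v_power_0)
  ultimately show ?thesis unfolding Z110_component_def Let_def floor_gampow(4) by (auto simp: zero_ereal_def)
qed

text \<open>In the rescaled valuation the radius 1/(4q^3) becomes Q(Q-1)/2, the valuation of
  w1.\<close>

lemma W_iff: "P \<in> W_affinoid S i yb \<longleftrightarrow> P \<in> Z110_component S i \<and> sc.ge (Q * (Q - 1) / 2) (yc S P - y0_of S yb)"
proof -
  have "1 / (4 * Q ^ 3) = Q * (Q - 1) / 2 / scl"
    using Q_bounds(1) by (simp add: scl_def divide_simps) (simp add: eval_nat_numeral)
  then show ?thesis unfolding W_affinoid_def sv_ge_iff mem_Collect_eq by (simp only:)
qed

lemma Z2_eq:
  "Z1_of S i P = (xc S P * yc S P ^ q - teich S (fst i) * theta S) / \<kappa> ^ (q * (q - 1)\<^sup>2)"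
  "Z2_of S i P = (Z1_of S i P - teich S (fst i) * (yc S P ^ (q\<^sup>2 - 1) + inverse (yc S P ^ (q\<^sup>2 - 1))))
     / (\<kappa> ^ ((q - 1)\<^sup>2) * yc S P ^ (q\<^sup>2 - 1))"
  unfolding Z1_of_def Z2_of_def Let_def floor_gampow(1,2) by (rule refl)+

lemma teich_facts: assumes "z \<in> Fq S" "z \<noteq> 0" shows "sv (teich S z) = 0" "teich S z ^ q = teich S z"
  using teich_unit[OF assms] mu0_power_q[OF teich_mu0[OF assms(1)]] by (simp_all add: sv_0_iff)

lemma component_facts:
  assumes i: "fst i \<in> Fq S" "fst i \<noteq> 0" and P: "P \<in> Z110_component S i"
  shows "sc.cg (Q * (Q - 1)\<^sup>2) (xc S P * yc S P ^ q) (teich S (fst i))"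
    "sc.cg (Q\<^sup>2 * (Q - 1)\<^sup>2) ((xc S P * yc S P ^ q) ^ q) (teich S (fst i))"
    "sc.ge 0 (Z2_of S i P)" "sc.cg (Q * (Q - 1)\<^sup>2) (Z2_of S i P ^ q) (Z1_of S i P)"
    "Z1_of S i P = teich S (fst i) * (yc S P ^ (q\<^sup>2 - 1) + inverse (yc S P ^ (q\<^sup>2 - 1)))
       + \<kappa> ^ ((q - 1)\<^sup>2) * yc S P ^ (q\<^sup>2 - 1) * Z2_of S i P"
proof -
  obtain n where n: "ge 0 n" "calZ S i P = teich S (fst i) * gamma0 S - \<kappa> ^ (2 * q ^ 3 * (q - 1)) * n"
    and P': "P \<in> Z110 S" using P unfolding component_iff by blast
  note ce = sc.component_estimates[OF gamma0_eq theta_eq Z110_units[OF P'] teich_facts[OF i] _ n(2)[unfolded calZ_eq] refl refl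
      Z2_eq(1) Z2_eq(2)]
  have "sc.ge 0 n" using n(1) by (simp add: sc_ge_0_iff)
  note ce = ce[OF this]
  show "sc.cg (Q * (Q - 1)\<^sup>2) (xc S P * yc S P ^ q) (teich S (fst i))"
    "sc.cg (Q\<^sup>2 * (Q - 1)\<^sup>2) ((xc S P * yc S P ^ q) ^ q) (teich S (fst i))"
    "sc.ge 0 (Z2_of S i P)" "sc.cg (Q * (Q - 1)\<^sup>2) (Z2_of S i P ^ q) (Z1_of S i P)"
    "Z1_of S i P = teich S (fst i) * (yc S P ^ (q\<^sup>2 - 1) + inverse (yc S P ^ (q\<^sup>2 - 1)))
       + \<kappa> ^ ((q - 1)\<^sup>2) * yc S P ^ (q\<^sup>2 - 1) * Z2_of S i P"
    by (fact ce(1) ce(5) ce(3) ce(4) ce(6))+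
qed

lemma w_eq: "w_of S yb = y0_of S yb ^ (q + 1) * \<kappa> ^ (q - 1)"
  unfolding w_of_def floor_gampow(3) ..

text \<open>All but the last conclusion specialize \<open>curve_equation\<close>. In the last one
  the left side is 1/r^2 with r^2 = 1 + \<gamma>^(1/q^2)\<delta>; it is the stationarity condition
  that \<open>coordinates_transform\<close> asks for.\<close>

lemma W_facts:
  assumes i: "fst i \<in> Fq S" "fst i \<noteq> 0" and yb: "yb ^ (2 * (q\<^sup>2 - 1)) = 1" and w1: "is_w1 S i yb w1"
    and P: "P \<in> W_affinoid S i yb"
  shows "sv (w_of S yb) = ereal (Q - 1)" "sv w1 = ereal (Q * (Q - 1) / 2)"
    "sc.cg (Q * (Q - 1) / 2) (yc S P ^ (q\<^sup>2 - 1)) (y0_of S yb ^ (q\<^sup>2 - 1))"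
    "sc.ge 0 (a_coord S i yb (w_of S yb) P)" "sc.ge 0 (s_coord S (y0_of S yb) w1 P)"
    "sc.cg (Q * (Q - 1) / 2) (a_coord S i yb (w_of S yb) P ^ q - a_coord S i yb (w_of S yb) P)
      ((s_coord S (y0_of S yb) w1 P)\<^sup>2)"
    "sc.cg 1 ((y0_of S yb ^ (q\<^sup>2 - 1))\<^sup>2) 1"
proof -
  obtain r where r: "principal_sqrt S (1 + gampow S (1 / (of_nat q)\<^sup>2) * delta S (iota_of S yb)) r"
    "delta S (iota_of S yb) ^ q = 2 * iota_of S yb * r" "v (y0_of S yb) = 0"
    "y0_of S yb ^ (q\<^sup>2 - 1) = iota_of S yb * inverse r" using y0_facts[OF yb] by metis
  have r2: "r\<^sup>2 = 1 + \<kappa> ^ ((q - 1)\<^sup>2) * delta S (iota_of S yb)"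
    using r(1) unfolding principal_sqrt_def floor_gampow(1) by blast
  have P': "P \<in> Z110_component S i" "sc.ge (Q * (Q - 1) / 2) (yc S P - y0_of S yb)" using P unfolding W_iff by blast+
  then have Z: "P \<in> Z110 S" unfolding component_iff by blast
  note cf = component_facts[OF i P'(1)]
  have vr: "sv r = 0" "sv (y0_of S yb) = 0" using sqrt_unit[OF r(1)] r(3) by (simp_all add: sv_0_iff)
  note ce = sc.curve_equation[OF Z110_units(2)[OF Z] teich_facts[OF i] cf(3,4) refl cf(5) iota_facts(1) vr(1) r2 r(2) vr(2) r(4)
      w_eq w1[unfolded is_w1_def gamma1_tilde_def floor_gampow(1)] P'(2) refl refl]
  show "sv (w_of S yb) = ereal (Q - 1)" "sv w1 = ereal (Q * (Q - 1) / 2)"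
    "sc.cg (Q * (Q - 1) / 2) (yc S P ^ (q\<^sup>2 - 1)) (y0_of S yb ^ (q\<^sup>2 - 1))"
    by (fact ce)+
  show "sc.ge 0 (a_coord S i yb (w_of S yb) P)" "sc.ge 0 (s_coord S (y0_of S yb) w1 P)"
    "sc.cg (Q * (Q - 1) / 2) (a_coord S i yb (w_of S yb) P ^ q - a_coord S i yb (w_of S yb) P)
      ((s_coord S (y0_of S yb) w1 P)\<^sup>2)"
    unfolding a_coord_def s_coord_def gamma1_tilde_def by (fact ce)+
  have "(y0_of S yb ^ (q\<^sup>2 - 1))\<^sup>2 = inverse (r\<^sup>2)"
    unfolding r(4) power_mult_distrib iota_facts(1) by (simp add: power_inverse)
  moreover have "sc.cg 1 (inverse (r\<^sup>2)) (inverse 1)"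
  proof (rule sc.cg_inverse)
    have "(1::nat) \<le> (q - 1)\<^sup>2" using q_ge_3 by simp
    then have "1 \<le> real ((q - 1)\<^sup>2)" by linarith
    then have "sc.ge 1 (\<kappa> ^ ((q - 1)\<^sup>2))" by (rule sc.ge_kpow)
    then show "sc.cg 1 (r\<^sup>2) 1" unfolding r2 by (intro sc.cg_drop sc.ge_mult_left ce(3))
    show "sv (r\<^sup>2) = 0" by (rule sc.v_power_0[OF vr(1)])
  qed simp
  ultimately show "sc.cg 1 ((y0_of S yb ^ (q\<^sup>2 - 1))\<^sup>2) 1" by simp
qed

lemma bounded_coords_W: "bounded_coords (W_affinoid S i yb)"
proof -
  have "ge 0 X \<and> ge 0 Y \<and> ge 0 u" if "(X, Y, u) \<in> W_affinoid S i yb" for X Y u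
  proof -
    have "(X, Y, u) \<in> Z110 S" using that unfolding W_iff component_iff by blast
    then have "sv u = ereal (Q ^ 4 * (Q - 1))" "sv X = ereal (Q\<^sup>2)" "sv Y = ereal Q" unfolding Z110_iff by auto
    then show ?thesis using Q_bounds(1) by (simp flip: sc_ge_0_iff)
  qed
  then show ?thesis unfolding bounded_coords_def by (intro exI[of _ 0]) auto
qed

text \<open>The only denominator that is not constant is a power of y, which is a unit at every
  point of the affinoid.\<close>

lemma approximable_W:
  "approximable (W_affinoid S i yb) (yc S)" "approximable (W_affinoid S i yb) (Z2_of S i)"
proof -
  let ?W = "W_affinoid S i yb"
  note B = bounded_coords_W[of i yb]
  have X: "approximable ?W (\<lambda>(X, Y, u). X)" and Y: "approximable ?W (\<lambda>(X, Y, u). Y)"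
    by (rule approximable_rational, rule rational_functions.intros)+
  note m = approximable_mult[OF B] and c = approximable_const
  have x: "approximable ?W (xc S)"
    by (rule approximable_cong[OF m[OF X c[of _ "inverse (kappa S ^ q)"]]]) (auto simp: xc_def divide_inverse)
  show y: "approximable ?W (yc S)"
    by (rule approximable_cong[OF m[OF Y c[of _ "inverse (kappa S)"]]]) (auto simp: yc_def divide_inverse)
  have t: "approximable ?W (\<lambda>P. inverse (yc S P ^ (q\<^sup>2 - 1)))"
  proof (rule approximable_inverse[OF B approximable_power[OF B y]])
    show "\<forall>P\<in>?W. v (yc S P ^ (q\<^sup>2 - 1)) \<le> ereal 0"
      using Z110_units(2) by (auto simp: W_iff component_iff sv_0_iff v_power_0)
  qed
  show "approximable ?W (Z2_of S i)"
    unfolding Z2_eq divide_inverse inverse_mult_distrib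
    by (intro m approximable_diff[OF B] approximable_add approximable_power[OF B] x y t c)
qed

lemma integral_on_W:
  assumes i: "fst i \<in> Fq S" "fst i \<noteq> 0" and yb: "yb ^ (2 * (q\<^sup>2 - 1)) = 1" and w1: "is_w1 S i yb w1"
  shows "integral_on (W_affinoid S i yb) (a_coord S i yb (w_of S yb))"
    "integral_on (W_affinoid S i yb) (s_coord S (y0_of S yb) w1)"
proof -
  note B = bounded_coords_W[of i yb]
  note m = approximable_mult[OF B] approximable_diff[OF B] approximable_const approximable_W
  show "integral_on (W_affinoid S i yb) (a_coord S i yb (w_of S yb))"
    unfolding integral_on_def
  proof
    show "\<forall>P\<in>W_affinoid S i yb. ge 0 (a_coord S i yb (w_of S yb) P)"
      using W_facts(4)[OF i yb w1] unfolding sc_ge_0_iff by blast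
    show "approximable (W_affinoid S i yb) (a_coord S i yb (w_of S yb))"
      unfolding a_coord_def divide_inverse by (intro m)
  qed
  show "integral_on (W_affinoid S i yb) (s_coord S (y0_of S yb) w1)"
    unfolding integral_on_def
  proof
    show "\<forall>P\<in>W_affinoid S i yb. ge 0 (s_coord S (y0_of S yb) w1 P)"
      using W_facts(5)[OF i yb w1] unfolding sc_ge_0_iff by blast
    show "approximable (W_affinoid S i yb) (s_coord S (y0_of S yb) w1)"
      unfolding s_coord_def divide_inverse by (intro m)
  qed
qed

lemma sc_pos: "0 < Q * (Q - 1) / 2 / scl"
  using Q_bounds(1) scl_pos by simp

lemma W_curve_coordinates:
  assumes i: "fst i \<in> Fq S" "fst i \<noteq> 0" and yb: "yb ^ (2 * (q\<^sup>2 - 1)) = 1" and w1: "is_w1 S i yb w1"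
  shows "curve_coordinates S (W_affinoid S i yb) (a_coord S i yb (w_of S yb)) (s_coord S (y0_of S yb) w1)"
  by (rule curve_coordinatesI[OF bounded_coords_W integral_on_W[OF assms] sc_pos W_facts(6)[OF assms, unfolded sc_cg_iff]])

end

subsection \<open>The action on the affinoids \<open>\<^bold>W\<close>\<close>

locale group_element = lt_dat S for S :: "('c::field, 'k::field) lt_data" +
  fixes a0 a1 b0 b1 c1 d0 d1 rt :: 'c and \<zeta> \<mu> yb :: 'k and g :: "'c^2^2" and i ig :: "'k \<times> 'k"
  assumes mu: "{a0, a1, b0, b1, c1, d0, d1} \<subseteq> mu0 S"
    and g: "g = vector [vector [a0 + a1 * unif S, b0 + b1 * unif S], vector [c1 * unif S, d0 + d1 * unif S]]"
    and gU: "g \<in> Ubar S"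
    and zeta: "\<zeta> \<in> Fq S - {0}" and mu': "\<mu> \<in> Fq S" and i: "i = (\<zeta>, \<mu>)" and ig: "ig = index_act S g i"
    and yb: "yb ^ (2 * (q\<^sup>2 - 1)) = 1" and rt: "rt\<^sup>2 = a0 / d0"
begin

lemma mu_simps: "a0 \<in> mu0 S" "a1 \<in> mu0 S" "b0 \<in> mu0 S" "b1 \<in> mu0 S" "c1 \<in> mu0 S" "d0 \<in> mu0 S" "d1 \<in> mu0 S"
  using mu by auto

lemmas mu_ge = mu_simps[THEN mu0_ge]

lemma entries: "vec_nth (vec_nth g 1) 1 = a0 + a1 * \<pi>" "vec_nth (vec_nth g 1) 2 = b0 + b1 * \<pi>"
  "vec_nth (vec_nth g 2) 1 = c1 * \<pi>" "vec_nth (vec_nth g 2) 2 = d0 + d1 * \<pi>"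
  unfolding g by (simp_all add: vector_2)

lemma gG: "g \<in> G2F S"
  using gU by (simp add: Ubar_def)

lemma br_pi: "ge 0 e \<Longrightarrow> ge 0 f \<Longrightarrow> br (e + f * \<pi>) = br e"
  by (rule br_cg[of 1]) (auto simp: cg_def intro: ge_mult_right ge_pi)

text \<open>The entry (1,1) of hg and the entry (2,2) of gh are 1 modulo \<pi>^2, and since g is
  upper triangular modulo \<pi> their residues contain only a0 and only d0 of its entries.\<close>

lemma units: "a0 \<noteq> 0" "d0 \<noteq> 0" "v a0 = 0" "v d0 = 0"
proof -
  obtain h where h: "integral_matrix S h"
    "\<And>j k. cong_pi2 S (vec_nth (vec_nth (g ** h) j) k) (vec_nth (vec_nth (mat 1) j) k)"
    "\<And>j k. cong_pi2 S (vec_nth (vec_nth (h ** g) j) k) (vec_nth (vec_nth (mat 1) j) k)"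
    using gG by (auto simp: G2F_def)
  define h' where "h' j k = vec_nth (vec_nth h j) k" for j k
  have hi: "ge 0 (h' j k)" for j k using h(1) by (auto simp: h'_def integral_matrix_def OF_ge)
  have "br (h' 1 1 * (a0 + a1 * \<pi>) + h' 1 2 * (c1 * \<pi>)) = 1" "br (c1 * \<pi> * h' 1 2 + (d0 + d1 * \<pi>) * h' 2 2) = 1"
    using cong_pi2_br[OF h(3)[of 1 1]] cong_pi2_br[OF h(2)[of 2 2]]
    by (simp_all add: matrix_matrix_mult_def mat_def sum_2 entries h'_def)
  moreover have "h' 1 1 * (a0 + a1 * \<pi>) + h' 1 2 * (c1 * \<pi>) = h' 1 1 * a0 + (h' 1 1 * a1 + h' 1 2 * c1) * \<pi>"
    "c1 * \<pi> * h' 1 2 + (d0 + d1 * \<pi>) * h' 2 2 = d0 * h' 2 2 + (c1 * h' 1 2 + d1 * h' 2 2) * \<pi>"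
    by (simp_all add: algebra_simps)
  ultimately have "br (h' 1 1 * a0) = 1" "br (d0 * h' 2 2) = 1"
    using br_pi[of "h' 1 1 * a0" "h' 1 1 * a1 + h' 1 2 * c1"] br_pi[of "d0 * h' 2 2" "c1 * h' 1 2 + d1 * h' 2 2"]
    by (simp_all add: ge_mult_left ge_add hi mu_ge)
  then show n: "a0 \<noteq> 0" "d0 \<noteq> 0" by auto
  show "v a0 = 0" "v d0 = 0" using mu0_unit[OF _ n(1)] mu0_unit[OF _ n(2)] mu_simps by auto
qed

section \<open>The data of the target: index, y0, w and w1\<close>

abbreviation "z \<equiv> teich S \<zeta>"
abbreviation "y0 \<equiv> y0_of S yb"

lemma z: "z \<in> mu0 S" "br z = \<zeta>" "sv z = 0" "z ^ q = z" "v z = 0" "ge 0 z"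
  using zeta teich_facts[of \<zeta>] teich_unit[of \<zeta>] teich_mu0[of \<zeta>] br_teich[of \<zeta>] mu0_ge[of z] by auto

text \<open>The product of det g with the unit of index i is z' + \<pi>(e + E\<pi>). As z' = a0 d0 z
  is itself a Teichmueller element, it is the first digit and there is no carry; e need not be one,
  but the second invariant only uses its residue.\<close>

lemma index:
  "teich S (fst ig) = a0 * d0 * z" "fst ig = br (a0 * d0 * z)" "fst ig \<in> Fq S" "fst ig \<noteq> 0"
  "snd ig * fst ig = br (a0 * d0 * teich S (\<mu> * \<zeta>) + (a1 * d0 + a0 * d1 - b0 * c1) * z)"
proof -
  define z' where "z' = a0 * d0 * z"
  define m where "m = teich S (\<mu> * \<zeta>)"
  define e where "e = a0 * d0 * m + (a1 * d0 + a0 * d1 - b0 * c1) * z"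
  define E where "E = (a1 * d0 + a0 * d1 - b0 * c1) * m + (a1 * d1 - b1 * c1) * (z + m * \<pi>)"
  define D where "D = det g * index_unit S i"
  have m: "m \<in> mu0 S" unfolding m_def using zeta mu' by (intro teich_mu0 Fq_mult) auto
  note O = mu_simps[THEN mu0_OF] mu0_OF[OF m] mu0_OF[OF z(1)]
  have z': "z' \<in> mu0 S" unfolding z'_def by (intro mu0_mult mu_simps z)
  have D: "D = z' + \<pi> * (e + E * \<pi>)"
    unfolding D_def det_2 entries index_unit_def i z'_def e_def E_def fst_conv snd_conv m_def[symmetric]
    by (simp add: algebra_simps)
  have eO: "e \<in> OF S" "E \<in> OF S" unfolding e_def E_def by (intro OF_add OF_mult OF_diff O OF_pi)+
  have brD: "br D = br z'"
    using br_pi[of z' "e + E * \<pi>"] eO OF_ge mu0_ge[OF z'] by (simp add: D mult.commute ge_add ge_mult_left OF_mult)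
  have d0: "digit S D 0 = z'" unfolding digit_def digit_rest.simps brD by (rule teich_br[OF z'])
  have "digit_rest S D 1 = e + E * \<pi>"
    unfolding One_nat_def digit_rest.simps brD teich_br[OF z'] by (simp add: D)
  then have d1: "br (digit S D 1) = br e"
    unfolding digit_def using br_pi[OF OF_ge[OF eO(1)] OF_ge[OF eO(2)]] br_teich[OF Fq_bar[OF eO(1)]] by simp
  have "v z' = 0" unfolding z'_def by (intro v_mult_0 units z)
  then have n: "br z' \<noteq> 0" using br_nonzero_iff[OF mu0_ge[OF z']] by simp
  have ig': "ig = (br z', br e / br z')"
    unfolding ig index_act_def D_def[symmetric] unit_index_def d0 d1 ..
  show "teich S (fst ig) = a0 * d0 * z" "fst ig = br (a0 * d0 * z)" "fst ig \<in> Fq S" "fst ig \<noteq> 0"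
    unfolding ig' fst_conv z'_def[symmetric] using n teich_br[OF z'] Fq_bar[OF mu0_OF[OF z']] by auto
  show "snd ig * fst ig = br (a0 * d0 * teich S (\<mu> * \<zeta>) + (a1 * d0 + a0 * d1 - b0 * c1) * z)"
    unfolding ig' m_def[symmetric] e_def[symmetric] using n by simp
qed

lemma d0_power: "d0 ^ (q\<^sup>2 - 1) = 1" "d0 ^ (q + 1) = d0\<^sup>2"
proof -
  have d: "d0 ^ q = d0" by (rule mu0_power_q[OF mu_simps(6)])
  then have "d0 ^ (q\<^sup>2) = d0" by (simp add: power2_eq_square power_mult)
  then show "d0 ^ (q\<^sup>2 - 1) = 1" unfolding power_q2 using units(2) by simp
  show "d0 ^ (q + 1) = d0\<^sup>2" by (simp add: power_add d power2_eq_square)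
qed

lemma yb': "(br d0 * yb) ^ (q\<^sup>2 - 1) = yb ^ (q\<^sup>2 - 1)" "(br d0 * yb) ^ (2 * (q\<^sup>2 - 1)) = 1"
  "iota_of S (br d0 * yb) = iota_of S yb"
proof -
  show 1: "(br d0 * yb) ^ (q\<^sup>2 - 1) = yb ^ (q\<^sup>2 - 1)"
    unfolding power_mult_distrib br_power[OF mu_ge(6), symmetric] d0_power(1) by simp
  show "(br d0 * yb) ^ (2 * (q\<^sup>2 - 1)) = 1"
    using yb unfolding mult.commute[of 2] power_mult 1 .
  show "iota_of S (br d0 * yb) = iota_of S yb" unfolding iota_of_def 1 ..
qed

text \<open>d0^(q^2-1) = 1 leaves \<iota> and hence the equation of y0 unchanged, and d0 y0 has the
  residue class prescribed for the target. The factor of w is d0^(q+1) = d0^2.\<close>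

lemma y0': "y0_of S (br d0 * yb) = d0 * y0" and w': "w_of S (br d0 * yb) = d0\<^sup>2 * w_of S yb"
proof -
  obtain r where r: "principal_sqrt S (1 + gampow S (1 / (of_nat q)\<^sup>2) * delta S (iota_of S yb)) r"
    "v y0 = 0" "br y0 = yb" "y0 ^ (q\<^sup>2 - 1) = iota_of S yb * inverse r" using y0_facts[OF yb] by metis
  show y0': "y0_of S (br d0 * yb) = d0 * y0"
  proof (rule y0_ex1[OF yb'(2), unfolded yb'(3), OF r(1)])
    show "ge 0 (d0 * y0)" "br (d0 * y0) = br d0 * yb"
      using r(2,3) mu_ge(6) ge_unit[OF r(2)] by (simp_all add: ge_mult_left br_mult)
    show "(d0 * y0) ^ (q\<^sup>2 - 1) = iota_of S yb * inverse r"
      unfolding power_mult_distrib d0_power(1) r(4) by simp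
  qed
  show "w_of S (br d0 * yb) = d0\<^sup>2 * w_of S yb"
    unfolding w_eq y0' power_mult_distrib d0_power(2) by (simp only: mult.assoc)
qed

lemma gamma1': "gamma1_tilde S ig (br d0 * yb) = a0 * d0 * z * delta S (iota_of S yb)"
  unfolding gamma1_tilde_def index(1) yb'(3) ..

text \<open>The factor a0 d0 of the new Teichmueller lift and the square d0/a0 of
  \<open>inverse rt\<close> give d0^2. With d0^2 from w1 and d0^(q^2-3) from y0 this makes
  d0^(q^2+1) = d0^2, the factor by which w^q changes.\<close>

lemma is_w1': assumes "is_w1 S i yb w1" shows "is_w1 S ig (br d0 * yb) (d0 * inverse rt * w1)"
proof -
  have rt0: "rt \<noteq> 0" using rt units by auto
  have "3 \<le> q\<^sup>2" using q_ge_3 mult_le_mono[of 3 q 1 q] by (simp add: power2_eq_square)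
  then have e: "q\<^sup>2 - 3 + 4 = q\<^sup>2 - 1 + 2" using q_ge_3 by simp
  have "d0 ^ (q\<^sup>2 - 3) * d0 ^ 4 = d0\<^sup>2"
    unfolding power_add[symmetric] e by (simp only: power_add d0_power(1) mult_1_left)
  moreover have "(inverse rt)\<^sup>2 = d0 / a0" using rt by (simp add: power_inverse)
  moreover have "(d0\<^sup>2) ^ q = d0\<^sup>2"
    using mu0_power_q[OF mu0_mult[OF mu_simps(6,6)]] by (simp add: power2_eq_square)
  moreover have "y0 ^ (q\<^sup>2 - 3) * (z + gampow S (1 / (of_nat q)\<^sup>2) * (z * delta S (iota_of S yb))) * w1\<^sup>2 = w_of S yb ^ q"
    using assms unfolding is_w1_def gamma1_tilde_def i by simp
  moreover have "(d0 * y0) ^ (q\<^sup>2 - 3) * (a0 * d0 * z + gampow S (1 / (of_nat q)\<^sup>2) * (a0 * d0 * z * delta S (iota_of S yb)))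
      * (d0 * inverse rt * w1)\<^sup>2
    = (d0 ^ (q\<^sup>2 - 3) * (d0\<^sup>2 * d0)) * (a0 * (inverse rt)\<^sup>2)
      * (y0 ^ (q\<^sup>2 - 3) * (z + gampow S (1 / (of_nat q)\<^sup>2) * (z * delta S (iota_of S yb))) * w1\<^sup>2)"
    by (simp add: power_mult_distrib algebra_simps)
  ultimately show ?thesis unfolding is_w1_def y0' index(1) gamma1' w' power_mult_distrib
    using units by (simp add: power4_eq_xxxx power2_eq_square mult_ac)
qed

lemma i_facts: "fst i \<in> Fq S" "fst i \<noteq> 0" "teich S (fst i) = z"
  using zeta by (simp_all add: i)

section \<open>The action at the points of the affinoid and on the reductions\<close>

lemma transformation:
  assumes P: "P \<in> Z110_component S i"
  shows "transformation sv q \<kappa> a0 a1 b0 c1 d0 d1 (xc S P) (yc S P) (xc S (lt_act S g P)) (yc S (lt_act S g P))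
    z (xc S P * yc S P ^ q) (yc S P ^ (q\<^sup>2 - 1))"
proof -
  have Z: "P \<in> Z110 S" using P unfolding component_iff by blast
  obtain X Y u where PX: "P = (X, Y, u)" by (cases P) auto
  define X' Y' where "X' = lt_add S u (lt_mult S u (a0 + a1 * \<pi>) X) (lt_mult S u (c1 * \<pi>) Y)"
    and "Y' = lt_add S u (lt_mult S u (b0 + b1 * \<pi>) X) (lt_mult S u (d0 + d1 * \<pi>) Y)"
  have act: "lt_act S g P = (X', Y', u)" by (simp add: PX lt_act_def entries X'_def Y'_def)
  note ex = act_expansion[OF Z[unfolded PX] mu_simps X'_def Y'_def]
  have k0: "\<kappa> \<noteq> 0" by simp
  have X: "X = \<kappa> ^ (q\<^sup>2) * xc S P" and Y: "Y = \<kappa> ^ q * yc S P" unfolding PX xc_eq by simp_all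
  obtain p where p: "q = Suc p" using q_ge_3 by (cases q) auto
  have e: "q * q\<^sup>2 = q\<^sup>2 + q\<^sup>2 * (q - 1)" "q\<^sup>2 * q\<^sup>2 = q\<^sup>2 + q\<^sup>2 * (q - 1) * (q + 1)" "q\<^sup>2 = q + q * (q - 1)"
    "q * q\<^sup>2 = q + q * (q - 1) * (q + 1)"
    unfolding p by (simp_all add: algebra_simps power2_eq_square)
  have Xe: "a0 * X + c1 * Y ^ (q\<^sup>2) + a1 * X ^ (q\<^sup>2) = \<kappa> ^ (q\<^sup>2) *
      (a0 * xc S P + c1 * \<kappa> ^ (q\<^sup>2 * (q - 1)) * yc S P ^ (q\<^sup>2) + a1 * \<kappa> ^ (q\<^sup>2 * (q - 1) * (q + 1)) * xc S P ^ (q\<^sup>2))"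
    unfolding X Y power_mult_distrib power_mult[symmetric] e(1,2) power_add by (simp add: algebra_simps)
  have Ye: "d0 * Y + b0 * X + d1 * Y ^ (q\<^sup>2) = \<kappa> ^ q *
      (d0 * yc S P + b0 * \<kappa> ^ (q * (q - 1)) * xc S P + d1 * \<kappa> ^ (q * (q - 1) * (q + 1)) * yc S P ^ (q\<^sup>2))"
  proof -
    have "\<kappa> ^ (q\<^sup>2) = \<kappa> ^ q * \<kappa> ^ (q * (q - 1))" by (subst e(3)) (rule power_add)
    moreover have "(\<kappa> ^ q) ^ (q\<^sup>2) = \<kappa> ^ q * \<kappa> ^ (q * (q - 1) * (q + 1))"
      unfolding power_mult[symmetric] e(4) by (rule power_add)
    ultimately show ?thesis unfolding X Y power_mult_distrib by (simp only: distrib_left mult_ac)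
  qed
  have X'e: "X' = \<kappa> ^ (q\<^sup>2) * xc S (lt_act S g P)" and Y'e: "Y' = \<kappa> ^ q * yc S (lt_act S g P)"
    unfolding act xc_eq by simp_all
  show ?thesis
  proof (unfold_locales, goal_cases)
    case (1 e)
    then have "e \<in> mu0 S" using mu_simps by blast
    then show ?case using mu0_ge mu0_power_q by (simp add: sc_ge_0_iff)
  next
    case 2 show ?case using units by (simp add: sv_0_iff)
  next
    case 3 show ?case using units by (simp add: sv_0_iff)
  next
    case 4 show ?case by (rule Z110_units(1)[OF Z])
  next
    case 5 show ?case by (rule Z110_units(2)[OF Z])
  next
    case 6 show ?case by (rule z(3))
  next
    case 7 show ?case by (rule z(4))
  next
    case 8
    show ?case by (rule sc.cg_cancel'[OF sc.v_kpow ex(1)[unfolded Xe X'e]]) simp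
  next
    case 9
    show ?case by (rule sc.cg_cancel'[OF sc.v_kpow ex(2)[unfolded Ye Y'e]]) simp
  next
    case 12 show ?case using component_facts(1)[OF i_facts(1,2) P] unfolding i_facts(3) .
  next
    case 13 show ?case using component_facts(2)[OF i_facts(1,2) P] unfolding i_facts(3) .
  qed (rule refl)+
qed

lemma act_Z110:
  assumes P: "P \<in> Z110_component S i" shows "lt_act S g P \<in> Z110 S"
proof -
  interpret T: transformation sv q \<kappa> a0 a1 b0 c1 d0 d1 "xc S P" "yc S P" "xc S (lt_act S g P)" "yc S (lt_act S g P)"
    z "xc S P * yc S P ^ q" "yc S P ^ (q\<^sup>2 - 1)" by (rule transformation[OF P])
  have Z: "P \<in> Z110 S" using P unfolding component_iff by blast
  obtain X' Y' u where act: "lt_act S g P = (X', Y', u)" by (cases "lt_act S g P") auto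
  obtain X Y where PX: "P = (X, Y, u)" using act by (cases P) (auto simp: lt_act_def)
  have u: "sv u = ereal (Q ^ 4 * (Q - 1))" using Z unfolding PX Z110_iff by blast
  have x: "X' = \<kappa> ^ (q\<^sup>2) * xc S (X', Y', u)" "Y' = \<kappa> ^ q * yc S (X', Y', u)" unfolding xc_eq by simp_all
  have "sv (xc S (X', Y', u)) = ereal 0" "sv (yc S (X', Y', u)) = ereal 0"
    using T.vx' T.vy' by (simp_all add: act zero_ereal_def)
  then have "sv X' = ereal (Q\<^sup>2)" "sv Y' = ereal Q"
    using sc.v_prod[OF sc.v_kpow[of "q\<^sup>2"]] sc.v_prod[OF sc.v_kpow[of q]] x by (metis add.right_neutral of_nat_power)+
  moreover have "P \<in> lt_curve S" using Z unfolding PX Z110_iff by blast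
  then have "lt_act S g P \<in> lt_curve S" by (rule lt_act_curve[OF _ gG])
  ultimately show ?thesis unfolding act Z110_iff using pi_torsion_val[OF u] u by blast
qed

lemma act_component:
  assumes P: "P \<in> Z110_component S i" shows "lt_act S g P \<in> Z110_component S ig"
proof -
  interpret T: transformation sv q \<kappa> a0 a1 b0 c1 d0 d1 "xc S P" "yc S P" "xc S (lt_act S g P)" "yc S (lt_act S g P)"
    z "xc S P * yc S P ^ q" "yc S P ^ (q\<^sup>2 - 1)" by (rule transformation[OF P])
  let ?P = "lt_act S g P" and ?N = "\<kappa> ^ (2 * q ^ 3 * (q - 1))"
  obtain n where n: "ge 0 n" "br n = \<mu> * \<zeta>" "calZ S i P = z * gamma0 S - ?N * n"
    using P unfolding component_iff i by auto
  define n' where "n' = (a0 * d0 * z * gamma0 S - calZ S ig ?P) / ?N"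
  have Nn': "?N * n' = a0 * d0 * z * gamma0 S - calZ S ig ?P" unfolding n'_def by simp
  define r where "r = a0 * d0 * n + (a1 * d0 + a0 * d1 - b0 * c1) * z"
  have cg: "sc.cg 1 n' r" unfolding r_def
    by (rule T.index_transform[OF n(3)[unfolded calZ_eq i fst_conv] Nn'[unfolded calZ_eq index(1)]])
  have r0: "ge 0 r" unfolding r_def
    by (intro ge_add ge_diff ge_mult_left mu_ge z n)
  have pos: "0 < 1 / scl" using scl_pos by simp
  have "ge 0 n'" by (rule cg_ge'[OF cg[unfolded sc_cg_iff] r0]) (use pos in simp)
  moreover have "br n' = br r" by (rule br_cg[OF cg[unfolded sc_cg_iff] pos r0])
  \<comment> \<open>n is only some integral lift of \<mu>\<zeta>; since residues alone count, it can
    be exchanged for the Teichmueller lift that occurs in \<open>index\<close>.\<close>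
  moreover have "br r = br (a0 * d0 * teich S (\<mu> * \<zeta>) + (a1 * d0 + a0 * d1 - b0 * c1) * z)"
  proof -
    have m: "ge 0 (teich S (\<mu> * \<zeta>))" "br (teich S (\<mu> * \<zeta>)) = br n"
      using zeta mu' n(2) by (auto intro: mu0_ge teich_mu0 br_teich Fq_mult)
    have k: "ge 0 (a0 * d0)" "ge 0 ((a1 * d0 + a0 * d1 - b0 * c1) * z)"
      by (intro ge_add ge_diff ge_mult_left mu_ge z)+
    show ?thesis unfolding r_def
      using m n(1) k by (simp add: br_add br_mult ge_mult_left)
  qed
  moreover have "br (xc S ?P * yc S ?P ^ q) = br (a0 * d0 * z)"
    by (rule br_cg[OF T.xy_reduction[unfolded sc_cg_iff] pos]) (intro ge_mult_left mu_ge z)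
  moreover have "calZ S ig ?P = a0 * d0 * z * gamma0 S - ?N * n'" unfolding Nn' by simp
  ultimately show ?thesis unfolding component_iff index(1,5) using act_Z110[OF P] index(2) by auto
qed

lemma act_coordinates:
  assumes w1: "is_w1 S i yb w1" and P: "P \<in> W_affinoid S i yb"
  defines "a' \<equiv> a_coord S ig (br d0 * yb) (d0\<^sup>2 * w_of S yb)" and "a \<equiv> a_coord S i yb (w_of S yb)"
    and "s' \<equiv> s_coord S (d0 * y0) (d0 * inverse rt * w1)" and "s \<equiv> s_coord S y0 w1"
  shows "lt_act S g P \<in> W_affinoid S ig (br d0 * yb)"
    "sc.cg 1 (a' (lt_act S g P)) (a0 / d0 * (a P + c1 / a0 + b0 / d0 * (z / y0 ^ (q + 1))\<^sup>2))"
    "sc.cg 1 (s' (lt_act S g P)) (rt * s P)"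
proof -
  have P': "P \<in> Z110_component S i" "sc.ge (Q * (Q - 1) / 2) (yc S P - y0)" using P unfolding W_iff by blast+
  interpret T: transformation sv q \<kappa> a0 a1 b0 c1 d0 d1 "xc S P" "yc S P" "xc S (lt_act S g P)" "yc S (lt_act S g P)"
    z "xc S P * yc S P ^ q" "yc S P ^ (q\<^sup>2 - 1)" by (rule transformation[OF P'(1)])
  note wf = W_facts[OF i_facts(1,2) yb w1 P]
  have vy0: "sv y0 = 0" using y0_facts[OF yb] sv_0_iff by metis
  note ct = T.coordinates_transform[OF Z2_eq(1)[of i P, unfolded i_facts(3)] Z2_eq(2)[of i P, unfolded i_facts(3)]
      Z2_eq(1)[of ig "lt_act S g P", unfolded index(1)] Z2_eq(2)[of ig "lt_act S g P", unfolded index(1)]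
      component_facts(3)[OF i_facts(1,2) P'(1)] vy0 P'(2) wf(3,7) w_eq wf(2) rt]
  show "lt_act S g P \<in> W_affinoid S ig (br d0 * yb)"
    unfolding W_iff y0' using act_component[OF P'(1)] ct(2) by blast
  show "sc.cg 1 (a' (lt_act S g P)) (a0 / d0 * (a P + c1 / a0 + b0 / d0 * (z / y0 ^ (q + 1))\<^sup>2))"
    unfolding a'_def a_def a_coord_def gamma1' unfolding gamma1_tilde_def i_facts(3) by (rule ct(1))
  show "sc.cg 1 (s' (lt_act S g P)) (rt * s P)"
    unfolding s'_def s_def s_coord_def by (rule ct(3))
qed

lemma morphism:
  assumes w1: "is_w1 S i yb w1"
  defines "W \<equiv> W_affinoid S i yb" and "Wg \<equiv> W_affinoid S ig (br d0 * yb)"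
    and "a' \<equiv> a_coord S ig (br d0 * yb) (d0\<^sup>2 * w_of S yb)" and "a \<equiv> a_coord S i yb (w_of S yb)"
    and "s' \<equiv> s_coord S (d0 * y0) (d0 * inverse rt * w1)" and "s \<equiv> s_coord S y0 w1"
  shows "curve_coordinates S W a s \<and> curve_coordinates S Wg a' s' \<and>
    (\<exists>\<phi>. induces_on_reductions S (lt_act S g) W Wg \<phi> \<and>
      \<phi> (reduce S Wg a') =
        scalar S W (br a0 / br d0) \<otimes>\<^bsub>reduction S W\<^esub>
          (reduce S W a \<oplus>\<^bsub>reduction S W\<^esub> scalar S W (br c1 / br a0)
             \<oplus>\<^bsub>reduction S W\<^esub> scalar S W (br b0 / br d0 * (\<zeta> / yb ^ (q + 1))\<^sup>2)) \<and>
      \<phi> (reduce S Wg s') = scalar S W (br rt) \<otimes>\<^bsub>reduction S W\<^esub> reduce S W s)"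
proof -
  note w1' = is_w1'[OF w1]
  have i': "fst ig \<in> Fq S" "fst ig \<noteq> 0" by (fact index)+
  note int = integral_on_W[OF i_facts(1,2) yb w1, folded W_def a_def s_def]
  note int' = integral_on_W[OF i' yb'(2) w1', unfolded w' y0', folded Wg_def a'_def s'_def]
  have B: "bounded_coords W" "bounded_coords Wg" unfolding W_def Wg_def by (rule bounded_coords_W)+
  note ac = act_coordinates[OF w1, folded a_def a'_def s_def s'_def W_def Wg_def]
  have h: "lt_act S g \<in> W \<rightarrow> Wg" using ac(1) by (auto simp: W_def Wg_def)
  have im: "integral_matrix S g" using gG by (simp add: G2F_def)
  have \<rho>: "0 < Q / scl" using Q_bounds(1) scl_pos by simp
  have ge: "ge 0 u \<and> ge (Q / scl) X \<and> ge (Q / scl) Y" if "(X, Y, u) \<in> W" for X Y u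
  proof -
    have "(X, Y, u) \<in> Z110 S" using that unfolding W_def W_iff component_iff by blast
    then have "sv u = ereal (Q ^ 4 * (Q - 1))" "sv X = ereal (Q\<^sup>2)" "sv Y = ereal Q" unfolding Z110_iff by auto
    then show ?thesis using Q_bounds by (simp flip: sc_ge_0_iff sv_ge_iff)
  qed
  obtain \<phi> where \<phi>: "induces_on_reductions S (lt_act S g) W Wg \<phi>"
    using induces_on_reductionsI[OF B h approximable_lt_act[OF B(1) im \<rho> ge]] by blast
  \<comment> \<open>\<open>induces_on_reductions\<close> speaks of functions in the carrier, which
    are \<open>undefined\<close> outside \<open>Wg\<close>. Restriction does not change the coset,
    so the statement holds for a' and s' as they are defined.\<close>
  have act: "integral_on W (f \<circ> lt_act S g) \<and> \<phi> (reduce S Wg f) = reduce S W (f \<circ> lt_act S g)" if f: "integral_on Wg f" for f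
  proof -
    have e: "restrict (restrict f Wg \<circ> lt_act S g) W = restrict (f \<circ> lt_act S g) W" using h by (auto simp: fun_eq_iff restrict_def Pi_iff)
    have "restrict f Wg \<in> carrier (power_bounded_ring S Wg)" using f by (simp add: restrict_carrier)
    then have "restrict (restrict f Wg \<circ> lt_act S g) W \<in> carrier (power_bounded_ring S W)"
      "\<phi> (reduce S Wg (restrict f Wg)) = reduce S W (restrict f Wg \<circ> lt_act S g)"
      using \<phi> unfolding induces_on_reductions_def by blast+
    then show ?thesis unfolding e by (simp add: reduce_def e restrict_carrier)
  qed
  have pos: "0 < 1 / scl" using scl_pos by simp
  have vy0: "v y0 = 0" "br y0 = yb" using y0_facts[OF yb] by metis+
  have vrt: "v (rt\<^sup>2) = 0" unfolding rt divide_inverse by (intro v_mult_0 v_inverse_0 units)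
  then have vrt: "v rt = 0" by (rule v_unit_root[rotated]) simp
  have c: "ge 0 (a0 / d0)" "br (a0 / d0) = br a0 / br d0" "ge 0 (c1 / a0)" "br (c1 / a0) = br c1 / br a0" "ge 0 (b0 / d0)" "br (b0 / d0) = br b0 / br d0"
    "ge 0 (z / y0 ^ (q + 1))" "br (z / y0 ^ (q + 1)) = \<zeta> / yb ^ (q + 1)" "ge 0 rt"
    using units mu_ge z vy0 vrt ge_unit[OF vy0(1)]
    by (simp_all only: divide_inverse br_mult br_inverse br_power v_power_0 v_inverse_0 ge_unit ge_mult_left)
  let ?c = "b0 / d0 * (z / y0 ^ (q + 1))\<^sup>2"
  have c3: "ge 0 ?c" "br ?c = br b0 / br d0 * (\<zeta> / yb ^ (q + 1))\<^sup>2"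
    using ge_mult_left[OF c(5) ge_power0[OF c(7)]] br_mult[OF c(5) ge_power0[OF c(7)]]
    by (simp_all only: br_power[OF c(7)] c(6,8))
  note K = integral_on_const
  have A: "\<phi> (reduce S Wg a') = scalar S W (br a0 / br d0) \<otimes>\<^bsub>reduction S W\<^esub>
          (reduce S W a \<oplus>\<^bsub>reduction S W\<^esub> scalar S W (br c1 / br a0)
             \<oplus>\<^bsub>reduction S W\<^esub> scalar S W (br b0 / br d0 * (\<zeta> / yb ^ (q + 1))\<^sup>2))"
  proof -
    have "reduce S W (a' \<circ> lt_act S g) = reduce S W (\<lambda>P. a0 / d0 * (a P + c1 / a0 + ?c))"
    proof (rule reduce_eqI[OF B(1) _ _ pos])
      show "ge (1 / scl) ((a' \<circ> lt_act S g) P - a0 / d0 * (a P + c1 / a0 + ?c))" if "P \<in> W" for P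
        using ac(2)[OF that] unfolding sc_cg_iff cg_def comp_def .
    qed (use act[OF int'(1)] in blast, intro integral_on_mult[OF B(1)] integral_on_add K int c c3)
    also have "\<dots> = reduce S W (\<lambda>P. a0 / d0) \<otimes>\<^bsub>reduction S W\<^esub>
        (reduce S W a \<oplus>\<^bsub>reduction S W\<^esub> reduce S W (\<lambda>P. c1 / a0) \<oplus>\<^bsub>reduction S W\<^esub> reduce S W (\<lambda>P. ?c))"
      by (simp only: reduce_mult[OF B(1)] reduce_add[OF B(1)] integral_on_add K int c c3)
    finally show ?thesis using act[OF int'(1)]
      by (simp only: scalar_eq[OF B(1) c(1,2)] scalar_eq[OF B(1) c(3,4)] scalar_eq[OF B(1) c3])
  qed
  have D: "\<phi> (reduce S Wg s') = scalar S W (br rt) \<otimes>\<^bsub>reduction S W\<^esub> reduce S W s"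
  proof -
    have "reduce S W (s' \<circ> lt_act S g) = reduce S W (\<lambda>P. rt * s P)"
    proof (rule reduce_eqI[OF B(1) _ _ pos])
      show "ge (1 / scl) ((s' \<circ> lt_act S g) P - rt * s P)" if "P \<in> W" for P
        using ac(3)[OF that] unfolding sc_cg_iff cg_def comp_def .
    qed (use act[OF int'(2)] in blast, intro integral_on_mult[OF B(1)] K int c)
    also have "\<dots> = reduce S W (\<lambda>P. rt) \<otimes>\<^bsub>reduction S W\<^esub> reduce S W s"
      by (simp only: reduce_mult[OF B(1)] K int c)
    finally show ?thesis using act[OF int'(2)] by (simp only: scalar_eq[OF B(1) c(9) refl])
  qed
  show ?thesis
    using W_curve_coordinates[OF i_facts(1,2) yb w1] W_curve_coordinates[OF i' yb'(2) w1'] \<phi> A D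
    unfolding w' y0' W_def[symmetric] Wg_def[symmetric] a_def[symmetric] a'_def[symmetric] s_def[symmetric] s'_def[symmetric]
    by blast
qed

end

theorem proposition5p6:
  fixes S :: "('c::field, 'k::field) lt_data"
    and a0 a1 b0 b1 c1 d0 d1 rt w1 :: 'c
    and \<zeta> \<mu> yb :: 'k
    and g :: "'c^2^2"
    and i ig :: "'k \<times> 'k"
    and W Wg :: "'c point set"
    and a s a' s' :: "'c point \<Rightarrow> 'c"
  assumes "lt_data_axioms S"
    and "{a0, a1, b0, b1, c1, d0, d1} \<subseteq> mu0 S"
    and "g = vector [vector [a0 + a1 * unif S, b0 + b1 * unif S],
                     vector [c1 * unif S, d0 + d1 * unif S]]"
    and "g \<in> Ubar S"
    and "\<zeta> \<in> Fq S - {0}" and "\<mu> \<in> Fq S" and "i = (\<zeta>, \<mu>)"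
    and "ig = index_act S g i"
    and "yb ^ (2 * ((qq S)\<^sup>2 - 1)) = 1"
    and "rt\<^sup>2 = a0 / d0"
    and "is_w1 S i yb w1"
    and "W = W_affinoid S i yb"
    and "Wg = W_affinoid S ig (bar S d0 * yb)"
    and "a = a_coord S i yb (w_of S yb)"
    and "s = s_coord S (y0_of S yb) w1"
    and "a' = a_coord S ig (bar S d0 * yb) (d0\<^sup>2 * w_of S yb)"
    and "s' = s_coord S (d0 * y0_of S yb) (d0 * inverse rt * w1)"
  shows "curve_coordinates S W a s \<and> curve_coordinates S Wg a' s' \<and>
    (\<exists>\<phi>. induces_on_reductions S (lt_act S g) W Wg \<phi> \<and>
      \<phi> (reduce S Wg a') =
        scalar S W (bar S a0 / bar S d0) \<otimes>\<^bsub>reduction S W\<^esub>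
          (reduce S W a \<oplus>\<^bsub>reduction S W\<^esub> scalar S W (bar S c1 / bar S a0)
             \<oplus>\<^bsub>reduction S W\<^esub> scalar S W (bar S b0 / bar S d0 * (\<zeta> / yb ^ (qq S + 1))\<^sup>2)) \<and>
      \<phi> (reduce S Wg s') = scalar S W (bar S rt) \<otimes>\<^bsub>reduction S W\<^esub> reduce S W s)"
proof -
  interpret group_element S a0 a1 b0 b1 c1 d0 d1 rt \<zeta> \<mu> yb g i ig
    using assms by unfold_locales
  show ?thesis unfolding assms(12-17) by (rule morphism[OF assms(11)])
qed

end
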